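(* Let $W:\mathbb{R}^d\to\mathbb{R}_+$ be continuous and $a\in\mathbb{R}$ such that $S_a=\{z\in\mathbb{R}^d:z_1=a,\ W(z)=0\}$ contains at least two distinct points $u^-$ and $u^+$. Assume: (H1) $S_a$ is finite; (H2) $\liminf_{z_1\to a,\ |z'|\to\infty}W(z_1,z')>0$; (H3) for all $z\in S_a\setminus\{u^-,u^+\}$, $d_W(u^-,z)+d_W(z,u^+)>d_W(u^-,u^+)$ (points of $S_a$ being identified with constant maps on $\mathbb{T}^{d-1}$); (H4) for every $z^\pm\in S_a$ and every sequences $(v_n^\pm)_{n\ge1}$ in $H^1_a(\mathbb{T}^{d-1},\mathbb{R}^d)$ converging strongly in $H^1(\mathbb{T}^{d-1})$ to $z^\pm$, one has $d_W(z^-,z^+)\le\liminf_{n\to\infty}d_W(v_n^-,v_n^+)$. Then there exists $u\in\dot H^1_{div}(\Omega,\mathbb{R}^d)$ with $\overline{u}(\pm\infty)=u^\pm$ and $E(u)=c_W(u^-,u^+)$.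
   Context: Let $d\ge2$, $\mathbb{T}=\mathbb{R}/\mathbb{Z}$, $\Omega=\mathbb{R}\times\mathbb{T}^{d-1}$, $x=(x_1,x')$; for $z\in\mathbb{R}^d$, $z=(z_1,z')$. For an interval $I\subset\mathbb{R}$, $\dot H^1_{div}(I\times\mathbb{T}^{d-1},\mathbb{R}^d)$ is the set of $u\in H^1_{loc}$ with $\nabla u\in L^2$ and $\nabla\cdot u=0$, and $E(u,I)=\int_{I\times\mathbb{T}^{d-1}}\frac12|\nabla u|^2+W(u)\,dx$; $E(u)=E(u,\mathbb{R})$. The $x'$-average is $\overline{u}(x_1)=\int_{\mathbb{T}^{d-1}}u(x_1,x')dx'$ and $\overline{u}(\pm\infty)=u^\pm$ means $\lim_{x_1\to\pm\infty}\overline{u}(x_1)=u^\pm$. For $u^\pm\in S_a$, $c_W(u^-,u^+)=\inf\{E(u): u\in\dot H^1_{div}(\Omega,\mathbb{R}^d),\ \overline{u}(\pm\infty)=u^\pm\}$. Let $H^1_a(\mathbb{T}^{d-1},\mathbb{R}^d)=\{v\in H^1(\mathbb{T}^{d-1},\mathbb{R}^d):\int_{\mathbb{T}^{d-1}}v_1=a\}$ and for $v^\pm\in H^1_a$, $d_W(v^-,v^+)=\inf\{E(u,I): I=[t^-,t^+]\subset\mathbb{R}\text{ bounded},\ u\in\dot H^1_{div}(I\times\mathbb{T}^{d-1},\mathbb{R}^d),\ u(t^\pm,\cdot)=v^\pm\}\in[0,+\infty]$, where $u(t^\pm,\cdot)$ denotes the trace. *)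

theory Defs
  imports "HOL-Analysis.Analysis"
begin

text \<open>Points of \<Omega> = R x T^(d-1) and of R^d are both represented as
  real x real^'m, with d - 1 = CARD('m) (so d >= 2 automatically).
  Functions on T^(d-1) are 1-periodic functions on real^'m; the torus is
  integrated over the fundamental cell [0,1]^(d-1).\<close>

type_synonym ('m) pt = "real \<times> (real ^ 'm)"

definition cell :: "(real ^ ('m::finite)) set" where
  "cell = cbox 0 One"

definition test_fun :: "('a::euclidean_space \<Rightarrow> real) \<Rightarrow> ('a \<Rightarrow> 'a \<Rightarrow> real) \<Rightarrow> 'a set \<Rightarrow> bool" where
  "test_fun \<phi> \<phi>' U \<longleftrightarrow>
     (\<forall>x. (\<phi> has_derivative \<phi>' x) (at x)) \<and>
     (\<forall>b\<in>Basis. continuous_on UNIV (\<lambda>x. \<phi>' x b)) \<and>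
     compact (closure {x. \<phi> x \<noteq> 0}) \<and> closure {x. \<phi> x \<noteq> 0} \<subseteq> U"

definition weak_grad :: "'a set \<Rightarrow> ('a::euclidean_space \<Rightarrow> 'b::euclidean_space) \<Rightarrow> ('a \<Rightarrow> 'a \<Rightarrow> 'b) \<Rightarrow> bool" where
  "weak_grad U u D \<longleftrightarrow> open U \<and>
     u \<in> borel_measurable lebesgue \<and> (\<forall>b\<in>Basis. D b \<in> borel_measurable lebesgue) \<and>
     (\<forall>K. compact K \<and> K \<subseteq> U \<longrightarrow>
        set_integrable lebesgue K (\<lambda>x. norm (u x) ^ 2) \<and>
        (\<forall>b\<in>Basis. set_integrable lebesgue K (\<lambda>x. norm (D b x) ^ 2))) \<and>
     (\<forall>\<phi> \<phi>'. test_fun \<phi> \<phi>' U \<longrightarrow>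
        (\<forall>b\<in>Basis. (\<integral>x. \<phi> x *\<^sub>R D b x \<partial>lebesgue) = - (\<integral>x. \<phi>' x b *\<^sub>R u x \<partial>lebesgue)))"

definition periodic_x' :: "(('m::finite) pt \<Rightarrow> 'c) \<Rightarrow> bool" where
  "periodic_x' u \<longleftrightarrow> (\<forall>x1 x' i. u (x1, x' + axis i 1) = u (x1, x'))"

definition sq_grad :: "('a::euclidean_space \<Rightarrow> 'a \<Rightarrow> 'b::euclidean_space) \<Rightarrow> 'a \<Rightarrow> real" where
  "sq_grad D x = (\<Sum>b\<in>Basis. norm (D b x) ^ 2)"

definition sob_div :: "real set \<Rightarrow> (('m::finite) pt \<Rightarrow> 'm pt) \<Rightarrow> ('m pt \<Rightarrow> 'm pt \<Rightarrow> 'm pt) \<Rightarrow> bool" where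
  "sob_div I u D \<longleftrightarrow> periodic_x' u \<and>
     weak_grad (interior I \<times> (UNIV :: (real ^ 'm) set)) u D \<and>
     (\<integral>\<^sup>+x. indicator (I \<times> cell) x * ennreal (sq_grad D x) \<partial>lebesgue) < \<infinity> \<and>
     (AE x in lebesgue. x \<in> interior I \<times> (UNIV :: (real ^ 'm) set) \<longrightarrow> (\<Sum>b\<in>Basis. D b x \<bullet> b) = 0)"

definition energy :: "(('m::finite) pt \<Rightarrow> real) \<Rightarrow> real set \<Rightarrow> ('m pt \<Rightarrow> 'm pt) \<Rightarrow> ('m pt \<Rightarrow> 'm pt \<Rightarrow> 'm pt) \<Rightarrow> ennreal" where
  "energy W I u D = (\<integral>\<^sup>+x. indicator (I \<times> cell) x * ennreal ((1/2) * sq_grad D x + W (u x)) \<partial>lebesgue)"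

definition xavg :: "(('m::finite) pt \<Rightarrow> 'm pt) \<Rightarrow> real \<Rightarrow> 'm pt" where
  "xavg u x1 = (\<integral>x'\<in>cell. u (x1, x') \<partial>lebesgue)"

definition cW :: "(('m::finite) pt \<Rightarrow> real) \<Rightarrow> 'm pt \<Rightarrow> 'm pt \<Rightarrow> ennreal" where
  "cW W um up = (INF p \<in> {(u, D). sob_div UNIV u D \<and> (xavg u \<longlongrightarrow> um) at_bot \<and> (xavg u \<longlongrightarrow> up) at_top}.
                   energy W UNIV (fst p) (snd p))"

definition h1_torus :: "(real ^ ('m::finite) \<Rightarrow> 'm pt) \<Rightarrow> (real ^ 'm \<Rightarrow> real ^ 'm \<Rightarrow> 'm pt) \<Rightarrow> bool" where
  "h1_torus v Dv \<longleftrightarrow> (\<forall>x' i. v (x' + axis i 1) = v x') \<and> weak_grad UNIV v Dv"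

definition h1a :: "real \<Rightarrow> (real ^ ('m::finite) \<Rightarrow> 'm pt) \<Rightarrow> (real ^ 'm \<Rightarrow> real ^ 'm \<Rightarrow> 'm pt) \<Rightarrow> bool" where
  "h1a a v Dv \<longleftrightarrow> h1_torus v Dv \<and> (\<integral>x'\<in>cell. fst (v x') \<partial>lebesgue) = a"

definition h1_conv_const :: "(nat \<Rightarrow> real ^ ('m::finite) \<Rightarrow> 'm pt) \<Rightarrow> (nat \<Rightarrow> real ^ 'm \<Rightarrow> real ^ 'm \<Rightarrow> 'm pt) \<Rightarrow> 'm pt \<Rightarrow> bool" where
  "h1_conv_const v Dv z \<longleftrightarrow>
     (\<lambda>n. \<integral>x'\<in>cell. norm (v n x' - z) ^ 2 \<partial>lebesgue) \<longlonglongrightarrow> 0 \<and>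
     (\<lambda>n. \<integral>x'\<in>cell. sq_grad (Dv n) x' \<partial>lebesgue) \<longlonglongrightarrow> 0"

text \<open>Traces at the ends of the slab [t,..] / [..,t], via the L^2 slice-average characterisation.\<close>
definition trace_left :: "real \<Rightarrow> (('m::finite) pt \<Rightarrow> 'm pt) \<Rightarrow> (real ^ 'm \<Rightarrow> 'm pt) \<Rightarrow> bool" where
  "trace_left t u v \<longleftrightarrow>
     ((\<lambda>h. ennreal (1 / h) * (\<integral>\<^sup>+x. indicator ({t..t+h} \<times> cell) x * ennreal (norm (u x - v (snd x)) ^ 2) \<partial>lebesgue))
       \<longlongrightarrow> 0) (at_right 0)"

definition trace_right :: "real \<Rightarrow> (('m::finite) pt \<Rightarrow> 'm pt) \<Rightarrow> (real ^ 'm \<Rightarrow> 'm pt) \<Rightarrow> bool" where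
  "trace_right t u v \<longleftrightarrow>
     ((\<lambda>h. ennreal (1 / h) * (\<integral>\<^sup>+x. indicator ({t-h..t} \<times> cell) x * ennreal (norm (u x - v (snd x)) ^ 2) \<partial>lebesgue))
       \<longlongrightarrow> 0) (at_right 0)"

definition dW :: "(('m::finite) pt \<Rightarrow> real) \<Rightarrow> (real ^ 'm \<Rightarrow> 'm pt) \<Rightarrow> (real ^ 'm \<Rightarrow> 'm pt) \<Rightarrow> ennreal" where
  "dW W vm vp = (INF p \<in> {(tm, tp, u, D). tm < tp \<and> sob_div {tm..tp} u D \<and>
                          trace_left tm u vm \<and> trace_right tp u vp}.
                  energy W {fst p..fst (snd p)} (fst (snd (snd p))) (snd (snd (snd p))))"

end

theory Submission
  imports Defs "HOL-Library.Diagonal_Subsequence"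
begin

text \<open>Direct method without weak topologies. A Sobolev field on the cylinder has a Borel periodic
representative that is absolutely continuous along the first variable for every pair of end points, so
slices, traces and the Hoelder continuous averages make sense at every time; the divergence
constraint keeps the first component of the average equal to a. A slice of small energy is
close to a point of \<open>S\<^sub>a\<close>, and moving the average between two such points costs a fixed amount of energy;
hence finite energy forces limits in \<open>S\<^sub>a\<close> at both ends. Minimizing fields are translated so that
time 0 is the last time the average is near \<open>u\<^sup>-\<close> and converge locally by a Rellich argument. If the limit
did not connect \<open>u\<^sup>-\<close> to \<open>u\<^sup>+\<close>, slices of the minimizing fields converging in \<open>H\<^sup>1\<close> to another
point of \<open>S\<^sub>a\<close> would cut them into two transitions and H4 contradicts H3, or the
cost of returning near \<open>u\<^sup>-\<close> contradicts minimality. Both use that \<open>c\<^sub>W \<le> d\<^sub>W\<close>: a field on a bounded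
interval with constant traces extends by constants.\<close>

text \<open>The obstacle is translation in the first variable: a local limit of minimizing fields
  may lose the transition at either end. Taking the last time within \<delta> of \<open>um\<close>
  as origin keeps the averages at distance at least \<delta> from \<open>um\<close> at all positive
  times. This bound passes to local L2 limits, so the right end of the limit is not
  \<open>um\<close>. Negative times have no such bound. A limit starting at \<open>up\<close> is
  excluded by cost: the fields would travel from \<open>um\<close> to near \<open>up\<close>, which
  asymptotically costs at least c_W, and then return within \<delta> of \<open>um\<close> by time 0,
  which costs a further fixed amount.

  (H4) speaks of strong H1 convergence of slices, whereas local compactness of the fields gives L2
  convergence. The gap is closed by choosing times at which the slice energy itself is small: the
  gradient of the slice is then small, and the Poincare inequality brings the slice close to its
  average.

  \<open>xavg\<close> reads each slice separately while weak gradients ignore null sets. Hence the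
  passage to representatives with meaningful slices, and the care taken when limits of averages are
  transferred between two versions of the same field.\<close>

abbreviation (input) nn_lborel :: "('a::euclidean_space => ennreal) => ennreal" (binder "NN " 10)
 where "nn_lborel f == integral\<^sup>N lborel f"
abbreviation (input) nsq :: "'a::real_normed_vector => ennreal" where "nsq x == ennreal ((norm x)\<^sup>2)"
abbreviation (input) gradsq :: "(('m::finite) pt => 'm pt => 'b::euclidean_space) => ennreal" where
 "gradsq D == NN x. indicator (UNIV \<times> cell) x * ennreal (sq_grad D x)"
abbreviation (input) bmeas :: "('a::topological_space => 'b::topological_space) set" where "bmeas == borel_measurable borel"
abbreviation (input) scale_by :: "real => 'a::real_vector => 'a" (infixr "*R" 75) where "r *R x == scaleR r x"
abbreviation (input) seq_limit :: "(nat => 'a::topological_space) => 'a => bool" (infix "~>" 60) where "f ~> x == f \<longlonglongrightarrow> x"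

section \<open>Test functions\<close>

text \<open>The cubic Hermite step 3 s^2 - 2 s^3, clamped to [0,1]. \<open>test_fun\<close> asks for
  C^1 functions, and this profile is the source of all cut-offs below: bumps on boxes, cut-offs near
  end slices, transitions between two wells.\<close>

definition smoothstep :: "real => real" where
 "smoothstep s = (max 0 (min 1 s))\<^sup>2 * (3 - 2 * max 0 (min 1 s))"

definition smoothstep_deriv :: "real => real" where
 "smoothstep_deriv s = 6 * max 0 (min 1 s) * (1 - max 0 (min 1 s))"

text \<open>On each side of a point only one of the three formulas 0, cubic, 1 is active nearby, so
  each one-sided derivative is that of a polynomial. \<open>Lim_Un\<close> glues the two sides,
  which treats the junctions 0 and 1 like every other point.\<close>

lemma DERIV_smoothstep: "(smoothstep has_real_derivative smoothstep_deriv s) (at s)"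
proof -
 let ?p = "%s::real. s\<^sup>2 * (3 - 2 * s)"
 have p: "(?p has_real_derivative 6 * s * (1 - s)) (at s within S)" for s S
  by (auto intro!: derivative_eq_intros simp: algebra_simps power2_eq_square)
 have r: "(smoothstep has_real_derivative smoothstep_deriv s) (at s within {s..})"
 proof -
  consider "s < 0" | "0 \<le> s" "s < 1" | "1 \<le> s" by linarith
  then show ?thesis
  proof cases
   case 1
   have "((%_. 0) has_real_derivative smoothstep_deriv s) (at s within {s..})"
    using 1 by (simp add: smoothstep_deriv_def)
   then show ?thesis
    by (rule has_field_derivative_transform_within[where d="-s"])
     (use 1 in \<open>auto simp: smoothstep_def dist_real_def\<close>)
  next
   case 2
   have "(?p has_real_derivative smoothstep_deriv s) (at s within {s..})"
    using p[of s "{s..}"] 2 by (simp add: smoothstep_deriv_def)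
   then show ?thesis
    by (rule has_field_derivative_transform_within[where d="1-s"])
     (use 2 in \<open>auto simp: smoothstep_def dist_real_def\<close>)
  next
   case 3
   have "((%_. 1) has_real_derivative smoothstep_deriv s) (at s within {s..})"
    using 3 by (simp add: smoothstep_deriv_def)
   then show ?thesis
    by (rule has_field_derivative_transform_within[where d=1])
     (use 3 in \<open>auto simp: smoothstep_def dist_real_def\<close>)
  qed
 qed
 have l: "(smoothstep has_real_derivative smoothstep_deriv s) (at s within {..s})"
 proof -
  consider "s \<le> 0" | "0 < s" "s \<le> 1" | "1 < s" by linarith
  then show ?thesis
  proof cases
   case 1
   have "((%_. 0) has_real_derivative smoothstep_deriv s) (at s within {..s})"
    using 1 by (simp add: smoothstep_deriv_def)
   then show ?thesis
    by (rule has_field_derivative_transform_within[where d=1])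
     (use 1 in \<open>auto simp: smoothstep_def dist_real_def\<close>)
  next
   case 2
   have "(?p has_real_derivative smoothstep_deriv s) (at s within {..s})"
    using p[of s "{..s}"] 2 by (simp add: smoothstep_deriv_def)
   then show ?thesis
    by (rule has_field_derivative_transform_within[where d="s"])
     (use 2 in \<open>auto simp: smoothstep_def dist_real_def\<close>)
  next
   case 3
   have "((%_. 1) has_real_derivative smoothstep_deriv s) (at s within {..s})"
    using 3 by (simp add: smoothstep_deriv_def)
   then show ?thesis
    by (rule has_field_derivative_transform_within[where d="s-1"])
     (use 3 in \<open>auto simp: smoothstep_def dist_real_def\<close>)
  qed
 qed
 have u: "{..s} \<union> {s..} = UNIV" by auto
 show ?thesis
  using Lim_Un[OF l[unfolded has_field_derivative_iff] r[unfolded has_field_derivative_iff]]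
  unfolding u has_field_derivative_iff .
qed

lemma continuous_smoothstep_deriv: "continuous_on UNIV smoothstep_deriv"
 unfolding smoothstep_deriv_def by (intro continuous_intros)

lemma continuous_smoothstep: "continuous_on UNIV smoothstep"
 unfolding smoothstep_def by (intro continuous_intros)

lemma smoothstep_bounds: "0 \<le> smoothstep s" "smoothstep s \<le> 1"
proof -
 define c where "c = max 0 (min 1 s)"
 have c: "0 \<le> c" "c \<le> 1" by (auto simp: c_def)
 have "1 - c\<^sup>2 * (3 - 2 * c) = (1 - c)\<^sup>2 * (1 + 2 * c)"
  by (simp add: power2_eq_square algebra_simps)
 also have "... \<ge> 0" using c by simp
 finally show "smoothstep s \<le> 1" unfolding smoothstep_def c_def by simp
 show "0 \<le> smoothstep s" using c unfolding smoothstep_def c_def[symmetric] by simp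
qed

lemma smoothstep_eq_0: "s \<le> 0 ==> smoothstep s = 0"
 and smoothstep_eq_1: "1 \<le> s ==> smoothstep s = 1"
 and smoothstep_deriv_eq_0: "s \<le> 0 ==> smoothstep_deriv s = 0"
 and smoothstep_deriv_eq_0': "1 \<le> s ==> smoothstep_deriv s = 0"
 by (auto simp: smoothstep_def smoothstep_deriv_def)

lemma smoothstep_deriv_bound: "\<bar>smoothstep_deriv s\<bar> \<le> 2"
proof -
 define c where "c = max 0 (min 1 s)"
 have c: "0 \<le> c" "c \<le> 1" by (auto simp: c_def)
 have "6 * c * (1 - c) = 3/2 - 6 * (c - 1/2)\<^sup>2"
  by (simp add: power2_eq_square algebra_simps)
 then have "6 * c * (1 - c) \<le> 2" using zero_le_power2[of "c - 1/2"] by linarith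
 moreover have "0 \<le> 6 * c * (1 - c)" using c by simp
 ultimately show ?thesis unfolding smoothstep_deriv_def c_def by simp
qed

text \<open>The compact set K may be larger than the support: being closed, it contains the closure
  of the set where \<phi> is non-zero.\<close>

lemma test_funI:
 assumes "!!x. (\<phi> has_derivative \<phi>' x) (at x)"
  and "!!b. b \<in> Basis ==> continuous_on UNIV (%x. \<phi>' x b)"
  and K: "compact K" "K \<subseteq> U" "!!x. x \<notin> K ==> \<phi> x = 0"
 shows "test_fun \<phi> \<phi>' U"
proof -
 have "{x. \<phi> x \<noteq> 0} \<subseteq> K" using K by auto
 then have "closure {x. \<phi> x \<noteq> 0} \<subseteq> K"
  by (simp add: K closure_minimal compact_imp_closed)
 moreover have "compact (closure {x. \<phi> x \<noteq> 0})"
  using \<open>{x. \<phi> x \<noteq> 0} \<subseteq> K\<close> K(1) compact_closure bounded_subset compact_imp_bounded by blast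
 ultimately show ?thesis unfolding test_fun_def using assms by auto
qed

text \<open>The complement of the closed support is open and \<phi> is identically 0 there, so its
  derivative vanishes as well. One compact set thus serves both sides of every integration by
  parts.\<close>

lemma test_fun_support:
 assumes "test_fun \<phi> \<phi>' U"
 obtains K where "compact K" "K \<subseteq> U" "!!x. x \<notin> K ==> \<phi> x = 0" "!!x. x \<notin> K ==> \<phi>' x = (%_. 0)"
proof
 let ?K = "closure {x. \<phi> x \<noteq> 0}"
 show "compact ?K" "?K \<subseteq> U" using assms by (auto simp: test_fun_def)
 show z: "\<phi> x = 0" if "x \<notin> ?K" for x using that subsetD[OF closure_subset[of "{x. \<phi> x \<noteq> 0}"], of x] by blast
 show "\<phi>' x = (%_. 0)" if "x \<notin> ?K" for x
 proof -
  have "(\<phi> has_derivative \<phi>' x) (at x)" using assms by (auto simp: test_fun_def)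
  moreover have "((%_. 0) has_derivative (%_. 0)) (at x)" by simp
  then have "(\<phi> has_derivative (%_. 0)) (at x)"
  proof (rule has_derivative_transform_within_open)
   show "open (- ?K)" by (simp add: open_Compl)
   show "x \<in> - ?K" using that by blast
   show "0 = \<phi> y" if "y \<in> - ?K" for y using z[of y] that by (metis ComplD)
  qed
  ultimately show ?thesis by (rule has_derivative_unique)
 qed
qed

lemma test_fun_mono: "test_fun \<phi> \<phi>' U ==> U \<subseteq> V ==> test_fun \<phi> \<phi>' V"
 by (auto simp: test_fun_def)

lemma test_fun_continuous: "test_fun \<phi> \<phi>' U ==> continuous_on UNIV \<phi>"
 by (auto simp: test_fun_def intro!: has_derivative_continuous_on)

lemma test_fun_linear: "test_fun \<phi> \<phi>' U ==> linear (\<phi>' x)"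
 by (meson has_derivative_linear test_fun_def)

text \<open>The definition gives continuity in basis directions; linearity of the derivative extends
  it to an arbitrary direction h, as used for difference quotients along h.\<close>

lemma test_fun_continuous_deriv:
 fixes \<phi> :: "'a::euclidean_space => real"
 assumes "test_fun \<phi> \<phi>' U" shows "continuous_on UNIV (%x. \<phi>' x h)"
proof -
 have "\<phi>' x h = (\<Sum>b\<in>Basis. (h \<bullet> b) * \<phi>' x b)" for x
 proof -
  have "\<phi>' x h = \<phi>' x (\<Sum>b\<in>Basis. (h \<bullet> b) *R b)" by (simp add: euclidean_representation)
  also have "... = (\<Sum>b\<in>Basis. (h \<bullet> b) * \<phi>' x b)"
   using test_fun_linear[OF assms] by (simp add: linear_sum linear_cmul)
  finally show ?thesis .
 qed
 then show ?thesis using assms by (auto simp: test_fun_def intro!: continuous_intros)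
qed

lemma test_fun_bounded:
 fixes \<phi> :: "'a::euclidean_space => real"
 assumes "test_fun \<phi> \<phi>' U"
 obtains M where "0 \<le> M" "!!x. \<bar>\<phi> x\<bar> \<le> M" "!!x. \<bar>\<phi>' x h\<bar> \<le> M"
proof -
 obtain K where K: "compact K" "K \<subseteq> U" "!!x. x \<notin> K ==> \<phi> x = 0" "!!x. x \<notin> K ==> \<phi>' x = (%_. 0)"
  using test_fun_support[OF assms] by blast
 have "compact (\<phi> ` K)" "compact ((%x. \<phi>' x h) ` K)"
  using K(1) test_fun_continuous[OF assms] test_fun_continuous_deriv[OF assms]
  by (auto intro!: compact_continuous_image intro: continuous_on_subset)
 then have "bounded (\<phi> ` K)" "bounded ((%x. \<phi>' x h) ` K)" by (auto intro: compact_imp_bounded)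
 then obtain M N where "!!x. x \<in> K ==> \<bar>\<phi> x\<bar> \<le> M" "!!x. x \<in> K ==> \<bar>\<phi>' x h\<bar> \<le> N"
  unfolding bounded_real by blast
 then have "\<bar>\<phi> x\<bar> \<le> max 0 (max M N)" "\<bar>\<phi>' x h\<bar> \<le> max 0 (max M N)" for x
  using K(3,4)[of x] by (cases "x \<in> K"; fastforce simp: le_max_iff_disj)+
 then show thesis by (intro that[of "max 0 (max M N)"]) auto
qed

lemma test_fun_borel:
 assumes "test_fun \<phi> \<phi>' U"
 shows "(\<phi> :: 'a::euclidean_space => real) \<in> bmeas" "(%x. \<phi>' x h) \<in> bmeas"
 using borel_measurable_continuous_onI[OF test_fun_continuous[OF assms]]
  borel_measurable_continuous_onI[OF test_fun_continuous_deriv[OF assms]] by auto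

lemma test_fun_translate:
 fixes \<phi> :: "'a::euclidean_space => real"
 assumes "test_fun \<phi> \<phi>' U" "!!x. x \<in> U ==> x + h \<in> V"
 shows "test_fun (%x. \<phi> (x - h)) (%x. \<phi>' (x - h)) V"
proof -
 obtain K where K: "compact K" "K \<subseteq> U" "!!x. x \<notin> K ==> \<phi> x = 0" "!!x. x \<notin> K ==> \<phi>' x = (%_. 0)"
  using test_fun_support[OF assms(1)] by blast
 show ?thesis
 proof (rule test_funI)
  show "((%x. \<phi> (x - h)) has_derivative \<phi>' (x - h)) (at x)" for x
  proof -
   have "(\<phi> has_derivative \<phi>' (x - h)) (at (x - h))" using assms by (auto simp: test_fun_def)
   moreover have "((%x. x - h) has_derivative (%y. y)) (at x)" by (auto intro!: derivative_eq_intros)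
   ultimately show ?thesis using has_derivative_compose[of "%x. x - h" "%y. y" x UNIV \<phi> "\<phi>' (x - h)"] by simp
  qed
  show "continuous_on UNIV (%x. \<phi>' (x - h) b)" for b
   by (rule continuous_on_compose2[OF test_fun_continuous_deriv[OF assms(1), of b], of UNIV "%x. x - h"])
    (intro continuous_intros, simp)
  show "compact ((%x. h + x) ` K)" using K by (intro compact_translation) 
  show "(%x. h + x) ` K \<subseteq> V" using K(2) assms(2) by (auto simp: add.commute[of h])
  show "\<phi> (x - h) = 0" if "x \<notin> (%x. h + x) ` K" for x
  proof -
   have "x - h \<notin> K" using that by (metis add_diff_cancel_left' diff_add_cancel image_eqI add.commute)
   then show ?thesis by (rule K(3))
  qed
 qed
qed

section \<open>Bumps approximating the indicator of a box\<close>

text \<open>One pair of ramps of slope of order k per coordinate, both growing inwards from the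
  faces. The support stays in the closed box for every k > 0, while the pointwise limit is the
  indicator of the open box.\<close>

definition box_bump :: "real => 'a::euclidean_space => 'a => 'a => real" where
 "box_bump k a b x = (\<Prod>i\<in>Basis. smoothstep (k * (x \<bullet> i - a \<bullet> i)) * smoothstep (k * (b \<bullet> i - x \<bullet> i)))"

lemma test_fun_box_bump:
 fixes a b :: "'a::euclidean_space"
 assumes "k > 0" "cbox a b \<subseteq> U"
 shows "\<exists>\<phi>'. test_fun (box_bump k a b) \<phi>' U"
proof -
 define f where "f i x = smoothstep (k * (x \<bullet> i - a \<bullet> i)) * smoothstep (k * (b \<bullet> i - x \<bullet> i))" for i x :: 'a
 define f' where "f' i x y = smoothstep (k * (x \<bullet> i - a \<bullet> i)) * (smoothstep_deriv (k * (b \<bullet> i - x \<bullet> i)) * (- k * (y \<bullet> i)))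
   + (smoothstep_deriv (k * (x \<bullet> i - a \<bullet> i)) * (k * (y \<bullet> i))) * smoothstep (k * (b \<bullet> i - x \<bullet> i))" for i x y :: 'a
 have d: "(f i has_derivative f' i x) (at x)" for i x
  unfolding f_def f'_def
  by (intro has_derivative_mult DERIV_smoothstep[THEN DERIV_compose_FDERIV, THEN has_derivative_eq_rhs])
   (auto intro!: derivative_eq_intros simp: fun_eq_iff)
 have c: "continuous_on UNIV (f i)" "continuous_on UNIV (%x. f' i x y)" for i y
  unfolding f_def f'_def
  by (intro continuous_intros continuous_on_compose2[OF continuous_smoothstep] continuous_on_compose2[OF continuous_smoothstep_deriv] subset_UNIV)+
 have e: "box_bump k a b = (%x. \<Prod>i\<in>Basis. f i x)" by (simp add: box_bump_def f_def fun_eq_iff)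
 have "test_fun (%x. \<Prod>i\<in>Basis. f i x) (%x y. \<Sum>i\<in>Basis. f' i x y * (\<Prod>j\<in>Basis - {i}. f j x)) U"
 proof (rule test_funI)
  show "((%x. \<Prod>i\<in>Basis. f i x) has_derivative (%y. \<Sum>i\<in>Basis. f' i x y * (\<Prod>j\<in>Basis - {i}. f j x))) (at x)" for x
   by (rule has_derivative_prod) (rule d)
  show "continuous_on UNIV (%x. \<Sum>i\<in>Basis. f' i x b * (\<Prod>j\<in>Basis - {i}. f j x))" for b
   by (intro continuous_intros c)
  show "compact (cbox a b)" by simp
  show "(\<Prod>i\<in>Basis. f i x) = 0" if "x \<notin> cbox a b" for x
  proof -
   from that obtain i where i: "i \<in> Basis" "x \<bullet> i < a \<bullet> i \<or> b \<bullet> i < x \<bullet> i"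
    by (auto simp: mem_box not_le)
   then have "k * (x \<bullet> i - a \<bullet> i) \<le> 0 \<or> k * (b \<bullet> i - x \<bullet> i) \<le> 0"
    using assms(1) by (auto simp: mult_le_0_iff)
   then have "f i x = 0" by (auto simp: f_def smoothstep_eq_0)
   then show ?thesis using i by (auto intro!: prod_zero)
  qed
 qed fact
 then show ?thesis unfolding e by blast
qed

lemma box_bump_bounds: "0 \<le> box_bump k a b x" "box_bump k a b x \<le> 1"
 unfolding box_bump_def by (auto intro!: prod_nonneg prod_le_1 mult_nonneg_nonneg mult_le_one smoothstep_bounds)

text \<open>At an interior point each of the finitely many ramps is saturated once k times the
  distance to its face reaches 1. At any other point some factor is 0 for every k.\<close>

lemma box_bump_tendsto: "(%n. box_bump (real n) a b x) ~> indicator (box a b) x"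
proof (cases "x \<in> box a b")
 case True
 have 1: "\<forall>\<^sub>F n in sequentially. smoothstep (real n * t) = 1" if "t > 0" for t :: real
 proof -
  obtain N where "1 / t \<le> real N" using real_arch_simple by blast
  then have "1 \<le> real n * t" if "n \<ge> N" for n
   using that \<open>t > 0\<close> by (simp add: field_simps) (smt (verit) mult_right_mono of_nat_mono mult.commute)
  then show ?thesis using smoothstep_eq_1 by (auto simp: eventually_sequentially)
 qed
 have "\<forall>\<^sub>F n in sequentially. \<forall>i\<in>Basis. smoothstep (real n * (x \<bullet> i - a \<bullet> i)) * smoothstep (real n * (b \<bullet> i - x \<bullet> i)) = 1"
 proof (intro eventually_ball_finite ballI finite_Basis)
  fix i :: 'a assume "i \<in> Basis"
  then have "0 < x \<bullet> i - a \<bullet> i" "0 < b \<bullet> i - x \<bullet> i" using True by (auto simp: mem_box)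
  from 1[OF this(1)] 1[OF this(2)]
  show "\<forall>\<^sub>F n in sequentially. smoothstep (real n * (x \<bullet> i - a \<bullet> i)) * smoothstep (real n * (b \<bullet> i - x \<bullet> i)) = 1"
   by eventually_elim simp
 qed
 then have "\<forall>\<^sub>F n in sequentially. box_bump (real n) a b x = 1"
  by eventually_elim (simp add: box_bump_def)
 then show ?thesis using True by (simp add: tendsto_eventually)
next
 case False
 then obtain i where i: "i \<in> Basis" "x \<bullet> i \<le> a \<bullet> i \<or> b \<bullet> i \<le> x \<bullet> i"
  by (auto simp: mem_box not_less)
 have "box_bump (real n) a b x = 0" for n
 proof -
  have "real n * (x \<bullet> i - a \<bullet> i) \<le> 0 \<or> real n * (b \<bullet> i - x \<bullet> i) \<le> 0"
   using i by (auto simp: mult_le_0_iff)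
  then show ?thesis unfolding box_bump_def
   using i(1) by (auto intro!: prod_zero bexI[of _ i] simp: smoothstep_eq_0)
 qed
 then show ?thesis using False by simp
qed

section \<open>Weak gradients with Borel representatives\<close>

lemma nn_integral_shift:
 fixes f :: "'a::euclidean_space => ennreal"
 assumes "f \<in> bmeas"
 shows "(NN x. f (x + h)) = (NN x. f x)"
 using nn_integral_distr[of "(+) h" lborel borel f] assms
 by (simp add: lborel_distr_plus add.commute)

lemma integral_shift:
 fixes f :: "'a::euclidean_space => 'b::{banach, second_countable_topology}"
 assumes "f \<in> bmeas"
 shows "(LBINT x. f (x + h)) = (LBINT x. f x)"
 using integral_distr[of "(+) h" lborel borel f] assms
 by (simp add: lborel_distr_plus add.commute)

lemma integrable_shift:
 fixes f :: "'a::euclidean_space => 'b::{banach, second_countable_topology}"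
 assumes "integrable lborel f"
 shows "integrable lborel (%x. f (x + h))"
 using integrable_distr[of "(+) h" lborel borel f] assms
 by (simp add: lborel_distr_plus add.commute)

lemma AE_shift:
 fixes P :: "'a::euclidean_space => bool"
 assumes "AE x in lborel. P x"
 shows "AE x in lborel. P (x + h)"
proof -
 have "AE x in distr lborel borel ((+) h). P x" using assms unfolding lborel_distr_plus .
 then have "AE x in lborel. P (h + x)" by (rule AE_distrD[rotated]) simp
 then show ?thesis by (simp add: add.commute)
qed

text \<open>Coordinatewise choice of Borel versions; the finitely many exceptional null sets combine
  to one.\<close>

lemma ex_borel_representative:
 fixes f :: "'a::euclidean_space => 'b::euclidean_space"
 assumes "f \<in> borel_measurable lebesgue"
 shows "\<exists>g\<in>bmeas. AE x in lborel. f x = g x"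
proof -
 have "\<exists>g\<in>borel_measurable lborel. AE x in lborel. f x \<bullet> i = g x" for i
  by (rule completion_ex_borel_measurable_real) (use assms in simp)
 then obtain g where g: "!!i. g i \<in> borel_measurable lborel" "!!i. AE x in lborel. f x \<bullet> i = g i x"
  by metis
 have "AE x in lborel. \<forall>i\<in>Basis. f x \<bullet> i = g i x"
  using g(2) by (simp add: AE_ball_countable countable_finite)
 then have "AE x in lborel. f x = (\<Sum>i\<in>Basis. g i x *R i)"
 proof eventually_elim
  case (elim x)
  then have "(\<Sum>i\<in>Basis. g i x *R i) = (\<Sum>i\<in>Basis. (f x \<bullet> i) *R i)"
   by (intro sum.cong) auto
  then show ?case by (simp add: euclidean_representation)
 qed
 moreover have "(%x. \<Sum>i\<in>Basis. g i x *R i) \<in> bmeas"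
  using g(1) by simp
 ultimately show ?thesis by (rule bexI)
qed

lemma set_integrable_square_imp:
 fixes u :: "'a::euclidean_space => 'b::euclidean_space"
 assumes "compact K" "u \<in> bmeas" "set_integrable lborel K (%x. (norm (u x))\<^sup>2)"
 shows "set_integrable lborel K u"
proof -
 have K: "K \<in> sets borel" by (simp add: assms(1) borel_compact)
 have "set_integrable lborel K (%x. 1 + (norm (u x))\<^sup>2)"
 proof (intro set_integral_add assms(3))
  show "set_integrable lborel K (%x. 1::real)"
   using K emeasure_bounded_finite[OF compact_imp_bounded[OF assms(1)]]
   by (simp add: set_integrable_def)
 qed
 then show ?thesis unfolding set_integrable_def
 proof (rule Bochner_Integration.integrable_bound)
  show "(%x. indicat_real K x *R u x) \<in> borel_measurable lborel" using K assms(2) by measurable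
  have "norm (u x) \<le> 1 + (norm (u x))\<^sup>2" for x
  proof -
   have "0 \<le> (norm (u x) - 1)\<^sup>2" by simp
   then have "2 * norm (u x) \<le> (norm (u x))\<^sup>2 + 1" by (simp add: power2_diff)
   then show ?thesis using norm_ge_zero[of "u x"] by linarith
  qed
  then show "AE x in lborel. norm (indicat_real K x *R u x) \<le> norm (indicat_real K x *R (1 + (norm (u x))\<^sup>2))"
   by (intro AE_I2) (auto simp: indicator_def)
 qed
qed

lemma integrable_bounded_support:
 fixes f :: "'a::euclidean_space => 'b::euclidean_space"
 assumes "set_integrable lborel K f" "f \<in> bmeas" "g \<in> bmeas" 
  and "!!x. x \<notin> K ==> g x = 0" "!!x. \<bar>g x\<bar> \<le> M"
 shows "integrable lborel (%x. g x *R f x)"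
proof (rule Bochner_Integration.integrable_bound)
 show "integrable lborel (%x. M *R (indicat_real K x *R f x))"
  using assms(1) unfolding set_integrable_def by (rule integrable_scaleR_right)
 show "(%x. g x *R f x) \<in> borel_measurable lborel" using assms by measurable
 show "AE x in lborel. norm (g x *R f x) \<le> norm (M *R indicat_real K x *R f x)"
 proof (intro AE_I2)
  fix x show "norm (g x *R f x) \<le> norm (M *R indicat_real K x *R f x)"
   using assms(4,5)[of x] by (cases "x \<in> K") (auto intro!: mult_right_mono)
 qed
qed

text \<open>Bumps tend to indicators of boxes, so by dominated convergence f has zero integral over
  every box in U. A Dynkin argument extends this to all Borel subsets of a box, in particular to the
  sets where a coordinate of f is positive or negative, which must then be null. Countably many
  boxes exhaust U.\<close>

lemma fundamental_lemma_of_variations: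
 fixes f :: "'a::euclidean_space => 'b::euclidean_space"
 assumes U: "open U" and f[measurable]: "f \<in> bmeas"
  and int: "!!K. compact K ==> K \<subseteq> U ==> set_integrable lborel K f"
  and zero: "!!\<phi> \<phi>'. test_fun \<phi> \<phi>' U ==> (LBINT x. \<phi> x *R f x) = 0"
 shows "AE x in lborel. x \<in> U \<longrightarrow> f x = 0"
proof -
 have box0: "(LBINT x. indicator (box a b) x *R f x) = 0" if ab: "cbox a b \<subseteq> U" for a b
 proof -
  have "(%n. (LBINT x. box_bump (real (Suc n)) a b x *R f x)) ~> (LBINT x. indicator (box a b) x *R f x)"
  proof (rule integral_dominated_convergence[where w="%x. indicator (cbox a b) x * norm (f x)"])
   show "integrable lborel (%x. indicat_real (cbox a b) x * norm (f x))"
    using integrable_norm[OF int[OF compact_cbox ab, unfolded set_integrable_def]] by simp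
   have "box_bump (real (Suc n)) a b \<in> bmeas" for n
   proof -
    obtain \<phi>' where "test_fun (box_bump (real (Suc n)) a b) \<phi>' U"
     using test_fun_box_bump[OF _ ab, of "real (Suc n)"] by auto
    then show ?thesis by (rule test_fun_borel)
   qed
   then show "(%x. box_bump (real (Suc n)) a b x *R f x) \<in> borel_measurable lborel" for n
    by measurable
   show "AE x in lborel. norm (box_bump (real (Suc n)) a b x *R f x) \<le> indicat_real (cbox a b) x * norm (f x)" for n
   proof (intro AE_I2)
    fix x
    obtain \<phi>' where "test_fun (box_bump (real (Suc n)) a b) \<phi>' (cbox a b)"
     using test_fun_box_bump[OF _ order_refl, of "real (Suc n)"] by auto
    then have "x \<notin> cbox a b ==> box_bump (real (Suc n)) a b x = 0"
     by (meson subsetD test_fun_support)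
    then show "norm (box_bump (real (Suc n)) a b x *R f x) \<le> indicat_real (cbox a b) x * norm (f x)"
     using box_bump_bounds[of "real (Suc n)" a b x] by (cases "x \<in> cbox a b") (auto intro!: mult_left_le_one_le)
   qed
   have "(%n. box_bump (real (Suc n)) a b x) ~> indicator (box a b) x" for x
    using box_bump_tendsto[THEN LIMSEQ_Suc] .
   then show "AE x in lborel. (%n. box_bump (real (Suc n)) a b x *R f x) ~> indicat_real (box a b) x *R f x"
    by (intro AE_I2 tendsto_intros)
  qed simp
  moreover have "(LBINT x. box_bump (real (Suc n)) a b x *R f x) = 0" for n
   using test_fun_box_bump[OF _ ab, of "real (Suc n)"] zero by auto
  ultimately show ?thesis by (simp add: LIMSEQ_const_iff)
 qed
 have on_box: "AE x in lborel. x \<in> box c d \<longrightarrow> f x = 0" if cd: "cbox c d \<subseteq> U" for c d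
 proof -
  define g where "g x = indicator (box c d) x *R f x" for x
  have g[measurable]: "g \<in> bmeas" unfolding g_def by measurable
  have gi: "integrable lborel g"
  proof (rule Bochner_Integration.integrable_bound[OF int[OF compact_cbox cd, unfolded set_integrable_def]])
   show "AE x in lborel. norm (g x) \<le> norm (indicat_real (cbox c d) x *R f x)"
    using box_subset_cbox[of c d] by (intro AE_I2) (auto simp: g_def indicator_def)
  qed simp
  \<comment> \<open>Open boxes are an intersection-stable generator of the Borel sets. Complements
    and disjoint unions go through because g, the restriction of f to one box, is integrable on the
    whole space.\<close>
  have "(LBINT x. indicator A x *R g x) = 0" if "A \<in> sets borel" for A
  proof -
   have "A \<in> sigma_sets UNIV (range (%(a,b). box a b))"
    using that by (simp add: borel_eq_box[where 'a='a] sets_measure_of)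
   have "Int_stable (range (%(a::'a, b). box a b))"
    by (auto simp: Int_stable_def box_Int_box)
   moreover have "range (%(a::'a, b). box a b) \<subseteq> Pow UNIV" by simp
   ultimately show ?thesis using \<open>A \<in> sigma_sets UNIV (range (%(a,b). box a b))\<close>
   proof (induction rule: sigma_sets_induct_disjoint)
    case (basic A)
    then obtain a b where A: "A = box a b" by auto
    obtain e k where ek: "box a b \<inter> box c d = box e k" using box_Int_box by blast
    have "(LBINT x. indicator A x *R g x) = (LBINT x. indicator (box e k) x *R f x)"
     by (intro Bochner_Integration.integral_cong) (auto simp: A g_def ek[symmetric] indicator_def)
    also have "... = 0"
    proof (cases "box e k = {}")
     case False
     then have "box e k \<subseteq> cbox c d" using ek box_subset_cbox by blast
     then have "cbox e k \<subseteq> cbox c d" using False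
      by (metis closed_cbox closure_box closure_minimal)
     then show ?thesis using cd by (intro box0) auto
    qed simp
    finally show ?case .
   next
    case empty show ?case by simp
   next
    case (compl A)
    have A: "A \<in> sets borel" using compl by (simp add: borel_eq_box[where 'a='a] sets_measure_of)
    have "(LBINT x. indicator (UNIV - A) x *R g x) = (LBINT x. g x - indicator A x *R g x)"
     by (intro Bochner_Integration.integral_cong) (auto simp: indicator_def)
    also have "... = (LBINT x. g x) - (LBINT x. indicator A x *R g x)"
     by (intro Bochner_Integration.integral_diff gi integrable_mult_indicator) (use A in auto)
    also have "... = 0" using compl box0[OF cd] by (simp add: g_def[abs_def])
    finally show ?case .
   next
    case (union A)
    have A: "A i \<in> sets lborel" for i using union(2) by (auto simp: borel_eq_box[where 'a='a] sets_measure_of)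
    have "(LINT x:\<Union>(range A)|lborel. g x) = (\<Sum>i. LINT x:A i|lborel. g x)"
    proof (rule lebesgue_integral_countable_add)
     show "set_integrable lborel (\<Union>(range A)) g" unfolding set_integrable_def
      by (intro integrable_mult_indicator gi) (use A in auto)
    qed (use A union in \<open>auto simp: disjoint_family_on_def\<close>)
    then show ?case using union by (simp add: set_lebesgue_integral_def)
   qed
  qed
  note Az = this
  have "AE x in lborel. g x \<bullet> i = 0" if "i \<in> Basis" for i
  proof -
   \<comment> \<open>The signs 1 and -1 treat the positive and the negative part of a coordinate: a
     non-negative function with zero integral vanishes almost everywhere.\<close>
   have *: "AE x in lborel. indicator {x. s * (g x \<bullet> i) > 0} x * (s * (g x \<bullet> i)) = 0" if "s = 1 \<or> s = -1" for s :: real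
   proof -
    define A where "A = {x. s * (g x \<bullet> i) > 0}"
    have A: "A \<in> sets borel" unfolding A_def by measurable
    have I: "integrable lborel (%x. indicator A x *R g x)"
     by (intro integrable_mult_indicator gi) (use A in auto)
    have "(LBINT x. indicator A x * (s * (g x \<bullet> i))) = (LBINT x. s * ((indicator A x *R g x) \<bullet> i))"
     by (intro Bochner_Integration.integral_cong) auto
    also have "... = s * ((LBINT x. indicator A x *R g x) \<bullet> i)"
     using I by (simp del: inner_scaleR_left)
    also have "... = 0" using Az[OF A] by simp
    finally have z: "(LBINT x. indicator A x * (s * (g x \<bullet> i))) = 0" .
    have "integrable lborel (%x. s * ((indicator A x *R g x) \<bullet> i))" using I by (simp del: inner_scaleR_left)
    then have J: "integrable lborel (%x. indicator A x * (s * (g x \<bullet> i)))"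
     by (simp add: mult.left_commute)
    show ?thesis using integral_nonneg_eq_0_iff_AE[OF J] z unfolding A_def by (auto simp: indicator_def)
   qed
   from *[of 1, simplified] *[of "-1", simplified] show ?thesis
    by eventually_elim (auto simp: indicator_def split: if_splits)
  qed
  then have "AE x in lborel. \<forall>i\<in>Basis. g x \<bullet> i = 0" by (simp add: AE_ball_countable countable_finite)
  then show ?thesis
   by eventually_elim (auto simp: g_def indicator_def intro: euclidean_eqI)
 qed
 \<comment> \<open>By Lindelof countably many boxes cover U, so their null sets have a null
   union.\<close>
 define \<F> where "\<F> = {X. \<exists>a b. X = box a b \<and> cbox a b \<subseteq> U}"
 obtain \<F>' where F: "\<F>' \<subseteq> \<F>" "countable \<F>'" "\<Union>\<F>' = \<Union>\<F>"
 proof (rule Lindelof[of \<F>])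
  show "open S" if "S \<in> \<F>" for S using that by (auto simp: \<F>_def)
 qed
 have "U \<subseteq> \<Union>\<F>"
 proof
  fix x assume "x \<in> U"
  then obtain a b where "cbox a b \<subseteq> U" "x \<in> box a b" using open_contains_cbox[OF U] by metis
  then show "x \<in> \<Union>\<F>" unfolding \<F>_def by blast
 qed
 have "AE x in lborel. \<forall>X\<in>\<F>'. x \<in> X \<longrightarrow> f x = 0"
  unfolding AE_ball_countable[OF F(2)]
 proof
  fix X assume "X \<in> \<F>'"
  then obtain a b where "X = box a b" "cbox a b \<subseteq> U" using F(1) by (auto simp: \<F>_def)
  then show "AE x in lborel. x \<in> X \<longrightarrow> f x = 0" using on_box[of a b] by simp
 qed
 then show ?thesis
 proof eventually_elim
  case (elim x)
  show ?case
  proof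
   assume "x \<in> U"
   then have "x \<in> \<Union>\<F>'" unfolding F(3) by (rule subsetD[OF \<open>U \<subseteq> \<Union>\<F>\<close>])
   then show "f x = 0" using elim by (metis UnionE)
  qed
 qed
qed

section \<open>Weak gradients of Borel functions\<close>

text \<open>The content of \<open>weak_grad\<close>, but with Borel functions and
  \<open>lborel\<close>. The completed measure on a product is not the product of the completed
  measures; for \<open>lborel\<close> it is, and Fubini, translations and slicing become
  available.\<close>

definition borel_grad :: "'a set => ('a::euclidean_space => 'b::euclidean_space) => ('a => 'a => 'b) => bool" where
 "borel_grad U u D \<longleftrightarrow> open U \<and> u \<in> bmeas \<and> (\<forall>b\<in>Basis. D b \<in> bmeas) \<and>
  (\<forall>K. compact K \<and> K \<subseteq> U \<longrightarrow>
    set_integrable lborel K (%x. (norm (u x))\<^sup>2) \<and>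
    (\<forall>b\<in>Basis. set_integrable lborel K (%x. (norm (D b x))\<^sup>2))) \<and>
  (\<forall>\<phi> \<phi>'. test_fun \<phi> \<phi>' U \<longrightarrow>
    (\<forall>b\<in>Basis. (LBINT x. \<phi> x *R D b x) = - (LBINT x. \<phi>' x b *R u x)))"

lemma borel_gradD:
 assumes "borel_grad U u D"
 shows "open U" "u \<in> bmeas" "!!b. b \<in> Basis ==> D b \<in> bmeas"
  "!!K. compact K ==> K \<subseteq> U ==> set_integrable lborel K (%x. (norm (u x))\<^sup>2)"
  "!!K b. compact K ==> K \<subseteq> U ==> b \<in> Basis ==> set_integrable lborel K (%x. (norm (D b x))\<^sup>2)"
  "!!\<phi> \<phi>' b. test_fun \<phi> \<phi>' U ==> b \<in> Basis ==>
   (LBINT x. \<phi> x *R D b x) = - (LBINT x. \<phi>' x b *R u x)"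
 using assms unfolding borel_grad_def by (simp, simp, simp, blast, blast, blast)

lemma borel_grad_L1:
 assumes "borel_grad U u D" "compact K" "K \<subseteq> U"
 shows "set_integrable lborel K u" "b \<in> Basis ==> set_integrable lborel K (D b)"
 by (rule set_integrable_square_imp[OF assms(2) borel_gradD(2)[OF assms(1)] borel_gradD(4)[OF assms]])
  (rule set_integrable_square_imp[OF assms(2) borel_gradD(3)[OF assms(1)] borel_gradD(5)[OF assms]])

lemma set_integrable_lebesgue_iff:
 fixes f :: "'a::euclidean_space => 'b::euclidean_space"
 assumes "f \<in> bmeas" "compact K"
 shows "set_integrable lebesgue K f \<longleftrightarrow> set_integrable lborel K f"
 using assms unfolding set_integrable_def
 by (intro integrable_completion borel_measurable_scaleR borel_measurable_indicator) (auto simp: borel_compact)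

lemma borel_grad_imp_weak_grad:
 assumes "borel_grad U u D"
 shows "weak_grad U u D"
 unfolding weak_grad_def
proof (intro conjI allI impI ballI)
 note D = borel_gradD[OF assms]
 have [measurable]: "u \<in> bmeas" by (rule D)
 show "open U" by (rule D)
 show "u \<in> borel_measurable lebesgue" using D(2) by (simp add: measurable_completion)
 fix b :: 'a assume b: "b \<in> Basis"
 have [measurable]: "D b \<in> bmeas" by (rule D(3)[OF b])
 show "D b \<in> borel_measurable lebesgue" using D(3)[OF b] by (simp add: measurable_completion)
 show "set_integrable lebesgue K (%x. (norm (D b x))\<^sup>2)" if "compact K \<and> K \<subseteq> U" for K
  using that D(5)[OF _ _ b, of K] by (subst set_integrable_lebesgue_iff) simp_all
 fix \<phi> \<phi>' assume t: "test_fun \<phi> \<phi>' U"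
 have [measurable]: "\<phi> \<in> bmeas" "(%x. \<phi>' x b) \<in> bmeas"
  using test_fun_borel[OF t] by auto
 show "(\<integral>x. \<phi> x *R D b x \<partial>lebesgue) = - (\<integral>x. \<phi>' x b *R u x \<partial>lebesgue)"
  using D(6)[OF t b] by (simp add: integral_completion)
next
 show "set_integrable lebesgue K (%x. (norm (u x))\<^sup>2)" if "compact K \<and> K \<subseteq> U" for K
  using that borel_gradD(4)[OF assms, of K] borel_gradD(2)[OF assms] by (subst set_integrable_lebesgue_iff) simp_all
qed

text \<open>All conditions in the definition are integrals, hence blind to null sets: any Borel
  versions of the field and of its partial derivatives inherit them.\<close>

lemma weak_grad_imp_borel_grad:
 fixes u u' :: "'a::euclidean_space => 'b::euclidean_space"
 assumes "weak_grad U u D" and u'[measurable]: "u' \<in> bmeas" and D': "!!b. b \<in> Basis ==> D' b \<in> bmeas"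
  and eq: "AE x in lborel. u x = u' x" "!!b. b \<in> Basis ==> AE x in lborel. D b x = D' b x"
 shows "borel_grad U u' D'"
 unfolding borel_grad_def
proof (intro conjI allI impI ballI)
 note W = assms(1)[unfolded weak_grad_def]
 show "open U" using W by simp
 show "u' \<in> bmeas" by fact
 have um: "u \<in> borel_measurable lebesgue" using W by simp
 have tr: "set_integrable lborel K (%x. (norm (g x))\<^sup>2)"
  if "set_integrable lebesgue K (%x. (norm (f x))\<^sup>2)" "compact K" "f \<in> borel_measurable lebesgue"
   "g \<in> bmeas" "AE x in lborel. f x = g x" for K and f g :: "'a => 'b"
 proof -
  have K: "K \<in> sets borel" using that(2) by (simp add: borel_compact)
  have [measurable]: "K \<in> sets lebesgue" "g \<in> bmeas" "K \<in> sets borel" using K that by auto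
  note [measurable] = that(3)
  have [measurable]: "g \<in> borel_measurable lebesgue" using that(4) by (simp add: measurable_completion)
  have "AE x in lebesgue. indicat_real K x *R (norm (f x))\<^sup>2 = indicat_real K x *R (norm (g x))\<^sup>2"
   using that(5) by (intro AE_completion) auto
  then have "set_integrable lebesgue K (%x. (norm (g x))\<^sup>2)"
   using that(1) unfolding set_integrable_def by (subst (asm) integrable_cong_AE) auto
  then show ?thesis by (subst (asm) set_integrable_lebesgue_iff) (use that in auto)
 qed
 show "set_integrable lborel K (%x. (norm (u' x))\<^sup>2)" if "compact K \<and> K \<subseteq> U" for K
  using W that by (intro tr[OF _ _ um u' eq(1)]) blast+
 fix b :: 'a assume b: "b \<in> Basis"
 show Db'[measurable]: "D' b \<in> bmeas" using D' b by auto
 have Db: "D b \<in> borel_measurable lebesgue" using W b by simp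
 show "set_integrable lborel K (%x. (norm (D' b x))\<^sup>2)" if "compact K \<and> K \<subseteq> U" for K
  using W that b by (intro tr[OF _ _ Db Db' eq(2)[OF b]]) blast+
 fix \<phi> \<phi>' assume t: "test_fun \<phi> \<phi>' U"
 have [measurable]: "\<phi> \<in> bmeas" "(%x. \<phi>' x b) \<in> bmeas"
  using test_fun_borel[OF t] by auto
 have co: "(\<integral>x. g x *R f x \<partial>lebesgue) = (LBINT x. g x *R f' x)"
  if [measurable]: "f \<in> borel_measurable lebesgue" "f' \<in> bmeas" "g \<in> bmeas" and "AE x in lborel. f x = f' x"
  for g :: "'a => real" and f f' :: "'a => 'b"
 proof -
  have [measurable]: "f' \<in> borel_measurable lebesgue" "g \<in> borel_measurable lebesgue" using that by (auto simp: measurable_completion)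
  have "(\<integral>x. g x *R f x \<partial>lebesgue) = (\<integral>x. g x *R f' x \<partial>lebesgue)"
  proof (rule integral_cong_AE)
   show "AE x in lebesgue. g x *R f x = g x *R f' x"
    using that(4) by (intro AE_completion) auto
  qed measurable
  then show ?thesis by (simp add: integral_completion)
 qed
 have "(\<integral>x. \<phi> x *R D b x \<partial>lebesgue) = - (\<integral>x. \<phi>' x b *R u x \<partial>lebesgue)"
  using W t b by blast
 then show "(LBINT x. \<phi> x *R D' b x) = - (LBINT x. \<phi>' x b *R u' x)"
  using co[OF Db Db' _ eq(2)[OF b], of \<phi>] co[OF um u' _ eq(1), of "%x. \<phi>' x b"] by simp
qed

text \<open>Testing with the translated test function shows that D b and its translate represent the
  derivative of the same function, and the fundamental lemma identifies them. This supplies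
  periodicity of the gradient, since \<open>sob_div\<close> states periodicity of the field alone.
  The version on a translation-invariant open U serves fields living on a strip.\<close>

lemma borel_grad_shift_invariant:
 assumes B: "borel_grad U u D" and U: "!!x. x + h \<in> U \<longleftrightarrow> x \<in> U" 
  and per: "AE x in lborel. u (x + h) = u x" and b: "b \<in> Basis"
 shows "AE x in lborel. x \<in> U \<longrightarrow> D b (x + h) = D b x"
proof -
 note D = borel_gradD[OF B]
 have [measurable]: "u \<in> bmeas" "D b \<in> bmeas" by (rule D, rule D(3)[OF b])
 have cK: "compact ((+) h ` K)" "(+) h ` K \<subseteq> U" if "compact K" "K \<subseteq> U" for K
 proof -
  show "compact ((+) h ` K)" by (rule compact_translation[OF that(1)])
  show "(+) h ` K \<subseteq> U"
  proof
   fix y assume "y \<in> (+) h ` K"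
   then obtain x where "x \<in> K" "y = x + h" by (auto simp: add.commute)
   then show "y \<in> U" using U that(2) by blast
  qed
 qed
 have sh: "set_integrable lborel K (%x. D b (x + h))" if K: "compact K" "K \<subseteq> U" for K
 proof -
  have "indicat_real ((+) h ` K) (x + h) = indicat_real K x" for x
   by (auto simp: indicator_def image_iff add.commute[of h])
  then show ?thesis
   using integrable_shift[OF borel_grad_L1(2)[OF B cK[OF K] b, unfolded set_integrable_def], of h]
   by (simp add: set_integrable_def)
 qed
 have "AE x in lborel. x \<in> U \<longrightarrow> D b (x + h) - D b x = 0"
 proof (rule fundamental_lemma_of_variations)
  show "open U" by (rule D)
  show "set_integrable lborel K (%x. D b (x + h) - D b x)" if "compact K" "K \<subseteq> U" for K
   using sh[OF that] borel_grad_L1(2)[OF B that b] by (rule set_integral_diff)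
  fix \<phi> \<phi>' assume t: "test_fun \<phi> \<phi>' U"
  have [measurable]: "\<phi> \<in> bmeas" "(%x. \<phi>' x b) \<in> bmeas"
   using test_fun_borel[OF t] by auto
  obtain K where K: "compact K" "K \<subseteq> U" "!!x. x \<notin> K ==> \<phi> x = 0" using test_fun_support[OF t] by metis
  obtain M where M: "!!x. \<bar>\<phi> x\<bar> \<le> M" using test_fun_bounded[OF t] by metis
  have t2: "test_fun (%x. \<phi> (x - h)) (%x. \<phi>' (x - h)) U" by (rule test_fun_translate[OF t]) (use U in auto)
  have "(LBINT x. \<phi> x *R D b (x + h)) = (LBINT x. \<phi> (x - h) *R D b x)"
   using integral_shift[of "%x. \<phi> (x - h) *R D b x" h] by simp
  also have "... = - (LBINT x. \<phi>' (x - h) b *R u x)" by (rule D(6)[OF t2 b])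
  also have "(LBINT x. \<phi>' (x - h) b *R u x) = (LBINT x. \<phi>' x b *R u (x + h))"
  proof -
   have [measurable]: "(%x. \<phi>' (x - h) b) \<in> bmeas" using test_fun_borel[OF t2] by auto
   show ?thesis using integral_shift[of "%x. \<phi>' (x - h) b *R u x" h] by simp
  qed
  also have "... = (LBINT x. \<phi>' x b *R u x)"
   by (rule integral_cong_AE) (use per in auto)
  also have "- ... = (LBINT x. \<phi> x *R D b x)" using D(6)[OF t b] by simp
  finally have "(LBINT x. \<phi> x *R D b (x + h)) = (LBINT x. \<phi> x *R D b x)" .
  moreover have "integrable lborel (%x. \<phi> x *R D b (x + h))" "integrable lborel (%x. \<phi> x *R D b x)"
   by (rule integrable_bounded_support[OF sh[OF K(1,2)] _ _ K(3) M]; simp)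
    (rule integrable_bounded_support[OF borel_grad_L1(2)[OF B K(1,2) b] _ _ K(3) M]; simp)
  ultimately show "(LBINT x. \<phi> x *R (D b (x + h) - D b x)) = 0"
   by (simp add: scaleR_diff_right)
 qed measurable
 then show ?thesis by simp
qed

section \<open>Difference quotients\<close>

text \<open>Cauchy-Schwarz against the indicator of A. Without integrability the Bochner integral is
  0 by convention, and the inequality is trivial.\<close>

lemma norm_set_integral_power2_le:
 fixes f :: "'c => 'b::{banach, second_countable_topology}"
 assumes A[measurable]: "A \<in> sets M" and f[measurable]: "f \<in> borel_measurable M"
 shows "nsq (\<integral>x. indicator A x *R f x \<partial>M) \<le>
  emeasure M A * (\<integral>\<^sup>+x. indicator A x * nsq (f x) \<partial>M)"
proof (cases "integrable M (%x. indicator A x *R f x)")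
 case True
 have "ennreal (norm (\<integral>x. indicator A x *R f x \<partial>M)) \<le> (\<integral>\<^sup>+x. ennreal (norm (indicator A x *R f x)) \<partial>M)"
  using integral_norm_bound_ennreal[OF True] .
 also have "... = (\<integral>\<^sup>+x. indicator A x * (indicator A x * ennreal (norm (f x))) \<partial>M)"
  by (intro nn_integral_cong) (auto simp: indicator_def)
 finally have "(ennreal (norm (\<integral>x. indicator A x *R f x \<partial>M)))\<^sup>2 \<le> (\<integral>\<^sup>+x. indicator A x * (indicator A x * ennreal (norm (f x))) \<partial>M)\<^sup>2"
  by (rule power_mono) simp
 also have "... \<le> (\<integral>\<^sup>+x. (indicator A x)\<^sup>2 \<partial>M) * (\<integral>\<^sup>+x. (indicator A x * ennreal (norm (f x)))\<^sup>2 \<partial>M)"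
  by (rule Cauchy_Schwarz_nn_integral) measurable
 also have "(\<integral>\<^sup>+x. (indicator A x)\<^sup>2 \<partial>M) = (\<integral>\<^sup>+x. indicator A x \<partial>M)"
  by (intro nn_integral_cong) (auto simp: indicator_def)
 also have "... = emeasure M A" by simp
 also have "(\<integral>\<^sup>+x. (indicator A x * ennreal (norm (f x)))\<^sup>2 \<partial>M) = (\<integral>\<^sup>+x. indicator A x * nsq (f x) \<partial>M)"
  by (intro nn_integral_cong) (auto simp: indicator_def ennreal_power)
 finally show ?thesis by (simp add: ennreal_power)
qed (simp add: not_integrable_integral_eq)

text \<open>Domination by M |f| on the ball times the unit interval. Joint integrability in the base
  point x and the position s on a segment justifies the exchanges of integrals below.\<close>

lemma locally_integrable_product:
 fixes f :: "'a::euclidean_space => 'b::euclidean_space" and k :: "'a \<times> real => real"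
 assumes f[measurable]: "f \<in> bmeas" and fi: "set_integrable lborel (cball 0 R) f"
  and k[measurable]: "k \<in> bmeas" and M: "!!x s. \<bar>k (x, s)\<bar> \<le> M"
  and z: "!!x s. s \<in> {0..1} ==> x \<notin> cball 0 R ==> k (x, s) = 0"
 shows "integrable (lborel \<Otimes>\<^sub>M lborel) (%(x, s). (indicator {0..1} s * k (x, s)) *R f x)"
proof (rule integrableI_bounded)
 have M0: "0 \<le> M" using M[of 0 0] by linarith
 have k'[measurable]: "k \<in> borel_measurable (lborel \<Otimes>\<^sub>M lborel)"
  using k by (simp add: lborel_prod)
 have [measurable]: "cball (0::'a) R \<in> sets borel" by simp
 define F where "F x = indicator (cball 0 R) x * ennreal (norm (f x))" for x
 have [measurable]: "F \<in> bmeas" unfolding F_def by measurable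
 show m: "(%(x, s). (indicator {0..1} s * k (x, s)) *R f x) \<in> borel_measurable (lborel \<Otimes>\<^sub>M lborel)"
  by measurable
 have "(\<integral>\<^sup>+p. ennreal (norm (case p of (x, s) => (indicator {0..1} s * k (x, s)) *R f x)) \<partial>(lborel \<Otimes>\<^sub>M lborel))
  \<le> (\<integral>\<^sup>+p. (case p of (x, s::real) => indicator {0..1} s * (ennreal M * F x)) \<partial>(lborel \<Otimes>\<^sub>M lborel))"
 proof (rule nn_integral_mono)
  fix p :: "'a \<times> real"
  obtain x s where p: "p = (x, s)" by (cases p)
  show "ennreal (norm (case p of (x, s) => (indicator {0..1} s * k (x, s)) *R f x))
    \<le> (case p of (x, s) => indicator {0..1} s * (ennreal M * F x))"
  proof (cases "s \<in> {0..1} \<and> x \<in> cball 0 R")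
   case True
   have "ennreal (\<bar>k (x, s)\<bar> * norm (f x)) \<le> ennreal (M * norm (f x))"
    by (intro ennreal_leI mult_right_mono M) simp
   then show ?thesis using True M0 by (simp add: p F_def ennreal_mult)
  next
   case False then show ?thesis using z[of s x] by (auto simp: p F_def indicator_def)
  qed
 qed
 also have "... = (NN x. (NN s. indicator {0..1::real} s * (ennreal M * F x)))"
  by (subst lborel.nn_integral_fst[symmetric]; measurable)
 also have "... = (NN x. ennreal M * F x)"
  by (simp add: nn_integral_multc)
 also have "... = ennreal M * (NN x. F x)"
  by (rule nn_integral_cmult) measurable
 also have "(NN x. F x) = (NN x. ennreal (norm (indicat_real (cball 0 R) x *R f x)))"
  by (intro nn_integral_cong) (auto simp: F_def indicator_def)
 also have "ennreal M * ... < \<infinity>"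
  using integrable_iff_bounded[THEN iffD1, OF fi[unfolded set_integrable_def]] by (auto simp: ennreal_mult_less_top)
 finally show "(\<integral>\<^sup>+p. ennreal (norm (case p of (x, s) => (indicator {0..1} s * k (x, s)) *R f x)) \<partial>(lborel \<Otimes>\<^sub>M lborel)) < \<infinity>" .
qed

section \<open>Averages along segments and their adjoints\<close>

lemma shifted_support:
 fixes x h :: "'a::real_normed_vector"
 assumes "s \<in> {0..1::real}" "x \<notin> cball 0 (R + norm h)"
 shows "x - s *R h \<notin> cball 0 R"
proof -
 have "norm x \<le> norm (x - s *R h) + norm (s *R h)" using norm_triangle_ineq[of "x - s *R h" "s *R h"] by simp
 moreover have "norm (s *R h) \<le> norm h" using assms(1) mult_right_mono[of s 1 "norm h"] by simp
 ultimately show ?thesis using assms(2) by simp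
qed

context
 fixes g :: "'a::euclidean_space => real" and f :: "'a => 'b::euclidean_space" and h :: 'a and R M :: real
 assumes g[measurable]: "g \<in> bmeas" and gz: "!!x. x \<notin> cball 0 R ==> g x = 0" and gM: "!!x. \<bar>g x\<bar> \<le> M"
  and f[measurable]: "f \<in> bmeas" and fi: "!!R. set_integrable lborel (cball 0 R) f"
begin

lemma integrable_shifted_weight:
 "integrable (lborel \<Otimes>\<^sub>M lborel) (%(x, s). (indicator {0..1} s * g (x - s *R h)) *R f x)"
 using locally_integrable_product[OF f fi, of "%(x,s). g (x - s *R h)" M "R + norm h"] gM gz shifted_support[of _ _ R h]
 by (auto simp: borel_prod[symmetric])

lemma integral_shifted_weight:
 "(LBINT x. (LBINT s. indicator {0..1} s * g (x - s *R h)) *R f x) =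
 (LBINT s. indicator {0..1} s *R (LBINT x. g (x - s *R h) *R f x))"
proof -
 have i: "integrable lborel (%s. indicator {0..1::real} s * g (x - s *R h))" for x
 proof (rule Bochner_Integration.integrable_bound[where f="%s. indicator {0..1} s *R M"])
  show "AE s in lborel. norm (indicat_real {0..1} s * g (x - s *R h)) \<le> norm (indicat_real {0..1} s *R M)"
  proof (intro AE_I2)
   fix s show "norm (indicat_real {0..1} s * g (x - s *R h)) \<le> norm (indicat_real {0..1} s *R M)"
    using gM[of "x - s *R h"] by (auto simp: indicator_def)
  qed
 qed auto
 have "(LBINT x. (LBINT s. indicator {0..1} s * g (x - s *R h)) *R f x) =
  (LBINT x. (LBINT s. (indicator {0..1} s * g (x - s *R h)) *R f x))"
  using i by (intro Bochner_Integration.integral_cong refl integral_scaleR_left[symmetric]) simp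
 also have "... = (LBINT s. (LBINT x. (indicator {0..1} s * g (x - s *R h)) *R f x))"
  using lborel_pair.Fubini_integral[OF integrable_shifted_weight] by simp
 also have "... = (LBINT s. indicator {0..1} s *R (LBINT x. g (x - s *R h) *R f x))"
  by (simp flip: scaleR_scaleR)
 finally show ?thesis .
qed

text \<open>For fixed s a translation in x moves the shift from f to g without changing the integral
  of the norm, which reduces the claim to \<open>integrable_shifted_weight\<close>.\<close>

lemma integrable_shifted:
 "integrable (lborel \<Otimes>\<^sub>M lborel) (%(x, s). g x *R (indicator {0..1} s *R f (x + s *R h)))"
proof (rule integrableI_bounded)
 have [measurable]: "(%(x::'a, s::real). f (x + s *R h)) \<in> borel_measurable (lborel \<Otimes>\<^sub>M lborel)"
  using f by measurable
 show "(%(x, s). g x *R (indicator {0..1} s *R f (x + s *R h))) \<in> borel_measurable (lborel \<Otimes>\<^sub>M lborel)"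
  by measurable
 have "(\<integral>\<^sup>+p. ennreal (norm (case p of (x, s) => g x *R (indicat_real {0..1} s *R f (x + s *R h)))) \<partial>(lborel \<Otimes>\<^sub>M lborel))
  = (NN s. (NN x. ennreal (norm (g x *R (indicat_real {0..1} s *R f (x + s *R h))))))"
  by (subst lborel_pair.nn_integral_snd[symmetric]) auto
 also have "... = (NN s. (NN x. ennreal (norm (g (x - s *R h) *R (indicat_real {0..1} s *R f x)))))"
 proof (rule nn_integral_cong)
  fix s
  show "(NN x. ennreal (norm (g x *R (indicat_real {0..1} s *R f (x + s *R h))))) =
   (NN x. ennreal (norm (g (x - s *R h) *R (indicat_real {0..1} s *R f x))))"
   using nn_integral_shift[of "%x. ennreal (norm (g (x - s *R h) *R (indicat_real {0..1} s *R f x)))" "s *R h"]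
   by simp
 qed
 also have "... = (\<integral>\<^sup>+p. ennreal (norm (case p of (x, s) => (indicator {0..1} s * g (x - s *R h)) *R f x)) \<partial>(lborel \<Otimes>\<^sub>M lborel))"
  by (subst lborel_pair.nn_integral_snd[symmetric]) (auto simp: mult_ac abs_mult)
 also have "... < \<infinity>" using integrable_iff_bounded[THEN iffD1, OF integrable_shifted_weight] by simp
 finally show "(\<integral>\<^sup>+p. ennreal (norm (case p of (x, s) => g x *R (indicat_real {0..1} s *R f (x + s *R h)))) \<partial>(lborel \<Otimes>\<^sub>M lborel)) < \<infinity>" .
qed

lemma integrable_shift_weight:
 "integrable lborel (%x. g x *R f (x + h))" "integrable lborel (%x. g (x - h) *R f x)"
 "(LBINT x. g x *R f (x + h)) = (LBINT x. g (x - h) *R f x)"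
proof -
 have z: "g (x - h) = 0" if "x \<notin> cball 0 (R + norm h)" for x
  using shifted_support[of 1 x R h] that gz by simp
 show i: "integrable lborel (%x. g (x - h) *R f x)"
  by (rule integrable_bounded_support[OF fi[of "R + norm h"] f _ z gM]) measurable
 show "integrable lborel (%x. g x *R f (x + h))" using integrable_shift[OF i, of h] by simp
 show "(LBINT x. g x *R f (x + h)) = (LBINT x. g (x - h) *R f x)"
  using integral_shift[of "%x. g (x - h) *R f x" h] by simp
qed

lemma integrable_line_average:
 "integrable lborel (%x. g x *R (LBINT s. indicator {0..1} s *R f (x + s *R h)))"
 using lborel_pair.integrable_fst[OF integrable_shifted] by (simp del: scaleR_scaleR)

text \<open>Adjointness: averaging f along the segment in direction h and pairing with g amounts to
  averaging g in the opposite direction and pairing with f. Together with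
  \<open>integral_shifted_weight\<close> this moves difference quotients between a function and the
  test function, in both directions of the equivalence between weak gradients and identities along
  lines.\<close>

lemma integral_line_average:
 "(LBINT x. g x *R (LBINT s. indicator {0..1} s *R f (x + s *R h))) =
 (LBINT s. indicator {0..1} s *R (LBINT x. g (x - s *R h) *R f x))"
proof -
 have "(LBINT x. g x *R (LBINT s. indicator {0..1} s *R f (x + s *R h))) =
  (LBINT x. (LBINT s. g x *R (indicator {0..1} s *R f (x + s *R h))))" by (simp del: scaleR_scaleR)
 also have "... = (LBINT s. (LBINT x. g x *R (indicator {0..1} s *R f (x + s *R h))))"
  using lborel_pair.Fubini_integral[OF integrable_shifted] by simp
 also have "... = (LBINT s. indicator {0..1} s *R (LBINT x. g (x - s *R h) *R f x))"
 proof (rule Bochner_Integration.integral_cong[OF refl])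
  fix s
  show "(LBINT x. g x *R (indicator {0..1} s *R f (x + s *R h))) = indicator {0..1} s *R (LBINT x. g (x - s *R h) *R f x)"
   using integral_shift[of "%x. indicator {0..1} s *R (g (x - s *R h) *R f x)" "s *R h"]
   by (simp only: integral_scaleR_right scaleR_left_commute[of "g _"]) simp
 qed
 finally show ?thesis .
qed

end

text \<open>Continuity of g makes the averaged weights converge pointwise. The bound |h n| \<le> 1
  confines all of them to the ball of radius R + 1, which yields the dominating function M |f|
  there.\<close>

lemma shifted_weight_tendsto:
 fixes g :: "'a::euclidean_space => real" and f :: "'a => 'b::euclidean_space"
 assumes g: "continuous_on UNIV g" and gz: "!!x. x \<notin> cball 0 R ==> g x = 0" and gM: "!!x. \<bar>g x\<bar> \<le> M"
  and f[measurable]: "f \<in> bmeas" and fi: "!!R. set_integrable lborel (cball 0 R) f"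
  and h: "h ~> 0" "!!n. norm (h n) \<le> 1"
 shows "(%n. (LBINT x. (LBINT s. indicator {0..1} s * g (x - s *R h n)) *R f x))
  ~> (LBINT x. g x *R f x)"
proof -
 have gm[measurable]: "g \<in> bmeas" using g by (rule borel_measurable_continuous_onI)
 have b: "norm (indicat_real {0..1} s * g (x - s *R h n)) \<le> indicat_real {0..1} s * M" for s x n
  using gM[of "x - s *R h n"] by (auto simp: indicator_def)
 have iM: "integrable lborel (%s::real. indicat_real {0..1} s * M)"
  by (intro integrable_mult_left integrable_real_indicator) simp_all
 have M0: "0 \<le> M" using gM[of 0] by linarith
 have pw: "(%n. (LBINT s. indicator {0..1} s * g (x - s *R h n))) ~> g x" for x
 proof -
  have "(%n. (LBINT s. indicator {0..1} s * g (x - s *R h n))) ~> (LBINT s. indicator {0..1::real} s * g x)"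
  proof (rule integral_dominated_convergence[where w="%s. indicat_real {0..1} s * M"])
   show "AE s in lborel. norm (indicat_real {0..1} s * g (x - s *R h n)) \<le> indicat_real {0..1} s * M" for n
    using b by simp
   show "AE s in lborel. (%n. indicat_real {0..1} s * g (x - s *R h n)) ~> indicat_real {0..1} s * g x"
   proof (intro AE_I2 tendsto_mult tendsto_const)
    fix s :: real
    have "(%n. x - s *R h n) ~> x - s *R 0" by (intro tendsto_intros h)
    then show "(%n. g (x - s *R h n)) ~> g x"
     using continuous_on_tendsto_compose[OF g, of "%n. x - s *R h n" x] by simp
   qed
  qed (use iM in measurable)
  then show ?thesis by simp
 qed
 have bd: "\<bar>(LBINT s. indicator {0..1} s * g (x - s *R h n))\<bar> \<le> M" for x n
 proof -
  have "\<bar>(LBINT s. indicator {0..1} s * g (x - s *R h n))\<bar> \<le> (LBINT s. indicat_real {0..1::real} s * M)"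
  proof -
   have "\<bar>(LBINT s. indicator {0..1} s * g (x - s *R h n))\<bar> \<le> (LBINT s. \<bar>indicator {0..1} s * g (x - s *R h n)\<bar>)"
    by (rule integral_abs_bound)
   also have "... \<le> (LBINT s. indicat_real {0..1::real} s * M)"
    by (rule Bochner_Integration.integral_mono'[OF iM]) (use b[of _ x n] M0 in auto)
   finally show ?thesis .
  qed
  then show ?thesis by simp
 qed
 have vz: "(LBINT s. indicator {0..1} s * g (x - s *R h n)) = 0" if "x \<notin> cball 0 (R + 1)" for x n
 proof -
  have "indicator {0..1} s * g (x - s *R h n) = 0" for s
  proof (cases "s \<in> {0..1}")
   case True
   have "x \<notin> cball 0 (R + norm (h n))" using that h(2)[of n] by simp
   then show ?thesis using gz[OF shifted_support[OF True]] by simp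
  qed simp
  then have "(LBINT s. indicator {0..1} s * g (x - s *R h n)) = (\<integral>s. 0 \<partial>(lborel :: real measure))"
   by (intro Bochner_Integration.integral_cong refl)
  then show ?thesis by simp
 qed
 have fi': "integrable lborel (%x. M * (indicat_real (cball 0 (R+1)) x * norm (f x)))"
  using integrable_norm[OF fi[of "R+1", unfolded set_integrable_def]] by simp
 show ?thesis
 proof (rule integral_dominated_convergence[OF _ _ fi'])
  show "AE x in lborel. (%n. (LBINT s. indicator {0..1} s * g (x - s *R h n)) *R f x) ~> g x *R f x"
   by (intro AE_I2 tendsto_intros pw)
  show "AE x in lborel. norm ((LBINT s. indicator {0..1} s * g (x - s *R h n)) *R f x)
    \<le> M * (indicat_real (cball 0 (R+1)) x * norm (f x))" for n
  proof (intro AE_I2)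
   fix x show "norm ((LBINT s. indicator {0..1} s * g (x - s *R h n)) *R f x)
    \<le> M * (indicat_real (cball 0 (R+1)) x * norm (f x))"
    using bd[of x n] vz[of x n] by (cases "x \<in> cball 0 (R+1)") (auto intro!: mult_right_mono)
  qed
 qed measurable
qed

lemma test_fun_integral_line:
 fixes \<phi> :: "'a::euclidean_space => real"
 assumes t: "test_fun \<phi> \<phi>' U"
 shows "(LBINT s. indicator {0..1} s * \<phi>' (x - s *R h) h) = \<phi> x - \<phi> (x - h)"
proof -
 have d: "((%s. - \<phi> (x - s *R h)) has_vector_derivative \<phi>' (x - s *R h) h) (at s within {0..1})" for s
 proof -
  have 1: "(\<phi> has_derivative \<phi>' (x - s *R h)) (at (x - s *R h))" using t by (auto simp: test_fun_def)
  have 2: "((%s. x - s *R h) has_derivative (%r. - (r *R h))) (at s within {0..1})"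
   by (auto intro!: derivative_eq_intros)
  have "((%s. \<phi> (x - s *R h)) has_derivative (%r. \<phi>' (x - s *R h) (- (r *R h)))) (at s within {0..1})"
   using has_derivative_compose[OF 2 1] .
  then have "((%s. - \<phi> (x - s *R h)) has_derivative (%r. - \<phi>' (x - s *R h) (- (r *R h)))) (at s within {0..1})"
   by (rule has_derivative_minus)
  then show ?thesis unfolding has_vector_derivative_def
   using test_fun_linear[OF t] by (simp add: linear_neg linear_cmul)
 qed
 have "continuous_on {0..1} (%s. \<phi>' (x - s *R h) h)"
  by (rule continuous_on_compose2[OF test_fun_continuous_deriv[OF t, of h]]) (intro continuous_intros, simp)
 from integral_FTC_atLeastAtMost[OF _ d this] show ?thesis by simp
qed

lemma borel_grad_L1_cball:
 assumes "borel_grad UNIV u D"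
 shows "set_integrable lborel (cball 0 R) u" "b \<in> Basis ==> set_integrable lborel (cball 0 R) (D b)"
 by (rule borel_grad_L1[OF assms]; simp)+

lemma test_fun_support_cball:
 fixes \<phi> :: "'a::euclidean_space => real"
 assumes "test_fun \<phi> \<phi>' U"
 obtains R where "!!x. x \<notin> cball 0 R ==> \<phi> x = 0" "!!x h. x \<notin> cball 0 R ==> \<phi>' x h = 0"
proof -
 obtain K where K: "compact K" "K \<subseteq> U" "!!x. x \<notin> K ==> \<phi> x = 0" "!!x. x \<notin> K ==> \<phi>' x = (%_. 0)"
  using test_fun_support[OF assms] by metis
 obtain R where "K \<subseteq> cball 0 R" using compact_imp_bounded[OF K(1)] bounded_subset_ballD[of K 0] ball_subset_cball by (metis order_trans)
 then show thesis using K(3,4) by (intro that[of R]) (metis subsetD)+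
qed

text \<open>The fundamental theorem of calculus in weak form. Paired with a test function, the
  average of the directional derivative becomes an average over translated test functions; each of
  them is differentiated by the definition of the weak gradient, and the classical theorem applies
  to the test function. The exceptional null set depends on h.\<close>

lemma borel_grad_line_identity:
 fixes u :: "'a::euclidean_space => 'b::euclidean_space"
 assumes B: "borel_grad UNIV u D"
 shows "AE x in lborel. u (x + h) - u x =
  (LBINT s. indicator {0..1} s *R (\<Sum>b\<in>Basis. (h \<bullet> b) *R D b (x + s *R h)))"
proof -
 define G where "G x = (\<Sum>b\<in>Basis. (h \<bullet> b) *R D b x)" for x
 define I where "I x = (LBINT s. indicator {0..1} s *R G (x + s *R h))" for x
 have u[measurable]: "u \<in> bmeas" by (rule borel_gradD(2)[OF B])
 have D[measurable]: "!!b. b \<in> Basis ==> D b \<in> bmeas" by (rule borel_gradD(3)[OF B])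
 have G[measurable]: "G \<in> bmeas" unfolding G_def by measurable
 have I[measurable]: "I \<in> bmeas" unfolding I_def by measurable
 have Gi: "set_integrable lborel (cball 0 R) G" for R
 proof -
  have "integrable lborel (%x. \<Sum>b\<in>Basis. (h \<bullet> b) *R (indicat_real (cball 0 R) x *R D b x))"
   using borel_grad_L1_cball(2)[OF B] unfolding set_integrable_def
   by (intro Bochner_Integration.integrable_sum integrable_scaleR_right)
  then show ?thesis by (simp add: set_integrable_def G_def scaleR_sum_right mult.commute)
 qed
 note ui = borel_grad_L1_cball(1)[OF B]
 have "AE x in lborel. x \<in> UNIV \<longrightarrow> u (x + h) - u x - I x = 0"
 proof (rule fundamental_lemma_of_variations)
  show "open (UNIV::'a set)" by simp
  show "(%x. u (x + h) - u x - I x) \<in> bmeas" by measurable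
  fix \<phi> :: "'a => real" and \<phi>' assume t: "test_fun \<phi> \<phi>' UNIV"
  obtain R where R: "!!x. x \<notin> cball 0 R ==> \<phi> x = 0" "!!x h. x \<notin> cball 0 R ==> \<phi>' x h = 0"
   using test_fun_support_cball[OF t] by metis
  obtain M where M: "!!x. \<bar>\<phi> x\<bar> \<le> M" "!!x. \<bar>\<phi>' x h\<bar> \<le> M" using test_fun_bounded[OF t, of h] by metis
  note tb[measurable] = test_fun_borel[OF t]
  have "(LBINT x. \<phi> x *R I x) = (LBINT s. indicator {0..1} s *R (LBINT x. \<phi> (x - s *R h) *R G x))"
   unfolding I_def by (rule integral_line_average[OF tb(1) R(1) M(1) G Gi])
  also have "... = (LBINT s. indicator {0..1} s *R (- (LBINT x. \<phi>' (x - s *R h) h *R u x)))"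
  proof (rule Bochner_Integration.integral_cong[OF refl])
   fix s :: real
   have t2: "test_fun (%x. \<phi> (x - s *R h)) (%x. \<phi>' (x - s *R h)) UNIV" by (rule test_fun_translate[OF t]) simp
   obtain R2 where R2: "!!x. x \<notin> cball 0 R2 ==> \<phi> (x - s *R h) = 0" "!!x h'. x \<notin> cball 0 R2 ==> \<phi>' (x - s *R h) h' = 0"
    using test_fun_support_cball[OF t2] by metis
   note t2b[measurable] = test_fun_borel[OF t2]
   have i1: "integrable lborel (%x. \<phi> (x - s *R h) *R D b x)" if "b \<in> Basis" for b
    by (rule integrable_bounded_support[OF borel_grad_L1_cball(2)[OF B that, of R2] D[OF that] t2b(1) R2(1) M(1)])
   have i2: "integrable lborel (%x. \<phi>' (x - s *R h) b *R u x)" for b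
   proof -
    obtain M2 where "!!x. \<bar>\<phi>' (x - s *R h) b\<bar> \<le> M2" using test_fun_bounded[OF t2, of b] by metis
    from integrable_bounded_support[OF ui[of R2] u t2b(2) R2(2) this] show ?thesis .
   qed
   have lin: "\<phi>' y h = (\<Sum>b\<in>Basis. (h \<bullet> b) * \<phi>' y b)" for y
   proof -
    have "\<phi>' y h = \<phi>' y (\<Sum>b\<in>Basis. (h \<bullet> b) *R b)" by (simp add: euclidean_representation)
    also have "... = (\<Sum>b\<in>Basis. (h \<bullet> b) * \<phi>' y b)"
     using test_fun_linear[OF t] by (simp add: linear_sum linear_cmul)
    finally show ?thesis .
   qed
   have "(LBINT x. \<phi> (x - s *R h) *R G x) = (LBINT x. (\<Sum>b\<in>Basis. (h \<bullet> b) *R (\<phi> (x - s *R h) *R D b x)))"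
    by (simp add: G_def scaleR_sum_right mult.commute)
   also have "... = (\<Sum>b\<in>Basis. (h \<bullet> b) *R (LBINT x. \<phi> (x - s *R h) *R D b x))"
    using i1 by (subst Bochner_Integration.integral_sum) (auto simp del: scaleR_scaleR)
   also have "... = (\<Sum>b\<in>Basis. (h \<bullet> b) *R (- (LBINT x. \<phi>' (x - s *R h) b *R u x)))"
    using borel_gradD(6)[OF B t2] by (intro sum.cong refl) simp
   also have "... = - (LBINT x. (\<Sum>b\<in>Basis. (h \<bullet> b) *R (\<phi>' (x - s *R h) b *R u x)))"
    using i2 by (subst Bochner_Integration.integral_sum) (auto simp: sum_negf simp del: scaleR_scaleR)
   also have "(%x. \<Sum>b\<in>Basis. (h \<bullet> b) *R (\<phi>' (x - s *R h) b *R u x)) = (%x. \<phi>' (x - s *R h) h *R u x)"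
    by (rule ext, subst lin) (simp add: scaleR_sum_left)
   finally show "indicat_real {0..1} s *R (LBINT x. \<phi> (x - s *R h) *R G x) =
    indicat_real {0..1} s *R (- (LBINT x. \<phi>' (x - s *R h) h *R u x))" by simp
  qed
  also have "... = - (LBINT s. indicator {0..1} s *R (LBINT x. \<phi>' (x - s *R h) h *R u x))" by simp
  also have "(LBINT s. indicator {0..1} s *R (LBINT x. \<phi>' (x - s *R h) h *R u x)) =
    (LBINT x. (LBINT s. indicator {0..1} s * \<phi>' (x - s *R h) h) *R u x)"
   by (rule integral_shifted_weight[OF tb(2) R(2) M(2) u ui, symmetric])
  \<comment> \<open>Here the classical fundamental theorem for the test function enters.\<close>
  also have "... = (LBINT x. (\<phi> x - \<phi> (x - h)) *R u x)"
   by (simp add: test_fun_integral_line[OF t])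
  also have "... = (LBINT x. \<phi> x *R u x) - (LBINT x. \<phi> (x - h) *R u x)"
   unfolding scaleR_diff_left
   by (intro Bochner_Integration.integral_diff integrable_bounded_support[OF ui[of R] u tb(1) R(1) M(1)] integrable_shift_weight(2)[OF tb(1) R(1) M(1) u ui])
  also have "(LBINT x. \<phi> (x - h) *R u x) = (LBINT x. \<phi> x *R u (x + h))"
   by (rule integrable_shift_weight(3)[OF tb(1) R(1) M(1) u ui, symmetric])
  finally have e: "(LBINT x. \<phi> x *R I x) = (LBINT x. \<phi> x *R u (x + h)) - (LBINT x. \<phi> x *R u x)" by simp
  have "(LBINT x. \<phi> x *R (u (x + h) - u x - I x)) = (LBINT x. \<phi> x *R u (x + h) - \<phi> x *R u x - \<phi> x *R I x)"
   by (simp add: algebra_simps)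
  also have "... = (LBINT x. \<phi> x *R u (x + h)) - (LBINT x. \<phi> x *R u x) - (LBINT x. \<phi> x *R I x)"
  proof -
   have "integrable lborel (%x. \<phi> x *R I x)" unfolding I_def
    by (rule integrable_line_average[OF tb(1) R(1) M(1) G Gi])
   then show ?thesis
    using integrable_bounded_support[OF ui[of R] u tb(1) R(1) M(1)] integrable_shift_weight(1)[OF tb(1) R(1) M(1) u ui, where h=h]
    by simp
  qed
  also have "... = 0" using e by simp
  finally show "(LBINT x. \<phi> x *R (u (x + h) - u x - I x)) = 0" .
 next
  \<comment> \<open>Local integrability: the indicator of K takes the place of the weight g in the
    lemmas on segments.\<close>
  fix K :: "'a set" assume K: "compact K"
  have Km[measurable]: "K \<in> sets borel" using K by (simp add: borel_compact)
  obtain R where "K \<subseteq> cball 0 R" using compact_imp_bounded[OF K] bounded_subset_ballD[of K 0] ball_subset_cball by (metis order_trans)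
  then have z: "x \<notin> cball 0 R ==> indicat_real K x = 0" for x by (auto simp: indicator_def)
  have m: "indicat_real K \<in> bmeas" by measurable
  have M: "\<bar>indicat_real K x\<bar> \<le> 1" for x by (simp add: indicator_def)
  have "integrable lborel (%x. indicat_real K x *R I x)" unfolding I_def
   by (rule integrable_line_average[OF m z M G Gi])
  moreover have "integrable lborel (%x. indicat_real K x *R u (x + h))"
   by (rule integrable_shift_weight(1)[OF m z M u ui])
  moreover have "integrable lborel (%x. indicat_real K x *R u x)"
   by (rule integrable_bounded_support[OF ui[of R] u m z M])
  ultimately have "integrable lborel (%x. indicat_real K x *R u (x + h) - indicat_real K x *R u x - indicat_real K x *R I x)"
   by (intro Bochner_Integration.integrable_diff)
  then show "set_integrable lborel K (%x. u (x + h) - u x - I x)"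
   by (simp add: set_integrable_def algebra_simps)
 qed
 then show ?thesis by eventually_elim (simp add: I_def G_def algebra_simps)
qed

lemma norm_sq_directional_le:
 fixes D :: "'a::euclidean_space => 'a => 'b::euclidean_space"
 shows "(norm (\<Sum>b\<in>Basis. (h \<bullet> b) *R D b x))\<^sup>2 \<le> (norm h)\<^sup>2 * sq_grad D x"
proof -
 have "norm (\<Sum>b\<in>Basis. (h \<bullet> b) *R D b x) \<le> (\<Sum>b\<in>Basis. \<bar>h \<bullet> b\<bar> * norm (D b x))"
  by (rule order_trans[OF norm_sum]) simp
 then have "(norm (\<Sum>b\<in>Basis. (h \<bullet> b) *R D b x))\<^sup>2 \<le> (\<Sum>b\<in>Basis. \<bar>h \<bullet> b\<bar> * norm (D b x))\<^sup>2"
  by (rule power_mono) simp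
 also have "... \<le> (\<Sum>b\<in>Basis. \<bar>h \<bullet> b\<bar>\<^sup>2) * (\<Sum>b\<in>Basis. (norm (D b x))\<^sup>2)"
  by (rule Cauchy_Schwarz_ineq_sum)
 also have "(\<Sum>b\<in>Basis. \<bar>h \<bullet> b\<bar>\<^sup>2) = (norm h)\<^sup>2"
  using euclidean_inner[of h h] by (simp add: power2_norm_eq_inner[symmetric] power2_eq_square)
 finally show ?thesis by (simp add: sq_grad_def)
qed

lemma sq_grad_nonneg[simp]: "0 \<le> sq_grad D x"
 by (simp add: sq_grad_def sum_nonneg)

lemma sq_grad_borel:
 assumes "!!b. b \<in> Basis ==> D b \<in> bmeas"
 shows "sq_grad D \<in> bmeas"
 unfolding sq_grad_def[abs_def] by (intro borel_measurable_sum borel_measurable_power borel_measurable_norm) (use assms in auto)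

section \<open>L2 estimates for translations\<close>

text \<open>If x and x + h lie in the convex set C, so does the segment between them. Cauchy-Schwarz
  on the identity along this segment and an exchange of integrals give the bound, the inner integral
  being independent of s after a translation.\<close>

lemma translation_estimate:
 fixes u :: "'a::euclidean_space => 'b::euclidean_space"
 assumes B: "borel_grad UNIV u D" and C: "convex C" and Cm[measurable]: "C \<in> sets borel"
 shows "(NN x. indicator C x * indicator C (x + h) * nsq (u (x + h) - u x))
  \<le> nsq h * (NN x. indicator C x * ennreal (sq_grad D x))"
proof -
 have u[measurable]: "u \<in> bmeas" by (rule borel_gradD(2)[OF B])
 have D[measurable]: "!!b. b \<in> Basis ==> D b \<in> bmeas" by (rule borel_gradD(3)[OF B])
 have [measurable]: "sq_grad D \<in> bmeas" by (rule sq_grad_borel[OF D])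
 have "(NN x. indicator C x * indicator C (x + h) * nsq (u (x + h) - u x))
  \<le> (NN x. (NN s. indicator {0..1::real} s * (nsq h * (indicator C (x + s *R h) * ennreal (sq_grad D (x + s *R h))))))"
 proof (rule nn_integral_mono_AE, use borel_grad_line_identity[OF B, of h] in eventually_elim)
  fix x assume e: "u (x + h) - u x = (LBINT s. indicator {0..1} s *R (\<Sum>b\<in>Basis. (h \<bullet> b) *R D b (x + s *R h)))"
  show "indicator C x * indicator C (x + h) * nsq (u (x + h) - u x) \<le>
   (NN s. indicator {0..1::real} s * (nsq h * (indicator C (x + s *R h) * ennreal (sq_grad D (x + s *R h)))))"
  proof (cases "x \<in> C \<and> x + h \<in> C")
   case True
   have inC: "x + s *R h \<in> C" if "s \<in> {0..1}" for s
   proof -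
    have "(1 - s) *R x + s *R (x + h) \<in> C" using C True that by (intro convexD) auto
    then show ?thesis by (simp add: algebra_simps)
   qed
   have "nsq (u (x + h) - u x) \<le> emeasure lborel {0..1::real} *
    (NN s. indicator {0..1::real} s * nsq (\<Sum>b\<in>Basis. (h \<bullet> b) *R D b (x + s *R h)))"
    unfolding e by (rule norm_set_integral_power2_le) measurable
   also have "... = (NN s. indicator {0..1::real} s * nsq (\<Sum>b\<in>Basis. (h \<bullet> b) *R D b (x + s *R h)))"
    by simp
   also have "... \<le> (NN s. indicator {0..1::real} s * (nsq h * (indicator C (x + s *R h) * ennreal (sq_grad D (x + s *R h)))))"
   proof (rule nn_integral_mono)
    fix s :: real
    show "indicator {0..1} s * nsq (\<Sum>b\<in>Basis. (h \<bullet> b) *R D b (x + s *R h)) \<le>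
     indicator {0..1} s * (nsq h * (indicator C (x + s *R h) * ennreal (sq_grad D (x + s *R h))))"
    proof (cases "s \<in> {0..1}")
     case T: True
     then show ?thesis using inC[OF T] norm_sq_directional_le[of h D "x + s *R h"]
      by (simp add: ennreal_mult[symmetric] ennreal_leI)
    qed simp
   qed
   finally show ?thesis using True by simp
  qed (auto simp: indicator_def)
 qed
 also have "... = (NN s. (NN x. indicator {0..1::real} s * (nsq h * (indicator C (x + s *R h) * ennreal (sq_grad D (x + s *R h))))))"
  by (rule lborel_pair.Fubini'[symmetric]) measurable
 also have "... = (NN s. indicator {0..1::real} s * (nsq h * (NN x. indicator C x * ennreal (sq_grad D x))))"
 proof (rule nn_integral_cong)
  fix s :: real
  have "(NN x. indicator C (x + s *R h) * ennreal (sq_grad D (x + s *R h))) = (NN x. indicator C x * ennreal (sq_grad D x))"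
   by (rule nn_integral_shift) measurable
  then show "(NN x. indicator {0..1::real} s * (nsq h * (indicator C (x + s *R h) * ennreal (sq_grad D (x + s *R h))))) =
   indicator {0..1::real} s * (nsq h * (NN x. indicator C x * ennreal (sq_grad D x)))"
   by (subst nn_integral_cmult, measurable, subst nn_integral_cmult, measurable)
 qed
 also have "... = nsq h * (NN x. indicator C x * ennreal (sq_grad D x))"
  by (subst nn_integral_multc) auto
 finally show ?thesis .
qed

text \<open>Substituting y = x + h turns the double integral into an integral of translation
  differences over h in S. With S a large ball this yields the Poincare inequality, with S a small
  ball the error of averaging over balls.\<close>

lemma translation_estimate_pairs:
 fixes u :: "'a::euclidean_space => 'b::euclidean_space"
 assumes B: "borel_grad UNIV u D" and C: "convex C" and Cm[measurable]: "C \<in> sets borel"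
  and S[measurable]: "S \<in> sets borel" and r: "!!h. h \<in> S ==> norm h \<le> r"
 shows "(NN x. (NN y. indicator C x * indicator C y * indicator S (y - x) * nsq (u y - u x)))
  \<le> emeasure lborel S * (ennreal (r\<^sup>2) * (NN x. indicator C x * ennreal (sq_grad D x)))"
proof -
 have u[measurable]: "u \<in> bmeas" by (rule borel_gradD(2)[OF B])
 let ?I = "(NN x. indicator C x * ennreal (sq_grad D x))"
 have "(NN x. (NN y. indicator C x * indicator C y * indicator S (y - x) * nsq (u y - u x)))
  = (NN x. (NN h. indicator C x * indicator C (x + h) * indicator S h * nsq (u (x + h) - u x)))"
 proof (rule nn_integral_cong)
  fix x
  show "(NN y. indicator C x * indicator C y * indicator S (y - x) * nsq (u y - u x)) =
   (NN h. indicator C x * indicator C (x + h) * indicator S h * nsq (u (x + h) - u x))"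
   using nn_integral_shift[of "%y. indicator C x * indicator C y * indicator S (y - x) * nsq (u y - u x)" x]
   by (simp add: add.commute)
 qed
 also have "... = (NN h. (NN x. indicator C x * indicator C (x + h) * indicator S h * nsq (u (x + h) - u x)))"
  by (rule lborel_pair.Fubini'[symmetric]) measurable
 also have "... \<le> (NN h. indicator S h * (ennreal (r\<^sup>2) * ?I))"
 proof (rule nn_integral_mono)
  fix h
  show "(NN x. indicator C x * indicator C (x + h) * indicator S h * nsq (u (x + h) - u x)) \<le> indicator S h * (ennreal (r\<^sup>2) * ?I)"
  proof (cases "h \<in> S")
   case True
   have "(NN x. indicator C x * indicator C (x + h) * nsq (u (x + h) - u x)) \<le> nsq h * ?I"
    by (rule translation_estimate[OF B C Cm])
   also have "... \<le> ennreal (r\<^sup>2) * ?I"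
    by (intro mult_right_mono ennreal_leI power_mono r[OF True]) auto
   finally show ?thesis using True by simp
  qed simp
 qed
 also have "... = emeasure lborel S * (ennreal (r\<^sup>2) * ?I)" by (simp add: nn_integral_multc)
 finally show ?thesis .
qed

text \<open>Converse of the identity along lines. Dividing the tested identity by the step and
  letting the step tend to 0 leaves integration by parts. The steps 1/(n+1) form a countable family,
  so that slicing can collect the exceptional sets of all of them in a single null set.\<close>

lemma borel_gradI_lines:
 fixes u :: "'a::euclidean_space => 'b::euclidean_space"
 assumes u[measurable]: "u \<in> bmeas" and D[measurable]: "!!b. b \<in> Basis ==> D b \<in> bmeas"
  and L2: "!!K. compact K ==> set_integrable lborel K (%x. (norm (u x))\<^sup>2)"
   "!!K b. compact K ==> b \<in> Basis ==> set_integrable lborel K (%x. (norm (D b x))\<^sup>2)"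
  and line: "!!b n. b \<in> Basis ==> AE x in lborel. u (x + (1 / real (Suc n)) *R b) - u x =
    (1 / real (Suc n)) *R (LBINT s. indicator {0..1} s *R D b (x + s *R ((1 / real (Suc n)) *R b)))"
 shows "borel_grad UNIV u D"
 unfolding borel_grad_def
proof (intro conjI allI impI ballI)
 fix b :: 'a assume b: "b \<in> Basis"
 fix \<phi> :: "'a => real" and \<phi>' assume t: "test_fun \<phi> \<phi>' UNIV"
 define h where "h n = (1 / real (Suc n)) *R b" for n
 have h1: "norm (h n) \<le> 1" for n using b by (simp add: h_def field_simps)
 have "(%n. (1 / real (Suc n)) *R b) ~> 0 *R b"
  using LIMSEQ_inverse_real_of_nat by (intro tendsto_intros) (simp add: inverse_eq_divide)
 then have h0: "h ~> 0" unfolding h_def[abs_def] by simp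
 obtain R where R: "!!x. x \<notin> cball 0 R ==> \<phi> x = 0" "!!x h. x \<notin> cball 0 R ==> \<phi>' x h = 0"
  using test_fun_support_cball[OF t] by metis
 obtain M where M: "!!x. \<bar>\<phi> x\<bar> \<le> M" "!!x. \<bar>\<phi>' x b\<bar> \<le> M" using test_fun_bounded[OF t, of b] by metis
 note tb[measurable] = test_fun_borel[OF t]
 have ui: "set_integrable lborel (cball 0 R) u" for R
  by (rule set_integrable_square_imp[OF _ u L2(1)]; simp)
 have Db: "D b \<in> bmeas" by (rule D[OF b])
 have Di: "set_integrable lborel (cball 0 R) (D b)" for R
  by (rule set_integrable_square_imp[OF _ Db L2(2)[OF _ b]]; simp)
 \<comment> \<open>Both sides are first compared after multiplication by the step 1/(n+1), in which
   form the hypothesis applies; the positive factor is cancelled at the end.\<close>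
 have key: "(LBINT x. (LBINT s. indicator {0..1} s * \<phi> (x - s *R h n)) *R D b x)
  = - (LBINT x. (LBINT s. indicator {0..1} s * \<phi>' (x - s *R h n) b) *R u x)" for n
 proof -
  let ?e = "1 / real (Suc n)"
  have "?e *R (LBINT x. (LBINT s. indicator {0..1} s * \<phi> (x - s *R h n)) *R D b x) =
   ?e *R (LBINT x. \<phi> x *R (LBINT s. indicator {0..1} s *R D b (x + s *R h n)))"
   using integral_line_average[OF tb(1) R(1) M(1) Db Di, where h="h n"] integral_shifted_weight[OF tb(1) R(1) M(1) Db Di, where h="h n"] by simp
  also have "... = (LBINT x. \<phi> x *R (?e *R (LBINT s. indicator {0..1} s *R D b (x + s *R h n))))"
   by (subst integral_scaleR_right[symmetric]) (simp add: mult.commute)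
  also have "... = (LBINT x. \<phi> x *R (u (x + h n) - u x))"
  proof (rule integral_cong_AE)
   show "AE x in lborel. \<phi> x *R (?e *R (LBINT s. indicator {0..1} s *R D b (x + s *R h n))) = \<phi> x *R (u (x + h n) - u x)"
    using line[OF b, of n] unfolding h_def by eventually_elim simp
  qed (use Db in measurable)
  also have "... = (LBINT x. \<phi> x *R u (x + h n)) - (LBINT x. \<phi> x *R u x)"
   using integrable_bounded_support[OF ui[of R] u tb(1) R(1) M(1)] integrable_shift_weight(1)[OF tb(1) R(1) M(1) u ui, where h="h n"]
   by (simp add: scaleR_diff_right)
  also have "... = (LBINT x. \<phi> (x - h n) *R u x) - (LBINT x. \<phi> x *R u x)"
   using integrable_shift_weight(3)[OF tb(1) R(1) M(1) u ui, where h="h n"] by simp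
  also have "... = - (LBINT x. (\<phi> x - \<phi> (x - h n)) *R u x)"
   using integrable_bounded_support[OF ui[of R] u tb(1) R(1) M(1)] integrable_shift_weight(2)[OF tb(1) R(1) M(1) u ui, where h="h n"]
   by (simp add: scaleR_diff_left)
  also have "... = - (LBINT x. (LBINT s. indicator {0..1} s * \<phi>' (x - s *R h n) (h n)) *R u x)"
   by (simp add: test_fun_integral_line[OF t])
  also have "... = - (LBINT x. ?e *R ((LBINT s. indicator {0..1} s * \<phi>' (x - s *R h n) b) *R u x))"
  proof -
   have "\<phi>' y (h n) = ?e * \<phi>' y b" for y
    unfolding h_def using test_fun_linear[OF t] by (simp add: linear_cmul)
   then have "indicator {0..1} s * \<phi>' (x - s *R h n) (h n) = ?e * (indicator {0..1} s * \<phi>' (x - s *R h n) b)" for s x by simp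
   then show ?thesis by (simp only: integral_mult_right_zero scaleR_scaleR)
  qed
  also have "... = ?e *R (- (LBINT x. (LBINT s. indicator {0..1} s * \<phi>' (x - s *R h n) b) *R u x))"
   by (simp only: integral_scaleR_right scaleR_minus_right)
  finally show ?thesis by (simp only: real_vector.scale_cancel_left) simp
 qed
 have "(%n. (LBINT x. (LBINT s. indicator {0..1} s * \<phi> (x - s *R h n)) *R D b x)) ~> (LBINT x. \<phi> x *R D b x)"
  by (rule shifted_weight_tendsto[OF test_fun_continuous[OF t] R(1) M(1) Db Di h0 h1])
 moreover have "(%n. - (LBINT x. (LBINT s. indicator {0..1} s * \<phi>' (x - s *R h n) b) *R u x)) ~> - (LBINT x. \<phi>' x b *R u x)"
  by (intro tendsto_minus shifted_weight_tendsto[OF test_fun_continuous_deriv[OF t] R(2) M(2) u ui h0 h1])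
 ultimately show "(LBINT x. \<phi> x *R D b x) = - (LBINT x. \<phi>' x b *R u x)"
  unfolding key by (rule LIMSEQ_unique)
qed (use assms(1-4) in auto)

section \<open>Periodic representatives and slices\<close>

lemma int_vec_induct:
 fixes k :: "real ^ 'm::finite"
 assumes k: "!!i. k $ i \<in> \<int>" and 0: "P 0"
  and plus: "!!k i. P k ==> P (k + axis i 1)" and minus: "!!k i. P k ==> P (k - axis i 1)"
 shows "P k"
proof -
 have step: "P l ==> P (l + of_int n *R axis i 1)" for l i and n :: int
 proof (induction n rule: int_induct[where k=0])
  case (step1 n)
  then show ?case using plus[of "l + of_int n *R axis i 1" i] by (simp add: scaleR_left_distrib add.assoc)
 next
  case (step2 n)
  then show ?case using minus[of "l + of_int n *R axis i 1" i] by (simp add: scaleR_left_diff_distrib add_diff_eq)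
 qed simp
 have "P (\<Sum>i\<in>S. (k $ i) *R axis i 1)" if "finite S" for S
  using that
 proof (induction S)
  case (insert i S)
  obtain n where "k $ i = of_int n" using k[of i] by (auto elim: Ints_cases)
  then show ?case using step[OF insert.IH, of n i] insert.hyps by (simp add: add.commute)
 qed (simp add: 0)
 from this[of UNIV] show ?thesis using basis_expansion[of k] by (simp add: scalar_mult_eq_scaleR)
qed

section \<open>The cell of the torus and its lattice\<close>

definition fracv :: "real ^ 'm::finite => real ^ 'm" where
 "fracv x = (\<chi> i. frac (x $ i))"

lemma fracv_shift: "fracv (x + axis i 1) = fracv x"
proof -
 have "frac (x $ j + axis i 1 $ j) = frac (x $ j)" for j
  by (simp add: axis_def frac_def)
 then show ?thesis by (simp add: fracv_def vec_eq_iff)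
qed

lemma fracv_diff_int: "(fracv x - x) $ i \<in> \<int>"
 by (simp add: fracv_def frac_def)

lemma fracv_borel[measurable]: "(fracv :: real ^ 'm::finite => real ^ 'm) \<in> bmeas"
proof -
 have "(%x. fracv x \<bullet> b) \<in> bmeas" if "b \<in> Basis" for b :: "real ^ 'm"
 proof -
  obtain i where b: "b = axis i 1" using \<open>b \<in> Basis\<close> by (auto simp: Basis_vec_def)
  have "(%x::real^'m. (x \<bullet> b) - real_of_int \<lfloor>x \<bullet> b\<rfloor>) \<in> bmeas"
   by measurable
  moreover have "fracv x \<bullet> b = (x \<bullet> b) - real_of_int \<lfloor>x \<bullet> b\<rfloor>" for x
   by (simp add: b inner_axis fracv_def frac_def)
  ultimately show ?thesis by simp
 qed
 then show ?thesis by (subst borel_measurable_euclidean_space) simp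
qed

lemma mem_cell: "x \<in> cell \<longleftrightarrow> (\<forall>i. 0 \<le> x $ i \<and> x $ i \<le> 1)"
proof
 assume "x \<in> cell"
 then have "!!b. b \<in> Basis ==> 0 \<le> x \<bullet> b \<and> x \<bullet> b \<le> 1" by (simp add: cell_def mem_box)
 then have "0 \<le> x \<bullet> axis i 1 \<and> x \<bullet> axis i 1 \<le> 1" for i by (auto simp: Basis_vec_def)
 then show "\<forall>i. 0 \<le> x $ i \<and> x $ i \<le> 1" by (simp add: inner_axis)
next
 assume "\<forall>i. 0 \<le> x $ i \<and> x $ i \<le> 1"
 then have "0 \<le> x \<bullet> b \<and> x \<bullet> b \<le> 1" if "b \<in> Basis" for b
  using that by (auto simp: Basis_vec_def inner_axis)
 then show "x \<in> cell" by (simp add: cell_def mem_box)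
qed

lemma cell_borel[measurable]: "cell \<in> sets borel" by (simp add: cell_def)
lemma convex_cell: "convex cell" by (simp add: cell_def)
lemma compact_cell: "compact cell" by (simp add: cell_def)

lemma emeasure_cell: "emeasure lborel (cell :: (real ^ 'm::finite) set) = 1"
 unfolding cell_def by (subst emeasure_lborel_cbox) (auto simp: inner_diff_left)

lemma measure_cell: "measure lborel (cell :: (real ^ 'm::finite) set) = 1"
 by (simp add: measure_def emeasure_cell)

lemma periodic_x'_int_vec:
 assumes "periodic_x' u" "!!i. k $ i \<in> \<int>"
 shows "u (t, x + k) = u (t, x)"
proof -
 have per: "u (t, x + axis i 1) = u (t, x)" for x i using assms(1) by (simp add: periodic_x'_def)
 have "\<forall>x. u (t, x + k) = u (t, x)"
 proof (rule int_vec_induct[where P="%k. \<forall>x. u (t, x + k) = u (t, x)" and k=k])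
  fix k i assume IH: "\<forall>x. u (t, x + k) = u (t, x)"
  show "\<forall>x. u (t, x + (k + axis i 1)) = u (t, x)"
  proof
   fix x show "u (t, x + (k + axis i 1)) = u (t, x)" using per[of "x + k" i] IH by (simp add: add.assoc)
  qed
  show "\<forall>x. u (t, x + (k - axis i 1)) = u (t, x)"
  proof
   fix x show "u (t, x + (k - axis i 1)) = u (t, x)" using per[of "x + (k - axis i 1)" i] IH by (simp add: add.assoc)
  qed
 qed (use assms(2) in auto)
 then show ?thesis by blast
qed

text \<open>Composition with \<open>fracv\<close> is periodic everywhere and stays Borel. It agrees
  with f almost everywhere because, the lattice being countable, almost every x satisfies f = f0 and
  the periodicity of f at all its lattice translates simultaneously.\<close>

lemma ex_periodic_borel_representative:
 fixes f f0 :: "('m::finite) pt => 'c::euclidean_space"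
 assumes [measurable]: "f0 \<in> bmeas" and eq: "AE x in lborel. f x = f0 x"
  and per: "!!i. AE x in lborel. f (x + (0, axis i 1)) = f x"
 shows "\<exists>g\<in>bmeas. periodic_x' g \<and> (AE x in lborel. f x = g x)"
proof -
 define g where "g p = f0 (fst p, fracv (snd p))" for p
 have "g \<in> bmeas" unfolding g_def borel_prod[symmetric] by measurable
 moreover have "periodic_x' g" by (simp add: periodic_x'_def g_def fracv_shift)
 moreover have "AE x in lborel. f x = g x"
 proof -
  have sh: "AE x in lborel. f (x + (0, k)) = f x" if "!!i. k $ i \<in> \<int>" for k
  proof (rule int_vec_induct[where P="%k. AE x in lborel. f (x + (0, k)) = f x" and k=k])
   show "AE x in lborel. f (x + (0, 0)) = f x" by (simp add: zero_prod_def[symmetric])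
   fix k i assume IH: "AE x in lborel. f (x + (0, k)) = f x"
   show "AE x in lborel. f (x + (0, k + axis i 1)) = f x" using IH AE_shift[OF per[of i], of "(0, k)"]
    by eventually_elim (simp add: add.assoc)
   show "AE x in lborel. f (x + (0, k - axis i 1)) = f x" using IH AE_shift[OF per[of i], of "(0, k - axis i 1)"]
    by eventually_elim (simp add: add.assoc)
  qed (rule that)
  define Z where "Z = {k :: real ^ 'm. \<forall>i. k $ i \<in> \<int>}"
  have "countable Z"
  proof -
   have "(%k. (\<chi> i. of_int (k i))) ` (UNIV :: ('m => int) set) = Z"
   proof (intro set_eqI iffI)
    fix k assume "k \<in> Z"
    then have "\<forall>i. \<exists>n. k $ i = of_int n" by (auto simp: Z_def elim: Ints_cases)
    then obtain n where "!!i. k $ i = of_int (n i)" by metis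
    then have "k = (\<chi> i. of_int (n i))" by (simp add: vec_eq_iff)
    then show "k \<in> (%k. (\<chi> i. of_int (k i))) ` (UNIV :: ('m => int) set)" by blast
   qed (auto simp: Z_def)
   moreover have "countable (UNIV :: ('m => int) set)" by simp
   ultimately show ?thesis by (metis countable_image)
  qed
  then have "AE x in lborel. \<forall>k\<in>Z. f (x + (0, k)) = f x \<and> f (x + (0, k)) = f0 (x + (0, k))"
   unfolding AE_ball_countable[OF \<open>countable Z\<close>]
  proof (intro ballI)
   fix k assume "k \<in> Z"
   then have "!!i. k $ i \<in> \<int>" by (simp add: Z_def)
   from sh[OF this] AE_shift[OF eq, of "(0, k)"]
   show "AE x in lborel. f (x + (0, k)) = f x \<and> f (x + (0, k)) = f0 (x + (0, k))" by eventually_elim simp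
  qed
  then show ?thesis
  proof eventually_elim
   case (elim x)
   obtain t y where x: "x = (t, y)" by (cases x)
   \<comment> \<open>The particular translate that brings y into the fundamental cell is one of the
     countably many already covered.\<close>
   have "fracv y - y \<in> Z" using fracv_diff_int[of y] by (simp add: Z_def)
   from bspec[OF elim this] show ?case by (simp add: g_def x) metis
  qed
 qed
 ultimately show ?thesis by blast
qed

text \<open>Finitely many lattice translates of the cell cover the ball. Their number depends on R
  alone, not on f or A, as uniform bounds along sequences of fields demand.\<close>

lemma nn_integral_periodic_ball_le:
 assumes "0 \<le> R"
 obtains N :: nat where "!!(f :: ('m::finite) pt => ennreal) A. f \<in> bmeas ==> periodic_x' f ==> A \<in> sets borel ==>
  (NN x. indicator (A \<times> cball 0 R) x * f x) \<le> of_nat N * (NN x. indicator (A \<times> cell) x * f x)"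
proof -
 \<comment> \<open>Coordinates of points of the ball have absolute value at most R, so their floors
   lie between -r and r.\<close>
 define r where "r = \<lceil>R\<rceil> + 1"
 define Z where "Z = (%n :: 'm => int. (\<chi> i. of_int (n i)) :: real ^ 'm) ` PiE UNIV (%_. {- r..r})"
 have fZ: "finite Z" unfolding Z_def by (intro finite_imageI finite_PiE) auto
 have cover: "\<exists>k\<in>Z. y - k \<in> cell" if "y \<in> cball 0 R" for y :: "real ^ 'm"
 proof (rule bexI)
  let ?n = "%i. \<lfloor>y $ i\<rfloor>"
  show "y - (\<chi> i. of_int (?n i)) \<in> cell"
   unfolding mem_cell by (simp, intro allI conjI; linarith)
  have "\<bar>y $ i\<bar> \<le> R" for i using that component_le_norm_cart[of y i] by simp
  then have "- r \<le> ?n i \<and> ?n i \<le> r" for i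
  proof -
   have "\<bar>y $ i\<bar> \<le> R" by fact
   moreover have "real_of_int (?n i) \<le> y $ i" "y $ i < real_of_int (?n i) + 1" "R \<le> real_of_int \<lceil>R\<rceil>"
    by linarith+
   ultimately have "real_of_int (- r) \<le> real_of_int (?n i)" "real_of_int (?n i) \<le> real_of_int r"
    unfolding r_def of_int_minus of_int_add of_int_1 by linarith+
   then show ?thesis by (simp only: of_int_le_iff)
  qed
  then show "(\<chi> i. of_int (?n i)) \<in> Z" unfolding Z_def by (intro imageI) auto
 qed
 have "(NN x. indicator (A \<times> cball 0 R) x * f x) \<le> of_nat (card Z) * (NN x. indicator (A \<times> cell) x * f x)"
  if f[measurable]: "f \<in> bmeas" and per: "periodic_x' f" and A[measurable]: "A \<in> sets borel"
  for f :: "'m pt => ennreal" and A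
 proof -
  have AC[measurable]: "A \<times> (cell :: (real ^ 'm) set) \<in> sets borel"
   unfolding borel_prod[symmetric] by measurable
  have "(NN x. indicator (A \<times> cball 0 R) x * f x) \<le> (NN x. (\<Sum>k\<in>Z. indicator (A \<times> cell) (x + (0, - k)) * f (x + (0, - k))))"
  proof (rule nn_integral_mono)
   fix x :: "'m pt"
   obtain t y where x: "x = (t, y)" by (cases x)
   show "indicator (A \<times> cball 0 R) x * f x \<le> (\<Sum>k\<in>Z. indicator (A \<times> cell) (x + (0, - k)) * f (x + (0, - k)))"
   proof (cases "x \<in> A \<times> cball 0 R")
    case True
    then obtain k where k: "k \<in> Z" "y - k \<in> cell" using cover[of y] x by auto
    have ki: "(- k) $ i \<in> \<int>" for i using k(1) by (auto simp: Z_def)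
    have "indicator (A \<times> cball 0 R) x * f x = indicator (A \<times> cell) (x + (0, - k)) * f (x + (0, - k))"
     using True k(2) periodic_x'_int_vec[OF per ki, of t y] by (simp add: x)
    also have "... \<le> (\<Sum>k\<in>Z. indicator (A \<times> cell) (x + (0, - k)) * f (x + (0, - k)))"
     using k(1) fZ by (intro member_le_sum) auto
    finally show ?thesis .
   qed simp
  qed
  also have "... = (\<Sum>k\<in>Z. (NN x. indicator (A \<times> cell) (x + (0, - k)) * f (x + (0, - k))))"
   by (rule nn_integral_sum) measurable
  also have "... = (\<Sum>k\<in>Z. (NN x. indicator (A \<times> cell) x * f x))"
   by (intro sum.cong refl nn_integral_shift) measurable
  finally show ?thesis by simp
 qed
 then show thesis by (rule that)
qed

lemma sum_Basis_inner_scaleR: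
 fixes c :: "'a::euclidean_space" and F :: "'a => 'b::real_vector"
 assumes "c \<in> Basis"
 shows "(\<Sum>b\<in>Basis. ((r *R c) \<bullet> b) *R F b) = r *R F c"
proof -
 have "(\<Sum>b\<in>Basis. ((r *R c) \<bullet> b) *R F b) = (\<Sum>b\<in>Basis. if b = c then r *R F c else 0)"
  by (rule sum.cong) (auto simp: inner_Basis assms)
 then show ?thesis using assms by simp
qed

section \<open>Restriction to almost every slice\<close>

lemma AE_pair_lborel:
 fixes P :: "'a::euclidean_space \<times> 'b::euclidean_space => bool"
 assumes "AE x in lborel. P x"
 shows "AE s in lborel. AE y in lborel. P (s, y)"
 by (rule lborel_pair.AE_pair) (use assms in \<open>unfold lborel_prod\<close>)

lemma set_integrable_compactI:
 fixes g :: "'a::euclidean_space => real"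
 assumes g: "!!n::nat. integrable lborel (%y. indicat_real (cball 0 (real n)) y * g y)" and K: "compact K"
 shows "set_integrable lborel K g"
proof -
 obtain r where "K \<subseteq> cball 0 r" using compact_imp_bounded[OF K] bounded_subset_ballD[of K 0] ball_subset_cball by (metis order_trans)
 moreover obtain n :: nat where "r \<le> real n" using real_arch_simple by blast
 ultimately have "K \<subseteq> cball 0 (real n)" by (meson order_trans subset_cball)
 moreover have "set_integrable lborel (cball 0 (real n)) g" unfolding set_integrable_def using g[of n] by simp
 ultimately show ?thesis using borel_compact[OF K] by (metis set_integrable_subset sets_lborel)
qed

text \<open>Fubini is applied on balls of integer radius: countably many null sets, after which a
  single null set of slices serves all compact K.\<close>

lemma AE_slice_L2:
 fixes f :: "'a::euclidean_space \<times> 'b::euclidean_space => 'c::euclidean_space"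
 assumes f[measurable]: "f \<in> bmeas"
  and K: "!!K. compact K ==> set_integrable lborel K (%x. (norm (f x))\<^sup>2)"
 shows "AE s in lborel. \<forall>K. compact K \<longrightarrow> set_integrable lborel K (%y. (norm (f (s, y)))\<^sup>2)"
  and "AE y in lborel. \<forall>K. compact K \<longrightarrow> set_integrable lborel K (%s. (norm (f (s, y)))\<^sup>2)"
proof -
 have f'[measurable]: "f \<in> borel_measurable (borel \<Otimes>\<^sub>M borel)" using f by (simp add: borel_prod)
 have int: "integrable (lborel \<Otimes>\<^sub>M lborel) (%(s, y). indicat_real (cball 0 (real n)) s * (indicat_real (cball 0 (real n)) y * (norm (f (s, y)))\<^sup>2))" for n :: nat
 proof -
  have "compact (cball (0::'a) (real n) \<times> cball (0::'b) (real n))" by (intro compact_Times) auto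
  from K[OF this] have "integrable (lborel \<Otimes>\<^sub>M lborel) (%x. indicat_real (cball (0::'a) (real n) \<times> cball (0::'b) (real n)) x *R (norm (f x))\<^sup>2)"
   by (simp add: set_integrable_def lborel_prod)
  also have "(%x. indicat_real (cball (0::'a) (real n) \<times> cball (0::'b) (real n)) x *R (norm (f x))\<^sup>2) = (%(s, y). indicat_real (cball 0 (real n)) s * (indicat_real (cball 0 (real n)) y * (norm (f (s, y)))\<^sup>2))"
   by (auto simp: fun_eq_iff indicator_def)
  finally show ?thesis .
 qed
 have "AE s in lborel. \<forall>n::nat. integrable lborel (%y. indicat_real (cball 0 (real n)) s * (indicat_real (cball 0 (real n)) y * (norm (f (s, y)))\<^sup>2))"
  unfolding AE_all_countable using lborel_pair.AE_integrable_fst[OF int] by simp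
 then show "AE s in lborel. \<forall>K. compact K \<longrightarrow> set_integrable lborel K (%y. (norm (f (s, y)))\<^sup>2)"
 proof eventually_elim
  case (elim s)
  obtain m :: nat where m: "norm s \<le> real m" using real_arch_simple by blast
  have "integrable lborel (%y. indicat_real (cball 0 (real n)) y * (norm (f (s, y)))\<^sup>2)" for n :: nat
  proof -
   have i: "integrable lborel (%y. indicat_real (cball 0 (real (max n m))) y * (norm (f (s, y)))\<^sup>2)"
    using elim[THEN spec, of "max n m"] m by simp
   have [measurable]: "(%y. f (s, y)) \<in> bmeas" by measurable
   have [measurable]: "cball (0::'b) (real n) \<in> sets borel" by simp
   show ?thesis by (rule Bochner_Integration.integrable_bound[OF i]) (measurable, auto simp: indicator_def)
  qed
  then show ?case by (intro allI impI set_integrable_compactI)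
 qed
 have "AE y in lborel. \<forall>n::nat. integrable lborel (%s. indicat_real (cball 0 (real n)) s * (indicat_real (cball 0 (real n)) y * (norm (f (s, y)))\<^sup>2))"
  unfolding AE_all_countable using lborel_pair.AE_integrable_snd[OF int] by simp
 then show "AE y in lborel. \<forall>K. compact K \<longrightarrow> set_integrable lborel K (%s. (norm (f (s, y)))\<^sup>2)"
 proof eventually_elim
  case (elim y)
  obtain m :: nat where m: "norm y \<le> real m" using real_arch_simple by blast
  have "integrable lborel (%s. indicat_real (cball 0 (real n)) s * (norm (f (s, y)))\<^sup>2)" for n :: nat
  proof -
   have i: "integrable lborel (%s. indicat_real (cball 0 (real (max n m))) s * (norm (f (s, y)))\<^sup>2)"
    using elim[THEN spec, of "max n m"] m by simp
   have [measurable]: "(%s. f (s, y)) \<in> bmeas" by measurable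
   have [measurable]: "cball (0::'a) (real n) \<in> sets borel" by simp
   show ?thesis by (rule Bochner_Integration.integrable_bound[OF i]) (measurable, auto simp: indicator_def)
  qed
  then show ?case by (intro allI impI set_integrable_compactI)
 qed
qed

text \<open>The identity along lines for shifts tangential to the slice holds almost everywhere on
  the product, hence on almost every slice by Fubini. Only countably many shifts occur, so almost
  every slice satisfies the criterion \<open>borel_gradI_lines\<close>.\<close>

lemma borel_grad_slice:
 fixes u :: "'a::euclidean_space \<times> 'b::euclidean_space => 'c::euclidean_space"
 assumes B: "borel_grad UNIV u D"
 shows "AE s in lborel. borel_grad UNIV (%y. u (s, y)) (%b y. D (0, b) (s, y))"
proof -
 have u[measurable]: "u \<in> bmeas" by (rule borel_gradD(2)[OF B])
 have D: "!!b. b \<in> Basis ==> D b \<in> bmeas" by (rule borel_gradD(3)[OF B])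
 have inB: "(0, b) \<in> (Basis :: ('a \<times> 'b) set)" if "b \<in> Basis" for b using that by (simp add: Basis_prod_def)
 have m1: "(%y. u (s, y)) \<in> bmeas" for s using u unfolding borel_prod[symmetric] by measurable
 have m2: "(%y. D (0, b) (s, y)) \<in> bmeas" if "b \<in> Basis" for s b
  using D[OF inB[OF that]] unfolding borel_prod[symmetric] by measurable
 have "AE s in lborel. \<forall>b\<in>Basis. \<forall>n. AE y in lborel. u (s, y + (1 / real (Suc n)) *R b) - u (s, y) =
    (1 / real (Suc n)) *R (LBINT r. indicator {0..1} r *R D (0, b) (s, y + r *R ((1 / real (Suc n)) *R b)))"
  unfolding AE_ball_countable[OF countable_finite[OF finite_Basis]] AE_all_countable
 proof (intro ballI allI)
  fix b :: 'b and n :: nat assume b: "b \<in> Basis"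
  let ?e = "1 / real (Suc n)"
  have h: "(0, ?e *R b) = ?e *R (0, b)" by simp
  have "AE x in lborel. u (x + (0, ?e *R b)) - u x =
   (LBINT r. indicator {0..1} r *R (\<Sum>c\<in>Basis. ((?e *R (0, b)) \<bullet> c) *R D c (x + r *R (0, ?e *R b))))"
   unfolding h by (rule borel_grad_line_identity[OF B])
  then have "AE x in lborel. u (x + (0, ?e *R b)) - u x =
   ?e *R (LBINT r. indicator {0..1} r *R D (0, b) (x + (0, r *R (?e *R b))))"
  proof eventually_elim
   case (elim x)
   show ?case unfolding elim sum_Basis_inner_scaleR[OF inB[OF b]]
    by (subst integral_scaleR_right[symmetric]) (simp add: mult.commute)
  qed
  from AE_pair_lborel[OF this]
  show "AE s in lborel. AE y in lborel. u (s, y + ?e *R b) - u (s, y) =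
   ?e *R (LBINT r. indicator {0..1} r *R D (0, b) (s, y + r *R (?e *R b)))"
   by simp
 qed
 moreover have "AE s in lborel. \<forall>K. compact K \<longrightarrow> set_integrable lborel K (%y. (norm (u (s, y)))\<^sup>2)"
  by (rule AE_slice_L2(1)[OF u borel_gradD(4)[OF B]]) auto
 moreover have "AE s in lborel. \<forall>b\<in>Basis. \<forall>K. compact K \<longrightarrow> set_integrable lborel K (%y. (norm (D (0, b) (s, y)))\<^sup>2)"
  unfolding AE_ball_countable[OF countable_finite[OF finite_Basis]]
  using AE_slice_L2(1)[OF D[OF inB] borel_gradD(5)[OF B _ _ inB]] by simp
 ultimately show ?thesis
 proof eventually_elim
  case (elim s)
  show ?case
  proof (rule borel_gradI_lines[OF m1 m2])
   show "set_integrable lborel K (%y. (norm (u (s, y)))\<^sup>2)" if "compact K" for K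
    using elim(2) that by simp
   show "set_integrable lborel K (%y. (norm (D (0, b) (s, y)))\<^sup>2)" if "compact K" "b \<in> Basis" for K b
    using elim(3) that by simp
   show "AE y in lborel. u (s, y + (1 / real (Suc n)) *R b) - u (s, y) =
    (1 / real (Suc n)) *R (LBINT r. indicator {0..1} r *R D (0, b) (s, y + r *R ((1 / real (Suc n)) *R b)))"
    if "b \<in> Basis" for b n
    using bspec[OF elim(1) that] by (rule spec)
  qed
 qed
qed

section \<open>Representatives absolutely continuous in the first variable\<close>

text \<open>The last clause is the decisive one: it holds for every pair of times, not for almost
  every pair, so each slice is meaningful. The null set of y may depend on the pair.\<close>

definition regular_field :: "(('m::finite) pt => 'm pt) => ('m pt => 'm pt => 'm pt) => bool" where
 "regular_field u D \<longleftrightarrow> borel_grad UNIV u D \<and> periodic_x' u \<and> (\<forall>b\<in>Basis. periodic_x' (D b)) \<and>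
  (gradsq D) < \<infinity> \<and>
  (AE x in lborel. (\<Sum>b\<in>Basis. D b x \<bullet> b) = 0) \<and>
  (\<forall>s t. s \<le> t \<longrightarrow> (AE y in lborel. u (t, y) - u (s, y) = (LBINT r. indicator {s..t} r *R D (1, 0) (r, y))))"

lemma regular_fieldD:
 assumes "regular_field u D"
 shows "borel_grad UNIV u D" "periodic_x' u" "!!b. b \<in> Basis ==> periodic_x' (D b)"
  "(gradsq D) < \<infinity>"
  "AE x in lborel. (\<Sum>b\<in>Basis. D b x \<bullet> b) = 0"
  "!!s t. s \<le> t ==> AE y in lborel. u (t, y) - u (s, y) = (LBINT r. indicator {s..t} r *R D (1, 0) (r, y))"
  "u \<in> bmeas" "!!b. b \<in> Basis ==> D b \<in> bmeas"
  "sq_grad D \<in> bmeas"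
proof -
 show B: "borel_grad UNIV u D" using assms unfolding regular_field_def by simp
 show "periodic_x' u" using assms unfolding regular_field_def by simp
 show "periodic_x' (D b)" if "b \<in> Basis" for b using assms that unfolding regular_field_def by simp
 show "(gradsq D) < \<infinity>" using assms unfolding regular_field_def by simp
 show "AE x in lborel. (\<Sum>b\<in>Basis. D b x \<bullet> b) = 0" using assms unfolding regular_field_def by simp
 show "AE y in lborel. u (t, y) - u (s, y) = (LBINT r. indicator {s..t} r *R D (1, 0) (r, y))" if "s \<le> t" for s t
  using assms that unfolding regular_field_def by blast
 show "u \<in> bmeas" by (rule borel_gradD(2)[OF B])
 show Db: "D b \<in> bmeas" if "b \<in> Basis" for b by (rule borel_gradD(3)[OF B that])
 show "sq_grad D \<in> bmeas" by (rule sq_grad_borel[OF Db])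
qed

text \<open>The weight of the oriented integral from a to t, up to a null set. It spares the case
  distinction on the order of a and t and is jointly measurable in all three arguments.\<close>

definition signed_ind :: "real => real => real => real" where
 "signed_ind a t r = indicator {a..t} r - indicator {t..a} r"

lemma signed_ind_measurable[measurable (raw)]:
 assumes [measurable]: "f \<in> borel_measurable M" "g \<in> borel_measurable M" "h \<in> borel_measurable M"
 shows "(%x. signed_ind (f x) (g x) (h x)) \<in> borel_measurable M"
 unfolding signed_ind_def indicator_def atLeastAtMost_iff by measurable

text \<open>Affine substitution; for negative r the absolute value from the change of variables and
  the sign in \<open>signed_ind\<close> together give back r.\<close>

lemma integral_unit_scale:
 fixes f :: "real => 'b::{banach, second_countable_topology}"
 shows "(LBINT s. indicator {0..1} s *R (r *R f (a + s * r))) = (LBINT x. signed_ind a (a + r) x *R f x)"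
proof (cases "r = 0")
 case True
 then show ?thesis by (simp add: signed_ind_def)
next
 case False
 have "(LBINT x. signed_ind a (a + r) x *R f x) = \<bar>r\<bar> *R (LBINT s. signed_ind a (a + r) (a + r * s) *R f (a + r * s))"
  by (rule lborel_integral_real_affine[OF False])
 also have "... = (LBINT s. \<bar>r\<bar> *R (signed_ind a (a + r) (a + r * s) *R f (a + r * s)))"
  by (rule integral_scaleR_right[symmetric])
 also have "... = (LBINT s. indicator {0..1} s *R (r *R f (a + s * r)))"
 proof (rule Bochner_Integration.integral_cong[OF refl])
  fix s :: real
  have "\<bar>r\<bar> * signed_ind a (a + r) (a + r * s) = indicator {0..1} s * r"
  proof (cases "r > 0")
   case True
   then have "r * s \<le> r \<longleftrightarrow> s \<le> 1" "0 \<le> r * s \<longleftrightarrow> 0 \<le> s" by (simp_all add: zero_le_mult_iff)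
   then show ?thesis using True by (auto simp: signed_ind_def indicator_def)
  next
   case F: False
   then have "r < 0" using False by simp
   then have "r \<le> r * s \<longleftrightarrow> s \<le> 1" "r * s \<le> 0 \<longleftrightarrow> 0 \<le> s"
    using mult_le_cancel_left_neg[of r 1 s] by (simp_all add: mult_le_0_iff)
   then show ?thesis using \<open>r < 0\<close> by (auto simp: signed_ind_def indicator_def)
  qed
  then show "\<bar>r\<bar> *R (signed_ind a (a + r) (a + r * s) *R f (a + r * s)) = indicator {0..1} s *R (r *R f (a + s * r))"
   by (simp add: mult.commute[of s])
 qed
 finally show ?thesis by simp
qed

lemma AE_lborel_neq: "AE x in lborel. x \<noteq> (c::real)"
 by (rule AE_lborel_singleton)

lemma ae_lborel_neq_bot: "ae_filter (lborel :: 'a::euclidean_space measure) \<noteq> bot"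
 by (simp add: ae_filter_eq_bot_iff)

text \<open>After Borel periodic versions are chosen, the identity along e_1 holds for every shift
  and almost every base point. Exchanging these quantifiers produces one base time a from which, for
  almost every y, the field at almost every time is recovered by integrating its derivative. Taking
  this recovery formula as the definition of the field makes it valid at all times.\<close>

lemma ex_regular_representative:
 fixes u :: "('m::finite) pt => 'm pt"
 assumes S: "sob_div UNIV u D"
 obtains u' D' where "regular_field u' D'" "AE x in lborel. u x = u' x"
  "!!b. b \<in> Basis ==> AE x in lborel. D b x = D' b x"
proof -
 have W: "weak_grad UNIV u D" and P: "periodic_x' u"
  and F: "(\<integral>\<^sup>+x. indicator (UNIV \<times> cell) x * ennreal (sq_grad D x) \<partial>lebesgue) < \<infinity>"
  and V: "AE x in lebesgue. (\<Sum>b\<in>Basis. D b x \<bullet> b) = 0"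
  using S unfolding sob_div_def by simp_all
 have um: "u \<in> borel_measurable lebesgue" and Dm: "!!b. b \<in> Basis ==> D b \<in> borel_measurable lebesgue"
  using W unfolding weak_grad_def by simp_all
 obtain u0 where u0: "u0 \<in> bmeas" "AE x in lborel. u x = u0 x"
  by (rule bexE[OF ex_borel_representative[OF um]])
 have "\<forall>b\<in>Basis. \<exists>g. g \<in> bmeas \<and> (AE x in lborel. D b x = g x)"
  using ex_borel_representative[OF Dm] unfolding Bex_def by (rule ballI)
 from bchoice[OF this] obtain D0 where D0': "\<forall>b\<in>Basis. D0 b \<in> bmeas \<and> (AE x in lborel. D b x = D0 b x)" by (rule exE)
 have D0: "D0 b \<in> bmeas" "AE x in lborel. D b x = D0 b x" if "b \<in> Basis" for b
  using bspec[OF D0' that] by simp_all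
 have B0: "borel_grad UNIV u0 D0" by (rule weak_grad_imp_borel_grad[OF W u0(1) D0(1) u0(2) D0(2)])
 have up: "AE x in lborel. u (x + (0, axis i 1)) = u x" for i
 proof (rule AE_I2)
  fix x :: "'m pt" show "u (x + (0, axis i 1)) = u x" using P by (cases x) (simp add: periodic_x'_def)
 qed
 have u0p: "AE x in lborel. u0 (x + (0, axis i 1)) = u0 x" for i
  using up[of i] AE_shift[OF u0(2), of "(0, axis i 1)"] u0(2) by eventually_elim simp
 obtain u1 where u1: "u1 \<in> bmeas" "periodic_x' u1" "AE x in lborel. u x = u1 x"
  using ex_periodic_borel_representative[OF u0 up] unfolding Bex_def by (elim exE conjE)
 have per: "\<exists>g\<in>bmeas. periodic_x' g \<and> (AE x in lborel. D0 b x = g x)" if b: "b \<in> Basis" for b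
 proof (rule ex_periodic_borel_representative[OF D0(1)[OF b]])
  show "AE x in lborel. D0 b (x + (0, axis i 1)) = D0 b x" for i
   using borel_grad_shift_invariant[OF B0 _ u0p b, of i] by simp
 qed simp
 have "\<forall>b\<in>Basis. \<exists>g. g \<in> bmeas \<and> periodic_x' g \<and> (AE x in lborel. D0 b x = g x)"
  using per unfolding Bex_def by (rule ballI)
 from bchoice[OF this] obtain D1 where D1'': "\<forall>b\<in>Basis. D1 b \<in> bmeas \<and> periodic_x' (D1 b) \<and> (AE x in lborel. D0 b x = D1 b x)" by (rule exE)
 have D1: "D1 b \<in> bmeas" "periodic_x' (D1 b)" "AE x in lborel. D0 b x = D1 b x" if "b \<in> Basis" for b
  using bspec[OF D1'' that] by simp_all
 have D1': "AE x in lborel. D b x = D1 b x" if "b \<in> Basis" for b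
  using D0(2)[OF that] D1(3)[OF that] by eventually_elim simp
 have B1: "borel_grad UNIV u1 D1" by (rule weak_grad_imp_borel_grad[OF W u1(1) D1(1) u1(3) D1'])
 let ?e = "(1, 0) :: 'm pt"
 have eB: "?e \<in> Basis" by (simp add: Basis_prod_def)
 define d where "d = D1 ?e"
 have dm[measurable]: "d \<in> bmeas" unfolding d_def by (rule D1(1)[OF eB])
 have dm'[measurable]: "d \<in> borel_measurable (borel \<Otimes>\<^sub>M borel)" using dm by (simp add: borel_prod)
 have u1m'[measurable]: "u1 \<in> borel_measurable (borel \<Otimes>\<^sub>M borel)" using u1(1) by (simp add: borel_prod)
 define Q where "Q a t y \<longleftrightarrow> u1 (t, y) - u1 (a, y) = (LBINT r. signed_ind a t r *R d (r, y))" for a t y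
 have Qr: "AE x in lborel. Q (fst x) (fst x + r) (snd x)" for r
  using borel_grad_line_identity[OF B1, of "r *R ?e"]
 proof eventually_elim
  case (elim x)
  obtain a y where x: "x = (a, y)" by (cases x)
  have "u1 (a + r, y) - u1 (a, y) = (LBINT s. indicator {0..1} s *R (r *R d (a + s * r, y)))"
   using elim unfolding sum_Basis_inner_scaleR[OF eB] by (simp add: x d_def)
  then show ?case unfolding Q_def x fst_conv snd_conv integral_unit_scale[of r "%s. d (s, y)" a] .
 qed
 \<comment> \<open>Measurability in the product sigma-algebra, the prerequisite for exchanging "for
   every shift, almost every point" into "for almost every point, almost every shift".\<close>
 have Qm: "{p \<in> space (lborel \<Otimes>\<^sub>M lborel). Q (fst (snd p)) (fst (snd p) + fst p) (snd (snd p))} \<in> sets ((lborel :: real measure) \<Otimes>\<^sub>M (lborel :: 'm pt measure))"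
 proof -
  have "{p \<in> space (borel \<Otimes>\<^sub>M (borel \<Otimes>\<^sub>M borel)). Q (fst (snd p)) (fst (snd p) + fst p) (snd (snd p))} \<in> sets ((borel :: real measure) \<Otimes>\<^sub>M ((borel :: real measure) \<Otimes>\<^sub>M (borel :: (real ^ 'm) measure)))"
   unfolding Q_def by measurable
  moreover have "sets ((lborel :: real measure) \<Otimes>\<^sub>M (lborel :: 'm pt measure)) = sets ((borel :: real measure) \<Otimes>\<^sub>M ((borel :: real measure) \<Otimes>\<^sub>M (borel :: (real ^ 'm) measure)))"
   unfolding borel_prod lborel_prod by simp
  ultimately show ?thesis by (simp add: space_pair_measure)
 qed
 have "AE r in lborel. AE x in lborel. Q (fst x) (fst x + r) (snd x)" using Qr by simp
 then have "AE x in lborel. AE r in lborel. Q (fst x) (fst x + r) (snd x)"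
  using lborel_pair.AE_commute[of "%r x. Q (fst x) (fst x + r) (snd x)"] Qm by simp
 from AE_pair_lborel[OF this] have "AE a in lborel. AE y in lborel. AE r in lborel. Q a (a + r) y" by simp
 \<comment> \<open>Almost every base time is good; one of them is fixed for the rest of the
   construction.\<close>
 from eventually_happens'[OF ae_lborel_neq_bot this] obtain a where a: "AE y in lborel. AE r in lborel. Q a (a + r) y"
  by (rule exE)
 have a2: "AE y in lborel. AE t in lborel. Q a t y"
  using a
 proof eventually_elim
  case (elim y)
  from AE_shift[OF this, of "- a"] show ?case by simp
 qed
 have Qm2: "{p \<in> space (lborel \<Otimes>\<^sub>M lborel). Q a (fst p) (snd p)} \<in> sets ((lborel :: real measure) \<Otimes>\<^sub>M (lborel :: (real ^ 'm) measure))"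
  unfolding Q_def by measurable
 \<comment> \<open>The slice at the base time plus the oriented integral of the derivative: equal to
   \<open>u1\<close> almost everywhere, and absolutely continuous in time for almost every y by
   construction.\<close>
 define v where "v p = u1 (a, snd p) + (LBINT r. signed_ind a (fst p) r *R d (r, snd p))" for p
 have "v \<in> borel_measurable (borel \<Otimes>\<^sub>M borel)" unfolding v_def by measurable
 then have vm: "v \<in> bmeas" by (simp add: borel_prod)
 have uv: "AE x in lborel. u1 x = v x"
 proof -
  have "AE t in lborel. AE y in lborel. Q a t y"
   using lborel_pair.AE_commute[of "%t y. Q a t y"] Qm2 a2 by simp
  then have "AE x in lborel \<Otimes>\<^sub>M lborel. Q a (fst x) (snd x)"
   using lborel_pair.AE_pair_iff[of "%t y. Q a t y"] Qm2 by simp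
  then have "AE x in lborel. Q a (fst x) (snd x)" unfolding lborel_prod .
  then show ?thesis
   by eventually_elim (auto simp: Q_def v_def algebra_simps)
 qed
 have uv': "AE x in lborel. u x = v x" using u1(3) uv by eventually_elim simp
 have Bv: "borel_grad UNIV v D1" by (rule weak_grad_imp_borel_grad[OF W vm D1(1) uv' D1'])
 have AED: "AE x in lborel. \<forall>b\<in>Basis. D b x = D1 b x"
  unfolding AE_ball_countable[OF countable_finite[OF finite_Basis]] using D1' by blast
 have reg: "regular_field v D1"
  unfolding regular_field_def
 proof (intro conjI ballI allI impI)
  show "borel_grad UNIV v D1" by fact
  show "periodic_x' v"
   using u1(2) D1(2)[OF eB] by (simp add: periodic_x'_def v_def d_def)
  show "periodic_x' (D1 b)" if "b \<in> Basis" for b by (rule D1(2)[OF that])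
  have "(gradsq D1) = (gradsq D)"
   by (rule nn_integral_cong_AE, use AED in eventually_elim) (simp add: sq_grad_def)
  then show "(gradsq D1) < \<infinity>"
   using F by (simp add: nn_integral_completion)
  show "AE x in lborel. (\<Sum>b\<in>Basis. D1 b x \<bullet> b) = 0"
   using V[unfolded AE_completion_iff] AED by eventually_elim simp
  fix s t :: real assume st: "s \<le> t"
  have "AE y in lborel. \<forall>K. compact K \<longrightarrow> set_integrable lborel K (%r. (norm (d (r, y)))\<^sup>2)"
   by (rule AE_slice_L2(2)[OF dm]) (simp add: d_def borel_gradD(5)[OF B1 _ _ eB])
  then show "AE y in lborel. v (t, y) - v (s, y) = (LBINT r. indicator {s..t} r *R D1 ?e (r, y))"
  proof eventually_elim
   case (elim y)
   have [measurable]: "(%r. d (r, y)) \<in> bmeas" by measurable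
   have i: "set_integrable lborel {c..e} (%r. d (r, y))" for c e
    by (rule set_integrable_square_imp) (use elim in auto)
   have j: "integrable lborel (%r. signed_ind a t r *R d (r, y))" for t
    unfolding signed_ind_def scaleR_diff_left
    using i[of a t] i[of t a] unfolding set_integrable_def by (rule Bochner_Integration.integrable_diff)
   have "v (t, y) - v (s, y) = (LBINT r. signed_ind a t r *R d (r, y) - signed_ind a s r *R d (r, y))"
    using j by (simp add: v_def)
   \<comment> \<open>The weights agree except possibly at s, t and a, where closed intervals
     overlap.\<close>
   also have "... = (LBINT r. indicator {s..t} r *R d (r, y))"
   proof (rule integral_cong_AE)
    show "AE r in lborel. signed_ind a t r *R d (r, y) - signed_ind a s r *R d (r, y) = indicator {s..t} r *R d (r, y)"
     using AE_lborel_neq[of s] AE_lborel_neq[of t] AE_lborel_neq[of a]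
    proof eventually_elim
     case (elim r)
     have "signed_ind a t r - signed_ind a s r = indicator {s..t} r"
      using elim st by (auto simp: signed_ind_def indicator_def)
     then show ?case by (simp flip: scaleR_diff_left)
    qed
   qed (use j i[of s t] in \<open>auto simp: set_integrable_def\<close>)
   finally show ?case by (simp add: d_def)
  qed
 qed
 show thesis by (rule that[OF reg uv' D1'])
qed

lemma regular_field_sob_div:
 assumes "regular_field u D"
 shows "sob_div UNIV u D"
 unfolding sob_div_def
 using regular_fieldD[OF assms] borel_grad_imp_weak_grad[of UNIV u D]
 by (simp add: nn_integral_completion AE_completion)

section \<open>The energy as an integral over time\<close>

definition slice_energy :: "(('m::finite) pt => real) => ('m pt => 'm pt) => ('m pt => 'm pt => 'm pt) => real => ennreal" where
 "slice_energy W u D t = (NN y. indicator cell y * ennreal ((1/2) * sq_grad D (t, y) + W (u (t, y))))"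

lemma energy_cong_AE:
 assumes "AE x in lborel. u x = u' x" "!!b. b \<in> Basis ==> AE x in lborel. D b x = D' b x"
 shows "energy W I u D = energy W I u' D'"
proof -
 have AED: "AE x in lborel. \<forall>b\<in>Basis. D b x = D' b x"
  unfolding AE_ball_countable[OF countable_finite[OF finite_Basis]] using assms(2) by blast
 show ?thesis unfolding energy_def nn_integral_completion
  by (rule nn_integral_cong_AE, use AED assms(1) in eventually_elim) (simp add: sq_grad_def)
qed

lemma nn_integral_Times:
 fixes f :: "'a::euclidean_space \<times> 'b::euclidean_space => ennreal"
 assumes f: "f \<in> bmeas" and I: "I \<in> sets borel" and C: "C \<in> sets borel"
 shows "(NN x. indicator (I \<times> C) x * f x) = (NN t. indicator I t * (NN y. indicator C y * f (t, y)))"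
  and "(%t. (NN y. indicator C y * f (t, y))) \<in> bmeas"
proof -
 have f'[measurable]: "f \<in> borel_measurable (borel \<Otimes>\<^sub>M borel)" using f by (simp add: borel_prod)
 note [measurable] = I C
 show "(%t. (NN y. indicator C y * f (t, y))) \<in> bmeas" by measurable
 have m: "(%x. indicator (I \<times> C) x * f x) \<in> borel_measurable (lborel \<Otimes>\<^sub>M lborel)" by measurable
 have "(NN x. indicator (I \<times> C) x * f x) = (\<integral>\<^sup>+x. indicator (I \<times> C) x * f x \<partial>(lborel \<Otimes>\<^sub>M lborel))"
  by (simp add: lborel_prod)
 also have "... = (NN t. (NN y. indicator (I \<times> C) (t, y) * f (t, y)))"
  using lborel.nn_integral_fst[OF m] by simp
 also have "... = (NN t. (NN y. indicator I t * (indicator C y * f (t, y))))"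
  by (intro nn_integral_cong) (auto simp: indicator_def)
 also have "... = (NN t. indicator I t * (NN y. indicator C y * f (t, y)))"
 proof (rule nn_integral_cong)
  fix t
  have "(%y. indicator C y * f (t, y)) \<in> borel_measurable lborel" by measurable
  then show "(NN y. indicator I t * (indicator C y * f (t, y))) = indicator I t * (NN y. indicator C y * f (t, y))"
   by (rule nn_integral_cmult)
 qed
 finally show "(NN x. indicator (I \<times> C) x * f x) = (NN t. indicator I t * (NN y. indicator C y * f (t, y)))" .
qed

lemma energy_eq_slices:
 assumes R: "regular_field u D" and W: "continuous_on UNIV W" and I: "I \<in> sets borel"
 shows "energy W I u D = (NN t. indicator I t * slice_energy W u D t)"
  and "slice_energy W u D \<in> bmeas"
proof -
 have [measurable]: "W \<in> bmeas" using W by (rule borel_measurable_continuous_onI)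
 note [measurable] = regular_fieldD(7,9)[OF R]
 have m: "(%x. ennreal ((1/2) * sq_grad D x + W (u x))) \<in> bmeas" by measurable
 show "energy W I u D = (NN t. indicator I t * slice_energy W u D t)"
  unfolding energy_def nn_integral_completion slice_energy_def by (rule nn_integral_Times(1)[OF m I cell_borel])
 show "slice_energy W u D \<in> bmeas"
  unfolding slice_energy_def[abs_def] by (rule nn_integral_Times(2)[OF m I cell_borel])
qed

text \<open>Cauchy-Schwarz in time on the fundamental theorem, integrated over the cell: the slices
  are Hoelder continuous of exponent 1/2 as a map into L2 of the cell.\<close>

lemma regular_field_slice_diff:
 fixes u :: "('m::finite) pt => 'm pt"
 assumes R: "regular_field u D" and st: "s \<le> t"
 shows "(NN y. indicator cell y * nsq (u (t, y) - u (s, y)))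
  \<le> ennreal (t - s) * (NN x. indicator ({s..t} \<times> cell) x * ennreal (sq_grad D x))"
proof -
 let ?e = "(1, 0) :: 'm pt"
 have eB: "?e \<in> Basis" by (simp add: Basis_prod_def)
 note [measurable] = regular_fieldD(7,9)[OF R]
 have [measurable]: "D ?e \<in> bmeas" by (rule regular_fieldD(8)[OF R eB])
 have dm'[measurable]: "D ?e \<in> borel_measurable (borel \<Otimes>\<^sub>M borel)" "sq_grad D \<in> borel_measurable (borel \<Otimes>\<^sub>M borel)"
  unfolding borel_prod by measurable
 have "(NN y. indicator cell y * nsq (u (t, y) - u (s, y)))
  \<le> (NN y. (NN r. ennreal (t - s) * (indicator {s..t} r * (indicator cell y * ennreal (sq_grad D (r, y))))))"
 proof (rule nn_integral_mono_AE, use regular_fieldD(6)[OF R st] in eventually_elim)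
  fix y assume e: "u (t, y) - u (s, y) = (LBINT r. indicator {s..t} r *R D ?e (r, y))"
  have "nsq (u (t, y) - u (s, y)) \<le> emeasure lborel {s..t} * (NN r. indicator {s..t} r * nsq (D ?e (r, y)))"
   unfolding e by (rule norm_set_integral_power2_le) measurable
  also have "emeasure lborel {s..t} = ennreal (t - s)" using st by simp
  also have "(NN r. indicator {s..t} r * nsq (D ?e (r, y))) \<le> (NN r. indicator {s..t} r * ennreal (sq_grad D (r, y)))"
   by (intro nn_integral_mono mult_left_mono ennreal_leI) (auto simp: sq_grad_def intro!: member_le_sum[OF eB])
  also have "ennreal (t - s) * ... = (NN r. ennreal (t - s) * (indicator {s..t} r * ennreal (sq_grad D (r, y))))"
   by (rule nn_integral_cmult[symmetric]) measurable
  finally have "nsq (u (t, y) - u (s, y)) \<le> (NN r. ennreal (t - s) * (indicator {s..t} r * ennreal (sq_grad D (r, y))))"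
   by (simp add: mult_left_mono)
  then show "indicator cell y * nsq (u (t, y) - u (s, y)) \<le> (NN r. ennreal (t - s) * (indicator {s..t} r * (indicator cell y * ennreal (sq_grad D (r, y)))))"
   by (cases "y \<in> cell") auto
 qed
 also have "... = (NN r. (NN y. ennreal (t - s) * (indicator {s..t} r * (indicator cell y * ennreal (sq_grad D (r, y))))))"
  by (rule lborel_pair.Fubini'[symmetric]) measurable
 also have "... = (NN r. ennreal (t - s) * (indicator {s..t} r * (NN y. indicator cell y * ennreal (sq_grad D (r, y)))))"
  by (intro nn_integral_cong) (simp add: nn_integral_cmult)
 also have "... = ennreal (t - s) * (NN r. indicator {s..t} r * (NN y. indicator cell y * ennreal (sq_grad D (r, y))))"
  by (rule nn_integral_cmult) measurable
 also have "(NN r. indicator {s..t} r * (NN y. indicator cell y * ennreal (sq_grad D (r, y)))) = (NN x. indicator ({s..t} \<times> cell) x * ennreal (sq_grad D x))"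
  by (rule nn_integral_Times(1)[symmetric]) measurable
 finally show ?thesis .
qed

section \<open>Averages over slices\<close>

lemma norm_add_power2_le:
 fixes a b :: "'a::real_inner"
 shows "(norm (a + b))\<^sup>2 \<le> 2 * (norm a)\<^sup>2 + 2 * (norm b)\<^sup>2"
proof -
 have "(norm (a + b))\<^sup>2 + (norm (a - b))\<^sup>2 = 2 * (norm a)\<^sup>2 + 2 * (norm b)\<^sup>2"
  by (simp add: power2_norm_eq_inner inner_simps inner_commute)
 then show ?thesis using zero_le_power2[of "norm (a - b)"] by linarith
qed

lemma nn_integral_norm_add_power2_le:
 fixes f g :: "'a => 'b::euclidean_space"
 assumes [measurable]: "f \<in> borel_measurable M" "g \<in> borel_measurable M" "A \<in> sets M"
 shows "(\<integral>\<^sup>+x. indicator A x * nsq (f x + g x) \<partial>M) \<le>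
  2 * (\<integral>\<^sup>+x. indicator A x * nsq (f x) \<partial>M) + 2 * (\<integral>\<^sup>+x. indicator A x * nsq (g x) \<partial>M)"
proof -
 have "(\<integral>\<^sup>+x. indicator A x * nsq (f x + g x) \<partial>M) \<le>
  (\<integral>\<^sup>+x. 2 * (indicator A x * nsq (f x)) + 2 * (indicator A x * nsq (g x)) \<partial>M)"
 proof (rule nn_integral_mono)
  fix x
  have "nsq (f x + g x) \<le> ennreal (2 * (norm (f x))\<^sup>2 + 2 * (norm (g x))\<^sup>2)"
   by (rule ennreal_leI[OF norm_add_power2_le])
  also have "... = 2 * nsq (f x) + 2 * nsq (g x)"
   by (simp add: ennreal_plus ennreal_mult')
  finally show "indicator A x * nsq (f x + g x) \<le> 2 * (indicator A x * nsq (f x)) + 2 * (indicator A x * nsq (g x))"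
   by (cases "x \<in> A") auto
 qed
 also have "... = 2 * (\<integral>\<^sup>+x. indicator A x * nsq (f x) \<partial>M) + 2 * (\<integral>\<^sup>+x. indicator A x * nsq (g x) \<partial>M)"
  by (subst nn_integral_add) (simp_all add: nn_integral_cmult)
 finally show ?thesis .
qed

lemma borel_slice:
 fixes f :: "'a::euclidean_space \<times> 'b::euclidean_space => 'c::topological_space"
 assumes "f \<in> bmeas"
 shows "(%y. f (t, y)) \<in> bmeas"
 by (rule measurable_compose[OF borel_measurable_continuous_onI assms]) (intro continuous_intros)

lemma nn_integral_subset_mono:
 assumes "A \<subseteq> B"
 shows "(\<integral>\<^sup>+x. indicator A x * f x \<partial>M) \<le> (\<integral>\<^sup>+x. indicator B x * f x \<partial>M)"
 by (intro nn_integral_mono mult_right_mono) (use assms in \<open>auto simp: indicator_def\<close>)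

lemma set_integrable_finite_L2:
 fixes f :: "'a => 'b::euclidean_space"
 assumes [measurable]: "f \<in> borel_measurable M" "A \<in> sets M" and A: "emeasure M A < \<infinity>"
  and L2: "(\<integral>\<^sup>+x. indicator A x * nsq (f x) \<partial>M) < \<infinity>"
 shows "set_integrable M A f" "set_integrable M A (%x. (norm (f x))\<^sup>2)"
proof -
 have le: "t \<le> 1 + t\<^sup>2" if "0 \<le> t" for t :: real
 proof -
  have "0 \<le> (t - 1)\<^sup>2" by simp
  then have "2 * t \<le> t\<^sup>2 + 1" by (simp add: power2_diff)
  then show ?thesis using that by linarith
 qed
 have "(\<integral>\<^sup>+x. ennreal (norm (indicat_real A x *R f x)) \<partial>M) \<le> (\<integral>\<^sup>+x. indicator A x + indicator A x * nsq (f x) \<partial>M)"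
 proof (rule nn_integral_mono)
  fix x
  have "ennreal (norm (f x)) \<le> ennreal (1 + (norm (f x))\<^sup>2)" by (rule ennreal_leI[OF le]) simp
  also have "... = 1 + nsq (f x)" by (simp add: ennreal_plus)
  finally show "ennreal (norm (indicat_real A x *R f x)) \<le> indicator A x + indicator A x * nsq (f x)"
   by (cases "x \<in> A") auto
 qed
 also have "... = emeasure M A + (\<integral>\<^sup>+x. indicator A x * nsq (f x) \<partial>M)"
  by (subst nn_integral_add) auto
 also have "... < \<infinity>" using A L2 by simp
 finally show "set_integrable M A f" unfolding set_integrable_def by (intro integrableI_bounded) measurable
 have "(\<integral>\<^sup>+x. ennreal (norm (indicat_real A x *R (norm (f x))\<^sup>2)) \<partial>M) = (\<integral>\<^sup>+x. indicator A x * nsq (f x) \<partial>M)"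
  by (intro nn_integral_cong) (auto simp: indicator_def)
 then show "set_integrable M A (%x. (norm (f x))\<^sup>2)" unfolding set_integrable_def
  by (intro integrableI_bounded) (measurable, use L2 in simp)
qed

lemma set_integrable_L2D:
 assumes "set_integrable M A (%x. (norm (f x))\<^sup>2)"
 shows "(\<integral>\<^sup>+x. indicator A x * nsq (f x) \<partial>M) < \<infinity>"
proof -
 have "(\<integral>\<^sup>+x. indicator A x * nsq (f x) \<partial>M) = (\<integral>\<^sup>+x. ennreal (norm (indicat_real A x *R (norm (f x))\<^sup>2)) \<partial>M)"
  by (intro nn_integral_cong) (auto simp: indicator_def)
 also have "... < \<infinity>" using assms unfolding set_integrable_def integrable_iff_bounded by simp
 finally show ?thesis .
qed

text \<open>Almost every slice is square integrable, so some slice is. The Hoelder estimate between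
  slices transfers this to every time.\<close>

lemma regular_field_slice_L2:
 fixes u :: "('m::finite) pt => 'm pt"
 assumes R: "regular_field u D"
 shows "(NN y. indicator cell y * nsq (u (t, y))) < \<infinity>"
proof -
 note um = regular_fieldD(7)[OF R]
 note [measurable] = borel_slice[OF um]
 have "AE s in lborel. \<forall>K. compact K \<longrightarrow> set_integrable lborel K (%y. (norm (u (s, y)))\<^sup>2)"
  by (rule AE_slice_L2(1)[OF um borel_gradD(4)[OF regular_fieldD(1)[OF R]]]) auto
 from eventually_happens'[OF ae_lborel_neq_bot this]
 obtain s where "\<forall>K. compact K \<longrightarrow> set_integrable lborel K (%y. (norm (u (s, y)))\<^sup>2)" by (rule exE)
 then have "set_integrable lborel cell (%y. (norm (u (s, y)))\<^sup>2)" using compact_cell[where 'a='m] by blast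
 from set_integrable_L2D[OF this] have 1: "(NN y. indicator cell y * nsq (u (s, y))) < \<infinity>" .
 have 2: "(NN y. indicator cell y * nsq (u (b, y) - u (a, y))) < \<infinity>" if "a \<le> b" for a b
 proof -
  have "(NN x. indicator ({a..b} \<times> cell) x * ennreal (sq_grad D x)) \<le> (gradsq D)"
   by (rule nn_integral_subset_mono) auto
  then have "(NN x. indicator ({a..b} \<times> cell) x * ennreal (sq_grad D x)) < \<infinity>"
   using regular_fieldD(4)[OF R] by (rule le_less_trans)
  then have "ennreal (b - a) * (NN x. indicator ({a..b} \<times> cell) x * ennreal (sq_grad D x)) < \<infinity>"
   by (simp add: ennreal_mult_less_top)
  then show ?thesis by (rule le_less_trans[OF regular_field_slice_diff[OF R that]])
 qed
 have 3: "(NN y. indicator cell y * nsq (u (t, y) - u (s, y))) < \<infinity>"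
 proof (cases "s \<le> t")
  case True then show ?thesis by (rule 2)
 next
  case False
  then have "t \<le> s" by simp
  from 2[OF this] show ?thesis by (simp add: norm_minus_commute)
 qed
 have "(NN y. indicator cell y * nsq (u (t, y))) = (NN y. indicator cell y * nsq (u (s, y) + (u (t, y) - u (s, y))))"
  by simp
 also have "... \<le> 2 * (NN y. indicator cell y * nsq (u (s, y))) + 2 * (NN y. indicator cell y * nsq (u (t, y) - u (s, y)))"
  by (rule nn_integral_norm_add_power2_le) measurable
 also have "... < \<infinity>" using 1 3 by (simp add: ennreal_mult_less_top)
 finally show ?thesis .
qed

lemma regular_field_slice_integrable:
 assumes R: "regular_field u D"
 shows "set_integrable lborel cell (%y. u (t, y))" "set_integrable lborel cell (%y. (norm (u (t, y)))\<^sup>2)"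
 using set_integrable_finite_L2[OF _ _ _ regular_field_slice_L2[OF R], of t] borel_slice[OF regular_fieldD(7)[OF R]]
 by (simp_all add: emeasure_cell)

lemma xavg_lborel:
 assumes "u \<in> bmeas"
 shows "xavg u t = (LBINT y. indicator cell y *R u (t, y))"
proof -
 note [measurable] = borel_slice[OF assms, of t]
 show ?thesis unfolding xavg_def set_lebesgue_integral_def by (rule integral_completion) measurable
qed

lemma xavg_diff_le:
 assumes R: "regular_field u D" and st: "s \<le> t"
 shows "nsq (xavg u t - xavg u s) \<le> ennreal (t - s) * (NN x. indicator ({s..t} \<times> cell) x * ennreal (sq_grad D x))"
proof -
 note um = regular_fieldD(7)[OF R]
 note [measurable] = borel_slice[OF um]
 have "xavg u t - xavg u s = (LBINT y. indicator cell y *R (u (t, y) - u (s, y)))"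
  unfolding xavg_lborel[OF um] scaleR_diff_right
  using regular_field_slice_integrable(1)[OF R] unfolding set_integrable_def by (intro Bochner_Integration.integral_diff[symmetric])
 then have "nsq (xavg u t - xavg u s) \<le> emeasure lborel (cell :: (real ^ 'a) set) * (NN y. indicator cell y * nsq (u (t, y) - u (s, y)))"
  using norm_set_integral_power2_le[of "cell :: (real ^ 'a) set" lborel "%y. u (t, y) - u (s, y)"] by simp
 then show ?thesis using regular_field_slice_diff[OF R st] by (simp add: emeasure_cell)
qed

section \<open>Poincare inequality on the cell\<close>

text \<open>Since the cell has measure 1, v y minus the mean is the average of v y - v z over the
  cell, and Jensen bounds its square by the average of squared differences, to which the estimate
  for pairs applies. The constant is chosen before v, hence is uniform over all fields and
  slices.\<close>

lemma poincare_cell: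
 "\<exists>C\<ge>0. \<forall>(v :: real ^ 'm::finite => 'c::euclidean_space) Dv. borel_grad UNIV v Dv \<longrightarrow>
  (NN y. indicator cell y * nsq (v y - (LBINT z. indicator cell z *R v z)))
  \<le> ennreal C * (NN y. indicator cell y * ennreal (sq_grad Dv y))"
proof -
 obtain r where r: "0 < r" "cell \<subseteq> (ball 0 r :: (real ^ 'm) set)"
  using bounded_subset_ballD[OF compact_imp_bounded[OF compact_cell], of 0] by metis
 \<comment> \<open>Radius 2 r makes S contain every difference of two points of the cell.\<close>
 define S where "S = (cball 0 (2 * r) :: (real ^ 'm) set)"
 have S[measurable]: "S \<in> sets borel" by (simp add: S_def)
 have Sf: "emeasure lborel S < \<infinity>" unfolding S_def by (rule emeasure_bounded_finite[OF bounded_cball])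
 define C where "C = measure lborel S * (2 * r)\<^sup>2"
 have Ce: "emeasure lborel S * ennreal ((2 * r)\<^sup>2) = ennreal C"
  using Sf by (simp add: C_def ennreal_mult emeasure_eq_ennreal_measure less_top)
 show ?thesis
 proof (intro exI[of _ C] conjI allI impI)
  show "0 \<le> C" by (simp add: C_def)
  fix v :: "real ^ 'm => 'c" and Dv assume B: "borel_grad UNIV v Dv"
  have [measurable]: "v \<in> bmeas" by (rule borel_gradD(2)[OF B])
  have vi: "integrable lborel (%z. indicator cell z *R v z)"
   using borel_grad_L1(1)[OF B compact_cell] by (simp add: set_integrable_def)
  let ?m = "(LBINT z. indicator cell z *R v z)"
  have "(NN y. indicator cell y * nsq (v y - ?m))
   \<le> (NN y. (NN z. indicator cell y * indicator cell z * indicator S (z - y) * nsq (v z - v y)))"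
  proof (rule nn_integral_mono)
   fix y :: "real ^ 'm"
   show "indicator cell y * nsq (v y - ?m) \<le> (NN z. indicator cell y * indicator cell z * indicator S (z - y) * nsq (v z - v y))"
   proof (cases "y \<in> cell")
    case True
    have "?m - v y = (LBINT z. indicator cell z *R (v z - v y))"
    proof -
     have "integrable lborel (%z. indicator (cell :: (real ^ 'm) set) z *R v y)"
      by (intro integrable_scaleR_left integrable_real_indicator) (auto simp: emeasure_cell)
     moreover have "(LBINT z. indicator (cell :: (real ^ 'm) set) z *R v y) = v y" by (simp add: measure_cell emeasure_cell)
     ultimately show ?thesis unfolding scaleR_diff_right using vi by simp
    qed
    then have e: "norm (v y - ?m) = norm (LBINT z. indicator cell z *R (v z - v y))"
     by (subst norm_minus_commute) simp
    have "nsq (v y - ?m) = nsq (LBINT z. indicator cell z *R (v z - v y))"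
     unfolding e ..
    also have "... \<le> emeasure lborel (cell :: (real ^ 'm) set) * (NN z. indicator cell z * nsq (v z - v y))"
     by (rule norm_set_integral_power2_le) measurable
    also have "... = (NN z. indicator cell z * nsq (v z - v y))" by (simp add: emeasure_cell)
    also have "... = (NN z. indicator cell y * indicator cell z * indicator S (z - y) * nsq (v z - v y))"
    proof (rule nn_integral_cong)
     fix z :: "real ^ 'm"
     have "z - y \<in> S" if "z \<in> cell"
     proof -
      have "norm z < r" "norm y < r" using subsetD[OF r(2) that] subsetD[OF r(2) True] by auto
      then show ?thesis using norm_triangle_ineq4[of z y] by (simp add: S_def)
     qed
     then show "indicator cell z * nsq (v z - v y) = indicator cell y * indicator cell z * indicator S (z - y) * nsq (v z - v y)"
      using True by (cases "z \<in> cell") auto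
    qed
    finally show ?thesis using True by simp
   qed simp
  qed
  also have "... \<le> emeasure lborel S * (ennreal ((2 * r)\<^sup>2) * (NN x. indicator cell x * ennreal (sq_grad Dv x)))"
   by (rule translation_estimate_pairs[OF B convex_cell cell_borel S]) (simp add: S_def)
  also have "... = ennreal C * (NN x. indicator cell x * ennreal (sq_grad Dv x))"
   by (simp add: Ce[symmetric] mult.assoc)
  finally show "(NN y. indicator cell y * nsq (v y - ?m)) \<le> ennreal C * (NN y. indicator cell y * ennreal (sq_grad Dv y))" .
 qed
qed

section \<open>Conservation of the mean of the first component\<close>

lemma AE_component_neq: "AE x in lborel. (x :: real ^ 'm::finite) $ i \<noteq> c"
proof -
 have b: "(axis i 1 :: real ^ 'm) \<in> Basis" by (auto simp: Basis_vec_def)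
 have "negligible {x :: real ^ 'm. x \<bullet> axis i 1 = c}" by (rule negligible_standard_hyperplane[OF b])
 then have "{x :: real ^ 'm. x \<bullet> axis i 1 = c} \<in> null_sets lebesgue" by (simp add: negligible_iff_null_sets)
 then have "AE x in lebesgue. (x :: real ^ 'm) \<notin> {x. x \<bullet> axis i 1 = c}" by (rule AE_not_in)
 then have "AE x in lborel. (x :: real ^ 'm) \<notin> {x. x \<bullet> axis i 1 = c}" by (simp only: AE_completion_iff)
 then show ?thesis by eventually_elim (simp add: inner_axis)
qed

text \<open>Shifting the cell by s along e_i removes the layer B where the i-th coordinate is at
  most s and adds its translate by a full period on the opposite face; periodicity equates the two
  integrals. The pieces overlap in hyperplanes, which are null.\<close>

lemma integral_cell_shift:
 fixes v :: "real ^ 'm::finite => 'c::euclidean_space"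
 assumes [measurable]: "v \<in> bmeas" and vi: "!!K. compact K ==> set_integrable lborel K v"
  and per: "!!x. v (x + axis i 1) = v x" and s: "s \<in> {0..1}"
 shows "(LBINT x. indicator cell (x - s *R axis i 1) *R v x) = (LBINT x. indicator cell x *R v x)"
proof -
 let ?b = "axis i 1 :: real ^ 'm"
 define A where "A = {x \<in> cell. s \<le> (x :: real ^ 'm) $ i}"
 define B where "B = {x \<in> cell. (x :: real ^ 'm) $ i \<le> s}"
 have cl: "compact A" "compact B"
 proof -
  have "A = cell \<inter> {x. s \<le> x $ i}" "B = cell \<inter> {x. x $ i \<le> s}" by (auto simp: A_def B_def)
  moreover have "closed {x :: real ^ 'm. s \<le> x $ i}" "closed {x :: real ^ 'm. x $ i \<le> s}"
   by (intro closed_Collect_le continuous_intros)+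
  ultimately show "compact A" "compact B" using compact_cell by (metis compact_Int_closed)+
 qed
 have [measurable]: "A \<in> sets borel" "B \<in> sets borel" using cl by (auto intro: borel_compact)
 have iA: "integrable lborel (%x. indicator A x *R v x)" and iB: "integrable lborel (%x. indicator B x *R v x)"
  using vi[OF cl(1)] vi[OF cl(2)] by (auto simp: set_integrable_def)
 have shB: "indicator B (x - ?b + ?b) = indicator B x" for x by simp
 have iB': "integrable lborel (%x. indicator B (x - ?b) *R v x)"
 proof -
  have "v (x - ?b) = v x" for x using per[of "x - ?b"] by simp
  then show ?thesis using integrable_shift[OF iB, of "- ?b"] by simp
 qed
 have eB: "(LBINT x. indicator B (x - ?b) *R v x) = (LBINT x. indicator B x *R v x)"
  using integral_shift[of "%x. indicator B (x - ?b) *R v x" ?b] by (simp add: per)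
 have "(LBINT x. indicator cell (x - s *R ?b) *R v x) = (LBINT x. indicator A x *R v x + indicator B (x - ?b) *R v x)"
 proof (rule integral_cong_AE)
  show "AE x in lborel. indicator cell (x - s *R ?b) *R v x = indicator A x *R v x + indicator B (x - ?b) *R v x"
   using AE_component_neq[of i 1]
  proof eventually_elim
   case (elim x)
   have c: "(x - r *R ?b) $ j = (if j = i then x $ i - r else x $ j)" for r j by (simp add: axis_def)
   have mem: "x - r *R ?b \<in> cell \<longleftrightarrow> (0 \<le> x $ i - r \<and> x $ i - r \<le> 1) \<and> (\<forall>j. j \<noteq> i \<longrightarrow> 0 \<le> x $ j \<and> x $ j \<le> 1)" for r
    unfolding mem_cell c by (auto split: if_splits)
   have "indicat_real cell (x - s *R ?b) = indicator A x + indicator B (x - ?b)"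
    using elim s mem[of s] mem[of 0] mem[of 1] by (auto simp: A_def B_def indicator_def axis_def)
   then show ?case by (simp add: scaleR_left_distrib)
  qed
 qed measurable
 also have "... = (LBINT x. indicator A x *R v x) + (LBINT x. indicator B x *R v x)"
  using iA iB' eB by simp
 also have "... = (LBINT x. indicator A x *R v x + indicator B x *R v x)"
  using iA iB by simp
 also have "... = (LBINT x. indicator cell x *R v x)"
 proof (rule integral_cong_AE)
  show "AE x in lborel. indicator A x *R v x + indicator B x *R v x = indicator cell x *R v x"
   using AE_component_neq[of i s]
   by eventually_elim (auto simp: A_def B_def indicator_def)
 qed measurable
 finally show ?thesis .
qed

text \<open>The identity along a full period has left side 0. Integrated over the cell and with the
  shift moved to the indicator, its right side is an average over s of integrals that, by
  \<open>integral_cell_shift\<close>, all equal the integral in question.\<close>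

lemma integral_cell_periodic_grad:
 fixes v :: "real ^ 'm::finite => 'c::euclidean_space"
 assumes B: "borel_grad UNIV v Dv" and per: "!!x i. v (x + axis i 1) = v x" and perD: "!!x i. Dv (axis i 1) (x + axis i 1) = Dv (axis i 1) x"
 shows "(LBINT x. indicator cell x *R Dv (axis i 1) x) = 0"
proof -
 let ?b = "axis i 1 :: real ^ 'm"
 have b: "?b \<in> Basis" by (auto simp: Basis_vec_def)
 have Dm[measurable]: "Dv ?b \<in> bmeas" by (rule borel_gradD(3)[OF B b])
 have vi: "set_integrable lborel K (Dv ?b)" if "compact K" for K by (rule borel_grad_L1(2)[OF B that _ b]) simp
 obtain R where R: "(cell :: (real ^ 'm) set) \<subseteq> ball 0 R"
  using bounded_subset_ballD[OF compact_imp_bounded[OF compact_cell], of 0] by metis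
 have z: "indicat_real cell x = 0" if "x \<notin> cball 0 R" for x :: "real ^ 'm" using that R by (auto simp: indicator_def)
 have M: "\<bar>indicat_real (cell :: (real ^ 'm) set) x\<bar> \<le> 1" for x by (simp add: indicator_def)
 have m: "indicat_real (cell :: (real ^ 'm) set) \<in> bmeas" by measurable
 have one: "?b = 1 *R ?b" by simp
 have "(LBINT x. indicat_real cell x *R (LBINT s. indicator {0..1} s *R Dv ?b (x + s *R ?b))) = (\<integral>x. 0 \<partial>(lborel :: (real ^ 'm) measure))"
 proof (rule integral_cong_AE)
  show "AE x in lborel. indicat_real cell x *R (LBINT s. indicator {0..1} s *R Dv ?b (x + s *R ?b)) = 0"
   using borel_grad_line_identity[OF B, of "1 *R ?b"]
  proof eventually_elim
   case (elim x)
   have "(LBINT s. indicator {0..1} s *R Dv ?b (x + s *R ?b)) = 0"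
    using elim unfolding sum_Basis_inner_scaleR[OF b] by (simp add: per)
   then show ?case by simp
  qed
 qed measurable
 moreover have "(LBINT x. indicat_real cell x *R (LBINT s. indicator {0..1} s *R Dv ?b (x + s *R ?b)))
   = (LBINT s. indicator {0..1} s *R (LBINT x. indicator cell (x - s *R ?b) *R Dv ?b x))"
  by (rule integral_line_average[OF m z M Dm vi[OF compact_cball]])
 moreover have "... = (LBINT s. indicator {0..1::real} s *R (LBINT x. indicator cell x *R Dv ?b x))"
 proof (rule Bochner_Integration.integral_cong[OF refl])
  fix s :: real
  show "indicator {0..1} s *R (LBINT x. indicator cell (x - s *R ?b) *R Dv ?b x) = indicator {0..1} s *R (LBINT x. indicator cell x *R Dv ?b x)"
   using integral_cell_shift[OF Dm vi perD, of s] by (cases "s \<in> {0..1}") auto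
 qed
 ultimately show ?thesis by simp
qed

lemma pair_one_inner: "(x :: ('m::finite) pt) \<bullet> (1, 0) = fst x"
 by (cases x) simp

lemma sum_Basis_pt:
 fixes f :: "('m::finite) pt => 'b::comm_monoid_add"
 shows "(\<Sum>b\<in>Basis. f b) = f (1, 0) + (\<Sum>c\<in>Basis. f (0, c))"
proof -
 have "(\<Sum>b\<in>Basis. f b) = (\<Sum>b\<in>(%u. (u, 0)) ` Basis. f b) + (\<Sum>b\<in>(%v. (0, v)) ` Basis. f b)"
  unfolding Basis_prod_def by (rule sum.union_disjoint) auto
 also have "(\<Sum>b\<in>(%v. (0, v)) ` Basis. f b) = (\<Sum>c\<in>Basis. f (0, c))"
  by (subst sum.reindex) (auto intro: inj_onI)
 finally show ?thesis by simp
qed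

text \<open>The use of the divergence constraint. The change of the average between two times is the
  integral of the x_1-derivative over cell and time. Its first component equals minus the sum of
  tangential derivatives, each of which integrates to 0 over the cell on almost every slice by
  periodicity.\<close>

lemma xavg_fst_mono_const:
 fixes u :: "('m::finite) pt => 'm pt"
 assumes R: "regular_field u D" and st: "s \<le> t"
 shows "fst (xavg u t) = fst (xavg u s)"
proof -
 let ?e = "(1, 0) :: 'm pt"
 have eB: "?e \<in> Basis" by (simp add: Basis_prod_def)
 note B = regular_fieldD(1)[OF R]
 note um = regular_fieldD(7)[OF R]
 note [measurable] = borel_slice[OF um]
 have dm[measurable]: "D ?e \<in> bmeas" by (rule regular_fieldD(8)[OF R eB])
 have dm'[measurable]: "D ?e \<in> borel_measurable (borel \<Otimes>\<^sub>M borel)" unfolding borel_prod by (rule dm)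
 have int: "integrable (lborel \<Otimes>\<^sub>M lborel) (%(r, y). indicat_real {s..t} r *R (indicat_real cell y *R D ?e (r, y)))"
 proof -
  have "compact ({s..t} \<times> (cell :: (real ^ 'm) set))" by (intro compact_Times compact_cell) simp
  from borel_grad_L1(2)[OF B this _ eB]
  have "integrable (lborel \<Otimes>\<^sub>M lborel) (%x. indicat_real ({s..t} \<times> cell) x *R D ?e x)"
   by (simp add: set_integrable_def lborel_prod)
  also have "(%x. indicat_real ({s..t} \<times> cell) x *R D ?e x) = (%(r, y). indicat_real {s..t} r *R (indicat_real cell y *R D ?e (r, y)))"
   by (auto simp: fun_eq_iff indicator_def)
  finally show ?thesis .
 qed
 have "xavg u t - xavg u s = (LBINT y. indicator cell y *R (u (t, y) - u (s, y)))"
  unfolding xavg_lborel[OF um] scaleR_diff_right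
  using regular_field_slice_integrable(1)[OF R] unfolding set_integrable_def by (intro Bochner_Integration.integral_diff[symmetric])
 also have "... = (LBINT y. indicat_real cell y *R (LBINT r. indicator {s..t} r *R D ?e (r, y)))"
 proof (rule integral_cong_AE)
  show "AE y in lborel. indicat_real cell y *R (u (t, y) - u (s, y)) = indicat_real cell y *R (LBINT r. indicator {s..t} r *R D ?e (r, y))"
   using regular_fieldD(6)[OF R st] by eventually_elim simp
 qed measurable
 also have "... = (LBINT y. (LBINT r. indicat_real {s..t} r *R (indicat_real cell y *R D ?e (r, y))))"
  by (subst integral_scaleR_right[symmetric]) (simp add: mult.commute)
 also have "... = (LBINT r. (LBINT y. indicat_real {s..t} r *R (indicat_real cell y *R D ?e (r, y))))"
  by (rule lborel_pair.Fubini_integral[OF int])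
 finally have e: "xavg u t - xavg u s = (LBINT r. (LBINT y. indicat_real {s..t} r *R (indicat_real cell y *R D ?e (r, y))))" .
 have i2: "integrable lborel (%r. (LBINT y. indicat_real {s..t} r *R (indicat_real cell y *R D ?e (r, y))))"
  using lborel_pair.integrable_fst[OF int] .
 have "(xavg u t - xavg u s) \<bullet> ?e = (LBINT r. (LBINT y. indicat_real {s..t} r *R (indicat_real cell y *R D ?e (r, y))) \<bullet> ?e)"
  unfolding e using i2 by simp
 also have "... = (\<integral>r. 0 \<partial>(lborel :: real measure))"
 proof (rule integral_cong_AE)
  have Dsl: "AE r in lborel. \<forall>K. compact K \<longrightarrow> set_integrable lborel K (%y. (norm (D ?e (r, y)))\<^sup>2)"
   by (rule AE_slice_L2(1)[OF dm borel_gradD(5)[OF B _ _ eB]]) auto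
  show "AE r in lborel. (LBINT y. indicat_real {s..t} r *R (indicat_real cell y *R D ?e (r, y))) \<bullet> ?e = 0"
   using borel_grad_slice[OF B] AE_pair_lborel[OF regular_fieldD(5)[OF R]] Dsl
  proof eventually_elim
   case (elim r)
   have [measurable]: "(%y. D ?e (r, y)) \<in> bmeas" by (rule borel_slice[OF dm])
   have L2: "set_integrable lborel cell (%y. (norm (D ?e (r, y)))\<^sup>2)" using elim(3) compact_cell[where 'a='m] by blast
   have i1: "integrable lborel (%y. indicat_real cell y *R D ?e (r, y))"
    using set_integrable_square_imp[OF compact_cell _ L2] by (simp add: set_integrable_def)
   have inB: "(0, c) \<in> (Basis :: 'm pt set)" if "c \<in> Basis" for c using that by (simp add: Basis_prod_def)
   have z: "(LBINT y. indicator cell y *R D (0, c) (r, y)) = 0" if c: "c \<in> Basis" for c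
   proof -
    obtain i where ci: "c = axis i 1" using c by (auto simp: Basis_vec_def)
    have "axis j 1 \<in> (Basis :: (real ^ 'm) set)" for j by (auto simp: Basis_vec_def)
    note pd = regular_fieldD(3)[OF R inB[OF this]]
    show ?thesis unfolding ci
     by (rule integral_cell_periodic_grad[OF elim(1)])
      (use regular_fieldD(2)[OF R] pd in \<open>simp_all add: periodic_x'_def\<close>)
   qed
   have ic: "integrable lborel (%y. indicator cell y *R D (0, c) (r, y))" if c: "c \<in> Basis" for c
    using borel_grad_L1(2)[OF elim(1) compact_cell _ c] by (simp add: set_integrable_def)
   have "(LBINT y. indicat_real cell y *R D ?e (r, y)) \<bullet> ?e = (LBINT y. (indicat_real cell y *R D ?e (r, y)) \<bullet> ?e)"
    by (rule integral_inner_left[symmetric]) (rule i1)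
   also have "... = (LBINT y. - (\<Sum>c\<in>Basis. (indicat_real cell y *R D (0, c) (r, y)) \<bullet> (0, c)))"
   proof (rule integral_cong_AE)
    show "AE y in lborel. (indicat_real cell y *R D ?e (r, y)) \<bullet> ?e = - (\<Sum>c\<in>Basis. (indicat_real cell y *R D (0, c) (r, y)) \<bullet> (0, c))"
     using elim(2)
    proof eventually_elim
     case (elim y)
     have "D ?e (r, y) \<bullet> ?e + (\<Sum>c\<in>Basis. D (0, c) (r, y) \<bullet> (0, c)) = 0"
      by (rule trans[OF sum_Basis_pt[of "%b. D b (r, y) \<bullet> b", symmetric] elim])
     then have "D ?e (r, y) \<bullet> ?e = - (\<Sum>c\<in>Basis. D (0, c) (r, y) \<bullet> (0, c))" by simp
     then show ?case by (simp only: inner_scaleR_left sum_distrib_left[symmetric])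
    qed
    show "(%y. (indicat_real cell y *R D ?e (r, y)) \<bullet> ?e) \<in> borel_measurable lborel" by measurable
    show "(%y. - (\<Sum>c\<in>Basis. (indicat_real cell y *R D (0, c) (r, y)) \<bullet> (0, c))) \<in> borel_measurable lborel"
     using ic by (intro borel_measurable_uminus borel_measurable_sum borel_measurable_inner) auto
   qed
   also have "... = - (\<Sum>c\<in>Basis. (LBINT y. (indicat_real cell y *R D (0, c) (r, y)) \<bullet> (0, c)))"
    using ic by (subst integral_minus, subst Bochner_Integration.integral_sum) (auto simp del: inner_scaleR_left)
   also have "... = - (\<Sum>c\<in>Basis. (LBINT y. indicat_real cell y *R D (0, c) (r, y)) \<bullet> (0, c))"
    using ic by (simp del: inner_scaleR_left)
   also have "... = 0" using z by simp
   finally show ?case by (simp only: integral_scaleR_right inner_scaleR_left)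
  qed
 qed (use i2 in simp_all)
 finally show ?thesis by (simp add: pair_one_inner del: inner_Pair)
qed

lemma xavg_fst_const:
 assumes "regular_field u D"
 shows "fst (xavg u t) = fst (xavg u s)"
 using xavg_fst_mono_const[OF assms] by (cases "s \<le> t") (simp, metis linear)

section \<open>Traces, and pieces of a field as competitors\<close>

text \<open>By the Hoelder estimate each slice within time h of t differs from the slice at t by at
  most h times the gradient integral in squared L2 norm. The mean over the layer obeys the same
  bound. The interval family J treats both sides at once.\<close>

lemma regular_field_traces:
 fixes u :: "('m::finite) pt => 'm pt"
 assumes R: "regular_field u D"
 shows "trace_left t u (%y. u (t, y))" "trace_right t u (%y. u (t, y))"
proof -
 note um[measurable] = regular_fieldD(7)[OF R]
 let ?Q = "(gradsq D)"
 obtain q where q: "0 \<le> q" "?Q = ennreal q" using regular_fieldD(4)[OF R] by (cases ?Q) auto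
 have bd: "(NN y. indicator cell y * nsq (u (s, y) - u (t, y))) \<le> ennreal (h * q)" if h: "\<bar>s - t\<bar> \<le> h" for s h
 proof -
  have *: "(NN y. indicator cell y * nsq (u (d, y) - u (c, y))) \<le> ennreal (h * q)" if cd: "c \<le> d" "d - c \<le> h" for c d
  proof -
   have "(NN y. indicator cell y * nsq (u (d, y) - u (c, y))) \<le> ennreal (d - c) * (NN x. indicator ({c..d} \<times> cell) x * ennreal (sq_grad D x))"
    by (rule regular_field_slice_diff[OF R cd(1)])
   also have "... \<le> ennreal h * ?Q"
    using cd(2) by (intro mult_mono ennreal_leI nn_integral_subset_mono) auto
   also have "... = ennreal (h * q)" using q cd by (simp add: ennreal_mult)
   finally show ?thesis .
  qed
  show ?thesis
  proof (cases "t \<le> s")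
   case True then show ?thesis using *[of t s] h by simp
  next
   case False then show ?thesis using *[of s t] h by (simp add: norm_minus_commute)
  qed
 qed
 have m: "(%x. nsq (u x - u (t, snd x))) \<in> bmeas"
 proof -
  have [measurable]: "(%x. u (t, snd x)) \<in> bmeas"
   by (rule measurable_compose[OF borel_measurable_continuous_onI um]) (intro continuous_intros)
  show ?thesis by measurable
 qed
 have main: "((%h. ennreal (1 / h) * (\<integral>\<^sup>+x. indicator (J h \<times> cell) x * nsq (u x - u (t, snd x)) \<partial>lebesgue)) \<longlongrightarrow> 0) (at_right 0)"
  if J: "!!h. 0 < h ==> J h \<in> sets borel" "!!h. 0 < h ==> emeasure lborel (J h) = ennreal h" "!!h s. 0 < h ==> s \<in> J h ==> \<bar>s - t\<bar> \<le> h" for J :: "real => real set"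
 proof (rule tendsto_sandwich[of "%_. 0" _ _ "%h. ennreal (h * q)"])
  show "\<forall>\<^sub>F h in at_right 0. ennreal (1 / h) * (\<integral>\<^sup>+x. indicator (J h \<times> cell) x * nsq (u x - u (t, snd x)) \<partial>lebesgue) \<le> ennreal (h * q)"
   using eventually_at_right_less[of "0::real"]
  proof eventually_elim
   case (elim h)
   have "(\<integral>\<^sup>+x. indicator (J h \<times> cell) x * nsq (u x - u (t, snd x)) \<partial>lebesgue) = 
    (NN s. indicator (J h) s * (NN y. indicator cell y * nsq (u (s, y) - u (t, y))))"
    unfolding nn_integral_completion using nn_integral_Times(1)[OF m J(1)[OF elim] cell_borel] by simp
   also have "... \<le> (NN s. ennreal (h * q) * indicator (J h) s)"
   proof (rule nn_integral_mono)
    fix s show "indicator (J h) s * (NN y. indicator cell y * nsq (u (s, y) - u (t, y))) \<le> ennreal (h * q) * indicator (J h) s"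
     using bd[OF J(3)[OF elim, of s]] by (cases "s \<in> J h") auto
   qed
   also have "... = ennreal (h * q) * ennreal h" using J(1,2)[OF elim] by (simp add: nn_integral_cmult_indicator)
   finally have "ennreal (1 / h) * (\<integral>\<^sup>+x. indicator (J h \<times> cell) x * nsq (u x - u (t, snd x)) \<partial>lebesgue) \<le> ennreal (1 / h) * (ennreal (h * q) * ennreal h)"
    by (rule mult_left_mono) simp
   also have "... = ennreal (h * q)" using elim q by (simp add: ennreal_mult[symmetric])
   finally show ?case .
  qed
  have "((%h. h * q) \<longlongrightarrow> 0 * q) (at_right 0)" by (intro tendsto_intros)
  then show "((%h. ennreal (h * q)) \<longlongrightarrow> 0) (at_right 0)" using tendsto_ennrealI[of "%h. h * q" 0] by simp
 qed simp_all
 show "trace_left t u (%y. u (t, y))" unfolding trace_left_def by (rule main) auto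
 show "trace_right t u (%y. u (t, y))" unfolding trace_right_def by (rule main) auto
qed

lemma weak_grad_subset:
 assumes W: "weak_grad U u D" and V: "V \<subseteq> U" "open V"
 shows "weak_grad V u D"
proof -
 have t: "test_fun \<phi> \<phi>' V ==> test_fun \<phi> \<phi>' U" for \<phi> \<phi>' by (erule test_fun_mono[OF _ V(1)])
 have c: "K \<subseteq> V ==> K \<subseteq> U" for K using V(1) by (rule order_trans[rotated])
 show ?thesis using W V(2) t c unfolding weak_grad_def by simp
qed

text \<open>The piece of a regular field between two times competes for the distance between its own
  end slices, which are its traces.\<close>

lemma dW_le_energy:
 fixes u :: "('m::finite) pt => 'm pt"
 assumes R: "regular_field u D" and st: "s < t"
 shows "dW W (%y. u (s, y)) (%y. u (t, y)) \<le> energy W {s..t} u D"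
proof -
 have "sob_div {s..t} u D"
  unfolding sob_div_def
 proof (intro conjI)
  show "periodic_x' u" by (rule regular_fieldD(2)[OF R])
  show "weak_grad (interior {s..t} \<times> UNIV) u D"
   by (rule weak_grad_subset[OF borel_grad_imp_weak_grad[OF regular_fieldD(1)[OF R]]]) (auto intro: open_Times)
  have "(NN x. indicator ({s..t} \<times> cell) x * ennreal (sq_grad D x)) \<le> (gradsq D)"
   by (rule nn_integral_subset_mono) auto
  then show "(\<integral>\<^sup>+x. indicator ({s..t} \<times> cell) x * ennreal (sq_grad D x) \<partial>lebesgue) < \<infinity>"
   unfolding nn_integral_completion using regular_fieldD(4)[OF R] by (rule le_less_trans)
  show "AE x in lebesgue. x \<in> interior {s..t} \<times> UNIV \<longrightarrow> (\<Sum>b\<in>Basis. D b x \<bullet> b) = 0"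
   using AE_completion[OF regular_fieldD(5)[OF R]] by eventually_elim simp
 qed
 then have "(s, t, u, D) \<in> {(tm, tp, u', D'). tm < tp \<and> sob_div {tm..tp} u' D' \<and> trace_left tm u' (%y. u (s, y)) \<and> trace_right tp u' (%y. u (t, y))}"
  using st regular_field_traces[OF R] by simp
 from INF_lower[OF this, of "%p. energy W {fst p..fst (snd p)} (fst (snd (snd p))) (snd (snd (snd p)))"]
 show ?thesis unfolding dW_def by simp
qed

lemma h1a_slice:
 fixes u :: "('m::finite) pt => 'm pt"
 assumes R: "regular_field u D" and a: "fst (xavg u t) = a"
  and B: "borel_grad UNIV (%y. u (t, y)) (%b y. D (0, b) (t, y))"
 shows "h1a a (%y. u (t, y)) (%b y. D (0, b) (t, y))"
proof -
 note um = regular_fieldD(7)[OF R]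
 note [measurable] = borel_slice[OF um]
 have "(\<integral>x'\<in>cell. fst (u (t, x')) \<partial>lebesgue) = (LBINT y. indicator cell y *R fst (u (t, y)))"
  unfolding set_lebesgue_integral_def by (rule integral_completion) (simp add: pair_one_inner[symmetric] del: inner_Pair)
 also have "... = (LBINT y. (indicator cell y *R u (t, y)) \<bullet> (1, 0))"
  by (simp only: pair_one_inner fst_scaleR)
 also have "... = (LBINT y. indicator cell y *R u (t, y)) \<bullet> (1, 0)"
  using regular_field_slice_integrable(1)[OF R, of t] unfolding set_integrable_def by (intro integral_inner_left) simp
 also have "... = a" using a by (simp only: xavg_lborel[OF um] pair_one_inner)
 finally show ?thesis unfolding h1a_def h1_torus_def
  using regular_fieldD(2)[OF R] borel_grad_imp_weak_grad[OF B] by (simp add: periodic_x'_def)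
qed

lemma sq_grad_slice_le:
 fixes D :: "('m::finite) pt => 'm pt => 'm pt"
 shows "sq_grad (%b y. D (0, b) (t, y)) y \<le> sq_grad D (t, y)"
 unfolding sq_grad_def sum_Basis_pt[of "%b. (norm (D b (t, y)))\<^sup>2"] by simp

text \<open>Summable integrals make the sum of the series integrable, hence finite almost
  everywhere, and the terms of a convergent series tend to 0. Summability gives almost everywhere
  convergence without passing to a subsequence.\<close>

lemma sum_finite_nn_integral_AE_tendsto_0:
 fixes f :: "nat => 'a => real"
 assumes m: "!!n. (%x. ennreal (f n x)) \<in> borel_measurable M" and nn: "!!n x. 0 \<le> f n x" and le: "!!n. (\<integral>\<^sup>+x. ennreal (f n x) \<partial>M) \<le> ennreal (c n)"
  and c: "summable c" "!!n. 0 \<le> c n"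
 shows "AE x in M. (%n. f n x) ~> 0"
proof -
 have "(\<integral>\<^sup>+x. (\<Sum>n. ennreal (f n x)) \<partial>M) = (\<Sum>n. \<integral>\<^sup>+x. ennreal (f n x) \<partial>M)"
  by (rule nn_integral_suminf) (rule m)
 also have "... \<le> (\<Sum>n. ennreal (c n))" by (intro suminf_le le) auto
 also have "... = ennreal (suminf c)" by (rule suminf_ennreal2[OF c(2,1)])
 finally have "(\<integral>\<^sup>+x. (\<Sum>n. ennreal (f n x)) \<partial>M) \<noteq> \<infinity>" by (auto simp: top_unique)
 then have "AE x in M. (\<Sum>n. ennreal (f n x)) \<noteq> \<infinity>"
  by (intro nn_integral_noteq_infinite borel_measurable_suminf_order m)
 then show ?thesis
 proof eventually_elim
  case (elim x)
  have "summable (%n. f n x)" by (rule summable_suminf_not_top[OF nn]) (use elim in simp)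
  then show ?case by (rule summable_LIMSEQ_zero)
 qed
qed

section \<open>Energy and wells\<close>

text \<open>p is the last time at which \<rho> is at least \<beta>, and q the first later time at
  which \<rho> is at most \<alpha>. Between them the function stays in the band, and the
  intermediate value theorem gives equality at both ends.\<close>

lemma continuous_crossing:
 fixes \<rho> :: "real => real"
 assumes c: "continuous_on {s..t} \<rho>" and st: "s \<le> t" and ends: "\<beta> \<le> \<rho> s" "\<rho> t \<le> \<alpha>" and ab: "\<alpha> < \<beta>"
 obtains p q where "s \<le> p" "p < q" "q \<le> t" "\<rho> p = \<beta>" "\<rho> q = \<alpha>" "!!r. r \<in> {p..q} ==> \<alpha> \<le> \<rho> r \<and> \<rho> r \<le> \<beta>"
proof -
 define P where "P = {r \<in> {s..t}. \<beta> \<le> \<rho> r}"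
 have "closed P" unfolding P_def
  using continuous_on_closed_Collect_le[of "{s..t}" "%_. \<beta>" \<rho>] c by (simp add: continuous_on_const)
 moreover have Pb: "bdd_above P" by (auto simp: P_def intro!: bdd_aboveI[of _ t])
 moreover have Pne: "P \<noteq> {}" using ends st by (auto simp: P_def)
 ultimately have pP: "Sup P \<in> P" using closed_contains_Sup by blast
 define p where "p = Sup P"
 have p: "s \<le> p" "p \<le> t" "\<beta> \<le> \<rho> p" using pP by (auto simp: P_def p_def)
 have above: "\<rho> r < \<beta>" if "p < r" "r \<le> t" for r
  using cSup_upper[OF _ Pb, of r] that p(1) unfolding P_def p_def by (auto simp: not_le[symmetric])
 define Q where "Q = {r \<in> {p..t}. \<rho> r \<le> \<alpha>}"
 have cp: "continuous_on {p..t} \<rho>" using c by (rule continuous_on_subset) (use p in auto)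
 have "closed Q" unfolding Q_def
  using continuous_on_closed_Collect_le[of "{p..t}" \<rho> "%_. \<alpha>"] cp by (simp add: continuous_on_const)
 moreover have Qb: "bdd_below Q" by (auto simp: Q_def intro!: bdd_belowI[of _ p])
 moreover have "Q \<noteq> {}" using ends p by (auto simp: Q_def)
 ultimately have qQ: "Inf Q \<in> Q" using closed_contains_Inf by blast
 define q where "q = Inf Q"
 have q: "p \<le> q" "q \<le> t" "\<rho> q \<le> \<alpha>" using qQ by (auto simp: Q_def q_def)
 have pq: "p < q" using q p ab by (cases "p = q") auto
 have below: "\<alpha> < \<rho> r" if "p \<le> r" "r < q" for r
  using cInf_lower[OF _ Qb, of r] that q(2) unfolding Q_def q_def by (auto simp: not_le[symmetric])
 have rp: "\<rho> p = \<beta>"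
 proof (rule ccontr)
  assume "\<rho> p \<noteq> \<beta>"
  then have "\<beta> < \<rho> p" using p by simp
  moreover have "\<rho> q < \<beta>" using q ab by simp
  moreover have "continuous_on {p..q} \<rho>" using cp by (rule continuous_on_subset) (use q in auto)
  ultimately obtain r where "p \<le> r" "r \<le> q" "\<rho> r = \<beta>" using IVT2'[of \<rho> q \<beta> p] pq by force
  then show False using above[of r] q \<open>\<beta> < \<rho> p\<close> by (cases "r = p") auto
 qed
 have rq: "\<rho> q = \<alpha>"
 proof (rule ccontr)
  assume "\<rho> q \<noteq> \<alpha>"
  then have "\<rho> q < \<alpha>" using q by simp
  moreover have "continuous_on {p..q} \<rho>" using cp by (rule continuous_on_subset) (use q in auto)
  ultimately obtain r where "p \<le> r" "r \<le> q" "\<rho> r = \<alpha>" using IVT2'[of \<rho> q \<alpha> p] pq p ab by force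
  then show False using below[of r] \<open>\<rho> q < \<alpha>\<close> by (cases "r = q") auto
 qed
 show thesis
 proof (rule that[OF p(1) pq q(2) rp rq])
  fix r assume "r \<in> {p..q}"
  then show "\<alpha> \<le> \<rho> r \<and> \<rho> r \<le> \<beta>"
   using above[of r] below[of r] rp rq q ab by (cases "r = p"; cases "r = q") auto
 qed
qed

lemma ennreal_two_mult: "0 \<le> r ==> 2 * ennreal r = ennreal (2 * r)"
 using ennreal_mult[of 2 r] by simp

lemma slice_energy_ge:
 assumes R: "regular_field u D" and W: "continuous_on UNIV W" and nn: "!!z. 0 \<le> W z"
 shows "(NN y. indicator cell y * ennreal (sq_grad (%b y. D (0, b) (t, y)) y)) \<le> 2 * slice_energy W u D t"
  and "(NN y. indicator cell y * ennreal (W (u (t, y)))) \<le> slice_energy W u D t"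
proof -
 have Wm[measurable]: "W \<in> bmeas" using W by (rule borel_measurable_continuous_onI)
 note [measurable] = borel_slice[OF regular_fieldD(7)[OF R]] borel_slice[OF regular_fieldD(9)[OF R]]
 have "(NN y. indicator cell y * ennreal (sq_grad (%b y. D (0, b) (t, y)) y))
   \<le> (NN y. 2 * (indicator cell y * ennreal ((1/2) * sq_grad D (t, y) + W (u (t, y)))))"
 proof (rule nn_integral_mono)
  fix y
  have "2 * ennreal ((1/2) * sq_grad D (t, y) + W (u (t, y))) = ennreal (2 * ((1/2) * sq_grad D (t, y) + W (u (t, y))))"
   by (rule ennreal_two_mult) (simp add: nn)
  also have "... \<ge> ennreal (sq_grad (%b y. D (0, b) (t, y)) y)"
   using nn[of "u (t, y)"] sq_grad_slice_le[of D t y] by (intro ennreal_leI) simp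
  finally show "indicator cell y * ennreal (sq_grad (%b y. D (0, b) (t, y)) y) \<le> 2 * (indicator cell y * ennreal ((1/2) * sq_grad D (t, y) + W (u (t, y))))"
   by (cases "y \<in> cell") simp_all
 qed
 also have "... = 2 * slice_energy W u D t" unfolding slice_energy_def by (rule nn_integral_cmult) measurable
 finally show "(NN y. indicator cell y * ennreal (sq_grad (%b y. D (0, b) (t, y)) y)) \<le> 2 * slice_energy W u D t" .
 show "(NN y. indicator cell y * ennreal (W (u (t, y)))) \<le> slice_energy W u D t"
  unfolding slice_energy_def by (intro nn_integral_mono mult_left_mono ennreal_leI) auto
qed

lemma sq_grad_le_energy:
 assumes R: "regular_field u D" and W: "continuous_on UNIV W" and nn: "!!z. 0 \<le> W z" and I: "I \<in> sets borel"
 shows "(NN x. indicator (I \<times> cell) x * ennreal (sq_grad D x)) \<le> 2 * energy W I u D"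
proof -
 have Wm[measurable]: "W \<in> bmeas" using W by (rule borel_measurable_continuous_onI)
 note [measurable] = regular_fieldD(7,9)[OF R]
 have IC[measurable]: "I \<times> cell \<in> sets borel" using I unfolding borel_prod[symmetric] by measurable
 have "(NN x. indicator (I \<times> cell) x * ennreal (sq_grad D x)) \<le> (NN x. 2 * (indicator (I \<times> cell) x * ennreal ((1/2) * sq_grad D x + W (u x))))"
 proof (rule nn_integral_mono)
  fix x
  have "2 * ennreal ((1/2) * sq_grad D x + W (u x)) = ennreal (2 * ((1/2) * sq_grad D x + W (u x)))"
   by (rule ennreal_two_mult) (simp add: nn)
  also have "... \<ge> ennreal (sq_grad D x)" using nn[of "u x"] by (intro ennreal_leI) simp
  finally show "indicator (I \<times> cell) x * ennreal (sq_grad D x) \<le> 2 * (indicator (I \<times> cell) x * ennreal ((1/2) * sq_grad D x + W (u x)))"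
   by (cases "x \<in> I \<times> cell") simp_all
 qed
 also have "... = 2 * energy W I u D" unfolding energy_def nn_integral_completion by (rule nn_integral_cmult) measurable
 finally show ?thesis .
qed

lemma xavg_diff_le_energy:
 assumes R: "regular_field u D" and W: "continuous_on UNIV W" and nn: "!!z. 0 \<le> W z" and st: "s \<le> t"
 shows "nsq (xavg u t - xavg u s) \<le> ennreal (t - s) * (2 * energy W {s..t} u D)"
 by (rule order_trans[OF xavg_diff_le[OF R st]]) (intro mult_left_mono sq_grad_le_energy[OF R W nn], simp_all)

lemma energy_mono: "I \<subseteq> J ==> energy W I u D \<le> energy W J u D"
 unfolding energy_def by (rule nn_integral_subset_mono) auto

lemma energy_additive_le:
 assumes R: "regular_field u D" and W: "continuous_on UNIV W" and I: "I \<in> sets borel" "J \<in> sets borel"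
  and IJ: "I \<inter> J \<subseteq> {c}"
 shows "energy W I u D + energy W J u D \<le> energy W (I \<union> J) u D"
proof -
 note e = energy_eq_slices[OF R W]
 note [measurable] = e(2)[OF I(1)] I
 have "energy W I u D + energy W J u D = (NN t. indicator I t * slice_energy W u D t + indicator J t * slice_energy W u D t)"
  unfolding e(1)[OF I(1)] e(1)[OF I(2)] by (rule nn_integral_add[symmetric]) measurable
 also have "... = (NN t. indicator (I \<union> J) t * slice_energy W u D t)"
  by (rule nn_integral_cong_AE, use AE_lborel_neq[of c] in eventually_elim) (use IJ in \<open>auto simp: indicator_def\<close>)
 also have "... = energy W (I \<union> J) u D" by (rule e(1)[symmetric]) (use I in auto)
 finally show ?thesis by simp
qed

lemma xavg_continuous:
 assumes R: "regular_field u D"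
 shows "continuous_on UNIV (xavg u)"
proof -
 let ?Q = "(gradsq D)"
 obtain q where q: "0 \<le> q" "?Q = ennreal q" using regular_fieldD(4)[OF R] by (cases ?Q) auto
 have *: "(norm (xavg u t - xavg u s))\<^sup>2 \<le> (t - s) * q" if st: "s \<le> t" for s t
 proof -
  have "nsq (xavg u t - xavg u s) \<le> ennreal (t - s) * (NN x. indicator ({s..t} \<times> cell) x * ennreal (sq_grad D x))"
   by (rule xavg_diff_le[OF R st])
  also have "... \<le> ennreal (t - s) * ?Q" by (intro mult_left_mono nn_integral_subset_mono) auto
  also have "... = ennreal ((t - s) * q)" using q st by (simp add: ennreal_mult)
  finally show ?thesis using q st by (subst (asm) ennreal_le_iff) auto
 qed
 have **: "norm (xavg u t - xavg u s) \<le> sqrt (\<bar>t - s\<bar> * q)" for s t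
 proof (cases "s \<le> t")
  case True then show ?thesis using *[OF True] by (intro real_le_rsqrt) simp
 next
  case False
  then show ?thesis using *[of t s] by (intro real_le_rsqrt) (simp add: norm_minus_commute abs_minus_commute)
 qed
 show ?thesis unfolding continuous_on_def
 proof
  fix t :: real
  have "((%s. xavg u s - xavg u t) \<longlongrightarrow> 0) (at t)"
  proof (rule Lim_null_comparison)
   show "\<forall>\<^sub>F s in at t. norm (xavg u s - xavg u t) \<le> sqrt (\<bar>s - t\<bar> * q)" using ** by simp
   have "((%s. sqrt (\<bar>s - t\<bar> * q)) \<longlongrightarrow> sqrt (\<bar>t - t\<bar> * q)) (at t)" by (intro tendsto_intros)
   then show "((%s. sqrt (\<bar>s - t\<bar> * q)) \<longlongrightarrow> 0) (at t)" by simp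
  qed
  then show "(xavg u \<longlongrightarrow> xavg u t) (at t within UNIV)" by (simp add: LIM_zero_iff)
 qed
qed

section \<open>Coercivity and the wells of the potential\<close>

text \<open>Collects the assumptions on the potential alone. The hypotheses on the distance are
  passed explicitly to the lemmas that use them.\<close>

locale potential =
 fixes W :: "('m::finite) pt => real" and a :: real
 assumes W_cont: "continuous_on UNIV W"
  and W_nonneg: "!!z. 0 \<le> W z"
  and finite_wells: "finite {z. fst z = a \<and> W z = 0}"
  and coercive: "Liminf (inf (filtercomap fst (nhds a)) (filtercomap (%z. norm (snd z)) at_top)) (%z. ereal (W z)) > 0"
begin

definition wells :: "'m pt set" where "wells = {z. fst z = a \<and> W z = 0}"

lemma W_borel: "W \<in> bmeas"
 using W_cont by (rule borel_measurable_continuous_onI)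

lemma coerciveE:
 obtains c \<rho> R where "c > 0" "\<rho> > 0" "!!z :: 'm pt. \<bar>fst z - a\<bar> < \<rho> ==> R < norm (snd z) ==> c < W z"
proof -
 obtain c where c: "0 < ereal c" "ereal c < Liminf (inf (filtercomap fst (nhds a)) (filtercomap (%z. norm (snd z)) at_top)) (%z. ereal (W z))"
  using ereal_dense2[OF coercive] by (metis less_ereal.simps(1))
 from less_LiminfD[OF c(2)] have "eventually (%z. c < W z) (inf (filtercomap fst (nhds a)) (filtercomap (%z. norm (snd z)) at_top))"
  by simp
 then obtain P Q where P: "eventually P (filtercomap fst (nhds a))" and Q: "eventually Q (filtercomap (%z. norm (snd z)) at_top)"
  and PQ: "!!z :: 'm pt. P z \<and> Q z \<longrightarrow> c < W z"
  unfolding eventually_inf by blast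
 obtain P' where P': "eventually P' (nhds a)" "!!z. P' (fst z) \<longrightarrow> P z" using P unfolding eventually_filtercomap by blast
 obtain Q' where Q': "eventually Q' at_top" "!!z. Q' (norm (snd z)) \<longrightarrow> Q z" using Q unfolding eventually_filtercomap by blast
 obtain \<rho> where rho: "\<rho> > 0" "!!t. dist t a < \<rho> \<longrightarrow> P' t" using P'(1) unfolding eventually_nhds_metric by blast
 obtain R where R: "!!r. R \<le> r \<longrightarrow> Q' r" using Q'(1) unfolding eventually_at_top_linorder by blast
 show thesis
 proof (rule that[of c \<rho> R])
  show "0 < c" using c by simp
  show "0 < \<rho>" by fact
  fix z :: "'m pt" assume "\<bar>fst z - a\<bar> < \<rho>" "R < norm (snd z)"
  then have "P' (fst z)" "Q' (norm (snd z))" using rho(2)[of "fst z"] R[of "norm (snd z)"] by (auto simp: dist_real_def)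
  then show "c < W z" using P'(2)[of z] Q'(2)[of z] PQ[of z] by blast
 qed
qed

text \<open>By contradiction, with a sequence of profiles of energy about 2^-n whose averages stay
  away from the wells. By Poincare and the summability of the bounds there is a point y where v n y
  minus its average and W (v n y) both tend to 0. Coercivity bounds these values, since their first
  components tend to a, and a limit point is a zero of W with first component a: a well to which the
  averages converge along the subsequence.\<close>

lemma small_energy_near_wells:
 assumes "\<delta> > 0"
 shows "\<exists>\<eta>>0. \<forall>(v :: real ^ 'm => 'm pt) Dv. borel_grad UNIV v Dv \<longrightarrow> fst (LBINT y. indicator cell y *R v y) = a \<longrightarrow>
  (NN y. indicator cell y * ennreal (sq_grad Dv y)) \<le> ennreal (2 * \<eta>) \<longrightarrow>
  (NN y. indicator cell y * ennreal (W (v y))) \<le> ennreal \<eta> \<longrightarrow>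
  (\<exists>z\<in>wells. norm ((LBINT y. indicator cell y *R v y) - z) < \<delta>)"
proof (rule ccontr)
 assume neg: "\<not> ?thesis"
 have "\<exists>(v :: real ^ 'm => 'm pt) Dv. borel_grad UNIV v Dv \<and> fst (LBINT y. indicator cell y *R v y) = a \<and>
  (NN y. indicator cell y * ennreal (sq_grad Dv y)) \<le> ennreal (2 * (1/2)^n) \<and>
  (NN y. indicator cell y * ennreal (W (v y))) \<le> ennreal ((1/2)^n) \<and>
  (\<forall>z\<in>wells. \<delta> \<le> norm ((LBINT y. indicator cell y *R v y) - z))" for n :: nat
 proof -
  have "(0::real) < (1/2)^n" by simp
  then have "\<not> (\<forall>(v :: real ^ 'm => 'm pt) Dv. borel_grad UNIV v Dv \<longrightarrow> fst (LBINT y. indicator cell y *R v y) = a \<longrightarrow>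
  (NN y. indicator cell y * ennreal (sq_grad Dv y)) \<le> ennreal (2 * (1/2)^n) \<longrightarrow>
  (NN y. indicator cell y * ennreal (W (v y))) \<le> ennreal ((1/2)^n) \<longrightarrow>
  (\<exists>z\<in>wells. norm ((LBINT y. indicator cell y *R v y) - z) < \<delta>))"
   using neg by blast
  then show ?thesis by (simp only: not_all not_imp bex_simps not_less)
 qed
 then have "\<forall>n. \<exists>p :: (real ^ 'm => 'm pt) \<times> _. borel_grad UNIV (fst p) (snd p) \<and> fst (LBINT y. indicator cell y *R fst p y) = a \<and>
  (NN y. indicator cell y * ennreal (sq_grad (snd p) y)) \<le> ennreal (2 * (1/2)^n) \<and>
  (NN y. indicator cell y * ennreal (W (fst p y))) \<le> ennreal ((1/2)^n) \<and>
  (\<forall>z\<in>wells. \<delta> \<le> norm ((LBINT y. indicator cell y *R fst p y) - z))" by simp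
 from choice[OF this] obtain p :: "nat => (real ^ 'm => 'm pt) \<times> (real ^ 'm => real ^ 'm => 'm pt)" where p: "!!n. borel_grad UNIV (fst (p n)) (snd (p n)) \<and> fst (LBINT y. indicator cell y *R fst (p n) y) = a \<and>
  (NN y. indicator cell y * ennreal (sq_grad (snd (p n)) y)) \<le> ennreal (2 * (1/2)^n) \<and>
  (NN y. indicator cell y * ennreal (W (fst (p n) y))) \<le> ennreal ((1/2)^n) \<and>
  (\<forall>z\<in>wells. \<delta> \<le> norm ((LBINT y. indicator cell y *R fst (p n) y) - z))" by blast
 define v where "v n = fst (p n)" for n
 define Dv where "Dv n = snd (p n)" for n
 define g where "g n = (LBINT y. indicator cell y *R v n y)" for n
 have B: "borel_grad UNIV (v n) (Dv n)" and ga: "fst (g n) = a"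
  and G: "(NN y. indicator cell y * ennreal (sq_grad (Dv n) y)) \<le> ennreal (2 * (1/2)^n)"
  and E: "(NN y. indicator cell y * ennreal (W (v n y))) \<le> ennreal ((1/2)^n)"
  and far: "!!z. z \<in> wells ==> \<delta> \<le> norm (g n - z)" for n
  using p[of n] unfolding v_def Dv_def g_def by simp_all
 note vm[measurable] = borel_gradD(2)[OF B]
 note [measurable] = W_borel
 obtain C where C: "0 \<le> C" "!!(v :: real ^ 'm => 'm pt) Dv. borel_grad UNIV v Dv ==>
  (NN y. indicator cell y * nsq (v y - (LBINT z. indicator cell z *R v z)))
  \<le> ennreal C * (NN y. indicator cell y * ennreal (sq_grad Dv y))"
  using poincare_cell[where 'm='m and 'c="'m pt"] by blast
 have sm: "summable (%n. C * (2 * (1/2)^n) :: real)" "summable (%n. (1/2)^n :: real)" by (auto intro!: summable_mult summable_geometric)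
 have ind: "ennreal (indicat_real cell y * r) = indicator cell y * ennreal r" for y :: "real ^ 'm" and r by (auto simp: indicator_def)
 \<comment> \<open>The geometric bounds are summable, so the whole sequence converges almost
   everywhere.\<close>
 have 1: "AE y in lborel. (%n. indicat_real cell y * (norm (v n y - g n))\<^sup>2) ~> 0"
 proof (rule sum_finite_nn_integral_AE_tendsto_0[OF _ _ _ sm(1)])
  show "(NN y. ennreal (indicat_real cell y * (norm (v n y - g n))\<^sup>2)) \<le> ennreal (C * (2 * (1/2)^n))" for n
  proof -
   have "(NN y. ennreal (indicat_real cell y * (norm (v n y - g n))\<^sup>2)) \<le> ennreal C * (NN y. indicator cell y * ennreal (sq_grad (Dv n) y))"
    unfolding ind g_def by (rule C(2)[OF B])
   also have "... \<le> ennreal C * ennreal (2 * (1/2)^n)" by (rule mult_left_mono[OF G]) simp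
   finally show ?thesis using C(1) by (simp add: ennreal_mult)
  qed
  show "(%x. ennreal (indicat_real cell x * (norm (v n x - g n))\<^sup>2)) \<in> borel_measurable lborel" for n by measurable
 qed (use C(1) in auto)
 have 2: "AE y in lborel. (%n. indicat_real cell y * W (v n y)) ~> 0"
 proof (rule sum_finite_nn_integral_AE_tendsto_0[OF _ _ _ sm(2)])
  show "(NN y. ennreal (indicat_real cell y * W (v n y))) \<le> ennreal ((1/2)^n)" for n
   unfolding ind by (rule E)
  show "(%x. ennreal (indicat_real cell x * W (v n x))) \<in> borel_measurable lborel" for n by measurable
 qed (auto intro: mult_nonneg_nonneg W_nonneg)
 \<comment> \<open>A single good point of the cell suffices, and one exists because the cell has
   positive measure.\<close>
 have "\<exists>y\<in>cell. (%n. indicat_real cell y * (norm (v n y - g n))\<^sup>2) ~> 0 \<and> (%n. indicat_real cell y * W (v n y)) ~> 0"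
 proof (rule ccontr)
  assume "\<not> ?thesis"
  with 1 2 have "AE y in lborel. y \<notin> (cell :: (real ^ 'm) set)" by (auto elim: eventually_elim2)
  then have "emeasure lborel (cell :: (real ^ 'm) set) = 0"
   by (subst (asm) AE_iff_measurable[OF _ refl]) auto
  then show False by (simp add: emeasure_cell)
 qed
 then obtain y where y: "y \<in> cell" "(%n. (norm (v n y - g n))\<^sup>2) ~> 0" "(%n. W (v n y)) ~> 0" by auto
 have d0: "(%n. v n y - g n) ~> 0"
 proof -
  have "(%n. sqrt ((norm (v n y - g n))\<^sup>2)) ~> sqrt 0" by (rule tendsto_real_sqrt[OF y(2)])
  then show ?thesis by (simp add: tendsto_norm_zero_iff)
 qed
 have fa: "(%n. fst (v n y)) ~> a"
 proof -
  have "(%n. fst (v n y - g n) + a) ~> fst (0 :: 'm pt) + a" by (intro tendsto_intros d0)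
  then show ?thesis using ga by simp
 qed
 \<comment> \<open>Coercivity acts only for first components near a; this is where the prescribed
   average a is used.\<close>
 obtain c \<rho> R where c: "c > 0" "\<rho> > 0" "!!z :: 'm pt. \<bar>fst z - a\<bar> < \<rho> ==> R < norm (snd z) ==> c < W z"
  by (rule coerciveE) blast
 have "\<forall>\<^sub>F n in sequentially. dist (fst (v n y)) a < \<rho>" using fa c(2) by (rule tendstoD)
 moreover have "\<forall>\<^sub>F n in sequentially. W (v n y) < c" using y(3) c(1) by (rule order_tendstoD(2))
 ultimately have "\<forall>\<^sub>F n in sequentially. norm (v n y) \<le> \<bar>a\<bar> + \<rho> + R"
 proof eventually_elim
  case (elim n)
  then have "norm (snd (v n y)) \<le> R" using c(3)[of "v n y"] by (auto simp: dist_real_def not_less[symmetric])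
  moreover have "\<bar>fst (v n y)\<bar> \<le> \<bar>a\<bar> + \<rho>" using elim by (simp add: dist_real_def)
  moreover have "norm (v n y) \<le> norm (fst (v n y)) + norm (snd (v n y))" using norm_Pair_le[of "fst (v n y)" "snd (v n y)"] by simp
  ultimately show ?case by simp
 qed
 then obtain N where N: "!!n. n \<ge> N ==> v n y \<in> cball 0 (\<bar>a\<bar> + \<rho> + R)" unfolding eventually_sequentially by auto
 have "seq_compact (cball (0 :: 'm pt) (\<bar>a\<bar> + \<rho> + R))" by (simp add: compact_imp_seq_compact)
 then obtain z r where z: "strict_mono r" "((%n. v (n + N) y) \<circ> r) ~> z"
  using N unfolding seq_compact_def by (metis le_add2)
 define k where "k n = r n + N" for n
 have k: "strict_mono k" using z(1) by (auto simp: k_def strict_mono_def)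
 have vz: "(%n. v (k n) y) ~> z" using z(2) by (simp add: k_def o_def)
 have "(%n. fst (v (k n) y)) ~> a" using LIMSEQ_subseq_LIMSEQ[OF fa k] by (simp add: o_def)
 moreover have "(%n. fst (v (k n) y)) ~> fst z" by (intro tendsto_intros vz)
 ultimately have "fst z = a" using LIMSEQ_unique by blast
 have "(%n. W (v (k n) y)) ~> 0" using LIMSEQ_subseq_LIMSEQ[OF y(3) k] by (simp add: o_def)
 moreover have "(%n. W (v (k n) y)) ~> W z" using continuous_on_tendsto_compose[OF W_cont vz] by simp
 ultimately have "W z = 0" using LIMSEQ_unique by blast
 have zS: "z \<in> wells" using \<open>fst z = a\<close> \<open>W z = 0\<close> by (simp add: wells_def)
 have "(%n. v (k n) y - (v (k n) y - g (k n)) - z) ~> z - 0 - z"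
  using LIMSEQ_subseq_LIMSEQ[OF d0 k] by (intro tendsto_intros vz) (simp add: o_def)
 then have "(%n. norm (g (k n) - z)) ~> 0" by (simp add: tendsto_norm_zero_iff)
 then have "\<forall>\<^sub>F n in sequentially. norm (g (k n) - z) < \<delta>" using assms by (rule order_tendstoD(2))
 then obtain n where "norm (g (k n) - z) < \<delta>" by (meson eventually_happens' sequentially_bot)
 then show False using far[OF zS, of "k n"] by simp
qed

text \<open>The previous lemma applied to almost every slice; the bound 2 \<eta> on the gradient
  there accounts for the factor 1/2 in the energy.\<close>

lemma small_slice_energy_near_wells:
 assumes "\<delta> > 0"
 shows "\<exists>\<eta>>0. \<forall>u D. regular_field u D \<longrightarrow> (\<forall>t. fst (xavg u t) = a) \<longrightarrow>
  (AE t in lborel. slice_energy W u D t \<le> ennreal \<eta> \<longrightarrow> (\<exists>z\<in>wells. norm (xavg u t - z) < \<delta>))"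
proof -
 obtain \<eta> where eta: "\<eta> > 0" "!!(v :: real ^ 'm => 'm pt) Dv. borel_grad UNIV v Dv ==> fst (LBINT y. indicator cell y *R v y) = a ==>
  (NN y. indicator cell y * ennreal (sq_grad Dv y)) \<le> ennreal (2 * \<eta>) ==>
  (NN y. indicator cell y * ennreal (W (v y))) \<le> ennreal \<eta> ==>
  (\<exists>z\<in>wells. norm ((LBINT y. indicator cell y *R v y) - z) < \<delta>)"
  using small_energy_near_wells[OF assms] by blast
 show ?thesis
 proof (intro exI[of _ \<eta>] conjI allI impI)
  show "\<eta> > 0" by fact
  fix u :: "'m pt => 'm pt" and D assume R: "regular_field u D" and a: "\<forall>t. fst (xavg u t) = a"
  show "AE t in lborel. slice_energy W u D t \<le> ennreal \<eta> \<longrightarrow> (\<exists>z\<in>wells. norm (xavg u t - z) < \<delta>)"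
   using borel_grad_slice[OF regular_fieldD(1)[OF R]]
  proof eventually_elim
   case (elim t)
   show ?case
   proof
    assume le: "slice_energy W u D t \<le> ennreal \<eta>"
    note x = xavg_lborel[OF regular_fieldD(7)[OF R], of t]
    show "\<exists>z\<in>wells. norm (xavg u t - z) < \<delta>" unfolding x
    proof (rule eta(2)[OF elim])
     show "fst (LBINT y. indicator cell y *R u (t, y)) = a" using a x by metis
     have "2 * slice_energy W u D t \<le> 2 * ennreal \<eta>" by (rule mult_left_mono[OF le]) simp
     also have "... = ennreal (2 * \<eta>)" using eta(1) by (simp add: ennreal_mult')
     finally show "(NN y. indicator cell y * ennreal (sq_grad (%b y. D (0, b) (t, y)) y)) \<le> ennreal (2 * \<eta>)"
      using slice_energy_ge(1)[OF R W_cont W_nonneg] by (rule order_trans[rotated])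
     show "(NN y. indicator cell y * ennreal (W (u (t, y)))) \<le> ennreal \<eta>"
      by (rule order_trans[OF slice_energy_ge(2)[OF R W_cont W_nonneg] le])
    qed
   qed
  qed
 qed
qed

end

text \<open>Chebyshev's inequality, read as a choice of a good time: the time found also satisfies
  any prescribed almost sure property, such as having a weak gradient on the slice. J may have
  infinite measure.\<close>

lemma ex_small_time:
 fixes f :: "real => ennreal"
 assumes f[measurable]: "f \<in> bmeas" and J[measurable]: "J \<in> sets borel"
  and less: "(NN t. indicator J t * f t) < c * emeasure lborel J" and P: "AE t in lborel. P t"
 shows "\<exists>t\<in>J. P t \<and> f t \<le> c"
proof (rule ccontr)
 assume "\<not> ?thesis"
 then have n: "!!t. t \<in> J ==> P t ==> c \<le> f t" by (metis linear)
 have "c * emeasure lborel J = (NN t. c * indicator J t)" by (simp add: nn_integral_cmult_indicator)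
 also have "... \<le> (NN t. indicator J t * f t)"
 proof (rule nn_integral_mono_AE, use P in eventually_elim)
  fix t assume "P t"
  then show "c * indicator J t \<le> indicator J t * f t" using n[of t] by (cases "t \<in> J") auto
 qed
 finally show False using less by simp
qed

lemma integral_cell_le:
 fixes f :: "real ^ 'm::finite => real"
 assumes [measurable]: "f \<in> bmeas" and nn: "!!y. 0 \<le> f y" and c: "0 \<le> c"
  and le: "(NN y. indicator cell y * ennreal (f y)) \<le> ennreal c"
 shows "0 \<le> (\<integral>y\<in>cell. f y \<partial>lebesgue)" "(\<integral>y\<in>cell. f y \<partial>lebesgue) \<le> c"
proof -
 have e: "(\<integral>y\<in>cell. f y \<partial>lebesgue) = (LBINT y. indicator cell y * f y)"
  unfolding set_lebesgue_integral_def by (subst integral_completion) auto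
 show "0 \<le> (\<integral>y\<in>cell. f y \<partial>lebesgue)" unfolding e by (intro Bochner_Integration.integral_nonneg mult_nonneg_nonneg nn) auto
 have i: "(NN y. ennreal (indicat_real cell y * f y)) = (NN y. indicator cell y * ennreal (f y))"
  by (intro nn_integral_cong) (auto simp: indicator_def)
 have "(LBINT y. indicator cell y * f y) = enn2real (NN y. ennreal (indicat_real cell y * f y))"
  by (rule integral_eq_nn_integral) (auto intro: mult_nonneg_nonneg nn)
 also have "... \<le> enn2real (ennreal c)" unfolding i by (rule enn2real_mono[OF le]) simp
 finally show "(\<integral>y\<in>cell. f y \<partial>lebesgue) \<le> c" unfolding e using c by simp
qed

text \<open>The gradient of the slice is controlled by its energy; by Poincare the slice is close to
  its average, and the distance of the average to z is added. C does not depend on field, time or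
  z.\<close>

lemma slice_H1_bound:
 assumes W: "continuous_on UNIV W" and nn: "!!z. 0 \<le> W z"
 obtains C where "0 \<le> C" "!!(u :: ('m::finite) pt => 'm pt) D t \<epsilon> z. regular_field u D ==> borel_grad UNIV (%y. u (t, y)) (%b y. D (0, b) (t, y)) ==>
  0 \<le> \<epsilon> ==> slice_energy W u D t \<le> ennreal \<epsilon> ==>
  0 \<le> (\<integral>y\<in>cell. (norm (u (t, y) - z))\<^sup>2 \<partial>lebesgue) \<and>
  (\<integral>y\<in>cell. (norm (u (t, y) - z))\<^sup>2 \<partial>lebesgue) \<le> C * \<epsilon> + 2 * (norm (xavg u t - z))\<^sup>2 \<and>
  0 \<le> (\<integral>y\<in>cell. sq_grad (%b y. D (0, b) (t, y)) y \<partial>lebesgue) \<and>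
  (\<integral>y\<in>cell. sq_grad (%b y. D (0, b) (t, y)) y \<partial>lebesgue) \<le> 2 * \<epsilon>"
proof -
 obtain C where C: "0 \<le> C" "!!(v :: real ^ 'm => 'm pt) Dv. borel_grad UNIV v Dv ==>
  (NN y. indicator cell y * nsq (v y - (LBINT z. indicator cell z *R v z)))
  \<le> ennreal C * (NN y. indicator cell y * ennreal (sq_grad Dv y))"
  using poincare_cell[where 'm='m and 'c="'m pt"] by blast
 show thesis
 \<comment> \<open>One factor 2 comes from the square of a sum, the other from the 1/2 in the
   energy.\<close>
 proof (rule that[of "4 * C"])
   show "0 \<le> 4 * C" using C by simp
   fix u :: "'m pt => 'm pt" and D t \<epsilon> z
   assume R: "regular_field u D" and B: "borel_grad UNIV (%y. u (t, y)) (%b y. D (0, b) (t, y))"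
    and e0: "0 \<le> \<epsilon>" and e: "slice_energy W u D t \<le> ennreal \<epsilon>"
   note um = regular_fieldD(7)[OF R]
   note [measurable] = borel_slice[OF um]
   have gm[measurable]: "sq_grad (%b y. D (0, b) (t, y)) \<in> bmeas" by (rule sq_grad_borel[OF borel_gradD(3)[OF B]])
   have g: "(NN y. indicator cell y * ennreal (sq_grad (%b y. D (0, b) (t, y)) y)) \<le> ennreal (2 * \<epsilon>)"
   proof -
    have "2 * slice_energy W u D t \<le> 2 * ennreal \<epsilon>" by (rule mult_left_mono[OF e]) simp
    then show ?thesis using slice_energy_ge(1)[OF R W nn, of t] ennreal_two_mult[OF e0] by simp
   qed
   have cm: "emeasure lborel (cell :: (real ^ 'm) set) = 1" by (rule emeasure_cell)
   have "(NN y. indicator cell y * nsq (u (t, y) - z)) = (NN y. indicator cell y * nsq ((u (t, y) - xavg u t) + (xavg u t - z)))"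
    by simp
   also have "... \<le> 2 * (NN y. indicator cell y * nsq (u (t, y) - xavg u t)) + 2 * (NN y. indicator (cell :: (real ^ 'm) set) y * nsq (xavg u t - z))"
    by (rule nn_integral_norm_add_power2_le) measurable
   also have "... \<le> 2 * (ennreal C * ennreal (2 * \<epsilon>)) + 2 * nsq (xavg u t - z)"
   proof (intro add_mono mult_left_mono)
    have "(NN y. indicator cell y * nsq (u (t, y) - xavg u t)) \<le> ennreal C * (NN y. indicator cell y * ennreal (sq_grad (%b y. D (0, b) (t, y)) y))"
     unfolding xavg_lborel[OF um] by (rule C(2)[OF B])
    also have "... \<le> ennreal C * ennreal (2 * \<epsilon>)" by (rule mult_left_mono[OF g]) simp
    finally show "(NN y. indicator cell y * nsq (u (t, y) - xavg u t)) \<le> ennreal C * ennreal (2 * \<epsilon>)" .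
    show "(NN y. indicator (cell :: (real ^ 'm) set) y * nsq (xavg u t - z)) \<le> nsq (xavg u t - z)"
     by (simp add: nn_integral_multc cm)
   qed auto
   also have "... = ennreal (4 * C * \<epsilon> + 2 * (norm (xavg u t - z))\<^sup>2)"
   proof -
    have "ennreal C * ennreal (2 * \<epsilon>) = ennreal (C * (2 * \<epsilon>))" using C(1) by (simp add: ennreal_mult')
    then show ?thesis using C(1) e0 by (simp add: ennreal_two_mult ennreal_plus[symmetric] del: ennreal_plus)
   qed
   finally have l: "(NN y. indicator cell y * nsq (u (t, y) - z)) \<le> ennreal (4 * C * \<epsilon> + 2 * (norm (xavg u t - z))\<^sup>2)" .
   have m1: "(%y. (norm (u (t, y) - z))\<^sup>2) \<in> bmeas" by measurable
   have p0: "0 \<le> 4 * C * \<epsilon> + 2 * (norm (xavg u t - z))\<^sup>2" using C(1) e0 by simp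
   have p1: "0 \<le> 2 * \<epsilon>" using e0 by simp
   show "0 \<le> (\<integral>y\<in>cell. (norm (u (t, y) - z))\<^sup>2 \<partial>lebesgue) \<and>
    (\<integral>y\<in>cell. (norm (u (t, y) - z))\<^sup>2 \<partial>lebesgue) \<le> 4 * C * \<epsilon> + 2 * (norm (xavg u t - z))\<^sup>2 \<and>
    0 \<le> (\<integral>y\<in>cell. sq_grad (%b y. D (0, b) (t, y)) y \<partial>lebesgue) \<and>
    (\<integral>y\<in>cell. sq_grad (%b y. D (0, b) (t, y)) y \<partial>lebesgue) \<le> 2 * \<epsilon>"
    using integral_cell_le[OF m1 _ p0 l] integral_cell_le[OF gm _ p1 g] by simp
 qed
qed

text \<open>Vanishing slice energies force the tangential gradients to 0 and the slices towards
  their averages, which converge. This produces the strongly converging sequences that (H4) speaks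
  of.\<close>

lemma h1_conv_constI:
 fixes u :: "nat => ('m::finite) pt => 'm pt"
 assumes W: "continuous_on UNIV W" and nn: "!!z. 0 \<le> W z"
  and R: "!!n. regular_field (u n) (D n)"
  and B: "!!n. borel_grad UNIV (%y. u n (t n, y)) (%b y. D n (0, b) (t n, y))"
  and e: "!!n. slice_energy W (u n) (D n) (t n) \<le> ennreal (\<epsilon> n)" "!!n. 0 \<le> \<epsilon> n" "\<epsilon> ~> 0"
  and g: "(%n. xavg (u n) (t n)) ~> z"
 shows "h1_conv_const (%n y. u n (t n, y)) (%n b y. D n (0, b) (t n, y)) z"
proof (rule slice_H1_bound[OF W nn])
 fix C assume C: "0 \<le> C" "!!(u :: 'm pt => 'm pt) D t \<epsilon> z. regular_field u D ==> borel_grad UNIV (%y. u (t, y)) (%b y. D (0, b) (t, y)) ==>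
  0 \<le> \<epsilon> ==> slice_energy W u D t \<le> ennreal \<epsilon> ==>
  0 \<le> (\<integral>y\<in>cell. (norm (u (t, y) - z))\<^sup>2 \<partial>lebesgue) \<and>
  (\<integral>y\<in>cell. (norm (u (t, y) - z))\<^sup>2 \<partial>lebesgue) \<le> C * \<epsilon> + 2 * (norm (xavg u t - z))\<^sup>2 \<and>
  0 \<le> (\<integral>y\<in>cell. sq_grad (%b y. D (0, b) (t, y)) y \<partial>lebesgue) \<and>
  (\<integral>y\<in>cell. sq_grad (%b y. D (0, b) (t, y)) y \<partial>lebesgue) \<le> 2 * \<epsilon>"
 note b = C(2)[OF R B e(2) e(1)]
 have "(%n. norm (xavg (u n) (t n) - z)) ~> 0" using g by (simp add: LIM_zero tendsto_norm_zero)
 then have "(%n. C * \<epsilon> n + 2 * (norm (xavg (u n) (t n) - z))\<^sup>2) ~> C * 0 + 2 * 0\<^sup>2" by (intro tendsto_intros e(3))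
 then have l1: "(%n. C * \<epsilon> n + 2 * (norm (xavg (u n) (t n) - z))\<^sup>2) ~> 0" by simp
 have "(%n. 2 * \<epsilon> n) ~> 2 * 0" by (intro tendsto_intros e(3))
 then have l2: "(%n. 2 * \<epsilon> n) ~> 0" by simp
 show ?thesis unfolding h1_conv_const_def
 proof
  show "(%n. \<integral>y\<in>cell. (norm (u n (t n, y) - z))\<^sup>2 \<partial>lebesgue) ~> 0"
   by (rule tendsto_sandwich[OF _ _ tendsto_const l1]) (use b in \<open>simp_all\<close>)
  show "(%n. \<integral>y\<in>cell. sq_grad (%b y. D n (0, b) (t n, y)) y \<partial>lebesgue) ~> 0"
   by (rule tendsto_sandwich[OF _ _ tendsto_const l2]) (use b in \<open>simp_all\<close>)
 qed
qed

section \<open>Finite energy on unbounded intervals\<close>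

lemma emeasure_lborel_unbounded_interval:
 fixes S :: "real set"
 assumes "S \<in> sets borel" "!!n::nat. \<exists>l. {l..l + real n} \<subseteq> S"
 shows "emeasure lborel S = \<infinity>"
proof (rule ccontr)
 assume "emeasure lborel S \<noteq> \<infinity>"
 then obtain x where x: "0 \<le> x" "emeasure lborel S = ennreal x" by (cases "emeasure lborel S") auto
 obtain n :: nat where n: "x < real n" using reals_Archimedean2 by blast
 obtain l where "{l..l + real n} \<subseteq> S" using assms(2) by blast
 then have "emeasure lborel {l..l + real n} \<le> ennreal x" unfolding x(2)[symmetric] by (rule emeasure_mono) (use assms(1) in simp)
 then show False using n x(1) by simp
qed

lemma emeasure_lborel_Ici: "emeasure lborel {c::real..} = \<infinity>"
 by (rule emeasure_lborel_unbounded_interval) (auto intro!: exI[of _ c])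

lemma emeasure_lborel_Iic: "emeasure lborel {..c::real} = \<infinity>"
proof (rule emeasure_lborel_unbounded_interval)
 show "\<exists>l. {l..l + real n} \<subseteq> {..c}" for n by (intro exI[of _ "c - real n"]) auto
qed simp

text \<open>The energy is a finite measure in time with density \<open>slice_energy\<close>;
  continuity from above along sets decreasing to the empty set. The abstract tails J serve both ends
  of the line.\<close>

lemma energy_tail:
 assumes R: "regular_field u D" and W: "continuous_on UNIV W" and fin: "energy W UNIV u D < \<infinity>"
  and J: "!!n. J n \<in> sets borel" "decseq J" "(\<Inter>n. J n) = {}" and k: "0 < \<kappa>"
 shows "\<exists>n. energy W (J n) u D < ennreal \<kappa>"
proof -
 note e = energy_eq_slices[OF R W]
 have em[measurable]: "slice_energy W u D \<in> bmeas" by (rule e(2)[of UNIV]) simp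
 let ?N = "density lborel (slice_energy W u D)"
 have eq: "energy W I u D = emeasure ?N I" if I: "I \<in> sets borel" for I
  unfolding e(1)[OF I] by (subst emeasure_density) (use I in \<open>auto simp: mult.commute\<close>)
 have "(%n. emeasure ?N (J n)) ~> emeasure ?N (\<Inter>n. J n)"
 proof (rule Lim_emeasure_decseq)
  show "range J \<subseteq> sets ?N" using J(1) by auto
  show "emeasure ?N (J n) \<noteq> \<infinity>" for n
   using energy_mono[of "J n" UNIV W u D] fin eq[OF J(1)] by (metis infinity_ennreal_def leD less_top subset_UNIV)
 qed fact
 then have "(%n. energy W (J n) u D) ~> 0" unfolding J(3) using eq[OF J(1)] by simp
 then have "\<forall>\<^sub>F n in sequentially. energy W (J n) u D < ennreal \<kappa>" by (rule order_tendstoD(2)) (simp add: k)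
 then show ?thesis by (meson eventually_happens' sequentially_bot)
qed

context potential
begin

text \<open>Finiteness of the set of wells. With 4 \<delta> as least distance, a point within 2
  \<delta> of one well is not within \<delta> of another, with a margin \<delta> left.\<close>

lemma wells_separated:
 obtains \<delta> where "\<delta> > 0" "!!z z'. z \<in> wells ==> z' \<in> wells ==> z \<noteq> z' ==> 4 * \<delta> \<le> norm (z - z')"
proof -
 \<comment> \<open>The inserted 4 keeps the finite set non-empty, so that \<open>Min\<close> is
   meaningful even with a single well.\<close>
 define A where "A = insert 4 ((%(z, z'). norm (z - z')) ` (wells \<times> wells) - {0})"
 have fA: "finite A" using finite_wells unfolding A_def wells_def by (intro finite.insertI finite_Diff finite_imageI finite_cartesian_product)
 have "A \<noteq> {}" by (simp add: A_def)
 have pos: "0 < Min A" using fA by (subst Min_gr_iff) (auto simp: A_def)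
 show thesis
 proof (rule that[of "Min A / 4"])
  show "0 < Min A / 4" using pos by simp
  fix z z' assume "z \<in> wells" "z' \<in> wells" "z \<noteq> z'"
  then have "norm (z - z') \<in> A" by (auto simp: A_def)
  then show "4 * (Min A / 4) \<le> norm (z - z')" using fA by simp
 qed
qed

text \<open>While the average is between \<delta> and 2 \<delta> from z it is at least \<delta> from
  every well, so the slice energy exceeds \<eta> at almost every time: a slow crossing pays in slice
  energy. A fast crossing pays in gradient, by the Hoelder estimate for averages. Multiplying the
  two bounds eliminates the duration.\<close>

lemma crossing_cost:
 assumes d: "\<delta> > 0" and sep: "!!z z'. z \<in> wells ==> z' \<in> wells ==> z \<noteq> z' ==> 4 * \<delta> \<le> norm (z - z')"
 shows "\<exists>\<kappa>>0. \<forall>u D z s t. regular_field u D \<longrightarrow> (\<forall>t. fst (xavg u t) = a) \<longrightarrow> z \<in> wells \<longrightarrow> s \<le> t \<longrightarrow>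
  (2 * \<delta> \<le> norm (xavg u s - z) \<and> norm (xavg u t - z) \<le> \<delta> \<or> norm (xavg u s - z) \<le> \<delta> \<and> 2 * \<delta> \<le> norm (xavg u t - z)) \<longrightarrow>
  ennreal \<kappa> \<le> energy W {s..t} u D"
proof -
 obtain \<eta> where eta: "\<eta> > 0" "!!u D. regular_field u D ==> (\<forall>t. fst (xavg u t) = a) ==>
  (AE t in lborel. slice_energy W u D t \<le> ennreal \<eta> \<longrightarrow> (\<exists>z\<in>wells. norm (xavg u t - z) < \<delta>))"
  using small_slice_energy_near_wells[OF d] by blast
 \<comment> \<open>If x is the energy and L the duration, then \<eta> L \<le> x and \<delta>^2 \<le>
   2 L x. Hence \<delta>^2 \<eta> \<le> 2 x^2, and \<kappa> is the value of x for which equality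
   holds.\<close>
 define \<kappa> where "\<kappa> = \<delta> * sqrt (\<eta> / 2)"
 have k0: "\<kappa> > 0" using d eta by (simp add: \<kappa>_def)
 have k2: "2 * \<kappa>\<^sup>2 = \<delta>\<^sup>2 * \<eta>" using eta(1) by (simp add: \<kappa>_def power_mult_distrib)
 have core: "ennreal \<kappa> \<le> energy W {p..q} u D"
  if R: "regular_field u D" and fa: "\<forall>t. fst (xavg u t) = a" and z: "z \<in> wells" and pq: "p < q"
   and ends: "\<delta> \<le> \<bar>norm (xavg u p - z) - norm (xavg u q - z)\<bar>"
   and mid: "!!r. r \<in> {p..q} ==> \<delta> \<le> norm (xavg u r - z) \<and> norm (xavg u r - z) \<le> 2 * \<delta>" for u D z p q
 proof (rule ccontr)
  assume "\<not> ?thesis"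
  then have lt: "energy W {p..q} u D < ennreal \<kappa>" by simp
  then obtain x where x: "0 \<le> x" "energy W {p..q} u D = ennreal x" by (cases "energy W {p..q} u D") auto
  have xk: "x < \<kappa>" using lt x by (simp add: ennreal_less_iff)
  have "ennreal \<eta> * ennreal (q - p) \<le> ennreal x"
  proof (rule ccontr)
   assume "\<not> ?thesis"
   then have lt2: "(NN t. indicator {p..q} t * slice_energy W u D t) < ennreal \<eta> * emeasure lborel {p..q}"
    using pq x energy_eq_slices(1)[OF R W_cont, of "{p..q}"] by simp
   have "{p..q} \<in> sets borel" by simp
   from ex_small_time[OF energy_eq_slices(2)[OF R W_cont this] this lt2 eta(2)[OF R fa]]
   obtain r where r: "r \<in> {p..q}" and "\<exists>z\<in>wells. norm (xavg u r - z) < \<delta>" by blast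
   then obtain z' where z': "z' \<in> wells" "norm (xavg u r - z') < \<delta>" by blast
   \<comment> \<open>z itself is ruled out by the lower radius \<delta>, any other well by the
     separation 4 \<delta> against 2 \<delta> + \<delta>.\<close>
   have "z' \<noteq> z" using mid[OF r(1)] z'(2) by auto
   then have "4 * \<delta> \<le> norm (z' - z)" using sep z z'(1) by blast
   also have "... \<le> norm (xavg u r - z) + norm (xavg u r - z')" using norm_triangle_ineq4[of "xavg u r - z" "xavg u r - z'"] by simp
   also have "... < 2 * \<delta> + \<delta>" using mid[OF r(1)] z'(2) by simp
   finally show False using d by simp
  qed
  then have 1: "\<eta> * (q - p) \<le> x" using eta(1) pq x(1) by (simp add: ennreal_mult[symmetric])
  have "\<delta> \<le> norm (xavg u q - xavg u p)"
   using ends norm_triangle_ineq3[of "xavg u p - z" "xavg u q - z"] by (simp add: norm_minus_commute)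
  then have "\<delta>\<^sup>2 \<le> (norm (xavg u q - xavg u p))\<^sup>2" using d by (intro power_mono) auto
  moreover have "(norm (xavg u q - xavg u p))\<^sup>2 \<le> (q - p) * (2 * x)"
  proof -
   have "nsq (xavg u q - xavg u p) \<le> ennreal (q - p) * (2 * ennreal x)"
    using xavg_diff_le_energy[OF R W_cont W_nonneg, of p q] pq x(2) by simp
   also have "... = ennreal ((q - p) * (2 * x))" unfolding ennreal_two_mult[OF x(1)]
    by (rule ennreal_mult[symmetric]) (use pq x(1) in auto)
   finally show ?thesis using pq x(1) by (subst (asm) ennreal_le_iff) auto
  qed
  ultimately have "\<delta>\<^sup>2 \<le> (q - p) * (2 * x)" by linarith
  then have "\<delta>\<^sup>2 * \<eta> \<le> (q - p) * (2 * x) * \<eta>" using eta(1) by (intro mult_right_mono) auto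
  also have "... = (\<eta> * (q - p)) * (2 * x)" by simp
  also have "... \<le> x * (2 * x)" using 1 x(1) by (intro mult_right_mono) auto
  also have "... < 2 * \<kappa>\<^sup>2" using xk x(1) by (simp add: power2_eq_square mult_strict_mono')
  finally show False using k2 by simp
 qed
 show ?thesis
 proof (intro exI[of _ \<kappa>] conjI allI impI k0)
  fix u D z s t assume R: "regular_field u D" and fa: "\<forall>t. fst (xavg u t) = a" and z: "z \<in> wells" and st: "s \<le> t"
   and alt: "2 * \<delta> \<le> norm (xavg u s - z) \<and> norm (xavg u t - z) \<le> \<delta> \<or> norm (xavg u s - z) \<le> \<delta> \<and> 2 * \<delta> \<le> norm (xavg u t - z)"
  have c: "continuous_on {s..t} (xavg u)" using xavg_continuous[OF R] by (rule continuous_on_subset) simp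
  from alt show "ennreal \<kappa> \<le> energy W {s..t} u D"
  proof
   assume *: "2 * \<delta> \<le> norm (xavg u s - z) \<and> norm (xavg u t - z) \<le> \<delta>"
   have c1: "continuous_on {s..t} (%r. norm (xavg u r - z))" by (intro continuous_intros c)
   obtain p q where pq: "s \<le> p" "p < q" "q \<le> t" "norm (xavg u p - z) = 2 * \<delta>" "norm (xavg u q - z) = \<delta>"
    "!!r. r \<in> {p..q} ==> \<delta> \<le> norm (xavg u r - z) \<and> norm (xavg u r - z) \<le> 2 * \<delta>"
    using continuous_crossing[OF c1 st, of "2 * \<delta>" \<delta>] * d by auto
   have "ennreal \<kappa> \<le> energy W {p..q} u D" by (rule core[OF R fa z pq(2) _ pq(6)]) (use pq d in auto)
   also have "... \<le> energy W {s..t} u D" by (rule energy_mono) (use pq in auto)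
   finally show ?thesis .
  next
   assume *: "norm (xavg u s - z) \<le> \<delta> \<and> 2 * \<delta> \<le> norm (xavg u t - z)"
   have c1: "continuous_on {s..t} (%r. - norm (xavg u r - z))" by (intro continuous_intros c)
   obtain p q where pq: "s \<le> p" "p < q" "q \<le> t" "- norm (xavg u p - z) = - \<delta>" "- norm (xavg u q - z) = - 2 * \<delta>"
    "!!r. r \<in> {p..q} ==> - 2 * \<delta> \<le> - norm (xavg u r - z) \<and> - norm (xavg u r - z) \<le> - \<delta>"
    using continuous_crossing[OF c1 st, of "- \<delta>" "- 2 * \<delta>"] * d by auto
   have "ennreal \<kappa> \<le> energy W {p..q} u D"
   proof (rule core[OF R fa z pq(2)])
    show "\<delta> \<le> norm (xavg u r - z) \<and> norm (xavg u r - z) \<le> 2 * \<delta>" if "r \<in> {p..q}" for r using pq(6)[OF that] by simp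
   qed (use pq d in auto)
   also have "... \<le> energy W {s..t} u D" by (rule energy_mono) (use pq in auto)
   finally show ?thesis .
  qed
 qed
qed

text \<open>On a set of infinite length with finite energy some slice has energy at most \<eta>, so
  the average comes within \<delta> of a well. Moving from there to distance 2 \<delta> would cost
  \<kappa>, more than is available.\<close>

lemma low_energy_ray:
 assumes d: "\<delta> > 0" and sep: "!!z z'. z \<in> wells ==> z' \<in> wells ==> z \<noteq> z' ==> 4 * \<delta> \<le> norm (z - z')"
 shows "\<exists>\<kappa>>0. \<forall>u D J. regular_field u D \<longrightarrow> (\<forall>t. fst (xavg u t) = a) \<longrightarrow> J \<in> sets borel \<longrightarrow> is_interval J \<longrightarrow>
  emeasure lborel J = \<infinity> \<longrightarrow> energy W J u D < ennreal \<kappa> \<longrightarrow> (\<exists>z\<in>wells. \<forall>t\<in>J. norm (xavg u t - z) < 2 * \<delta>)"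
proof -
 obtain \<kappa> where k: "\<kappa> > 0" "!!u D z s t. regular_field u D ==> (\<forall>t. fst (xavg u t) = a) ==> z \<in> wells ==> s \<le> t ==>
  (2 * \<delta> \<le> norm (xavg u s - z) \<and> norm (xavg u t - z) \<le> \<delta> \<or> norm (xavg u s - z) \<le> \<delta> \<and> 2 * \<delta> \<le> norm (xavg u t - z)) ==>
  ennreal \<kappa> \<le> energy W {s..t} u D"
  using crossing_cost[OF d sep] by blast
 obtain \<eta> where eta: "\<eta> > 0" "!!u D. regular_field u D ==> (\<forall>t. fst (xavg u t) = a) ==>
  (AE t in lborel. slice_energy W u D t \<le> ennreal \<eta> \<longrightarrow> (\<exists>z\<in>wells. norm (xavg u t - z) < \<delta>))"
  using small_slice_energy_near_wells[OF d] by blast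
 show ?thesis
 proof (intro exI[of _ \<kappa>] conjI allI impI k(1))
  fix u D J assume R: "regular_field u D" and fa: "\<forall>t. fst (xavg u t) = a" and J: "J \<in> sets borel" and iv: "is_interval J"
   and inf: "emeasure lborel J = \<infinity>" and E: "energy W J u D < ennreal \<kappa>"
  have "energy W J u D < \<infinity>" using E by (metis ennreal_less_top infinity_ennreal_def less_trans)
  then have "(NN t. indicator J t * slice_energy W u D t) < ennreal \<eta> * emeasure lborel J"
   using energy_eq_slices(1)[OF R W_cont J] inf eta(1) by (simp add: ennreal_mult_top)
  from ex_small_time[OF energy_eq_slices(2)[OF R W_cont J] J this eta(2)[OF R fa]]
  obtain r z where r: "r \<in> J" and z: "z \<in> wells" "norm (xavg u r - z) < \<delta>" by blast
  show "\<exists>z\<in>wells. \<forall>t\<in>J. norm (xavg u t - z) < 2 * \<delta>"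
  proof (intro bexI[of _ z] ballI z(1), rule ccontr)
   fix t assume t: "t \<in> J" and "\<not> norm (xavg u t - z) < 2 * \<delta>"
   then have big: "2 * \<delta> \<le> norm (xavg u t - z)" by simp
   have "\<exists>s s'. s \<le> s' \<and> s \<in> J \<and> s' \<in> J \<and> ennreal \<kappa> \<le> energy W {s..s'} u D"
   proof (cases "r \<le> t")
    case True
    have "ennreal \<kappa> \<le> energy W {r..t} u D" by (rule k(2)[OF R fa z(1) True]) (use big z(2) in auto)
    then show ?thesis using True r t by blast
   next
    case False
    then have tr: "t \<le> r" by simp
    have "ennreal \<kappa> \<le> energy W {t..r} u D" by (rule k(2)[OF R fa z(1) tr]) (use big z(2) in auto)
    then show ?thesis using tr r t by blast
   qed
   then obtain s s' where s: "s \<le> s'" "s \<in> J" "s' \<in> J" "ennreal \<kappa> \<le> energy W {s..s'} u D" by blast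
   have "{s..s'} \<subseteq> J"
   proof
    fix r' assume "r' \<in> {s..s'}"
    then show "r' \<in> J" using mem_is_interval_1_I[OF iv s(2,3), of r'] by simp
   qed
   then have "ennreal \<kappa> \<le> energy W J u D" using s(4) energy_mono[of "{s..s'}" J W u D] by simp
   then show False using E by simp
  qed
 qed
qed

text \<open>At every scale some tail stays within 2 \<delta> of a well. That well is the same at all
  scales: two tails share a time, so the wells found at scales \<delta> and \<open>\<delta>0\<close>
  are closer than the separation of distinct wells.\<close>

lemma xavg_limit_along:
 assumes R: "regular_field u D" and fa: "\<forall>t. fst (xavg u t) = a" and fin: "energy W UNIV u D < \<infinity>"
  and J: "!!n. J n \<in> sets borel" "decseq J" "(\<Inter>n. J n) = {}" "!!n. is_interval (J n)" "!!n. emeasure lborel (J n) = \<infinity>"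
 shows "\<exists>z\<in>wells. \<forall>\<epsilon>>0. \<exists>n. \<forall>t\<in>J n. norm (xavg u t - z) < \<epsilon>"
proof -
 obtain \<delta>0 where d0: "\<delta>0 > 0" "!!z z'. z \<in> wells ==> z' \<in> wells ==> z \<noteq> z' ==> 4 * \<delta>0 \<le> norm (z - z')"
  by (rule wells_separated) blast
 have near: "\<exists>z\<in>wells. \<exists>n. \<forall>t\<in>J n. norm (xavg u t - z) < 2 * \<delta>" if d: "\<delta> > 0" "\<delta> \<le> \<delta>0" for \<delta>
 proof -
  have sep: "4 * \<delta> \<le> norm (z - z')" if "z \<in> wells" "z' \<in> wells" "z \<noteq> z'" for z z' using d0(2)[OF that] d(2) by simp
  obtain \<kappa> where k: "\<kappa> > 0" "!!u D J. regular_field u D ==> (\<forall>t. fst (xavg u t) = a) ==> J \<in> sets borel ==> is_interval J ==>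
   emeasure lborel J = \<infinity> ==> energy W J u D < ennreal \<kappa> ==> (\<exists>z\<in>wells. \<forall>t\<in>J. norm (xavg u t - z) < 2 * \<delta>)"
   using low_energy_ray[OF d(1) sep] by blast
  obtain n where "energy W (J n) u D < ennreal \<kappa>" using energy_tail[OF R W_cont fin J(1-3) k(1)] by blast
  from k(2)[OF R fa J(1) J(4) J(5) this] show ?thesis by blast
 qed
 obtain z0 n0 where z0: "z0 \<in> wells" "!!t. t \<in> J n0 ==> norm (xavg u t - z0) < 2 * \<delta>0" using near[OF d0(1) order_refl] by blast
 show ?thesis
 proof (intro bexI[of _ z0] allI impI z0(1))
  fix \<epsilon> :: real assume e: "\<epsilon> > 0"
  define \<delta> where "\<delta> = min \<delta>0 (\<epsilon> / 2)"
  have d: "\<delta> > 0" "\<delta> \<le> \<delta>0" "2 * \<delta> \<le> \<epsilon>" using e d0 by (auto simp: \<delta>_def)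
  obtain z n where z: "z \<in> wells" "!!t. t \<in> J n ==> norm (xavg u t - z) < 2 * \<delta>" using near[OF d(1,2)] by blast
  \<comment> \<open>Infinite measure makes the smaller of the two tails non-empty, which provides
    the common time.\<close>
  have "J (max n n0) \<noteq> {}" using J(5)[of "max n n0"] by auto
  then obtain t where "t \<in> J (max n n0)" by blast
  then have t: "t \<in> J n" "t \<in> J n0" using decseqD[OF J(2), of n "max n n0"] decseqD[OF J(2), of n0 "max n n0"] by auto
  have "norm (z - z0) \<le> norm (xavg u t - z0) + norm (xavg u t - z)" using norm_triangle_ineq4[of "xavg u t - z0" "xavg u t - z"] by simp
  also have "... < 2 * \<delta>0 + 2 * \<delta>" using z0(2)[OF t(2)] z(2)[OF t(1)] by simp
  finally have "norm (z - z0) < 4 * \<delta>0" using d(2) by simp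
  then have "z = z0" using d0(2)[OF z(1) z0(1)] by fastforce
  have "norm (xavg u t - z0) < \<epsilon>" if "t \<in> J n" for t using z(2)[OF that] d(3) \<open>z = z0\<close> by simp
  then show "\<exists>n. \<forall>t\<in>J n. norm (xavg u t - z0) < \<epsilon>" by blast
 qed
qed

lemma xavg_limit_at_top:
 assumes R: "regular_field u D" and fa: "\<forall>t. fst (xavg u t) = a" and fin: "energy W UNIV u D < \<infinity>"
 obtains z where "z \<in> wells" "(xavg u \<longlongrightarrow> z) at_top"
proof -
 have inter: "(\<Inter>n. {real n..}) = {}"
 proof -
  have "\<exists>n. \<not> real n \<le> x" for x using reals_Archimedean2[of x] not_le by blast
  then show ?thesis by auto
 qed
 have "\<exists>z\<in>wells. \<forall>\<epsilon>>0. \<exists>n. \<forall>t\<in>{real n..}. norm (xavg u t - z) < \<epsilon>"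
  by (rule xavg_limit_along[OF R fa fin _ _ inter]) (auto simp: decseq_def is_interval_1 emeasure_lborel_Ici)
 then obtain z where z: "z \<in> wells" "!!\<epsilon>. \<epsilon> > 0 ==> \<exists>n. \<forall>t\<in>{real n..}. norm (xavg u t - z) < \<epsilon>" by blast
 have "(xavg u \<longlongrightarrow> z) at_top"
 proof (rule tendstoI)
  fix \<epsilon> :: real assume "\<epsilon> > 0"
  then obtain n where "\<forall>t\<in>{real n..}. norm (xavg u t - z) < \<epsilon>" using z(2) by blast
  then show "\<forall>\<^sub>F t in at_top. dist (xavg u t) z < \<epsilon>"
   unfolding eventually_at_top_linorder by (intro exI[of _ "real n"]) (simp add: dist_norm)
 qed
 then show thesis using z(1) that by blast
qed

lemma xavg_limit_at_bot:
 assumes R: "regular_field u D" and fa: "\<forall>t. fst (xavg u t) = a" and fin: "energy W UNIV u D < \<infinity>"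
 obtains z where "z \<in> wells" "(xavg u \<longlongrightarrow> z) at_bot"
proof -
 have inter: "(\<Inter>n. {..- real n}) = {}"
 proof -
  have "\<exists>n. \<not> x \<le> - real n" for x
  proof -
   obtain n where "- x < real n" using reals_Archimedean2 by blast
   then show ?thesis by (intro exI[of _ n]) simp
  qed
  then show ?thesis by auto
 qed
 have "\<exists>z\<in>wells. \<forall>\<epsilon>>0. \<exists>n. \<forall>t\<in>{..- real n}. norm (xavg u t - z) < \<epsilon>"
  by (rule xavg_limit_along[OF R fa fin _ _ inter]) (auto simp: decseq_def is_interval_1 emeasure_lborel_Iic)
 then obtain z where z: "z \<in> wells" "!!\<epsilon>. \<epsilon> > 0 ==> \<exists>n. \<forall>t\<in>{..- real n}. norm (xavg u t - z) < \<epsilon>" by blast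
 have "(xavg u \<longlongrightarrow> z) at_bot"
 proof (rule tendstoI)
  fix \<epsilon> :: real assume "\<epsilon> > 0"
  then obtain n where "\<forall>t\<in>{..- real n}. norm (xavg u t - z) < \<epsilon>" using z(2) by blast
  then show "\<forall>\<^sub>F t in at_bot. dist (xavg u t) z < \<epsilon>"
   unfolding eventually_at_bot_linorder by (intro exI[of _ "- real n"]) (simp add: dist_norm)
 qed
 then show thesis using z(1) that by blast
qed

end

section \<open>Local compactness\<close>

text \<open>Bolzano-Weierstrass for each index i, combined by the diagonal argument.\<close>

lemma diagonal_convergent:
 fixes a :: "nat => nat => 'c::heine_borel"
 assumes b: "!!i. bounded (range (%n. a n i))"
 obtains r where "strict_mono r" "!!i. convergent (%n. a (r n) i)"
proof -
 interpret subseqs "%i s. convergent (%n. a (s n) i)"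
 proof
  fix i and s :: "nat => nat" assume "strict_mono s"
  have "bounded (range (%n. a (s n) i))" by (rule bounded_subset[OF b[of i]]) auto
  from bounded_imp_convergent_subsequence[OF this]
  obtain l r where "strict_mono r" "((%n. a (s n) i) \<circ> r) ~> l" by blast
  then show "\<exists>r'. strict_mono r' \<and> convergent (%n. a ((s \<circ> r') n) i)"
   by (intro exI[of _ r]) (auto simp: o_def convergent_def)
 qed
 have "convergent (%n. a (diagseq n) i)" for i
 proof -
  have "convergent (%n. a ((diagseq \<circ> ((+) (Suc i))) n) i)"
  proof (rule diagseq_holds)
   fix r s :: "nat => nat" and n assume "strict_mono r" "convergent (%k. a (s k) n)"
   then show "convergent (%k. a ((s \<circ> r) k) n)"
    using convergent_subseq_convergent[of "%k. a (s k) n" r] by (simp add: o_def)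
  qed
  then have "convergent (%n. a (diagseq (n + Suc i)) i)" by (simp add: o_def add.commute)
  then show ?thesis by (rule convergent_ignore_initial_segment[THEN iffD1])
 qed
 then show thesis using subseq_diagseq by (intro that)
qed

text \<open>Completeness of local L2 together with almost everywhere convergence of a subsequence.
  The subsequence depends only on the Cauchy bounds, which are uniform over A, so all components of
  a gradient share it; the full sequence still converges in L2 by Fatou.\<close>

lemma L2_local_limit:
 fixes f :: "nat => 'i => 'a::euclidean_space => 'b::euclidean_space" and C :: "nat => 'a set"
 assumes f: "!!n b. b \<in> A ==> f n b \<in> bmeas" and C[measurable]: "!!i. C i \<in> sets borel" and inc: "incseq C"
  and Cauchy: "!!i \<epsilon>. \<epsilon> > 0 ==> \<exists>N. \<forall>n\<ge>N. \<forall>m\<ge>N. \<forall>b\<in>A. (NN x. indicator (C i) x * nsq (f n b x - f m b x)) \<le> ennreal \<epsilon>"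
 obtains r where "strict_mono r" "!!b. b \<in> A ==> AE x in lborel. x \<in> (\<Union>i. C i) \<longrightarrow> (%n. f (r n) b x) ~> lim (%n. f (r n) b x)"
  "!!i b. b \<in> A ==> (%n. (NN x. indicator (C i) x * nsq (f n b x - lim (%k. f (r k) b x)))) ~> 0"
proof -
 have "\<forall>j. \<exists>N. \<forall>n\<ge>N. \<forall>m\<ge>N. \<forall>b\<in>A. (NN x. indicator (C j) x * nsq (f n b x - f m b x)) \<le> ennreal ((1/4)^j)"
  using Cauchy by simp
 from choice[OF this] obtain N where N: "!!j n m b. n \<ge> N j ==> m \<ge> N j ==> b \<in> A ==>
   (NN x. indicator (C j) x * nsq (f n b x - f m b x)) \<le> ennreal ((1/4)^j)" by blast
 \<comment> \<open>A strictly increasing sequence dominating every \<open>N i\<close> with i \<le>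
   j.\<close>
 define r where "r j = (\<Sum>i\<le>j. N i) + j" for j
 have r: "strict_mono r" by (auto simp: strict_mono_Suc_iff r_def)
 have rN: "N j \<le> r i" if "j \<le> i" for i j
 proof -
  have "N j \<le> (\<Sum>i\<le>i. N i)" using that by (intro member_le_sum) auto
  then show ?thesis by (simp add: r_def)
 qed
 have main: "(AE x in lborel. x \<in> (\<Union>i. C i) \<longrightarrow> (%n. f (r n) b x) ~> lim (%n. f (r n) b x)) \<and>
  (\<forall>i. (%n. (NN x. indicator (C i) x * nsq (f n b x - lim (%k. f (r k) b x)))) ~> 0)" if b: "b \<in> A" for b
 proof -
 note fb[measurable] = f[OF b]
 have ae: "AE x in lborel. x \<in> C i \<longrightarrow> convergent (%n. f (r n) b x)" for i
 proof -
  \<comment> \<open>The rate 4^-j leaves room for the weight 2^j: the weighted squares have summable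
    integrals, hence tend to 0 almost everywhere, and the increments are eventually bounded by the
    geometric sequence (1/2)^(j/2). Starting at index j + i places the estimate on a member of the
    exhaustion that contains C i.\<close>
  define g where "g j x = indicat_real (C i) x * (2^j * (norm (f (r (Suc (j + i))) b x - f (r (j + i)) b x))\<^sup>2)" for j x
  have "AE x in lborel. (%j. g j x) ~> 0"
  proof (rule sum_finite_nn_integral_AE_tendsto_0[where c="%j. (1/2)^j"])
   show "(NN x. ennreal (g j x)) \<le> ennreal ((1/2)^j)" for j
   proof -
    have sub: "C i \<subseteq> C (j + i)" using inc by (rule incseqD) simp
    have "(NN x. ennreal (g j x)) = (NN x. ennreal (2^j) * (indicator (C i) x * nsq (f (r (Suc (j + i))) b x - f (r (j + i)) b x)))"
     by (intro nn_integral_cong) (auto simp: g_def indicator_def ennreal_mult')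
    also have "... = ennreal (2^j) * (NN x. indicator (C i) x * nsq (f (r (Suc (j + i))) b x - f (r (j + i)) b x))"
     by (rule nn_integral_cmult) measurable
    also have "... \<le> ennreal (2^j) * (NN x. indicator (C (j + i)) x * nsq (f (r (Suc (j + i))) b x - f (r (j + i)) b x))"
     by (intro mult_left_mono nn_integral_subset_mono sub) simp
    also have "... \<le> ennreal (2^j) * ennreal ((1/4)^(j + i))"
     by (intro mult_left_mono N rN b) auto
    also have "... = ennreal (2^j * (1/4)^(j + i))" by (simp add: ennreal_mult')
    also have "... \<le> ennreal ((1/2)^j)"
    proof (rule ennreal_leI)
     have "(2::real)^j * (1/4)^(j + i) = (1/2)^j * (1/4)^i" by (simp add: power_add power_divide power_mult_distrib[symmetric] field_simps flip: power_mult)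
     also have "... \<le> (1/2)^j * 1" by (intro mult_left_mono power_le_one) auto
     finally show "(2::real)^j * (1/4)^(j + i) \<le> (1/2)^j" by simp
    qed
    finally show ?thesis .
   qed
   show "(%x. ennreal (g n x)) \<in> borel_measurable lborel" for n unfolding g_def by measurable
  qed (auto simp: g_def intro!: summable_geometric)
  then show ?thesis
  proof eventually_elim
   case (elim x)
   show ?case
   proof
    assume x: "x \<in> C i"
    have "\<forall>\<^sub>F j in sequentially. g j x < 1" using elim by (rule order_tendstoD(2)) simp
    then have "\<forall>\<^sub>F j in sequentially. norm (f (r (Suc (j + i))) b x - f (r (j + i)) b x) \<le> (sqrt (1/2))^j"
    proof eventually_elim
     case (elim j)
     then have "2^j * (norm (f (r (Suc (j + i))) b x - f (r (j + i)) b x))\<^sup>2 < 1" using x by (simp add: g_def)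
     then have "(norm (f (r (Suc (j + i))) b x - f (r (j + i)) b x))\<^sup>2 \<le> (1/2)^j"
      by (simp add: field_simps power_one_over)
     also have "(1/2::real)^j = ((sqrt (1/2))^j)\<^sup>2" by (simp flip: power_mult add: mult.commute[of j] power_mult)
     finally show ?case by (rule power2_le_imp_le) simp
    qed
    moreover have "summable (%j. (sqrt (1/2))^j)" by (rule summable_geometric) (simp add: real_sqrt_lt_1_iff)
    ultimately have "summable (%j. f (r (Suc (j + i))) b x - f (r (j + i)) b x)"
     by (rule summable_comparison_test_ev)
    then have "convergent (%n. \<Sum>j<n. f (r (Suc (j + i))) b x - f (r (j + i)) b x)" by (rule summable_iff_convergent[THEN iffD1])
    moreover have "(\<Sum>j<n. f (r (Suc (j + i))) b x - f (r (j + i)) b x) = f (r (n + i)) b x - f (r i) b x" for n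
     using sum_lessThan_telescope[of "%j. f (r (j + i)) b x" n] by simp
    ultimately have "convergent (%n. f (r (n + i)) b x - f (r i) b x)" by simp
    then have "convergent (%n. (f (r (n + i)) b x - f (r i) b x) + f (r i) b x)" by (rule convergent_add[OF _ convergent_const])
    then have "convergent (%n. f (r (n + i)) b x)" by simp
    then show "convergent (%n. f (r n) b x)" by (rule convergent_ignore_initial_segment[THEN iffD1])
   qed
  qed
 qed
 have AE: "AE x in lborel. x \<in> (\<Union>i. C i) \<longrightarrow> (%n. f (r n) b x) ~> lim (%n. f (r n) b x)"
 proof -
  have "AE x in lborel. \<forall>i. x \<in> C i \<longrightarrow> convergent (%n. f (r n) b x)" unfolding AE_all_countable using ae by blast
  then show ?thesis by eventually_elim (auto simp: convergent_LIMSEQ_iff)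
 qed
 define h where "h x = lim (%n. f (r n) b x)" for x
 have hm[measurable]: "h \<in> bmeas" unfolding h_def by (rule borel_measurable_lim_metric) (rule fb)
 have lim0: "(%n. (NN x. indicator (C i) x * nsq (f n b x - h x))) ~> 0" for i
 proof (rule order_tendstoI)
  fix e :: ennreal assume "0 < e"
  obtain \<epsilon> where eps: "0 < \<epsilon>" "ennreal \<epsilon> < e"
  proof (cases e)
   case (real t) then show ?thesis using \<open>0 < e\<close> that[of "t/2"] by (auto simp: ennreal_less_iff)
  next
   case top then show ?thesis using that[of 1] by simp
  qed
  obtain N' where N': "!!n m. n \<ge> N' ==> m \<ge> N' ==> (NN x. indicator (C i) x * nsq (f n b x - f m b x)) \<le> ennreal \<epsilon>"
   using Cauchy[OF eps(1), of i] b by blast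
  have "(NN x. indicator (C i) x * nsq (f n b x - h x)) \<le> ennreal \<epsilon>" if n: "n \<ge> N'" for n
  proof -
   \<comment> \<open>Fatou along the subsequence, with n fixed, turns the Cauchy bound into a bound
     on the distance to the limit.\<close>
   have "(NN x. indicator (C i) x * nsq (f n b x - h x)) \<le> (NN x. liminf (%j. indicator (C i) x * nsq (f n b x - f (r j) b x)))"
   proof (rule nn_integral_mono_AE, use AE in eventually_elim)
    fix x assume ax: "x \<in> (\<Union>i. C i) \<longrightarrow> (%n. f (r n) b x) ~> lim (%n. f (r n) b x)"
    show "indicator (C i) x * nsq (f n b x - h x) \<le> liminf (%j. indicator (C i) x * nsq (f n b x - f (r j) b x))"
    proof (cases "x \<in> C i")
     case True
     then have "(%n. f (r n) b x) ~> h x" using ax by (auto simp: h_def)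
     then have "(%j. nsq (f n b x - f (r j) b x)) ~> nsq (f n b x - h x)"
      by (intro tendsto_ennrealI tendsto_intros)
     then have "liminf (%j. nsq (f n b x - f (r j) b x)) = nsq (f n b x - h x)"
      by (intro lim_imp_Liminf) auto
     then show ?thesis using True by simp
    qed simp
   qed
   also have "... \<le> liminf (%j. (NN x. indicator (C i) x * nsq (f n b x - f (r j) b x)))"
    by (rule nn_integral_liminf) measurable
   also have "... \<le> ennreal \<epsilon>"
   proof (rule Liminf_le)
    show "\<forall>\<^sub>F j in sequentially. (NN x. indicator (C i) x * nsq (f n b x - f (r j) b x)) \<le> ennreal \<epsilon>"
     unfolding eventually_sequentially using N'[OF n] seq_suble[OF r] by (meson order_trans)
   qed simp
   finally show ?thesis .
  qed
  then show "\<forall>\<^sub>F n in sequentially. (NN x. indicator (C i) x * nsq (f n b x - h x)) < e"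
   unfolding eventually_sequentially using eps(2) by (meson le_less_trans)
 qed simp

 show ?thesis using AE lim0[unfolded h_def] by blast
 qed
 show thesis by (rule that[OF r]) (use main in blast)+
qed

text \<open>By Cauchy-Schwarz on a set of finite measure, L2 convergence passes to integrals against
  a bounded weight supported there.\<close>

lemma integral_weight_tendsto:
 fixes f :: "nat => 'a::euclidean_space => 'b::euclidean_space"
 assumes f[measurable]: "!!n. f n \<in> bmeas" and g[measurable]: "g \<in> bmeas"
  and C[measurable]: "C \<in> sets borel" and Cf: "emeasure lborel C < \<infinity>"
  and fi: "!!n. set_integrable lborel C (f n)" and gi: "set_integrable lborel C g"
  and lim: "(%n. (NN x. indicator C x * nsq (f n x - g x))) ~> 0"
  and \<phi>[measurable]: "\<phi> \<in> bmeas" and \<phi>z: "!!x. x \<notin> C ==> \<phi> x = 0" and \<phi>M: "!!x. \<bar>\<phi> x\<bar> \<le> M"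
 shows "(%n. (LBINT x. \<phi> x *R f n x)) ~> (LBINT x. \<phi> x *R g x)"
proof -
 have M0: "0 \<le> M" using \<phi>M[of 0] by linarith
 have i1: "integrable lborel (%x. \<phi> x *R f n x)" for n by (rule integrable_bounded_support[OF fi f \<phi> \<phi>z \<phi>M])
 have i2: "integrable lborel (%x. \<phi> x *R g x)" by (rule integrable_bounded_support[OF gi g \<phi> \<phi>z \<phi>M])
 have bd: "nsq ((LBINT x. \<phi> x *R f n x) - (LBINT x. \<phi> x *R g x)) \<le> emeasure lborel C * (ennreal (M\<^sup>2) * (NN x. indicator C x * nsq (f n x - g x)))" for n
 proof -
  have "(LBINT x. \<phi> x *R f n x) - (LBINT x. \<phi> x *R g x) = (LBINT x. \<phi> x *R f n x - \<phi> x *R g x)"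
   using i1 i2 by simp
  also have "... = (LBINT x. indicator C x *R (\<phi> x *R (f n x - g x)))"
   by (intro Bochner_Integration.integral_cong) (use \<phi>z in \<open>auto simp: indicator_def algebra_simps\<close>)
  finally have "nsq ((LBINT x. \<phi> x *R f n x) - (LBINT x. \<phi> x *R g x))
   \<le> emeasure lborel C * (NN x. indicator C x * nsq (\<phi> x *R (f n x - g x)))"
   using norm_set_integral_power2_le[of C lborel "%x. \<phi> x *R (f n x - g x)"] by simp
  also have "... \<le> emeasure lborel C * (NN x. ennreal (M\<^sup>2) * (indicator C x * nsq (f n x - g x)))"
  proof (intro mult_left_mono nn_integral_mono)
   fix x
   have "(norm (\<phi> x *R (f n x - g x)))\<^sup>2 \<le> M\<^sup>2 * (norm (f n x - g x))\<^sup>2"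
    unfolding norm_scaleR power_mult_distrib by (intro mult_right_mono power_mono \<phi>M) auto
   then have "nsq (\<phi> x *R (f n x - g x)) \<le> ennreal (M\<^sup>2) * nsq (f n x - g x)"
    by (simp add: ennreal_mult[symmetric] ennreal_leI)
   then show "indicator C x * nsq (\<phi> x *R (f n x - g x)) \<le> ennreal (M\<^sup>2) * (indicator C x * nsq (f n x - g x))"
    by (cases "x \<in> C") auto
  qed simp
  also have "... = emeasure lborel C * (ennreal (M\<^sup>2) * (NN x. indicator C x * nsq (f n x - g x)))"
   by (subst nn_integral_cmult) auto
  finally show ?thesis .
 qed
 have "(%n. emeasure lborel C * (ennreal (M\<^sup>2) * (NN x. indicator C x * nsq (f n x - g x)))) ~> emeasure lborel C * (ennreal (M\<^sup>2) * 0)"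
  by (intro ennreal_tendsto_cmult lim) (use Cf in auto)
 then have up: "(%n. emeasure lborel C * (ennreal (M\<^sup>2) * (NN x. indicator C x * nsq (f n x - g x)))) ~> 0"
  by simp
 have "(%n. nsq ((LBINT x. \<phi> x *R f n x) - (LBINT x. \<phi> x *R g x))) ~> 0"
  by (rule tendsto_sandwich[OF always_eventually[OF allI[OF zero_le]] always_eventually[OF allI[OF bd]] tendsto_const up])
 then have "(%n. (norm ((LBINT x. \<phi> x *R f n x) - (LBINT x. \<phi> x *R g x)))\<^sup>2) ~> 0"
  using tendsto_ennreal_iff[of "%n. (norm ((LBINT x. \<phi> x *R f n x) - (LBINT x. \<phi> x *R g x)))\<^sup>2" sequentially 0] by simp
 then have "(%n. sqrt ((norm ((LBINT x. \<phi> x *R f n x) - (LBINT x. \<phi> x *R g x)))\<^sup>2)) ~> sqrt 0" by (rule tendsto_real_sqrt)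
 then show ?thesis by (simp add: LIM_zero_iff tendsto_norm_zero_iff)
qed

text \<open>Each test function is supported in one member of the exhaustion, and both sides of its
  integration by parts pass to the limit there.\<close>

lemma borel_grad_limit:
 fixes w :: "nat => 'a::euclidean_space => 'b::euclidean_space" and C :: "nat => 'a set"
 assumes B: "!!n. borel_grad UNIV (w n) (F n)"
  and u[measurable]: "u \<in> bmeas" and D: "!!b. b \<in> Basis ==> D b \<in> bmeas"
  and C: "!!i. compact (C i)" and cover: "!!K. compact K ==> \<exists>i. K \<subseteq> C i"
  and lu: "!!i. (%n. (NN x. indicator (C i) x * nsq (w n x - u x))) ~> 0"
  and lD: "!!i b. b \<in> Basis ==> (%n. (NN x. indicator (C i) x * nsq (F n b x - D b x))) ~> 0"
 shows "borel_grad UNIV u D"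
proof -
 have Cm[measurable]: "C i \<in> sets borel" for i using C by (rule borel_compact)
 have Cf: "emeasure lborel (C i) < \<infinity>" for i using C by (intro emeasure_bounded_finite compact_imp_bounded)
 have L2: "set_integrable lborel (C i) (%x. (norm (g x))\<^sup>2)" "set_integrable lborel (C i) g"
  if g[measurable]: "g \<in> bmeas" and f[measurable]: "!!n. f n \<in> bmeas"
   and lim: "(%n. (NN x. indicator (C i) x * nsq (f n x - g x))) ~> 0"
   and fi: "!!n. set_integrable lborel (C i) (%x. (norm (f n x))\<^sup>2)" for f :: "nat => 'a => 'b" and g i
 proof -
  have "\<forall>\<^sub>F n in sequentially. (NN x. indicator (C i) x * nsq (f n x - g x)) < 1"
   using lim by (rule order_tendstoD(2)) simp
  then obtain n where n: "(NN x. indicator (C i) x * nsq (f n x - g x)) < 1"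
   by (meson eventually_happens' sequentially_bot)
  have "(NN x. indicator (C i) x * nsq (g x)) = (NN x. indicator (C i) x * nsq ((g x - f n x) + f n x))" by simp
  also have "... \<le> 2 * (NN x. indicator (C i) x * nsq (g x - f n x)) + 2 * (NN x. indicator (C i) x * nsq (f n x))"
   by (rule nn_integral_norm_add_power2_le) measurable
  also have "... < \<infinity>"
  proof -
   have "(NN x. indicator (C i) x * nsq (g x - f n x)) < \<infinity>"
    using n by (simp add: norm_minus_commute order.strict_trans[OF _ ennreal_one_less_top])
   then show ?thesis using set_integrable_L2D[OF fi[of n]] by (simp add: ennreal_mult_less_top)
  qed
  finally show "set_integrable lborel (C i) (%x. (norm (g x))\<^sup>2)" "set_integrable lborel (C i) g"
   using set_integrable_finite_L2[of g lborel "C i"] Cf by simp_all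
 qed
 have wm: "w n \<in> bmeas" for n by (rule borel_gradD(2)[OF B])
 have Fm: "F n b \<in> bmeas" if "b \<in> Basis" for n b by (rule borel_gradD(3)[OF B that])
 have uL: "set_integrable lborel (C i) (%x. (norm (u x))\<^sup>2)" "set_integrable lborel (C i) u" for i
  using L2[OF u wm lu borel_gradD(4)[OF B C]] by simp_all
 have DL: "set_integrable lborel (C i) (%x. (norm (D b x))\<^sup>2)" "set_integrable lborel (C i) (D b)" if b: "b \<in> Basis" for i b
  using L2[OF D[OF b] Fm[OF b] lD[OF b] borel_gradD(5)[OF B C _ b]] by simp_all
 show ?thesis unfolding borel_grad_def
 proof (intro conjI allI impI ballI)
  fix K :: "'a set" assume "compact K \<and> K \<subseteq> UNIV"
  then have K: "compact K" by simp
  obtain i where i: "K \<subseteq> C i" using cover[OF K] by blast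
  have Km: "K \<in> sets lborel" using K by (simp add: borel_compact)
  show "set_integrable lborel K (%x. (norm (u x))\<^sup>2)" by (rule set_integrable_subset[OF uL(1)[of i] Km i])
  show "set_integrable lborel K (%x. (norm (D b x))\<^sup>2)" if "b \<in> Basis" for b by (rule set_integrable_subset[OF DL(1)[OF that, of i] Km i])
 next
  fix \<phi> :: "'a => real" and \<phi>' and b :: 'a assume t: "test_fun \<phi> \<phi>' UNIV" and b: "b \<in> Basis"
  obtain K where K: "compact K" "K \<subseteq> UNIV" "!!x. x \<notin> K ==> \<phi> x = 0" "!!x. x \<notin> K ==> \<phi>' x = (%_. 0)"
   using test_fun_support[OF t] by metis
  obtain M where M: "0 \<le> M" "!!x. \<bar>\<phi> x\<bar> \<le> M" "!!x. \<bar>\<phi>' x b\<bar> \<le> M" using test_fun_bounded[OF t, of b] by metis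
  obtain i where i: "K \<subseteq> C i" using cover[OF K(1)] by blast
  have z: "\<phi> x = 0" "\<phi>' x b = 0" if "x \<notin> C i" for x
  proof -
   have "x \<notin> K" using that i by blast
   then show "\<phi> x = 0" "\<phi>' x b = 0" using K(3)[of x] K(4)[of x] by simp_all
  qed
  have "(%n. (LBINT x. \<phi> x *R F n b x)) ~> (LBINT x. \<phi> x *R D b x)"
   by (rule integral_weight_tendsto[OF Fm[OF b] D[OF b] Cm Cf borel_grad_L1(2)[OF B C _ b] DL(2)[OF b] lD[OF b] test_fun_borel(1)[OF t] z(1) M(2)]) auto
  moreover have "(%n. (LBINT x. \<phi>' x b *R w n x)) ~> (LBINT x. \<phi>' x b *R u x)"
   by (rule integral_weight_tendsto[OF wm u Cm Cf borel_grad_L1(1)[OF B C] uL(2) lu test_fun_borel(2)[OF t] z(2) M(3)]) auto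
  then have "(%n. - (LBINT x. \<phi>' x b *R w n x)) ~> - (LBINT x. \<phi>' x b *R u x)" by (rule tendsto_minus)
  ultimately show "(LBINT x. \<phi> x *R D b x) = - (LBINT x. \<phi>' x b *R u x)"
   unfolding borel_gradD(6)[OF B t b] by (rule LIMSEQ_unique)
 qed (use u D in auto)
qed

lemma borel_grad_lincomb:
 fixes u v :: "'a::euclidean_space => 'b::euclidean_space"
 assumes "borel_grad S u D" "borel_grad S v G"
 shows "borel_grad S (%x. \<alpha> *R u x + \<beta> *R v x) (%b x. \<alpha> *R D b x + \<beta> *R G b x)"
proof -
 note U = borel_gradD[OF assms(1)] and V = borel_gradD[OF assms(2)]
 have L2: "set_integrable lborel K (%x. (norm (\<alpha> *R f x + \<beta> *R g x))\<^sup>2)"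
  if [measurable]: "f \<in> bmeas" "g \<in> bmeas" and K: "compact K"
   and f: "set_integrable lborel K (%x. (norm (f x))\<^sup>2)" and g: "set_integrable lborel K (%x. (norm (g x))\<^sup>2)" for f g :: "'a => 'b" and K
 proof -
  have Km[measurable]: "K \<in> sets borel" using K by (rule borel_compact)
  have "set_integrable lborel K (%x. (2 * \<alpha>\<^sup>2) * (norm (f x))\<^sup>2 + (2 * \<beta>\<^sup>2) * (norm (g x))\<^sup>2)"
   by (intro set_integral_add set_integrable_mult_right f g)
  then show ?thesis unfolding set_integrable_def
  proof (rule Bochner_Integration.integrable_bound)
   have "(norm (\<alpha> *R f x + \<beta> *R g x))\<^sup>2 \<le> (2 * \<alpha>\<^sup>2) * (norm (f x))\<^sup>2 + (2 * \<beta>\<^sup>2) * (norm (g x))\<^sup>2" for x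
    using norm_add_power2_le[of "\<alpha> *R f x" "\<beta> *R g x"] by (simp add: power_mult_distrib)
   then show "AE x in lborel. norm (indicat_real K x *R (norm (\<alpha> *R f x + \<beta> *R g x))\<^sup>2) \<le> norm (indicat_real K x *R ((2 * \<alpha>\<^sup>2) * (norm (f x))\<^sup>2 + (2 * \<beta>\<^sup>2) * (norm (g x))\<^sup>2))"
    by (intro AE_I2) (auto simp: indicator_def)
  qed measurable
 qed
 show ?thesis unfolding borel_grad_def
 proof (intro conjI allI impI ballI)
  show "(%x. \<alpha> *R u x + \<beta> *R v x) \<in> bmeas" using U(2) V(2) by measurable
  show "(%x. \<alpha> *R D b x + \<beta> *R G b x) \<in> bmeas" if "b \<in> Basis" for b using U(3)[OF that] V(3)[OF that] by measurable
  fix K :: "'a set" assume "compact K \<and> K \<subseteq> S"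
  then have K: "compact K" "K \<subseteq> S" by simp_all
  show "set_integrable lborel K (%x. (norm (\<alpha> *R u x + \<beta> *R v x))\<^sup>2)" by (rule L2[OF U(2) V(2) K(1) U(4)[OF K] V(4)[OF K]])
  show "set_integrable lborel K (%x. (norm (\<alpha> *R D b x + \<beta> *R G b x))\<^sup>2)" if "b \<in> Basis" for b
   by (rule L2[OF U(3)[OF that] V(3)[OF that] K(1) U(5)[OF K that] V(5)[OF K that]])
 next
  fix \<phi> :: "'a => real" and \<phi>' and b :: 'a assume t: "test_fun \<phi> \<phi>' S" and b: "b \<in> Basis"
  obtain K where K: "compact K" "K \<subseteq> S" "!!x. x \<notin> K ==> \<phi> x = 0" "!!x. x \<notin> K ==> \<phi>' x = (%_. 0)"
   using test_fun_support[OF t] by metis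
  obtain M where M: "0 \<le> M" "!!x. \<bar>\<phi> x\<bar> \<le> M" "!!x. \<bar>\<phi>' x b\<bar> \<le> M" using test_fun_bounded[OF t, of b] by metis
  have z: "\<phi>' x b = 0" if "x \<notin> K" for x using K(4)[OF that] by simp
  have iD: "integrable lborel (%x. \<phi> x *R D b x)"
   by (rule integrable_bounded_support[OF borel_grad_L1(2)[OF assms(1) K(1,2) b] U(3)[OF b] test_fun_borel(1)[OF t] K(3) M(2)])
  have iG: "integrable lborel (%x. \<phi> x *R G b x)"
   by (rule integrable_bounded_support[OF borel_grad_L1(2)[OF assms(2) K(1,2) b] V(3)[OF b] test_fun_borel(1)[OF t] K(3) M(2)])
  have iu: "integrable lborel (%x. \<phi>' x b *R u x)"
   by (rule integrable_bounded_support[OF borel_grad_L1(1)[OF assms(1) K(1,2)] U(2) test_fun_borel(2)[OF t] z M(3)])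
  have iv: "integrable lborel (%x. \<phi>' x b *R v x)"
   by (rule integrable_bounded_support[OF borel_grad_L1(1)[OF assms(2) K(1,2)] V(2) test_fun_borel(2)[OF t] z M(3)])
  have comm: "(LBINT x. g x *R (\<alpha> *R p x + \<beta> *R q x)) = \<alpha> *R (LBINT x. g x *R p x) + \<beta> *R (LBINT x. g x *R q x)"
   if "integrable lborel (%x. g x *R p x)" "integrable lborel (%x. g x *R q x)" for g :: "'a => real" and p q :: "'a => 'b"
  proof -
   have "(LBINT x. g x *R (\<alpha> *R p x + \<beta> *R q x)) = (LBINT x. \<alpha> *R (g x *R p x) + \<beta> *R (g x *R q x))"
    by (intro Bochner_Integration.integral_cong refl) (simp add: scaleR_add_right mult.commute)
   also have "... = \<alpha> *R (LBINT x. g x *R p x) + \<beta> *R (LBINT x. g x *R q x)"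
    using that by (simp only: integral_scaleR_right Bochner_Integration.integral_add integrable_scaleR_right)
   finally show ?thesis .
  qed
  show "(LBINT x. \<phi> x *R (\<alpha> *R D b x + \<beta> *R G b x)) = - (LBINT x. \<phi>' x b *R (\<alpha> *R u x + \<beta> *R v x))"
   unfolding comm[OF iD iG] comm[OF iu iv] U(6)[OF t b] V(6)[OF t b] by simp
 qed (rule U(1))
qed

lemma borel_grad_midpoint:
 fixes u v :: "'a::euclidean_space => 'b::euclidean_space"
 assumes "borel_grad S u D" "borel_grad S v G"
 shows "borel_grad S (%x. (1/2) *R (u x + v x)) (%b x. (1/2) *R (D b x + G b x))"
 using borel_grad_lincomb[OF assms, of "1/2" "1/2"] by (simp add: scaleR_add_right)

section \<open>Averages over small balls\<close>

text \<open>A mollifier with constant kernel. The compactness argument uses three properties: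
  closeness to u uniformly in terms of the gradient, a Lipschitz bound, and a pointwise bound; each
  of them follows directly from Cauchy-Schwarz or the translation estimates.\<close>

definition ball_avg :: "real => ('a::euclidean_space => 'b::euclidean_space) => 'a => 'b" where
 "ball_avg \<rho> f x = (1 / measure lborel (cball (0::'a) \<rho>)) *R (LBINT y. indicator (cball 0 \<rho>) y *R f (x + y))"

context
 fixes u :: "'a::euclidean_space => 'b::euclidean_space" and D and C :: "'a set" and \<rho> :: real
 assumes B: "borel_grad UNIV u D" and C: "convex C" and Cm: "C \<in> sets borel" and \<rho>: "\<rho> > 0"
begin

private lemma um: "u \<in> bmeas" by (rule borel_gradD(2)[OF B])

private lemma Sm: "cball (0::'a) \<rho> \<in> sets borel" by simp

private lemma Spos: "measure lborel (cball (0::'a) \<rho>) > 0" using content_cball_pos[OF \<rho>, of "0::'a"] by simp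

private lemma Se: "emeasure lborel (cball (0::'a) \<rho>) = ennreal (measure lborel (cball (0::'a) \<rho>))"
proof -
 have "emeasure lborel (cball (0::'a) \<rho>) < \<infinity>" by (rule emeasure_bounded_finite[OF bounded_cball])
 then show ?thesis by (intro emeasure_eq_ennreal_measure) simp
qed

private lemma ui: "integrable lborel (%y. indicator (cball 0 \<rho>) y *R u (x + y))"
proof -
 have "set_integrable lborel (cball x \<rho>) u" by (rule borel_grad_L1(1)[OF B]) auto
 from integrable_shift[OF this[unfolded set_integrable_def], of x]
 have "integrable lborel (%y. indicator (cball x \<rho>) (y + x) *R u (y + x))" .
 moreover have "indicat_real (cball x \<rho>) (y + x) = indicator (cball 0 \<rho>) y" for y
  by (simp add: indicator_def dist_norm norm_minus_commute)
 ultimately show ?thesis by (simp add: add.commute)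
qed

private lemma norm_ball_integral_le:
 fixes g :: "'a => 'b"
 assumes [measurable]: "g \<in> bmeas"
 shows "nsq ((1 / measure lborel (cball (0::'a) \<rho>)) *R (LBINT y. indicator (cball 0 \<rho>) y *R g y))
  \<le> ennreal (1 / measure lborel (cball (0::'a) \<rho>)) * (NN y. indicator (cball 0 \<rho>) y * nsq (g y))"
proof -
 let ?s = "measure lborel (cball (0::'a) \<rho>)"
 let ?I = "(LBINT y. indicator (cball 0 \<rho>) y *R g y)"
 have "nsq ((1 / ?s) *R ?I) = ennreal ((1 / ?s)\<^sup>2) * nsq ?I"
  by (simp add: ennreal_mult[symmetric] power_mult_distrib power_divide)
 also have "... \<le> ennreal ((1 / ?s)\<^sup>2) * (emeasure lborel (cball (0::'a) \<rho>) * (NN y. indicator (cball 0 \<rho>) y * nsq (g y)))"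
  by (intro mult_left_mono norm_set_integral_power2_le) (use Sm in auto)
 also have "... = (ennreal ((1 / ?s)\<^sup>2) * ennreal ?s) * (NN y. indicator (cball 0 \<rho>) y * nsq (g y))"
  unfolding Se by (simp add: mult.assoc)
 also have "ennreal ((1 / ?s)\<^sup>2) * ennreal ?s = ennreal (1 / ?s)"
  using Spos by (simp add: ennreal_mult[symmetric] power2_eq_square)
 finally show ?thesis .
qed

text \<open>u minus its average is an average of differences over the ball. The normalisation from
  Jensen cancels the measure of the ball S in the estimate for pairs, which leaves \<rho>^2.\<close>

lemma ball_avg_close:
 assumes K[measurable]: "K \<in> sets borel" and KC: "!!x y. x \<in> K ==> norm (y - x) \<le> \<rho> ==> y \<in> C"
 shows "(NN x. indicator K x * nsq (u x - ball_avg \<rho> u x)) \<le> ennreal (\<rho>\<^sup>2) * (NN x. indicator C x * ennreal (sq_grad D x))"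
proof -
 let ?S = "cball (0::'a) \<rho>" and ?s = "measure lborel (cball (0::'a) \<rho>)"
 note [measurable] = um Sm Cm
 have "(NN x. indicator K x * nsq (u x - ball_avg \<rho> u x))
  \<le> (NN x. ennreal (1 / ?s) * (NN y. indicator C x * indicator C y * indicator ?S (y - x) * nsq (u y - u x)))"
 proof (rule nn_integral_mono)
  fix x
  show "indicator K x * nsq (u x - ball_avg \<rho> u x) \<le> ennreal (1 / ?s) * (NN y. indicator C x * indicator C y * indicator ?S (y - x) * nsq (u y - u x))"
  proof (cases "x \<in> K")
   case True
   have "x \<in> C" using KC[OF True, of x] \<rho> by simp
   have "(LBINT y. indicator ?S y *R (u (x + y) - u x)) = (LBINT y. indicator ?S y *R u (x + y)) - ?s *R u x"
   proof -
    have "integrable lborel (%y. indicator ?S y *R u x)" using Se by (intro integrable_scaleR_left integrable_real_indicator) auto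
    moreover have "(LBINT y. indicator ?S y *R u x) = ?s *R u x" using Se by simp
    ultimately show ?thesis unfolding scaleR_diff_right using ui by simp
   qed
   then have "ball_avg \<rho> u x - u x = (1 / ?s) *R (LBINT y. indicator ?S y *R (u (x + y) - u x))"
    using Spos by (simp add: ball_avg_def scaleR_diff_right)
   then have "norm (u x - ball_avg \<rho> u x) = norm ((1 / ?s) *R (LBINT y. indicator ?S y *R (u (x + y) - u x)))"
    by (subst norm_minus_commute) simp
   then have "nsq (u x - ball_avg \<rho> u x) \<le> ennreal (1 / ?s) * (NN y. indicator ?S y * nsq (u (x + y) - u x))"
    using norm_ball_integral_le[of "%y. u (x + y) - u x"] by simp
   also have "(NN y. indicator ?S y * nsq (u (x + y) - u x)) = (NN y. indicator ?S (y - x) * nsq (u y - u x))"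
    using nn_integral_shift[of "%y. indicator ?S (y - x) * nsq (u y - u x)" x] by (simp add: add.commute)
   also have "... = (NN y. indicator C x * indicator C y * indicator ?S (y - x) * nsq (u y - u x))"
   proof (rule nn_integral_cong)
    fix y
    show "indicator ?S (y - x) * nsq (u y - u x) = indicator C x * indicator C y * indicator ?S (y - x) * nsq (u y - u x)"
     using KC[OF True, of y] \<open>x \<in> C\<close> by (cases "y - x \<in> ?S") auto
   qed
   finally show ?thesis using True by simp
  qed simp
 qed
 also have "... = ennreal (1 / ?s) * (NN x. (NN y. indicator C x * indicator C y * indicator ?S (y - x) * nsq (u y - u x)))"
  by (rule nn_integral_cmult) measurable
 also have "... \<le> ennreal (1 / ?s) * (emeasure lborel ?S * (ennreal (\<rho>\<^sup>2) * (NN x. indicator C x * ennreal (sq_grad D x))))"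
  by (intro mult_left_mono translation_estimate_pairs[OF B C Cm Sm]) auto
 also have "... = (ennreal (1 / ?s) * ennreal ?s) * (ennreal (\<rho>\<^sup>2) * (NN x. indicator C x * ennreal (sq_grad D x)))"
  unfolding Se by (simp add: mult.assoc)
 also have "ennreal (1 / ?s) * ennreal ?s = 1" using Spos by (simp add: ennreal_mult[symmetric])
 finally show ?thesis by simp
qed

text \<open>The difference of two averages is the average of u minus a translate of u by x' - x, so
  the translation estimate applies. The constant deteriorates with the measure of the ball, but
  \<rho> is fixed when it is used.\<close>

lemma ball_avg_Lipschitz:
 assumes "!!y. norm (y - x) \<le> \<rho> ==> y \<in> C" "!!y. norm (y - x') \<le> \<rho> ==> y \<in> C"
 shows "nsq (ball_avg \<rho> u x' - ball_avg \<rho> u x) \<le> ennreal (1 / measure lborel (cball (0::'a) \<rho>)) * (nsq (x' - x) * (NN x. indicator C x * ennreal (sq_grad D x)))"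
proof -
 let ?S = "cball (0::'a) \<rho>" and ?s = "measure lborel (cball (0::'a) \<rho>)"
 note [measurable] = um Sm Cm
 have "ball_avg \<rho> u x' - ball_avg \<rho> u x = (1 / ?s) *R (LBINT y. indicator ?S y *R (u (x' + y) - u (x + y)))"
  unfolding ball_avg_def scaleR_diff_right using ui[of x] ui[of x'] by (simp add: scaleR_diff_right)
 then have "nsq (ball_avg \<rho> u x' - ball_avg \<rho> u x) \<le> ennreal (1 / ?s) * (NN y. indicator ?S y * nsq (u (x' + y) - u (x + y)))"
  using norm_ball_integral_le[of "%y. u (x' + y) - u (x + y)"] by simp
 also have "(NN y. indicator ?S y * nsq (u (x' + y) - u (x + y))) = (NN z. indicator ?S (z - x) * nsq (u (z + (x' - x)) - u z))"
  using nn_integral_shift[of "%z. indicator ?S (z - x) * nsq (u (z + (x' - x)) - u z)" x] by (simp add: algebra_simps)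
 also have "... \<le> (NN z. indicator C z * indicator C (z + (x' - x)) * nsq (u (z + (x' - x)) - u z))"
 proof (rule nn_integral_mono)
  fix z
  have "norm (z - x) = norm (z + (x' - x) - x')" by (simp add: algebra_simps)
  then show "indicator ?S (z - x) * nsq (u (z + (x' - x)) - u z) \<le> indicator C z * indicator C (z + (x' - x)) * nsq (u (z + (x' - x)) - u z)"
   using assms(1)[of z] assms(2)[of "z + (x' - x)"] by (cases "norm (z - x) \<le> \<rho>") auto
 qed
 also have "... \<le> nsq (x' - x) * (NN x. indicator C x * ennreal (sq_grad D x))"
  by (rule translation_estimate[OF B C Cm])
 finally show ?thesis by (simp add: mult_left_mono)
qed

lemma ball_avg_bound:
 assumes "!!y. norm (y - x) \<le> \<rho> ==> y \<in> C"
 shows "nsq (ball_avg \<rho> u x) \<le> ennreal (1 / measure lborel (cball (0::'a) \<rho>)) * (NN x. indicator C x * nsq (u x))"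
proof -
 let ?S = "cball (0::'a) \<rho>" and ?s = "measure lborel (cball (0::'a) \<rho>)"
 note [measurable] = um Sm Cm
 have "nsq (ball_avg \<rho> u x) \<le> ennreal (1 / ?s) * (NN y. indicator ?S y * nsq (u (x + y)))"
  unfolding ball_avg_def by (rule norm_ball_integral_le) measurable
 also have "(NN y. indicator ?S y * nsq (u (x + y))) = (NN z. indicator ?S (z - x) * nsq (u z))"
  using nn_integral_shift[of "%z. indicator ?S (z - x) * nsq (u z)" x] by (simp add: algebra_simps)
 also have "... \<le> (NN z. indicator C z * nsq (u z))"
 proof (rule nn_integral_mono)
  fix z show "indicator ?S (z - x) * nsq (u z) \<le> indicator C z * nsq (u z)"
   using assms[of z] by (cases "norm (z - x) \<le> \<rho>") auto
 qed
 finally show ?thesis by (simp add: mult_left_mono)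
qed

lemma ball_avg_measurable: "ball_avg \<rho> u \<in> bmeas"
 unfolding ball_avg_def[abs_def] using um Sm by measurable

end

lemma dist_three_quarters:
 fixes p q s t :: "'a::real_normed_vector"
 assumes e: "e > 0" and "norm (p - q) \<le> e / 4" "dist q s < e / 4" "norm (t - s) \<le> e / 4"
 shows "dist p t < e"
proof -
 have "dist p t \<le> dist p q + (dist q s + dist s t)"
  using dist_triangle[of p t q] dist_triangle[of q t s] by linarith
 moreover have "dist p q \<le> e / 4" "dist s t \<le> e / 4" using assms by (simp_all add: dist_norm norm_minus_commute[of s])
 ultimately show ?thesis using assms(1,3) by linarith
qed

text \<open>At each fixed scale the averages are equibounded and equi-Lipschitz on each C i. A
  diagonal subsequence converges at a countable dense set for all scales, hence everywhere by the
  Lipschitz bound, hence in L2 by domination. At small scale the averages are close to the functions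
  uniformly in n, which transfers the Cauchy property. Passing from C i to its successor leaves room
  for balls of radius at most 1.\<close>

lemma rellich:
 fixes f :: "nat => 'a::euclidean_space => 'b::euclidean_space" and C :: "nat => 'a set"
 assumes B: "!!n. borel_grad UNIV (f n) (F n)"
  and G: "!!n i. (NN x. indicator (C i) x * ennreal (sq_grad (F n) x)) \<le> ennreal (G i)"
  and L: "!!n i. (NN x. indicator (C i) x * nsq (f n x)) \<le> ennreal (L i)"
  and GL: "!!i. 0 \<le> G i" "!!i. 0 \<le> L i"
  and C: "!!i. compact (C i)" "!!i. convex (C i)" and cover: "(\<Union>i. C i) = UNIV"
  and nbr: "!!i x y. x \<in> C i ==> norm (y - x) \<le> 1 ==> y \<in> C (Suc i)"
 obtains r :: "nat => nat" where "strict_mono r"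
  "!!i \<epsilon>. \<epsilon> > 0 ==> \<exists>N. \<forall>n\<ge>N. \<forall>m\<ge>N. (NN x. indicator (C i) x * nsq (f (r n) x - f (r m) x)) \<le> ennreal \<epsilon>"
proof -
 define \<rho> where "\<rho> j = 1 / real (Suc j)" for j
 have rho: "0 < \<rho> j" "\<rho> j \<le> 1" for j by (auto simp: \<rho>_def)
 define \<sigma> where "\<sigma> j = measure lborel (cball (0::'a) (\<rho> j))" for j
 have sig: "0 < \<sigma> j" for j using content_cball_pos[OF rho(1), of "0::'a" j] by (simp add: \<sigma>_def)
 have Cm[measurable]: "C i \<in> sets borel" for i using C(1) by (rule borel_compact)
 note fm[measurable] = borel_gradD(2)[OF B]
 have nbr': "y \<in> C (Suc i)" if "x \<in> C i" "norm (y - x) \<le> \<rho> j" for x y i j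
  using nbr[OF that(1)] that(2) rho(2)[of j] by simp
 have lip: "norm (ball_avg (\<rho> j) (f n) x' - ball_avg (\<rho> j) (f n) x) \<le> norm (x' - x) * sqrt (G (Suc i) / \<sigma> j)"
  if "x \<in> C i" "x' \<in> C i" for n j x x' i
 proof -
  have "nsq (ball_avg (\<rho> j) (f n) x' - ball_avg (\<rho> j) (f n) x) \<le> ennreal (1 / \<sigma> j) * (nsq (x' - x) * (NN x. indicator (C (Suc i)) x * ennreal (sq_grad (F n) x)))"
   unfolding \<sigma>_def by (rule ball_avg_Lipschitz[OF B C(2) Cm rho(1)]) (use nbr' that in blast)+
  also have "... \<le> ennreal (1 / \<sigma> j) * (nsq (x' - x) * ennreal (G (Suc i)))"
   by (intro mult_left_mono G) auto
  also have "... = ennreal ((norm (x' - x))\<^sup>2 * (G (Suc i) / \<sigma> j))"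
   using sig[of j] GL(1)[of "Suc i"] by (simp add: ennreal_mult[symmetric])
  finally have "(norm (ball_avg (\<rho> j) (f n) x' - ball_avg (\<rho> j) (f n) x))\<^sup>2 \<le> (norm (x' - x))\<^sup>2 * (G (Suc i) / \<sigma> j)"
   using sig[of j] GL(1)[of "Suc i"] by (subst (asm) ennreal_le_iff) auto
  then have "norm (ball_avg (\<rho> j) (f n) x' - ball_avg (\<rho> j) (f n) x) \<le> sqrt ((norm (x' - x))\<^sup>2 * (G (Suc i) / \<sigma> j))"
   by (rule real_le_rsqrt)
  then show ?thesis by (simp only: real_sqrt_mult real_sqrt_abs abs_norm_cancel)
 qed
 have bnd: "norm (ball_avg (\<rho> j) (f n) x) \<le> sqrt (L (Suc i) / \<sigma> j)" if "x \<in> C i" for n j x i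
 proof -
  have "nsq (ball_avg (\<rho> j) (f n) x) \<le> ennreal (1 / \<sigma> j) * (NN x. indicator (C (Suc i)) x * nsq (f n x))"
   unfolding \<sigma>_def by (rule ball_avg_bound[OF B C(2) Cm rho(1)]) (use nbr' that in blast)
  also have "... \<le> ennreal (1 / \<sigma> j) * ennreal (L (Suc i))" by (intro mult_left_mono L) auto
  also have "... = ennreal (L (Suc i) / \<sigma> j)" using sig[of j] GL(2)[of "Suc i"] by (simp add: ennreal_mult[symmetric])
  finally have "(norm (ball_avg (\<rho> j) (f n) x))\<^sup>2 \<le> L (Suc i) / \<sigma> j"
   using sig[of j] GL(2)[of "Suc i"] by (subst (asm) ennreal_le_iff) auto
  then show ?thesis by (rule real_le_rsqrt)
 qed
 obtain Z :: "'a set" where Z: "countable Z" "!!X. open X ==> X \<noteq> {} ==> \<exists>d\<in>Z. d \<in> X"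
  by (rule countable_dense_setE) blast
 \<comment> \<open>Enumerates pairs of a scale and a point of the dense set, so that one diagonal
   argument serves all scales.\<close>
 define e where "e = from_nat_into ((UNIV :: nat set) \<times> Z)"
 have Zne: "Z \<noteq> {}" using Z(2)[of UNIV] by auto
 have eonto: "range e = UNIV \<times> Z" unfolding e_def by (rule range_from_nat_into) (use Z(1) Zne in auto)
 have "bounded (range (%n. ball_avg (\<rho> (fst (e k))) (f n) (snd (e k))))" for k
 proof -
  obtain i where "snd (e k) \<in> C i" using cover by blast
  from bnd[OF this] show ?thesis unfolding bounded_iff by blast
 qed
 note bd = this
 obtain r where r: "strict_mono r" and conv: "!!k. convergent (%n. ball_avg (\<rho> (fst (e k))) (f (r n)) (snd (e k)))"
 proof (rule diagonal_convergent[OF bd])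
  fix r assume "strict_mono r" "!!k. convergent (%n. ball_avg (\<rho> (fst (e k))) (f (r n)) (snd (e k)))"
  then show thesis by (rule that)
 qed
 have convZ: "convergent (%n. ball_avg (\<rho> j) (f (r n)) z)" if "z \<in> Z" for j z
 proof -
  have "(j, z) \<in> range e" using eonto that by simp
  then obtain k where "e k = (j, z)" by (metis imageE)
  then show ?thesis using conv[of k] by simp
 qed
 have convx: "convergent (%n. ball_avg (\<rho> j) (f (r n)) x)" for j x
 proof -
  obtain i where i: "x \<in> C i" using cover by blast
  \<comment> \<open>The double successor: the dense point near x may lie outside C i but is in the
    next set, and the averages there involve the one after. The summand 1 keeps \<Lambda>
    positive.\<close>
  define \<Lambda> where "\<Lambda> = sqrt (G (Suc (Suc i)) / \<sigma> j) + 1"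
  have L0: "\<Lambda> > 0" using GL(1)[of "Suc (Suc i)"] sig[of j] by (simp add: \<Lambda>_def add_nonneg_pos)
  have "Cauchy (%n. ball_avg (\<rho> j) (f (r n)) x)"
  proof (rule metric_CauchyI)
   fix \<epsilon> :: real assume e: "\<epsilon> > 0"
   define \<eta> where "\<eta> = min 1 (\<epsilon> / (4 * \<Lambda>))"
   have "\<eta> > 0" using e L0 by (simp add: \<eta>_def)
   then obtain z where z: "z \<in> Z" "z \<in> ball x \<eta>" using Z(2)[of "ball x \<eta>"] by auto
   have zx: "norm (x - z) < \<eta>" using z(2) by (simp add: dist_norm)
   have zi: "z \<in> C (Suc i)" using nbr[OF i, of z] zx by (simp add: \<eta>_def norm_minus_commute)
   have xi: "x \<in> C (Suc i)" using nbr[OF i, of x] by simp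
   have close: "norm (ball_avg (\<rho> j) (f n) x - ball_avg (\<rho> j) (f n) z) \<le> \<epsilon> / 4" for n
   proof -
    have "norm (ball_avg (\<rho> j) (f n) x - ball_avg (\<rho> j) (f n) z) \<le> norm (x - z) * sqrt (G (Suc (Suc i)) / \<sigma> j)" by (rule lip[OF zi xi])
    also have "... \<le> (\<epsilon> / (4 * \<Lambda>)) * \<Lambda>" 
    proof (rule mult_mono)
     show "norm (x - z) \<le> \<epsilon> / (4 * \<Lambda>)" using zx by (simp add: \<eta>_def)
     show "sqrt (G (Suc (Suc i)) / \<sigma> j) \<le> \<Lambda>" by (simp add: \<Lambda>_def)
     show "0 \<le> \<epsilon> / (4 * \<Lambda>)" using e L0 by simp
     show "0 \<le> sqrt (G (Suc (Suc i)) / \<sigma> j)" using GL(1)[of "Suc (Suc i)"] sig[of j] by simp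
    qed
    also have "... = \<epsilon> / 4" using L0 by simp
    finally show ?thesis .
   qed
   have "Cauchy (%n. ball_avg (\<rho> j) (f (r n)) z)" using convZ[OF z(1)] by (rule convergent_Cauchy)
   then obtain N where N: "!!n m. n \<ge> N ==> m \<ge> N ==> dist (ball_avg (\<rho> j) (f (r n)) z) (ball_avg (\<rho> j) (f (r m)) z) < \<epsilon> / 4"
    using metric_CauchyD[of _ "\<epsilon> / 4"] e by (metis zero_less_divide_iff zero_less_numeral)
   have "dist (ball_avg (\<rho> j) (f (r m)) x) (ball_avg (\<rho> j) (f (r n)) x) < \<epsilon>" if "m \<ge> N" "n \<ge> N" for m n
    by (rule dist_three_quarters[OF e close N[OF that] close])
   then show "\<exists>N. \<forall>m\<ge>N. \<forall>n\<ge>N. dist (ball_avg (\<rho> j) (f (r m)) x) (ball_avg (\<rho> j) (f (r n)) x) < \<epsilon>" by blast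
  qed
  then show ?thesis by (rule Cauchy_convergent)
 qed
 have avgL2: "(%n. (NN x. indicator (C i) x * nsq (ball_avg (\<rho> j) (f (r n)) x - lim (%n. ball_avg (\<rho> j) (f (r n)) x)))) ~> 0" for i j
 proof -
  define h where "h x = lim (%n. ball_avg (\<rho> j) (f (r n)) x)" for x
  note am[measurable] = ball_avg_measurable[OF B C(2)[of 0] Cm rho(1)]
  have hm[measurable]: "h \<in> bmeas" unfolding h_def by (rule borel_measurable_lim_metric) (rule am)
  have hl: "(%n. ball_avg (\<rho> j) (f (r n)) x) ~> h x" for x using convx[of j x] by (simp add: h_def convergent_LIMSEQ_iff)
  define b where "b = sqrt (L (Suc i) / \<sigma> j)"
  have hb: "norm (h x) \<le> b" if "x \<in> C i" for x
   using hl[of x] bnd[OF that] unfolding b_def by (intro LIMSEQ_le_const2[OF tendsto_norm[OF hl]]) auto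
  have "(%n. (NN x. indicator (C i) x * nsq (ball_avg (\<rho> j) (f (r n)) x - h x))) ~> (\<integral>\<^sup>+x. 0 \<partial>(lborel :: 'a measure))"
  proof (rule nn_integral_dominated_convergence[where w="%x. ennreal ((2 * b)\<^sup>2) * indicator (C i) x"])
   have "emeasure lborel (C i) < \<infinity>" using C(1) by (intro emeasure_bounded_finite compact_imp_bounded)
   then show "(NN x. ennreal ((2 * b)\<^sup>2) * indicator (C i) x) < \<infinity>"
    by (simp add: nn_integral_cmult_indicator ennreal_mult_less_top)
   show "AE x in lborel. indicator (C i) x * nsq (ball_avg (\<rho> j) (f (r n)) x - h x) \<le> ennreal ((2 * b)\<^sup>2) * indicator (C i) x" for n
   proof (rule AE_I2)
    fix x show "indicator (C i) x * nsq (ball_avg (\<rho> j) (f (r n)) x - h x) \<le> ennreal ((2 * b)\<^sup>2) * indicator (C i) x"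
    proof (cases "x \<in> C i")
     case True
     have "norm (ball_avg (\<rho> j) (f (r n)) x - h x) \<le> 2 * b"
      using norm_triangle_ineq4[of "ball_avg (\<rho> j) (f (r n)) x" "h x"] hb[OF True] bnd[OF True, of j "r n"] by (simp add: b_def)
     then have "(norm (ball_avg (\<rho> j) (f (r n)) x - h x))\<^sup>2 \<le> (2 * b)\<^sup>2" by (rule power_mono) simp
     from ennreal_leI[OF this] show ?thesis using True by simp
    qed simp
   qed
   show "AE x in lborel. (%n. indicator (C i) x * nsq (ball_avg (\<rho> j) (f (r n)) x - h x)) ~> 0"
   proof (rule AE_I2)
    fix x
    have "(%n. nsq (ball_avg (\<rho> j) (f (r n)) x - h x)) ~> nsq (h x - h x)"
     by (intro tendsto_ennrealI tendsto_intros hl)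
    then show "(%n. indicator (C i) x * nsq (ball_avg (\<rho> j) (f (r n)) x - h x)) ~> 0"
     by (cases "x \<in> C i") auto
   qed
  qed measurable
  then show ?thesis by (simp add: h_def)
 qed
 have final: "\<exists>N. \<forall>n\<ge>N. \<forall>m\<ge>N. (NN x. indicator (C i) x * nsq (f (r n) x - f (r m) x)) \<le> ennreal \<epsilon>" if e: "\<epsilon> > 0" for i \<epsilon>
 proof -
  \<comment> \<open>The estimate |a + b|^2 \<le> 2 |a|^2 + 2 |b|^2 is used twice with two equal
    terms, each time costing a factor 4; hence \<epsilon>/16.\<close>
  obtain j :: nat where j: "G (Suc i) / (\<epsilon> / 16) < real (Suc j)" 
  proof -
   obtain j :: nat where "G (Suc i) / (\<epsilon> / 16) < real j" using reals_Archimedean2 by blast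
   then show thesis by (intro that[of j]) simp
  qed
  have rG: "(\<rho> j)\<^sup>2 * G (Suc i) \<le> \<epsilon> / 16"
  proof -
   have "(\<rho> j)\<^sup>2 * G (Suc i) \<le> \<rho> j * G (Suc i)" using rho[of j] GL(1)[of "Suc i"] by (intro mult_right_mono) (auto simp: power2_eq_square mult_left_le)
   also have "... = G (Suc i) / real (Suc j)" by (simp add: \<rho>_def)
   also have "... \<le> \<epsilon> / 16"
   proof -
    have "G (Suc i) < real (Suc j) * (\<epsilon> / 16)" using j e by (simp add: pos_divide_less_eq)
    then show ?thesis by (simp add: divide_le_eq mult.commute)
   qed
   finally show ?thesis .
  qed
  define h where "h x = lim (%n. ball_avg (\<rho> j) (f (r n)) x)" for x
  note am[measurable] = ball_avg_measurable[OF B C(2)[of 0] Cm rho(1)]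
  have hm[measurable]: "h \<in> bmeas" unfolding h_def by (rule borel_measurable_lim_metric) (rule am)
  have close: "(NN x. indicator (C i) x * nsq (f n x - ball_avg (\<rho> j) (f n) x)) \<le> ennreal (\<epsilon> / 16)" for n
  proof -
   have "(NN x. indicator (C i) x * nsq (f n x - ball_avg (\<rho> j) (f n) x)) \<le> ennreal ((\<rho> j)\<^sup>2) * (NN x. indicator (C (Suc i)) x * ennreal (sq_grad (F n) x))"
    by (rule ball_avg_close[OF B C(2) Cm rho(1) Cm]) (rule nbr')
   also have "... \<le> ennreal ((\<rho> j)\<^sup>2) * ennreal (G (Suc i))" by (intro mult_left_mono G) auto
   also have "... \<le> ennreal (\<epsilon> / 16)" using rG by (simp add: ennreal_mult'[symmetric] ennreal_leI)
   finally show ?thesis .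
  qed
  have "\<forall>\<^sub>F n in sequentially. (NN x. indicator (C i) x * nsq (ball_avg (\<rho> j) (f (r n)) x - h x)) < ennreal (\<epsilon> / 16)"
   unfolding h_def using avgL2[of i j] by (rule order_tendstoD(2)) (use e in simp)
  then obtain N where N: "!!n. n \<ge> N ==> (NN x. indicator (C i) x * nsq (ball_avg (\<rho> j) (f (r n)) x - h x)) < ennreal (\<epsilon> / 16)"
   unfolding eventually_sequentially by blast
  have near: "(NN x. indicator (C i) x * nsq (f (r n) x - h x)) \<le> ennreal (\<epsilon> / 4)" if "n \<ge> N" for n
  proof -
   have "(NN x. indicator (C i) x * nsq (f (r n) x - h x)) = (NN x. indicator (C i) x * nsq ((f (r n) x - ball_avg (\<rho> j) (f (r n)) x) + (ball_avg (\<rho> j) (f (r n)) x - h x)))" by simp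
   also have "... \<le> 2 * (NN x. indicator (C i) x * nsq (f (r n) x - ball_avg (\<rho> j) (f (r n)) x)) + 2 * (NN x. indicator (C i) x * nsq (ball_avg (\<rho> j) (f (r n)) x - h x))"
    by (rule nn_integral_norm_add_power2_le) measurable
   also have "... \<le> 2 * ennreal (\<epsilon> / 16) + 2 * ennreal (\<epsilon> / 16)"
    by (intro add_mono mult_left_mono close less_imp_le[OF N[OF that]]) auto
   also have "... = ennreal (2 * (\<epsilon> / 16) + 2 * (\<epsilon> / 16))" using e ennreal_two_mult[of "\<epsilon> / 16"] by (subst ennreal_plus) auto
   also have "2 * (\<epsilon> / 16) + 2 * (\<epsilon> / 16) = \<epsilon> / 4" by simp
   finally show ?thesis .
  qed
  have "(NN x. indicator (C i) x * nsq (f (r n) x - f (r m) x)) \<le> ennreal \<epsilon>" if "n \<ge> N" "m \<ge> N" for n m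
  proof -
   have "(NN x. indicator (C i) x * nsq (f (r n) x - f (r m) x)) = (NN x. indicator (C i) x * nsq ((f (r n) x - h x) + (h x - f (r m) x)))" by simp
   also have "... \<le> 2 * (NN x. indicator (C i) x * nsq (f (r n) x - h x)) + 2 * (NN x. indicator (C i) x * nsq (h x - f (r m) x))"
    by (rule nn_integral_norm_add_power2_le) measurable
   also have "... \<le> 2 * ennreal (\<epsilon> / 4) + 2 * ennreal (\<epsilon> / 4)"
    using near[OF that(1)] near[OF that(2)] by (intro add_mono mult_left_mono) (auto simp: norm_minus_commute)
   also have "... = ennreal (2 * (\<epsilon> / 4) + 2 * (\<epsilon> / 4))" using e ennreal_two_mult[of "\<epsilon> / 4"] by (subst ennreal_plus) auto
   also have "2 * (\<epsilon> / 4) + 2 * (\<epsilon> / 4) = \<epsilon>" by simp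
   finally show ?thesis .
  qed
  then show ?thesis by blast
 qed
 show thesis by (rule that[OF r]) (rule final)
qed

section \<open>Uniform bounds on an exhaustion by slabs\<close>

text \<open>A compact convex exhaustion. The cross-section is a growing ball instead of the cell, so
  that the unit neighbourhood of a slab lies in the next one; periodicity converts integrals over it
  into integrals over the cell.\<close>

definition slab :: "nat => ('m::finite) pt set" where
 "slab i = {- real i..real i} \<times> cball 0 (real i)"

lemma slab_compact: "compact (slab i)" and slab_convex: "convex (slab i)"
 by (auto simp: slab_def intro!: compact_Times convex_Times)

lemma slab_borel[measurable]: "slab i \<in> sets borel" by (rule borel_compact[OF slab_compact])

lemma slab_incseq: "incseq slab"
 by (auto simp: incseq_def slab_def)

lemma slab_cover_compact:
 assumes "compact (K :: ('m::finite) pt set)"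
 shows "\<exists>i. K \<subseteq> slab i"
proof -
 obtain r where r: "!!x. x \<in> K ==> norm x \<le> r" using compact_imp_bounded[OF assms] unfolding bounded_iff by blast
 obtain i :: nat where i: "r \<le> real i" using real_arch_simple by blast
 have "x \<in> slab i" if "x \<in> K" for x
 proof -
  have "norm x \<le> real i" using r[OF that] i by simp
  moreover have "\<bar>fst x\<bar> \<le> norm x" "norm (snd x) \<le> norm x" using norm_fst_le[of "fst x" "snd x"] norm_snd_le[of "snd x" "fst x"] by auto
  ultimately show ?thesis by (cases x) (auto simp: slab_def)
 qed
 then show ?thesis by blast
qed

lemma slab_Union: "(\<Union>i. slab i) = UNIV"
proof -
 have "\<exists>i. x \<in> slab i" for x :: "'a pt" using slab_cover_compact[of "{x}"] by auto
 then show ?thesis by auto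
qed

lemma slab_nbr: "x \<in> slab i ==> norm (y - x) \<le> 1 ==> y \<in> slab (Suc i)"
proof -
 assume x: "x \<in> slab i" and n: "norm (y - x) \<le> 1"
 have "\<bar>fst y - fst x\<bar> \<le> 1" "norm (snd y - snd x) \<le> 1"
  using order_trans[OF norm_fst_le[of "fst (y - x)" "snd (y - x)"]] order_trans[OF norm_snd_le[of "snd (y - x)" "fst (y - x)"]] n
  unfolding prod.collapse by simp_all
 moreover have "norm (snd y) \<le> norm (snd x) + norm (snd y - snd x)" using norm_triangle_ineq[of "snd x" "snd y - snd x"] by simp
 ultimately show ?thesis using x by (cases x, cases y) (auto simp: slab_def)
qed

lemma nn_integral_slab_le:
 obtains N :: "nat => nat" where "!!i (f :: ('m::finite) pt => ennreal). f \<in> bmeas ==> periodic_x' f ==>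
  (NN x. indicator (slab i) x * f x) \<le> of_nat (N i) * (NN x. indicator ({- real i..real i} \<times> cell) x * f x)"
proof -
 have "\<exists>N :: nat. \<forall>(f :: 'm pt => ennreal). f \<in> bmeas \<longrightarrow> periodic_x' f \<longrightarrow>
  (NN x. indicator (slab i) x * f x) \<le> of_nat N * (NN x. indicator ({- real i..real i} \<times> cell) x * f x)" for i
 proof -
  have "0 \<le> real i" by simp
  then show ?thesis
  proof (rule nn_integral_periodic_ball_le[where 'm='m])
   fix N assume N: "!!(f :: 'm pt => ennreal) A. f \<in> bmeas ==> periodic_x' f ==> A \<in> sets borel ==>
   (NN x. indicator (A \<times> cball 0 (real i)) x * f x) \<le> of_nat N * (NN x. indicator (A \<times> cell) x * f x)"
   show ?thesis unfolding slab_def by (intro exI[of _ N] allI impI N) auto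
  qed
 qed
 then have "\<forall>i. \<exists>N :: nat. \<forall>(f :: 'm pt => ennreal). f \<in> bmeas \<longrightarrow> periodic_x' f \<longrightarrow>
  (NN x. indicator (slab i) x * f x) \<le> of_nat N * (NN x. indicator ({- real i..real i} \<times> cell) x * f x)" by (rule allI)
 from choice[OF this] obtain N where "\<forall>i. \<forall>(f :: 'm pt => ennreal). f \<in> bmeas \<longrightarrow> periodic_x' f \<longrightarrow>
  (NN x. indicator (slab i) x * f x) \<le> of_nat (N i) * (NN x. indicator ({- real i..real i} \<times> cell) x * f x)" by (rule exE)
 then show thesis by (intro that[of N]) simp
qed

lemma periodic_sq_grad:
 assumes "!!b. b \<in> Basis ==> periodic_x' (D b)"
 shows "periodic_x' (%x. ennreal (sq_grad D x))"
 using assms by (simp add: periodic_x'_def sq_grad_def)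

text \<open>Both bounds depend on Q and M alone. The gradient bound is the covering of a ball by
  cells. For the field, Poincare controls the distance to the slice average, and the Hoelder
  estimate controls that average starting from its value at time 0.\<close>

lemma regular_field_slab_L2:
 assumes Q: "0 \<le> Q" and M: "0 \<le> M"
 obtains G L :: "nat => real" where "!!i. 0 \<le> G i" "!!i. 0 \<le> L i"
  "!!(u :: ('m::finite) pt => 'm pt) D i. regular_field u D ==> (gradsq D) \<le> ennreal Q ==>
   norm (xavg u 0) \<le> M ==> (NN x. indicator (slab i) x * ennreal (sq_grad D x)) \<le> ennreal (G i)"
  "!!(u :: ('m::finite) pt => 'm pt) D i. regular_field u D ==> (gradsq D) \<le> ennreal Q ==>
   norm (xavg u 0) \<le> M ==> (NN x. indicator (slab i) x * nsq (u x)) \<le> ennreal (L i)"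
proof (rule nn_integral_slab_le[where 'm='m])
 fix N :: "nat => nat" assume N: "!!i (f :: 'm pt => ennreal). f \<in> bmeas ==> periodic_x' f ==>
  (NN x. indicator (slab i) x * f x) \<le> of_nat (N i) * (NN x. indicator ({- real i..real i} \<times> cell) x * f x)"
 obtain C where C: "0 \<le> C" "!!(v :: real ^ 'm => 'm pt) Dv. borel_grad UNIV v Dv ==>
  (NN y. indicator cell y * nsq (v y - (LBINT z. indicator cell z *R v z)))
  \<le> ennreal C * (NN y. indicator cell y * ennreal (sq_grad Dv y))"
  using poincare_cell[where 'm='m and 'c="'m pt"] by blast
 \<comment> \<open>The squared average is at most 2 M^2 + 2 i Q at times up to i. The square of
   slice minus average plus average doubles this and the Poincare term, and 2 i is the length of the
   time interval.\<close>
 define l where "l i = 2 * C * Q + (4 * M\<^sup>2 + 4 * (real i * Q)) * (2 * real i)" for i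
 have l0: "0 \<le> l i" for i using Q C(1) by (simp add: l_def)
 have nat_mult: "of_nat n * ennreal x = ennreal (real n * x)" if "0 \<le> x" for n x
  using that by (simp add: ennreal_of_nat_eq_real_of_nat ennreal_mult'[symmetric])
 show thesis
 proof (rule that[of "%i. real (N i) * Q" "%i. real (N i) * l i"])
  show "0 \<le> real (N i) * Q" "0 \<le> real (N i) * l i" for i using Q l0 by simp_all
  fix u :: "'m pt => 'm pt" and D i
  assume R: "regular_field u D" and q: "(gradsq D) \<le> ennreal Q" and g0: "norm (xavg u 0) \<le> M"
  note um[measurable] = regular_fieldD(7)[OF R]
  note gm[measurable] = regular_fieldD(9)[OF R]
  have sub: "(NN x. indicator (A \<times> cell) x * ennreal (sq_grad D x)) \<le> ennreal Q" for A
   by (rule order_trans[OF nn_integral_subset_mono q]) auto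
  have "(NN x. indicator (slab i) x * ennreal (sq_grad D x)) \<le> of_nat (N i) * (NN x. indicator ({- real i..real i} \<times> cell) x * ennreal (sq_grad D x))"
   by (rule N[OF _ periodic_sq_grad[OF regular_fieldD(3)[OF R]]]) measurable
  also have "... \<le> of_nat (N i) * ennreal Q" by (intro mult_left_mono sub) simp
  also have "... = ennreal (real (N i) * Q)" by (rule nat_mult[OF Q])
  finally show "(NN x. indicator (slab i) x * ennreal (sq_grad D x)) \<le> ennreal (real (N i) * Q)" .
  let ?A = "{- real i..real i}"
  have gt: "(norm (xavg u t))\<^sup>2 \<le> 2 * M\<^sup>2 + 2 * (real i * Q)" if t: "t \<in> ?A" for t
  proof -
   have *: "(norm (xavg u t - xavg u 0))\<^sup>2 \<le> real i * Q"
   proof -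
    have d: "(norm (xavg u d - xavg u c))\<^sup>2 \<le> (d - c) * Q" if "c \<le> d" for c d
    proof -
     have "nsq (xavg u d - xavg u c) \<le> ennreal (d - c) * (NN x. indicator ({c..d} \<times> cell) x * ennreal (sq_grad D x))"
      by (rule xavg_diff_le[OF R that])
     also have "... \<le> ennreal (d - c) * ennreal Q" by (intro mult_left_mono sub) simp
     also have "... = ennreal ((d - c) * Q)" using that Q by (simp add: ennreal_mult)
     finally show ?thesis using that Q by (subst (asm) ennreal_le_iff) auto
    qed
    show ?thesis
    proof (cases "0 \<le> t")
     case True
     then have "(norm (xavg u t - xavg u 0))\<^sup>2 \<le> (t - 0) * Q" by (rule d)
     also have "... \<le> real i * Q" using t Q by (intro mult_right_mono) auto
     finally show ?thesis .
    next
     case False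
     then have "(norm (xavg u 0 - xavg u t))\<^sup>2 \<le> (0 - t) * Q" by (intro d) simp
     also have "... \<le> real i * Q" using t Q by (intro mult_right_mono) auto
     finally show ?thesis by (simp add: norm_minus_commute)
    qed
   qed
   have "(norm (xavg u t))\<^sup>2 \<le> 2 * (norm (xavg u 0))\<^sup>2 + 2 * (norm (xavg u t - xavg u 0))\<^sup>2"
    using norm_add_power2_le[of "xavg u 0" "xavg u t - xavg u 0"] by simp
   moreover have "(norm (xavg u 0))\<^sup>2 \<le> M\<^sup>2" using g0 by (intro power_mono) auto
   ultimately show ?thesis using * by linarith
  qed
  have "(NN x. indicator (?A \<times> cell) x * nsq (u x)) = (NN t. indicator ?A t * (NN y. indicator cell y * nsq (u (t, y))))"
   by (rule nn_integral_Times(1)) measurable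
  also have "... \<le> (NN t. ennreal (2 * C) * (indicator ?A t * (NN y. indicator cell y * ennreal (sq_grad D (t, y)))) + ennreal (4 * M\<^sup>2 + 4 * (real i * Q)) * indicator ?A t)"
  proof (rule nn_integral_mono_AE, use borel_grad_slice[OF regular_fieldD(1)[OF R]] in eventually_elim)
   fix t assume B: "borel_grad UNIV (%y. u (t, y)) (%b y. D (0, b) (t, y))"
   note [measurable] = borel_slice[OF um]
   show "indicator ?A t * (NN y. indicator cell y * nsq (u (t, y))) \<le>
    ennreal (2 * C) * (indicator ?A t * (NN y. indicator cell y * ennreal (sq_grad D (t, y)))) + ennreal (4 * M\<^sup>2 + 4 * (real i * Q)) * indicator ?A t"
   proof (cases "t \<in> ?A")
    case True
    have "(NN y. indicator cell y * nsq (u (t, y))) = (NN y. indicator cell y * nsq ((u (t, y) - xavg u t) + xavg u t))" by simp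
    also have "... \<le> 2 * (NN y. indicator cell y * nsq (u (t, y) - xavg u t)) + 2 * (NN y. indicator (cell :: (real ^ 'm) set) y * nsq (xavg u t))"
     by (rule nn_integral_norm_add_power2_le) measurable
    also have "... \<le> 2 * (ennreal C * (NN y. indicator cell y * ennreal (sq_grad D (t, y)))) + 2 * ennreal (2 * M\<^sup>2 + 2 * (real i * Q))"
    proof (intro add_mono mult_left_mono)
     have "(NN y. indicator cell y * nsq (u (t, y) - xavg u t)) \<le> ennreal C * (NN y. indicator cell y * ennreal (sq_grad (%b y. D (0, b) (t, y)) y))"
      unfolding xavg_lborel[OF um] by (rule C(2)[OF B])
     also have "... \<le> ennreal C * (NN y. indicator cell y * ennreal (sq_grad D (t, y)))"
      by (intro mult_left_mono nn_integral_mono ennreal_leI sq_grad_slice_le) auto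
     finally show "(NN y. indicator cell y * nsq (u (t, y) - xavg u t)) \<le> ennreal C * (NN y. indicator cell y * ennreal (sq_grad D (t, y)))" .
     have "(NN y. indicator (cell :: (real ^ 'm) set) y * nsq (xavg u t)) = nsq (xavg u t)"
      by (simp add: nn_integral_multc emeasure_cell)
     also have "... \<le> ennreal (2 * M\<^sup>2 + 2 * (real i * Q))" by (rule ennreal_leI[OF gt[OF True]])
     finally show "(NN y. indicator (cell :: (real ^ 'm) set) y * nsq (xavg u t)) \<le> ennreal (2 * M\<^sup>2 + 2 * (real i * Q))" .
    qed auto
    also have "2 * ennreal (2 * M\<^sup>2 + 2 * (real i * Q)) = ennreal (4 * M\<^sup>2 + 4 * (real i * Q))"
     using Q ennreal_two_mult[of "2 * M\<^sup>2 + 2 * (real i * Q)"] by (simp add: algebra_simps)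
    also have "2 * (ennreal C * (NN y. indicator cell y * ennreal (sq_grad D (t, y)))) = ennreal (2 * C) * (NN y. indicator cell y * ennreal (sq_grad D (t, y)))"
     unfolding ennreal_two_mult[OF C(1), symmetric] by (simp add: mult.assoc)
    finally show ?thesis using True by simp
   qed simp
  qed
  also have "... = ennreal (2 * C) * (NN x. indicator (?A \<times> cell) x * ennreal (sq_grad D x)) + ennreal (4 * M\<^sup>2 + 4 * (real i * Q)) * emeasure lborel ?A"
  proof -
   have m: "(%t. (NN y. indicator cell y * ennreal (sq_grad D (t, y)))) \<in> bmeas"
    by (rule nn_integral_Times(2)[where I=UNIV]) auto
   note [measurable] = m
   have "(NN x. indicator (?A \<times> cell) x * ennreal (sq_grad D x)) = (NN t. indicator ?A t * (NN y. indicator cell y * ennreal (sq_grad D (t, y))))"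
    by (rule nn_integral_Times(1)) measurable
   then show ?thesis by (subst nn_integral_add) (auto simp: nn_integral_cmult nn_integral_cmult_indicator)
  qed
  also have "... \<le> ennreal (2 * C) * ennreal Q + ennreal (4 * M\<^sup>2 + 4 * (real i * Q)) * ennreal (2 * real i)"
   by (intro add_mono mult_left_mono sub) auto
  also have "... = ennreal (l i)"
   using C(1) Q by (simp add: l_def ennreal_mult[symmetric] ennreal_plus[symmetric] del: ennreal_plus)
  finally have A: "(NN x. indicator (?A \<times> cell) x * nsq (u x)) \<le> ennreal (l i)" .
  have "(NN x. indicator (slab i) x * nsq (u x)) \<le> of_nat (N i) * (NN x. indicator (?A \<times> cell) x * nsq (u x))"
  proof (rule N)
   show "periodic_x' (%x. nsq (u x))" using regular_fieldD(2)[OF R] by (simp add: periodic_x'_def)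
  qed measurable
  also have "... \<le> of_nat (N i) * ennreal (l i)" by (intro mult_left_mono A) simp
  also have "... = ennreal (real (N i) * l i)" by (rule nat_mult[OF l0])
  finally show "(NN x. indicator (slab i) x * nsq (u x)) \<le> ennreal (real (N i) * l i)" .
 qed
qed

text \<open>Midpoint-convex hulls of the tails replace weak compactness: by the parallelogram law,
 almost minimal elements of the hulls form a Cauchy sequence.\<close>

inductive mid_hull :: "(nat => 'a => 'b::real_vector) => (nat => 'c => 'a => 'b) => nat => ('a => 'b) => ('c => 'a => 'b) => bool"
 for u D N where
 base: "N \<le> n ==> mid_hull u D N (u n) (D n)"
| mid: "mid_hull u D N v G ==> mid_hull u D N w H ==>
  mid_hull u D N (%x. (1/2) *R (v x + w x)) (%b x. (1/2) *R (G b x + H b x))"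

lemma mid_hull_mono:
 assumes "mid_hull u D M v G" "N \<le> M"
 shows "mid_hull u D N v G"
 using assms(1)
proof (induction rule: mid_hull.induct)
 case (base n) then show ?case using assms(2) by (intro mid_hull.base) simp
next
 case (mid v G w H) then show ?case by (intro mid_hull.mid)
qed

lemma sq_grad_parallelogram:
 "4 * sq_grad (%b x. (1/2) *R (F b x + G b x)) x + sq_grad (%b x. F b x - G b x) x = 2 * sq_grad F x + 2 * sq_grad G x"
proof -
 have "4 * (norm ((1/2) *R (p + q)))\<^sup>2 + (norm (p - q))\<^sup>2 = 2 * (norm p)\<^sup>2 + 2 * (norm q)\<^sup>2" for p q :: 'b
  by (simp add: power2_norm_eq_inner inner_simps inner_commute algebra_simps)
 then show ?thesis by (simp add: sq_grad_def sum_distrib_left flip: sum.distrib)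
qed

lemma nn_integral_sq_grad_parallelogram:
 fixes F G :: "'a::euclidean_space => 'a => 'b::euclidean_space"
 assumes F: "!!b. b \<in> Basis ==> F b \<in> bmeas" and G: "!!b. b \<in> Basis ==> G b \<in> bmeas"
  and S[measurable]: "S \<in> sets borel"
 shows "4 * (NN x. indicator S x * ennreal (sq_grad (%b x. (1/2) *R (F b x + G b x)) x)) + (NN x. indicator S x * ennreal (sq_grad (%b x. F b x - G b x) x))
  = 2 * (NN x. indicator S x * ennreal (sq_grad F x)) + 2 * (NN x. indicator S x * ennreal (sq_grad G x))"
proof -
 have m1[measurable]: "sq_grad F \<in> bmeas" "sq_grad G \<in> bmeas"
  using sq_grad_borel[OF F] sq_grad_borel[OF G] by simp_all
 have m2[measurable]: "sq_grad (%b x. (1/2) *R (F b x + G b x)) \<in> bmeas"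
  by (rule sq_grad_borel) (use F G in measurable)
 have m3[measurable]: "sq_grad (%b x. F b x - G b x) \<in> bmeas"
  by (rule sq_grad_borel) (use F G in measurable)
 have pw: "4 * (indicator S x * ennreal (sq_grad (%b x. (1/2) *R (F b x + G b x)) x)) + indicator S x * ennreal (sq_grad (%b x. F b x - G b x) x)
  = 2 * (indicator S x * ennreal (sq_grad F x)) + 2 * (indicator S x * ennreal (sq_grad G x))" for x
 proof -
  have f: "4 * ennreal p + ennreal q = ennreal (4 * p + q)" "2 * ennreal p + 2 * ennreal q = ennreal (2 * p + 2 * q)" if "0 \<le> p" "0 \<le> q" for p q :: real
   using that ennreal_mult[of 4 p] ennreal_mult[of 2 p] ennreal_mult[of 2 q] by (auto simp: ennreal_plus)
  show ?thesis using sq_grad_parallelogram[of F G x] by (cases "x \<in> S") (simp_all add: f)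
 qed
 have "4 * (NN x. indicator S x * ennreal (sq_grad (%b x. (1/2) *R (F b x + G b x)) x)) + (NN x. indicator S x * ennreal (sq_grad (%b x. F b x - G b x) x))
  = (NN x. 4 * (indicator S x * ennreal (sq_grad (%b x. (1/2) *R (F b x + G b x)) x)) + indicator S x * ennreal (sq_grad (%b x. F b x - G b x) x))"
  by (subst nn_integral_add, measurable, subst nn_integral_cmult, measurable)
 also have "... = (NN x. 2 * (indicator S x * ennreal (sq_grad F x)) + 2 * (indicator S x * ennreal (sq_grad G x)))"
  by (simp only: pw)
 also have "... = 2 * (NN x. indicator S x * ennreal (sq_grad F x)) + 2 * (NN x. indicator S x * ennreal (sq_grad G x))"
  by (subst nn_integral_add, measurable, subst nn_integral_cmult, measurable, subst nn_integral_cmult, measurable)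
 finally show ?thesis .
qed

lemma ennreal_avg_le: "4 * (x::ennreal) + d = 2 * y + 2 * z ==> y \<le> ennreal c ==> z \<le> ennreal c ==> 0 \<le> c ==> x \<le> ennreal c"
proof -
 assume e: "4 * x + d = 2 * y + 2 * z" and y: "y \<le> ennreal c" and z: "z \<le> ennreal c" and c: "0 \<le> c"
 have "4 * x \<le> 4 * x + d" by simp
 also have "... \<le> 2 * ennreal c + 2 * ennreal c" unfolding e by (intro add_mono mult_left_mono y z) auto
 also have "... = 4 * ennreal c" by (simp flip: distrib_right)
 finally show ?thesis by (simp add: ennreal_mult_le_mult_iff)
qed

text \<open>Weak gradient, periodicity and zero divergence are linear conditions, and the bound on
  the gradient passes to midpoints by the parallelogram law.\<close>

lemma mid_hull_properties:
 fixes u :: "nat => ('m::finite) pt => 'm pt"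
 assumes R: "!!n. regular_field (u n) (D n)" and Q: "0 \<le> Q" "!!n. (gradsq (D n)) \<le> ennreal Q"
  and H: "mid_hull u D N w F"
 shows "borel_grad UNIV w F" "!!b. b \<in> Basis ==> periodic_x' (F b)" 
  "(gradsq F) \<le> ennreal Q"
  "AE x in lborel. (\<Sum>b\<in>Basis. F b x \<bullet> b) = 0"
proof -
 have "borel_grad UNIV w F \<and> (\<forall>b\<in>Basis. periodic_x' (F b)) \<and>
  (gradsq F) \<le> ennreal Q \<and> (AE x in lborel. (\<Sum>b\<in>Basis. F b x \<bullet> b) = 0)"
  using H
 proof (induction rule: mid_hull.induct)
  case (base n) show ?case using regular_fieldD(3)[OF R[of n]] regular_fieldD(1)[OF R[of n]] regular_fieldD(5)[OF R[of n]] Q(2)[of n] by blast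
 next
  case (mid v G w H)
  have S: "UNIV \<times> (cell :: (real ^ 'm) set) \<in> sets (borel :: 'm pt measure)" unfolding borel_prod[symmetric] by measurable
  show ?case
  proof (intro conjI ballI)
   show "borel_grad UNIV (%x. (1/2) *R (v x + w x)) (%b x. (1/2) *R (G b x + H b x))"
    using mid by (intro borel_grad_midpoint) blast+
   show "periodic_x' (%x. (1/2) *R (G b x + H b x))" if "b \<in> Basis" for b
    using mid that unfolding periodic_x'_def by simp
   have "AE x in lborel. (\<Sum>b\<in>Basis. G b x \<bullet> b) = 0" "AE x in lborel. (\<Sum>b\<in>Basis. H b x \<bullet> b) = 0" using mid by blast+
   then show "AE x in lborel. (\<Sum>b\<in>Basis. ((1/2) *R (G b x + H b x)) \<bullet> b) = 0"
   proof eventually_elim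
    case (elim x)
    have "(\<Sum>b\<in>Basis. ((1/2) *R (G b x + H b x)) \<bullet> b) = (1/2) * ((\<Sum>b\<in>Basis. G b x \<bullet> b) + (\<Sum>b\<in>Basis. H b x \<bullet> b))"
     by (simp only: inner_scaleR_left inner_add_left sum_distrib_left sum.distrib distrib_left)
    then show ?case using elim by simp
   qed
   have GB: "borel_grad UNIV v G" "borel_grad UNIV w H" using mid by blast+
   show "(NN x. indicator (UNIV \<times> cell) x * ennreal (sq_grad (%b x. (1/2) *R (G b x + H b x)) x)) \<le> ennreal Q"
    using ennreal_avg_le[OF nn_integral_sq_grad_parallelogram[of G H, OF borel_gradD(3)[OF GB(1)] borel_gradD(3)[OF GB(2)] S] _ _ Q(1)] mid by blast
  qed
 qed
 then show "borel_grad UNIV w F" "!!b. b \<in> Basis ==> periodic_x' (F b)" 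
  "(gradsq F) \<le> ennreal Q"
  "AE x in lborel. (\<Sum>b\<in>Basis. F b x \<bullet> b) = 0" by blast+
qed

text \<open>Balls of L2 are convex, so the hull of a tail lies as close to v as the tail itself. The
  almost minimal hull elements therefore still converge to v.\<close>

lemma mid_hull_close:
 fixes u :: "nat => ('m::finite) pt => 'm pt"
 assumes um: "!!n. u n \<in> bmeas" and v[measurable]: "v \<in> bmeas" and C[measurable]: "C \<in> sets borel" and c: "0 \<le> c"
  and le: "!!n. N \<le> n ==> (NN x. indicator C x * nsq (u n x - v x)) \<le> ennreal c"
  and H: "mid_hull u D N w F"
 shows "w \<in> bmeas \<and> (NN x. indicator C x * nsq (w x - v x)) \<le> ennreal c"
 using H
proof (induction rule: mid_hull.induct)
 case (base n) then show ?case using le um by blast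
next
 case (mid p G q H)
 have [measurable]: "p \<in> bmeas" "q \<in> bmeas" using mid by blast+
 have pw: "2 * (indicator C x * nsq ((1/2) *R (p x + q x) - v x)) \<le> indicator C x * nsq (p x - v x) + indicator C x * nsq (q x - v x)" for x
 proof -
  have e: "(1/2) *R (p x + q x) - v x = (1/2) *R ((p x - v x) + (q x - v x))"
   by (simp add: algebra_simps flip: scaleR_left_distrib)
  have "2 * (norm ((1/2) *R (p x + q x) - v x))\<^sup>2 \<le> (norm (p x - v x))\<^sup>2 + (norm (q x - v x))\<^sup>2"
   unfolding e using norm_add_power2_le[of "p x - v x" "q x - v x"] by (simp add: power_divide)
  then have "ennreal (2 * (norm ((1/2) *R (p x + q x) - v x))\<^sup>2) \<le> ennreal ((norm (p x - v x))\<^sup>2 + (norm (q x - v x))\<^sup>2)" by (rule ennreal_leI)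
  then show ?thesis by (cases "x \<in> C") (simp_all add: ennreal_two_mult ennreal_plus)
 qed
 have "2 * (NN x. indicator C x * nsq ((1/2) *R (p x + q x) - v x)) = (NN x. 2 * (indicator C x * nsq ((1/2) *R (p x + q x) - v x)))"
  by (rule nn_integral_cmult[symmetric]) measurable
 also have "... \<le> (NN x. indicator C x * nsq (p x - v x) + indicator C x * nsq (q x - v x))"
  by (rule nn_integral_mono) (rule pw)
 also have "... = (NN x. indicator C x * nsq (p x - v x)) + (NN x. indicator C x * nsq (q x - v x))"
  by (rule nn_integral_add) measurable
 also have "... \<le> ennreal c + ennreal c" using mid by (intro add_mono) blast+
 also have "... = 2 * ennreal c" by (simp flip: mult_2)
 finally have "(NN x. indicator C x * nsq ((1/2) *R (p x + q x) - v x)) \<le> ennreal c"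
  by (simp add: ennreal_mult_le_mult_iff)
 then show ?case by simp
qed

text \<open>Let m N be the infimum of the gradient integral over the hull of the N-th tail. These
  infima increase to a finite limit. A midpoint of almost minimal elements stays in the hull, so its
  gradient integral is at least m N, and the parallelogram law forces the gradients to be Cauchy in
  L2. Their limit is a gradient of v, and it inherits lower semicontinuity because m N is below the
  gradient integral of every field of the N-th tail.\<close>

lemma gradient_limit:
 fixes u :: "nat => ('m::finite) pt => 'm pt"
 assumes R: "!!n. regular_field (u n) (D n)" and Q: "0 \<le> Q" "!!n. (gradsq (D n)) \<le> ennreal Q"
  and v[measurable]: "v \<in> bmeas"
  and lim: "!!i. (%n. (NN x. indicator (slab i) x * nsq (u n x - v x))) ~> 0"
 obtains G where "borel_grad UNIV v G" "AE x in lborel. (\<Sum>b\<in>Basis. G b x \<bullet> b) = 0"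
  "(gradsq G) \<le> liminf (%n. (gradsq (D n)))"
proof -
 define q where "q F = (gradsq F)" for F :: "'m pt => 'm pt => 'm pt"
 have S[measurable]: "UNIV \<times> (cell :: (real ^ 'm) set) \<in> sets (borel :: 'm pt measure)" unfolding borel_prod[symmetric] by measurable
 note hull = mid_hull_properties[OF R Q]
 \<comment> \<open>The infimum runs over gradients only; the accompanying functions all approach v
   by \<open>mid_hull_close\<close>.\<close>
 define m where "m N = (INF F\<in>{F. \<exists>w. mid_hull u D N w F}. q F)" for N
 have mle: "m N \<le> q F" if "mid_hull u D N w F" for N w F unfolding m_def by (rule INF_lower) (use that in blast)
 have mD: "m N \<le> q (D n)" if "N \<le> n" for N n by (rule mle[OF mid_hull.base[OF that]])
 have mQ: "m N \<le> ennreal Q" for N using mD[OF order_refl, of N] Q(2)[of N] unfolding q_def by (rule order_trans)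
 have minc: "m N \<le> m M" if "N \<le> M" for N M
  unfolding m_def[of M] by (rule INF_greatest) (use mid_hull_mono[OF _ that] mle in blast)
 define \<mu> where "\<mu> N = enn2real (m N)" for N
 have mfin: "m N < top" for N using mQ[of N] by (rule le_less_trans) simp
 have m\<mu>: "m N = ennreal (\<mu> N)" for N unfolding \<mu>_def using mfin[of N] by (simp add: less_top[symmetric])
 have \<mu>0: "0 \<le> \<mu> N" for N by (simp add: \<mu>_def)
 have inc\<mu>: "incseq \<mu>" using minc unfolding m\<mu> by (auto simp: incseq_def \<mu>0)
 have \<mu>Q: "\<mu> N \<le> Q" for N using mQ[of N] Q(1) unfolding m\<mu> by simp
 obtain \<mu>\<^sub>1 where \<mu>1: "\<mu> ~> \<mu>\<^sub>1" "!!N. \<mu> N \<le> \<mu>\<^sub>1" using incseq_convergent[OF inc\<mu> allI[OF \<mu>Q]] by blast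
 have "\<forall>N. \<exists>p. mid_hull u D N (fst p) (snd p) \<and> q (snd p) < m N + ennreal (1 / real (Suc N))"
 proof
  fix N
  have "m N < m N + ennreal (1 / real (Suc N))" using mfin[of N] by (simp add: ennreal_add_left_cancel_less less_top)
  then obtain F where "\<exists>w. mid_hull u D N w F" "q F < m N + ennreal (1 / real (Suc N))"
   unfolding m_def[of N] INF_less_iff by blast
  then show "\<exists>p. mid_hull u D N (fst p) (snd p) \<and> q (snd p) < m N + ennreal (1 / real (Suc N))" by auto
 qed
 from choice[OF this] obtain p where p: "!!N. mid_hull u D N (fst (p N)) (snd (p N))" "!!N. q (snd (p N)) < m N + ennreal (1 / real (Suc N))" by blast
 define w where "w N = fst (p N)" for N
 define F where "F N = snd (p N)" for N
 have H: "mid_hull u D N (w N) (F N)" for N using p(1) by (simp add: w_def F_def)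
 have qF: "q (F N) \<le> ennreal (\<mu> N + 1 / real (Suc N))" for N
 proof -
  have "q (F N) \<le> ennreal (\<mu> N) + ennreal (1 / real (Suc N))" using p(2)[of N] unfolding m\<mu> F_def by simp
  then show ?thesis using \<mu>0[of N] by (simp add: ennreal_plus)
 qed
 note B = hull(1)[OF H] and per = hull(2)[OF H]
 have Fm: "F N b \<in> bmeas" if "b \<in> Basis" for N b by (rule borel_gradD(3)[OF B that])
 \<comment> \<open>From the parallelogram law: four times the value at the midpoint is at least 4
   \<mu> N, while the right side is at most four times \<open>\<mu>\<^sub>1\<close> +
   1/(N+1).\<close>
 define c where "c N = 4 * (\<mu>\<^sub>1 - \<mu> N) + 4 / real (Suc N)" for N
 have c0: "c ~> 0"
 proof -
  have "(%N. 4 * (\<mu>\<^sub>1 - \<mu> N) + 4 * inverse (real (Suc N))) ~> 4 * (\<mu>\<^sub>1 - \<mu>\<^sub>1) + 4 * 0"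
   by (intro tendsto_intros \<mu>1(1) LIMSEQ_inverse_real_of_nat)
  then show ?thesis by (simp add: c_def[abs_def] divide_inverse)
 qed
 have diff: "q (%b x. F N b x - F M b x) \<le> ennreal (c N)" if NM: "N \<le> M" for N M
 proof -
  \<comment> \<open>Hulls of later tails are contained in those of earlier ones, so both elements
    lie in the N-th hull.\<close>
  have mid: "mid_hull u D N (%x. (1/2) *R (w N x + w M x)) (%b x. (1/2) *R (F N b x + F M b x))"
   by (rule mid_hull.mid[OF H mid_hull_mono[OF H NM]])
  let ?d = "q (%b x. F N b x - F M b x)"
  have "4 * ennreal (\<mu> N) + ?d \<le> 4 * q (%b x. (1/2) *R (F N b x + F M b x)) + ?d"
   using mle[OF mid] unfolding m\<mu> by (intro add_right_mono mult_left_mono) auto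
  also have "... = 2 * q (F N) + 2 * q (F M)"
   unfolding q_def by (rule nn_integral_sq_grad_parallelogram[of "F N" "F M", OF Fm Fm S])
  also have "... \<le> 2 * ennreal (\<mu>\<^sub>1 + 1 / real (Suc N)) + 2 * ennreal (\<mu>\<^sub>1 + 1 / real (Suc N))"
  proof (intro add_mono mult_left_mono)
   show "q (F N) \<le> ennreal (\<mu>\<^sub>1 + 1 / real (Suc N))" by (rule order_trans[OF qF ennreal_leI]) (use \<mu>1(2)[of N] in simp)
   have "1 / real (Suc M) \<le> 1 / real (Suc N)" using NM by (simp add: frac_le)
   then show "q (F M) \<le> ennreal (\<mu>\<^sub>1 + 1 / real (Suc N))" by (intro order_trans[OF qF ennreal_leI]) (use \<mu>1(2)[of M] in linarith)
  qed auto
  also have "... = ennreal (4 * (\<mu>\<^sub>1 + 1 / real (Suc N)))"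
  proof -
   have p0: "0 \<le> \<mu>\<^sub>1 + 1 / real (Suc N)" using \<mu>0[of N] \<mu>1(2)[of N] by (intro add_nonneg_nonneg) auto
   show ?thesis unfolding ennreal_two_mult[OF p0] using p0 by (simp add: ennreal_plus[symmetric] del: ennreal_plus)
  qed
  finally have le: "4 * ennreal (\<mu> N) + ?d \<le> ennreal (4 * (\<mu>\<^sub>1 + 1 / real (Suc N)))" .
  then have "?d \<le> ennreal (4 * (\<mu>\<^sub>1 + 1 / real (Suc N)))" by (rule order_trans[rotated]) simp
  then have "?d < top" by (rule le_less_trans) simp
  then obtain d where d: "0 \<le> d" "?d = ennreal d" by (cases ?d) auto
  have f4: "4 * ennreal (\<mu> N) = ennreal (4 * \<mu> N)" using \<mu>0[of N] ennreal_mult[of 4 "\<mu> N"] by simp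
  have "ennreal (4 * \<mu> N + d) \<le> ennreal (4 * (\<mu>\<^sub>1 + 1 / real (Suc N)))" using le d \<mu>0[of N] unfolding f4 by (simp add: ennreal_plus)
  then have "4 * \<mu> N + d \<le> 4 * (\<mu>\<^sub>1 + 1 / real (Suc N))"
   using \<mu>0[of N] \<mu>1(2)[of N] by (subst (asm) ennreal_le_iff) auto
  then have "d \<le> c N" by (simp add: c_def algebra_simps)
  then show ?thesis unfolding d(2) by (rule ennreal_leI)
 qed
 have diffsym: "q (%b x. F M b x - F N b x) = q (%b x. F N b x - F M b x)" for N M
  unfolding q_def sq_grad_def by (simp only: norm_minus_commute)
 obtain Nn :: "nat => nat" where Nn: "!!i (f :: 'm pt => ennreal). f \<in> bmeas ==> periodic_x' f ==>
  (NN x. indicator (slab i) x * f x) \<le> of_nat (Nn i) * (NN x. indicator ({- real i..real i} \<times> cell) x * f x)"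
  using nn_integral_slab_le[where 'm='m] by blast
 have loc: "(NN x. indicator (slab i) x * nsq (F N b x - F M b x)) \<le> of_nat (Nn i) * q (%b x. F N b x - F M b x)" if b: "b \<in> Basis" for i N M b
 proof -
  have dm[measurable]: "sq_grad (%b x. F N b x - F M b x) \<in> bmeas"
   by (rule sq_grad_borel) (use Fm in measurable)
  have dp: "periodic_x' (%x. ennreal (sq_grad (%b x. F N b x - F M b x) x))"
   by (rule periodic_sq_grad) (use per[of _ N] per[of _ M] in \<open>simp add: periodic_x'_def\<close>)
  have "(NN x. indicator (slab i) x * nsq (F N b x - F M b x)) \<le> (NN x. indicator (slab i) x * ennreal (sq_grad (%b x. F N b x - F M b x) x))"
  proof (intro nn_integral_mono mult_left_mono ennreal_leI)
   fix x show "(norm (F N b x - F M b x))\<^sup>2 \<le> sq_grad (%b x. F N b x - F M b x) x"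
    unfolding sq_grad_def by (rule member_le_sum[OF b, of "%b. (norm (F N b x - F M b x))\<^sup>2"]) auto
  qed simp
  also have "... \<le> of_nat (Nn i) * (NN x. indicator ({- real i..real i} \<times> cell) x * ennreal (sq_grad (%b x. F N b x - F M b x) x))"
   by (rule Nn[OF _ dp]) measurable
  also have "... \<le> of_nat (Nn i) * q (%b x. F N b x - F M b x)"
   unfolding q_def by (intro mult_left_mono nn_integral_subset_mono) auto
  finally show ?thesis .
 qed
 have Cauchy: "\<exists>N. \<forall>n\<ge>N. \<forall>k\<ge>N. \<forall>b\<in>Basis. (NN x. indicator (slab i) x * nsq (F n b x - F k b x)) \<le> ennreal \<epsilon>" if e: "\<epsilon> > 0" for i \<epsilon>
 proof -
  define \<epsilon>' where "\<epsilon>' = \<epsilon> / (real (Nn i) + 1)"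
  have e': "0 < \<epsilon>'" using e by (simp add: \<epsilon>'_def)
  have "\<forall>\<^sub>F n in sequentially. c n < \<epsilon>'" using c0 e' by (rule order_tendstoD(2))
  then obtain N where N: "!!n. n \<ge> N ==> c n < \<epsilon>'" unfolding eventually_sequentially by blast
  have "(NN x. indicator (slab i) x * nsq (F n b x - F k b x)) \<le> ennreal \<epsilon>" if nk: "n \<ge> N" "k \<ge> N" and b: "b \<in> Basis" for n k b
  proof -
   have "q (%b x. F n b x - F k b x) \<le> ennreal \<epsilon>'"
   proof (cases "n \<le> k")
    case True
    show ?thesis by (rule order_trans[OF diff[OF True] ennreal_leI]) (use N[OF nk(1)] in simp)
   next
    case False
    then have "k \<le> n" by simp
    show ?thesis unfolding diffsym[of n k] by (rule order_trans[OF diff[OF \<open>k \<le> n\<close>] ennreal_leI]) (use N[OF nk(2)] in simp)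
   qed
   then have "of_nat (Nn i) * q (%b x. F n b x - F k b x) \<le> of_nat (Nn i) * ennreal \<epsilon>'" by (rule mult_left_mono) simp
   also have "... = ennreal (real (Nn i) * \<epsilon>')" using e' by (simp add: ennreal_of_nat_eq_real_of_nat ennreal_mult'[symmetric])
   also have "... \<le> ennreal \<epsilon>"
   proof (rule ennreal_leI)
    have "real (Nn i) * \<epsilon>' \<le> (real (Nn i) + 1) * \<epsilon>'" using e' by simp
    also have "... = \<epsilon>" by (simp add: \<epsilon>'_def)
    finally show "real (Nn i) * \<epsilon>' \<le> \<epsilon>" .
   qed
   finally show ?thesis by (rule order_trans[OF loc[OF b]])
  qed
  then show ?thesis by blast
 qed
 show thesis
 proof (rule L2_local_limit[of Basis F slab, OF Fm slab_borel slab_incseq Cauchy])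
  fix r assume r: "strict_mono r"
   and ae: "!!b. b \<in> Basis ==> AE x in lborel. x \<in> (\<Union>i. slab i) \<longrightarrow> (%n. F (r n) b x) ~> lim (%n. F (r n) b x)"
   and L2: "!!i b. b \<in> Basis ==> (%n. (NN x. indicator (slab i) x * nsq (F n b x - lim (%k. F (r k) b x)))) ~> 0"
  define G where "G b x = lim (%k. F (r k) b x)" for b x
  have Gm: "G b \<in> bmeas" if "b \<in> Basis" for b unfolding G_def by (rule borel_measurable_lim_metric) (rule Fm[OF that])
  have wl: "(%n. (NN x. indicator (slab i) x * nsq (w n x - v x))) ~> 0" for i
  proof (rule order_tendstoI)
   fix e :: ennreal assume "0 < e"
   obtain \<epsilon> where eps: "0 < \<epsilon>" "ennreal \<epsilon> < e"
   proof (cases e)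
    case (real t) then show ?thesis using \<open>0 < e\<close> that[of "t/2"] by (auto simp: ennreal_less_iff)
   next
    case top then show ?thesis using that[of 1] by simp
   qed
   have "\<forall>\<^sub>F n in sequentially. (NN x. indicator (slab i) x * nsq (u n x - v x)) < ennreal \<epsilon>"
    using lim[of i] by (rule order_tendstoD(2)) (use eps in simp)
   then obtain N where N: "!!n. n \<ge> N ==> (NN x. indicator (slab i) x * nsq (u n x - v x)) < ennreal \<epsilon>"
    unfolding eventually_sequentially by blast
   have "(NN x. indicator (slab i) x * nsq (w n x - v x)) < e" if "n \<ge> N" for n
   proof -
    have "w n \<in> bmeas \<and> (NN x. indicator (slab i) x * nsq (w n x - v x)) \<le> ennreal \<epsilon>"
     by (rule mid_hull_close[OF regular_fieldD(7)[OF R] v slab_borel _ _ H]) (use eps N that in \<open>auto intro: less_imp_le\<close>)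
    then show ?thesis using eps(2) by (meson le_less_trans)
   qed
   then show "\<forall>\<^sub>F n in sequentially. (NN x. indicator (slab i) x * nsq (w n x - v x)) < e"
    unfolding eventually_sequentially by blast
  qed simp
  have GB: "borel_grad UNIV v G"
   by (rule borel_grad_limit[OF B v Gm slab_compact slab_cover_compact wl L2[folded G_def]])
  have AEall: "AE x in lborel. \<forall>b\<in>Basis. (%n. F (r n) b x) ~> G b x"
   unfolding AE_ball_countable[OF countable_finite[OF finite_Basis]] G_def using ae by (simp add: slab_Union)
  have div: "AE x in lborel. (\<Sum>b\<in>Basis. G b x \<bullet> b) = 0"
  proof -
   have "AE x in lborel. \<forall>n. (\<Sum>b\<in>Basis. F n b x \<bullet> b) = 0" unfolding AE_all_countable using hull(4)[OF H] by blast
   then show ?thesis using AEall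
   proof eventually_elim
    case (elim x)
    have "(%n. \<Sum>b\<in>Basis. F (r n) b x \<bullet> b) ~> (\<Sum>b\<in>Basis. G b x \<bullet> b)"
     using elim(2) by (intro tendsto_sum tendsto_inner tendsto_const) blast
    then show ?case using elim(1) by (simp add: LIMSEQ_const_iff)
   qed
  qed
  have qG: "q G \<le> liminf (%n. q (D n))"
  proof -
   have "q G \<le> (NN x. liminf (%n. indicator (UNIV \<times> cell) x * ennreal (sq_grad (F (r n)) x)))"
    unfolding q_def
   proof (rule nn_integral_mono_AE, use AEall in eventually_elim)
    fix x assume "\<forall>b\<in>Basis. (%n. F (r n) b x) ~> G b x"
    then have "(%n. sq_grad (F (r n)) x) ~> sq_grad G x"
     unfolding sq_grad_def by (intro tendsto_sum tendsto_power tendsto_norm) blast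
    then have "liminf (%n. ennreal (sq_grad (F (r n)) x)) = ennreal (sq_grad G x)"
     by (intro lim_imp_Liminf tendsto_ennrealI) auto
    then show "indicator (UNIV \<times> cell) x * ennreal (sq_grad G x) \<le> liminf (%n. indicator (UNIV \<times> cell) x * ennreal (sq_grad (F (r n)) x))"
     by (cases "x \<in> UNIV \<times> cell") simp_all
   qed
   also have "... \<le> liminf (%n. q (F (r n)))"
    unfolding q_def by (rule nn_integral_liminf) (use sq_grad_borel[OF Fm] in measurable)
   also have "... \<le> liminf (%n. ennreal (\<mu> (r n) + 1 / real (Suc (r n))))"
    by (intro Liminf_mono always_eventually allI qF)
   also have "... = ennreal \<mu>\<^sub>1"
   proof (rule lim_imp_Liminf)
    have "(%n. \<mu> n + inverse (real (Suc n))) ~> \<mu>\<^sub>1 + 0" by (intro tendsto_intros \<mu>1(1) LIMSEQ_inverse_real_of_nat)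
    then have "(%n. \<mu> n + 1 / real (Suc n)) ~> \<mu>\<^sub>1" by (simp add: inverse_eq_divide)
    from LIMSEQ_subseq_LIMSEQ[OF this r] show "(%n. ennreal (\<mu> (r n) + 1 / real (Suc (r n)))) ~> ennreal \<mu>\<^sub>1"
     by (intro tendsto_ennrealI) (simp add: o_def)
   qed simp
   \<comment> \<open>Each original gradient with index n \<ge> N is itself in the N-th hull, hence
     bounds \<open>\<mu> N\<close> from above.\<close>
   also have "... \<le> liminf (%n. q (D n))"
   proof (rule LIMSEQ_le_const2[OF tendsto_ennrealI[OF \<mu>1(1)]])
    show "\<exists>N. \<forall>n\<ge>N. ennreal (\<mu> n) \<le> liminf (%n. q (D n))"
    proof (intro exI[of _ 0] allI impI)
     fix N
     show "ennreal (\<mu> N) \<le> liminf (%n. q (D n))"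
      unfolding m\<mu>[symmetric] by (rule Liminf_bounded) (use mD in \<open>auto simp: eventually_sequentially\<close>)
    qed
   qed
   finally show ?thesis .
  qed
  show thesis by (rule that[OF GB div qG[unfolded q_def]])
 qed
qed

text \<open>Rellich gives a subsequence that is Cauchy in L2 on all slabs, and a further one
  converging almost everywhere, as Fatou will want for the potential term. The gradient is obtained
  along the final subsequence. The bound on the average at time 0 fixes the additive constant left
  free by a gradient bound.\<close>

lemma compactness:
 fixes u :: "nat => ('m::finite) pt => 'm pt"
 assumes R: "!!n. regular_field (u n) (D n)" and Q: "0 \<le> Q" "!!n. (gradsq (D n)) \<le> ennreal Q"
  and M: "0 \<le> M" "!!n. norm (xavg (u n) 0) \<le> M"
 obtains r v G where "strict_mono r" "sob_div UNIV v G" "v \<in> bmeas"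
  "AE x in lborel. (%n. u (r n) x) ~> v x"
  "!!i. (%n. (NN x. indicator (slab i) x * nsq (u (r n) x - v x))) ~> 0"
  "(gradsq G) \<le> liminf (%n. (gradsq (D (r n))))"
proof (rule regular_field_slab_L2[OF Q(1) M(1), where 'm='m])
 fix g l :: "nat => real"
 assume g0: "!!i. 0 \<le> g i" and l0: "!!i. 0 \<le> l i"
  and g: "!!(u :: 'm pt => 'm pt) D i. regular_field u D ==> (gradsq D) \<le> ennreal Q ==>
   norm (xavg u 0) \<le> M ==> (NN x. indicator (slab i) x * ennreal (sq_grad D x)) \<le> ennreal (g i)"
  and l: "!!(u :: 'm pt => 'm pt) D i. regular_field u D ==> (gradsq D) \<le> ennreal Q ==>
   norm (xavg u 0) \<le> M ==> (NN x. indicator (slab i) x * nsq (u x)) \<le> ennreal (l i)"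
 show thesis
 proof (rule rellich[of u D slab g l])
  show "borel_grad UNIV (u n) (D n)" for n by (rule regular_fieldD(1)[OF R])
  show "(NN x. indicator (slab i) x * ennreal (sq_grad (D n) x)) \<le> ennreal (g i)" for n i by (rule g[OF R Q(2) M(2)])
  show "(NN x. indicator (slab i) x * nsq (u n x)) \<le> ennreal (l i)" for n i by (rule l[OF R Q(2) M(2)])
  show "0 \<le> g i" "0 \<le> l i" for i by (rule g0, rule l0)
  show "compact (slab i :: 'm pt set)" "convex (slab i :: 'm pt set)" for i by (rule slab_compact, rule slab_convex)
  show "(\<Union>i. slab i) = (UNIV :: 'm pt set)" by (rule slab_Union)
  show "y \<in> slab (Suc i)" if "x \<in> slab i" "norm (y - x) \<le> 1" for i and x y :: "'m pt" by (rule slab_nbr[OF that])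
  fix r1 :: "nat => nat" assume r1: "strict_mono r1"
   and C1: "!!i \<epsilon>. \<epsilon> > 0 ==> \<exists>N. \<forall>n\<ge>N. \<forall>m\<ge>N. (NN x. indicator (slab i) x * nsq (u (r1 n) x - u (r1 m) x)) \<le> ennreal \<epsilon>"
  show thesis
  proof (rule L2_local_limit[of "{()}" "%n _. u (r1 n)" slab])
   show "u (r1 n) \<in> bmeas" for n by (rule regular_fieldD(7)[OF R])
   show "slab i \<in> sets (borel :: 'm pt measure)" for i by (rule slab_borel)
   show "incseq (slab :: nat => 'm pt set)" by (rule slab_incseq)
   show "\<exists>N. \<forall>n\<ge>N. \<forall>m\<ge>N. \<forall>b\<in>{()}. (NN x. indicator (slab i) x * nsq (u (r1 n) x - u (r1 m) x)) \<le> ennreal \<epsilon>" if "\<epsilon> > 0" for i \<epsilon>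
    using C1[OF that, of i] by simp
   fix r2 :: "nat => nat" assume r2: "strict_mono r2"
    and ae: "!!b. b \<in> {()} ==> AE x in lborel. x \<in> (\<Union>i. slab i) \<longrightarrow> (%n. u (r1 (r2 n)) x) ~> lim (%n. u (r1 (r2 n)) x)"
    and L2: "!!i b. b \<in> {()} ==> (%n. (NN x. indicator (slab i) x * nsq (u (r1 n) x - lim (%k. u (r1 (r2 k)) x)))) ~> 0"
   define r where "r n = r1 (r2 n)" for n
   have r: "strict_mono r" using strict_mono_o[OF r1 r2] by (simp add: r_def o_def strict_mono_def)
   define v where "v x = lim (%k. u (r k) x)" for x
   have vm: "v \<in> bmeas" unfolding v_def by (rule borel_measurable_lim_metric) (rule regular_fieldD(7)[OF R])
   have conv: "AE x in lborel. (%n. u (r n) x) ~> v x" using ae[of "()"] by (simp add: slab_Union v_def r_def)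
   have lim: "(%n. (NN x. indicator (slab i) x * nsq (u (r n) x - v x))) ~> 0" for i
    using LIMSEQ_subseq_LIMSEQ[OF L2[of "()" i] r2] by (simp add: o_def v_def r_def)
   show thesis
   proof (rule gradient_limit[of "%n. u (r n)" "%n. D (r n)" Q v, OF R Q vm lim])
    fix G assume GB: "borel_grad UNIV v G" and div: "AE x in lborel. (\<Sum>b\<in>Basis. G b x \<bullet> b) = 0"
     and qG: "(gradsq G) \<le> liminf (%n. (gradsq (D (r n))))"
    have "liminf (%n. (gradsq (D (r n)))) \<le> ennreal Q"
     by (rule Liminf_le) (use Q(2) in auto)
    then have qfin: "(gradsq G) < \<infinity>"
     using le_less_trans[OF order_trans[OF qG] ennreal_less_top] by simp
    have "sob_div UNIV v G" unfolding sob_div_def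
    proof (intro conjI)
     have per: "u n (t, y + axis i 1) = u n (t, y)" for n t y i using regular_fieldD(2)[OF R, of n] by (simp add: periodic_x'_def)
     show "periodic_x' v" unfolding periodic_x'_def v_def per by simp
     show "weak_grad (interior UNIV \<times> UNIV) v G" using borel_grad_imp_weak_grad[OF GB] by simp
     show "(\<integral>\<^sup>+x. indicator (UNIV \<times> cell) x * ennreal (sq_grad G x) \<partial>lebesgue) < \<infinity>" unfolding nn_integral_completion by (rule qfin)
     show "AE x in lebesgue. x \<in> interior UNIV \<times> UNIV \<longrightarrow> (\<Sum>b\<in>Basis. G b x \<bullet> b) = 0"
      using AE_completion[OF div] by eventually_elim simp
    qed
    then show thesis by (rule that[OF r _ vm conv lim qG])
   qed
  qed
 qed
qed

section \<open>Gluing constants to a field\<close>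

lemma borel_grad_const: "borel_grad UNIV (%x :: 'a::euclidean_space. c :: 'b::euclidean_space) (%b x. 0)"
proof (rule borel_gradI_lines)
 fix K :: "'a set" assume "compact K"
 then have "integrable lborel (%x. indicator K x *R (norm c)\<^sup>2)"
  by (rule borel_integrable_compact) simp
 then show "set_integrable lborel K (%x. (norm c)\<^sup>2)" by (simp add: set_integrable_def)
qed (simp_all add: set_integrable_def)

text \<open>The set K may be smaller than the support of \<phi>: a profile vanishing outside an
  interval moves a test function on the whole space into a strip.\<close>

lemma test_fun_mult_fst:
 fixes \<phi> :: "('m::finite) pt => real"
 assumes t: "test_fun \<phi> \<phi>' V" and f: "!!s. (f has_real_derivative f' s) (at s)" and f': "continuous_on UNIV f'"
  and K: "compact K" "K \<subseteq> U" "!!x. x \<notin> K ==> f (fst x) * \<phi> x = 0"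
 shows "test_fun (%x. f (fst x) * \<phi> x) (%x h. f (fst x) * \<phi>' x h + \<phi> x * (f' (fst x) * fst h)) U"
proof (rule test_funI[OF _ _ K])
 fix x :: "'m pt"
 have "(f has_derivative (%h. f' (fst x) * h)) (at (fst x))"
  using f[of "fst x"] unfolding has_field_derivative_def by (simp add: mult_commute_abs)
 from has_derivative_compose[OF has_derivative_fst[OF has_derivative_ident] this]
 have 1: "((%x. f (fst x)) has_derivative (%h. f' (fst x) * fst h)) (at x)" .
 have 2: "(\<phi> has_derivative \<phi>' x) (at x)" using t unfolding test_fun_def by blast
 show "((%x. f (fst x) * \<phi> x) has_derivative (%h. f (fst x) * \<phi>' x h + \<phi> x * (f' (fst x) * fst h))) (at x)"
  by (rule has_derivative_eq_rhs[OF has_derivative_mult[OF 1 2]]) (simp add: fun_eq_iff mult_ac)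
next
 fix b :: "'m pt" assume b: "b \<in> Basis"
 have fc: "continuous_on UNIV f" by (rule continuous_at_imp_continuous_on) (use f DERIV_isCont in blast)
 have "continuous_on UNIV (%x :: 'm pt. f (fst x))" "continuous_on UNIV (%x :: 'm pt. f' (fst x))"
  by (rule continuous_on_compose2[OF fc continuous_on_fst[OF continuous_on_id]], simp)
   (rule continuous_on_compose2[OF f' continuous_on_fst[OF continuous_on_id]], simp)
 then show "continuous_on UNIV (%x. f (fst x) * \<phi>' x b + \<phi> x * (f' (fst x) * fst b))"
  by (intro continuous_intros test_fun_continuous[OF t] test_fun_continuous_deriv[OF t])
qed

text \<open>The product of \<phi> with the profile is again a test function. Integrated against a
  constant its derivative gives 0, and the product rule splits this into the two sides of the
  integration by parts.\<close>

lemma borel_grad_profile: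
 fixes c :: "'b::euclidean_space"
 assumes f: "!!s. (f has_real_derivative f' s) (at s)" and f': "continuous_on UNIV f'"
 shows "borel_grad UNIV (%x :: ('m::finite) pt. f (fst x) *R c) (%b x. (fst b * f' (fst x)) *R c)"
proof -
 have fc: "continuous_on UNIV f" by (rule continuous_at_imp_continuous_on) (use f DERIV_isCont in blast)
 have c1: "continuous_on A (%x :: 'm pt. f (fst x) *R c)" "continuous_on A (%x :: 'm pt. (fst b * f' (fst x)) *R c)" for A and b :: "'m pt"
  by (intro continuous_intros continuous_on_compose2[OF fc] continuous_on_compose2[OF f']; simp)+
 have m: "(%x :: 'm pt. f (fst x) *R c) \<in> bmeas" "(%x :: 'm pt. (fst b * f' (fst x)) *R c) \<in> bmeas" for b :: "'m pt"
  by (intro borel_measurable_continuous_onI c1)+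
 have si: "set_integrable lborel K g" if "compact K" "continuous_on K g" for K :: "'m pt set" and g :: "'m pt => 'd::euclidean_space"
  using borel_integrable_compact[OF that] by (simp add: set_integrable_def)
 show ?thesis
  unfolding borel_grad_def
 proof (intro conjI ballI allI impI)
  fix K :: "'m pt set" assume K: "compact K \<and> K \<subseteq> UNIV"
  show "set_integrable lborel K (%x. (norm (f (fst x) *R c))\<^sup>2)"
   by (rule si[OF _ continuous_on_power[OF continuous_on_norm[OF c1(1)]]]) (use K in simp)
  fix b :: "'m pt"
  show "set_integrable lborel K (%x. (norm ((fst b * f' (fst x)) *R c))\<^sup>2)"
   by (rule si[OF _ continuous_on_power[OF continuous_on_norm[OF c1(2)]]]) (use K in simp)
 next
  fix \<phi> \<phi>' and b :: "'m pt" assume t: "test_fun \<phi> \<phi>' (UNIV :: 'm pt set)" and b: "b \<in> Basis"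
  obtain K where K: "compact K" "K \<subseteq> UNIV" "!!x. x \<notin> K ==> \<phi> x = 0" "!!x. x \<notin> K ==> \<phi>' x = (%_. 0)" using test_fun_support[OF t] by metis
  obtain M where M: "!!x. \<bar>\<phi> x\<bar> \<le> M" "!!x. \<bar>\<phi>' x b\<bar> \<le> M" using test_fun_bounded[OF t, of b] by metis
  have i1: "integrable lborel (%x. \<phi>' x b *R (f (fst x) *R c))"
   by (rule integrable_bounded_support[where K = K and M = M, OF si[OF K(1) c1(1)] m(1) test_fun_borel(2)[OF t] _ M(2)]) (simp add: K)
  have i2: "integrable lborel (%x. \<phi> x *R ((fst b * f' (fst x)) *R c))"
   by (rule integrable_bounded_support[where K = K and M = M, OF si[OF K(1) c1(2)] m(2) test_fun_borel(1)[OF t] _ M(1)]) (simp add: K)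
  have t2: "test_fun (%x. f (fst x) * \<phi> x) (%x h. f (fst x) * \<phi>' x h + \<phi> x * (f' (fst x) * fst h)) UNIV"
   by (rule test_fun_mult_fst[OF t f f' K(1,2)]) (simp add: K(3))
  have "(LBINT x. (f (fst x) * \<phi>' x b + \<phi> x * (f' (fst x) * fst b)) *R c) = 0"
   using borel_gradD(6)[OF borel_grad_const[of c] t2 b] by simp
  moreover have "(LBINT x. (f (fst x) * \<phi>' x b + \<phi> x * (f' (fst x) * fst b)) *R c)
   = (LBINT x. \<phi>' x b *R (f (fst x) *R c) + \<phi> x *R ((fst b * f' (fst x)) *R c))"
   by (rule Bochner_Integration.integral_cong) (simp_all add: scaleR_add_left mult_ac)
  ultimately show "(LBINT x. \<phi> x *R ((fst b * f' (fst x)) *R c)) = - (LBINT x. \<phi>' x b *R (f (fst x) *R c))"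
   unfolding Bochner_Integration.integral_add[OF i1 i2] by (simp add: eq_neg_iff_add_eq_0 add.commute)
 qed (use m in simp_all)
qed

lemma borel_grad_subset:
 assumes B: "borel_grad U u D" and V: "open V" "V \<subseteq> U"
 shows "borel_grad V u D"
 unfolding borel_grad_def
proof (intro conjI ballI allI impI)
 fix K assume "compact K \<and> K \<subseteq> V"
 then have K: "compact K" "K \<subseteq> U" using V by auto
 show "set_integrable lborel K (%x. (norm (u x))\<^sup>2)" by (rule borel_gradD(4)[OF B K])
 fix b :: 'a assume "b \<in> Basis"
 then show "set_integrable lborel K (%x. (norm (D b x))\<^sup>2)" by (rule borel_gradD(5)[OF B K])
next
 fix \<phi> \<phi>' and b :: 'a assume "test_fun \<phi> \<phi>' V" "b \<in> Basis"
 then show "(LBINT x. \<phi> x *R D b x) = - (LBINT x. \<phi>' x b *R u x)"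
  by (intro borel_gradD(6)[OF B] test_fun_mono[OF _ V(2)])
qed (use V borel_gradD(2,3)[OF B] in auto)

lemma borel_grad_cong_on:
 fixes u u' :: "'a::euclidean_space => 'b::euclidean_space"
 assumes B: "borel_grad U u D" and m[measurable]: "u' \<in> bmeas" and Dm[measurable]: "!!b. b \<in> Basis ==> D' b \<in> bmeas"
  and u: "AE x in lborel. x \<in> U \<longrightarrow> u x = u' x" and D: "!!b. b \<in> Basis ==> AE x in lborel. x \<in> U \<longrightarrow> D b x = D' b x"
 shows "borel_grad U u' D'"
proof -
 note [measurable] = borel_gradD(2,3)[OF B]
 have sc: "set_integrable lborel K (%x. (norm (g x))\<^sup>2)" if "set_integrable lborel K (%x. (norm (f x))\<^sup>2)" "compact K" "K \<subseteq> U" "AE x in lborel. x \<in> U \<longrightarrow> f x = g x"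
   "f \<in> bmeas" "g \<in> bmeas" for K and f g :: "'a => 'b"
 proof -
  note [measurable] = that(5,6) borel_compact[OF that(2)]
  have "integrable lborel (%x. indicator K x *R (norm (f x))\<^sup>2) \<longleftrightarrow> integrable lborel (%x. indicator K x *R (norm (g x))\<^sup>2)"
   by (rule integrable_cong_AE) (use that(4) in \<open>auto simp: indicator_def elim!: eventually_mono dest: subsetD[OF that(3)]\<close>)
  then show ?thesis using that(1) by (simp add: set_integrable_def)
 qed
 have ic: "(LBINT x. \<phi> x *R f x) = (LBINT x. \<phi> x *R g x)" if "!!x. x \<notin> U ==> \<phi> x = 0" "AE x in lborel. x \<in> U \<longrightarrow> f x = g x"
   "\<phi> \<in> bmeas" "f \<in> bmeas" "g \<in> bmeas" for \<phi> and f g :: "'a => 'b"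
 proof -
  note [measurable] = that(3,4,5)
  show ?thesis
  proof (rule integral_cong_AE)
   show "AE x in lborel. \<phi> x *R f x = \<phi> x *R g x" using that(2) 
   proof eventually_elim
    case (elim x) then show ?case using that(1)[of x] by (cases "x \<in> U") auto
   qed
  qed auto
 qed
 show ?thesis
  unfolding borel_grad_def
 proof (intro conjI ballI allI impI)
  fix K assume K: "compact K \<and> K \<subseteq> U"
  show "set_integrable lborel K (%x. (norm (u' x))\<^sup>2)"
   by (rule sc[OF borel_gradD(4)[OF B]]) (use K u m borel_gradD(2)[OF B] in auto)
  fix b :: 'a assume b: "b \<in> Basis"
  show "set_integrable lborel K (%x. (norm (D' b x))\<^sup>2)"
   by (rule sc[OF borel_gradD(5)[OF B]]) (use K b D[OF b] Dm[OF b] borel_gradD(3)[OF B b] in auto)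
 next
  fix \<phi> \<phi>' and b :: 'a assume t: "test_fun \<phi> \<phi>' U" and b: "b \<in> Basis"
  obtain K where K: "compact K" "K \<subseteq> U" "!!x. x \<notin> K ==> \<phi> x = 0" "!!x. x \<notin> K ==> \<phi>' x = (%_. 0)" using test_fun_support[OF t] by metis
  have z: "\<phi> x = 0" "\<phi>' x b = 0" if "x \<notin> U" for x
  proof -
   have "x \<notin> K" using K(2) that by blast
   from K(3)[OF this] K(4)[OF this] show "\<phi> x = 0" "\<phi>' x b = 0" by simp_all
  qed
  have "(LBINT x. \<phi> x *R D b x) = (LBINT x. \<phi> x *R D' b x)"
   by (rule ic[OF z(1) D[OF b] test_fun_borel(1)[OF t] borel_gradD(3)[OF B b] Dm[OF b]])
  moreover have "(LBINT x. \<phi>' x b *R u x) = (LBINT x. \<phi>' x b *R u' x)"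
   by (rule ic[OF z(2) u test_fun_borel(2)[OF t] borel_gradD(2)[OF B] m])
  ultimately show "(LBINT x. \<phi> x *R D' b x) = - (LBINT x. \<phi>' x b *R u' x)"
   using borel_gradD(6)[OF B t b] by simp
 qed (use borel_gradD(1)[OF B] m Dm in auto)
qed

lemma periodic_L2_compact:
 fixes f :: "('m::finite) pt => 'b::euclidean_space"
 assumes f[measurable]: "f \<in> bmeas" and per: "periodic_x' f"
  and fin: "(NN x. indicator (UNIV \<times> cell) x * nsq (f x)) < \<infinity>" and K: "compact K"
 shows "set_integrable lborel K (%x. (norm (f x))\<^sup>2)" "set_integrable lborel K f"
proof -
 note [measurable] = borel_compact[OF K]
 obtain R where R: "0 < R" "!!x. x \<in> K ==> norm x \<le> R" using compact_imp_bounded[OF K] by (meson bounded_pos)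
 obtain N :: nat where N: "!!(f :: 'm pt => ennreal) A. f \<in> bmeas ==> periodic_x' f ==> A \<in> sets borel ==>
  (NN x. indicator (A \<times> cball 0 R) x * f x) \<le> of_nat N * (NN x. indicator (A \<times> cell) x * f x)"
  by (rule nn_integral_periodic_ball_le[of R]) (use R in auto)
 have KR: "K \<subseteq> UNIV \<times> cball 0 R"
  using R(2) norm_snd_le order_trans by (fastforce simp: subset_iff)
 have "(NN x. indicator K x * nsq (f x)) \<le> (NN x. indicator (UNIV \<times> cball 0 R) x * nsq (f x))"
  by (rule nn_integral_subset_mono[OF KR])
 also have "... \<le> of_nat N * (NN x. indicator (UNIV \<times> cell) x * nsq (f x))"
  by (rule N) (use per in \<open>auto simp: periodic_x'_def\<close>)
 also have "... < \<infinity>" using fin by (simp add: ennreal_mult_less_top of_nat_less_top)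
 finally have *: "(NN x. indicator K x * nsq (f x)) < \<infinity>" .
 have e: "emeasure lborel K < \<infinity>" using emeasure_compact_finite[OF K] by simp
 show "set_integrable lborel K (%x. (norm (f x))\<^sup>2)" "set_integrable lborel K f"
  by (rule set_integrable_finite_L2[OF _ _ e *]; simp)+
qed

section \<open>Extension by zero across end slices\<close>

text \<open>\<open>smoothstep\<close> of a normalised quadratic in s treats both ends with one
  formula: the cut-off vanishes where (s - tm)(tp - s) is at most e \<rho> and equals 1 where it is
  at least 2 e \<rho>. Near an end the quadratic is comparable to the distance to that end times the
  length of the interval, whence layers of width of order e.\<close>

lemma cutoff_profile:
 fixes tm tp e :: real
 defines "\<rho> \<equiv> (tp - tm) / 2"
 assumes tt: "tm < tp" and e: "0 < e"
 obtains X X' where "!!s. (X has_real_derivative X' s) (at s)" "continuous_on UNIV X'" "!!s. 0 \<le> X s \<and> X s \<le> 1"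
  "!!s. s \<notin> {tm + e/2..tp - e/2} ==> X s = 0" "!!s. s \<notin> {tm..tm + 2*e} \<union> {tp - 2*e..tp} ==> X' s = 0" "!!s. \<bar>X' s\<bar> \<le> 4 / e"
  "!!s. 2 * e * \<rho> \<le> (s - tm) * (tp - s) ==> X s = 1"
proof -
 define q where "q = (%s. (s - tm) * (tp - s) / (e * \<rho>) - 1)"
 define X where "X = (%s. smoothstep (q s))"
 define X' where "X' = (%s. smoothstep_deriv (q s) * ((tm + tp - 2 * s) / (e * \<rho>)))"
 have r: "0 < \<rho>" using tt by (simp add: \<rho>_def)
 then have er: "0 < e * \<rho>" using e by simp
 have "2 * \<rho> = tp - tm" by (simp add: \<rho>_def)
 have q0: "q s \<le> 0" if "(s - tm) * (tp - s) \<le> e * \<rho>" for s using that er by (simp add: q_def field_simps)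
 have q1: "1 \<le> q s" if "2 * e * \<rho> \<le> (s - tm) * (tp - s)" for s using that er by (simp add: q_def field_simps)
 have out: "(s - tm) * (tp - s) \<le> 0" if "s \<notin> {tm..tp}" for s
  using that tt by (auto simp: mult_le_0_iff)
 have dq: "(q has_real_derivative (tm + tp - 2 * s) / (e * \<rho>)) (at s)" for s
  unfolding q_def using e r by (auto intro!: derivative_eq_intros simp: field_simps)
 have qc: "continuous_on UNIV q" unfolding q_def using e r by (intro continuous_intros) auto
 show thesis
 proof (rule that[of X X'])
  fix s
  show "(X has_real_derivative X' s) (at s)" unfolding X_def X'_def by (rule DERIV_chain2[OF DERIV_smoothstep dq])
  show "0 \<le> X s \<and> X s \<le> 1" by (simp add: X_def smoothstep_bounds)
  show "X s = 1" if "2 * e * \<rho> \<le> (s - tm) * (tp - s)" unfolding X_def by (rule smoothstep_eq_1[OF q1[OF that]])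
  show "X s = 0" if "s \<notin> {tm + e/2..tp - e/2}"
  proof -
   have "(s - tm) * (tp - s) \<le> e * \<rho>"
   proof (cases "s \<in> {tm..tp}")
    case True
    show ?thesis
    proof (cases "s < tm + e/2")
     case t: True
     have "(s - tm) * (tp - s) \<le> (e/2) * (2 * \<rho>)" by (rule mult_mono) (use True t e r in \<open>auto simp: \<rho>_def\<close>)
     then show ?thesis by simp
    next
     case False
     have "(s - tm) * (tp - s) \<le> (2 * \<rho>) * (e/2)" by (rule mult_mono) (use True False that e r in \<open>auto simp: \<rho>_def\<close>)
     then show ?thesis by (simp add: mult_ac)
    qed
   qed (use out[of s] er in auto)
   then show ?thesis unfolding X_def by (intro smoothstep_eq_0 q0)
  qed
  show "X' s = 0" if s: "s \<notin> {tm..tm + 2*e} \<union> {tp - 2*e..tp}"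
  proof (cases "s \<in> {tm..tp}")
   case True
   have "2 * e * \<rho> \<le> (s - tm) * (tp - s)"
   proof (cases "\<rho> \<le> tp - s")
    case t: True
    show ?thesis by (rule mult_mono) (use True t s e r in \<open>auto simp: \<rho>_def\<close>)
   next
    case False
    have "\<rho> * (2 * e) \<le> (s - tm) * (tp - s)" by (rule mult_mono) (use True False s e r in \<open>auto simp: \<rho>_def field_simps\<close>)
    then show ?thesis by (simp add: mult_ac)
   qed
   then show ?thesis unfolding X'_def by (simp add: smoothstep_deriv_eq_0'[OF q1])
  next
   case False
   have "q s \<le> 0" by (rule q0) (use out[OF False] er in linarith)
   then show ?thesis unfolding X'_def by (simp add: smoothstep_deriv_eq_0)
  qed
  \<comment> \<open>On the interval the quadratic has derivative at most 2 \<rho>, divided by e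
    \<rho> this is 2/e, and the derivative of \<open>smoothstep\<close> is bounded by 2.\<close>
  show "\<bar>X' s\<bar> \<le> 4 / e"
  proof (cases "s \<in> {tm..tp}")
   case True
   have "\<bar>tm + tp - 2 * s\<bar> \<le> 2 * \<rho>"
   using True \<open>2 * \<rho> = tp - tm\<close> by (intro abs_leI) auto
   then have "\<bar>(tm + tp - 2 * s) / (e * \<rho>)\<bar> \<le> 2 * \<rho> / (e * \<rho>)" unfolding abs_divide abs_of_pos[OF er] using er by (intro divide_right_mono) auto
   then have "\<bar>(tm + tp - 2 * s) / (e * \<rho>)\<bar> \<le> 2 / e" using r by simp
   then have "\<bar>smoothstep_deriv (q s)\<bar> * \<bar>(tm + tp - 2 * s) / (e * \<rho>)\<bar> \<le> 2 * (2 / e)"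
    by (intro mult_mono smoothstep_deriv_bound) auto
   then show ?thesis by (simp add: X'_def abs_mult)
  next
   case False
   have "q s \<le> 0" by (rule q0) (use out[OF False] er in linarith)
   then show ?thesis using e unfolding X'_def by (simp add: smoothstep_deriv_eq_0)
  qed
 next
  show "continuous_on UNIV X'" unfolding X'_def using e r
   by (intro continuous_intros continuous_on_compose2[OF continuous_smoothstep_deriv qc]) auto
 qed
qed

text \<open>Cutting a test function off near the end slices brings it into the strip, where
  integration by parts is known. The extra term contains the derivative of the cut-off, of size 1/e
  on layers of width 2 e; by Cauchy-Schwarz its square is bounded by 1/(2 e) times the integral of
  |w|^2 over the layers. This is exactly the quantity that vanishes when both traces are
  zero.\<close>

lemma zero_extension:
 fixes w :: "('m::finite) pt => 'm pt"
 assumes tt: "tm < tp" and B: "borel_grad ({tm<..<tp} \<times> UNIV) w E"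
  and wz: "!!x. fst x \<notin> {tm<..<tp} ==> w x = 0" and Ez: "!!b x. b \<in> Basis ==> fst x \<notin> {tm<..<tp} ==> E b x = 0"
  and per: "periodic_x' w" "!!b. b \<in> Basis ==> periodic_x' (E b)"
  and E2: "!!b. b \<in> Basis ==> (NN x. indicator (UNIV \<times> cell) x * nsq (E b x)) < \<infinity>"
  and tl: "((%h. ennreal (1 / h) * (NN x. indicator ({tm..tm+h} \<times> cell) x * nsq (w x))) \<longlongrightarrow> 0) (at_right 0)"
  and tr: "((%h. ennreal (1 / h) * (NN x. indicator ({tp-h..tp} \<times> cell) x * nsq (w x))) \<longlongrightarrow> 0) (at_right 0)"
 shows "borel_grad UNIV w E"
proof -
 let ?J = "{tm<..<tp} \<times> (UNIV :: (real ^ 'm) set)"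
 define Il where "Il = (%h. (NN x. indicator ({tm..tm+h} \<times> cell) x * nsq (w x)))"
 define Ir where "Ir = (%h. (NN x. indicator ({tp-h..tp} \<times> cell) x * nsq (w x)))"
 note [measurable] = borel_gradD(2)[OF B] borel_gradD(3)[OF B]
 have [measurable]: "A \<times> (cell :: (real ^ 'm) set) \<in> sets borel" if "A \<in> sets borel" for A :: "real set"
  by (rule borel_Times[OF that cell_borel])
 have tl': "((%h. ennreal (1 / h) * Il h) \<longlongrightarrow> 0) (at_right 0)" and tr': "((%h. ennreal (1 / h) * Ir h) \<longlongrightarrow> 0) (at_right 0)"
  using tl tr by (simp_all add: Il_def Ir_def)
 \<comment> \<open>One fixed h with finite layer integrals shows that w is square integrable up to
   the end slices; the part in between is compact in the strip modulo periodicity.\<close>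
 have "\<forall>\<^sub>F h in at_right (0::real). ennreal (1 / h) * Il h < 1 \<and> ennreal (1 / h) * Ir h < 1 \<and> 0 < h"
  using order_tendstoD(2)[OF tl', of 1] order_tendstoD(2)[OF tr', of 1] eventually_at_right_less[of 0]
  by (simp add: eventually_conj_iff)
 from eventually_happens[OF this] obtain h :: real where h: "ennreal (1 / h) * Il h < 1" "ennreal (1 / h) * Ir h < 1" "0 < h" by auto
 have top: "x < \<infinity>" if "ennreal (1 / h) * x < 1" for x
  using that h(3) by (cases "x = \<infinity>") (auto simp: ennreal_mult_top less_top)
 let ?K = "{tm + h..tp - h} \<times> (cell :: (real ^ 'm) set)"
 have "set_integrable lborel ?K (%x. (norm (w x))\<^sup>2)"
  by (rule borel_gradD(4)[OF B]) (use h(3) in \<open>auto intro!: compact_Times compact_cell\<close>)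
 from set_integrable_L2D[OF this]
 have mid: "(NN x. indicator ?K x * nsq (w x)) < \<infinity>" .
 have "(NN x. indicator (UNIV \<times> cell) x * nsq (w x))
  \<le> (NN x. (indicator ({tm..tm+h} \<times> cell) x * nsq (w x) + indicator ({tp-h..tp} \<times> cell) x * nsq (w x))
    + indicator ?K x * nsq (w x))"
 proof (rule nn_integral_mono)
  fix x :: "'m pt"
  show "indicator (UNIV \<times> cell) x * nsq (w x) \<le> (indicator ({tm..tm+h} \<times> cell) x * nsq (w x) + indicator ({tp-h..tp} \<times> cell) x * nsq (w x))
    + indicator ?K x * nsq (w x)"
   using wz[of x] by (cases x) (auto simp: indicator_def)
 qed
 also have "... = (Il h + Ir h) + (NN x. indicator ?K x * nsq (w x))"
  unfolding Il_def Ir_def by (subst nn_integral_add; simp)+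
 also have "... < \<infinity>" using top[OF h(1)] top[OF h(2)] mid by simp
 finally have w2: "(NN x. indicator (UNIV \<times> cell) x * nsq (w x)) < \<infinity>" .
 note wK = periodic_L2_compact[OF borel_gradD(2)[OF B] per(1) w2]
 note EK = periodic_L2_compact[OF borel_gradD(3)[OF B] per(2) E2]
 define \<rho> where "\<rho> = (tp - tm) / 2"
 define e where "e = (%n. inverse (real (Suc n)))"
 have e: "0 < e n" for n by (simp add: e_def)
 have e0: "e ~> 0" unfolding e_def by (rule LIMSEQ_inverse_real_of_nat)
 have "\<exists>X X'. (\<forall>s. (X has_real_derivative X' s) (at s)) \<and> continuous_on UNIV X' \<and> (\<forall>s. 0 \<le> X s \<and> X s \<le> 1) \<and>
   (\<forall>s. s \<notin> {tm + e n/2..tp - e n/2} \<longrightarrow> X s = 0) \<and> (\<forall>s. s \<notin> {tm..tm + 2*e n} \<union> {tp - 2*e n..tp} \<longrightarrow> X' s = 0) \<and> (\<forall>s. \<bar>X' s\<bar> \<le> 4 / e n) \<and>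
   (\<forall>s. 2 * e n * \<rho> \<le> (s - tm) * (tp - s) \<longrightarrow> X s = 1)" for n
  unfolding \<rho>_def by (rule cutoff_profile[OF tt e[of n]]) (intro exI conjI allI impI; assumption?; blast)
 then obtain X X' where X: "!!n s. (X n has_real_derivative X' n s) (at s)" "!!n. continuous_on UNIV (X' n)" "!!n s. 0 \<le> X n s \<and> X n s \<le> 1"
  "!!n s. s \<notin> {tm + e n/2..tp - e n/2} ==> X n s = 0" "!!n s. s \<notin> {tm..tm + 2*e n} \<union> {tp - 2*e n..tp} ==> X' n s = 0"
  "!!n s. \<bar>X' n s\<bar> \<le> 4 / e n" "!!n s. 2 * e n * \<rho> \<le> (s - tm) * (tp - s) ==> X n s = 1"
  by metis
 have Xc: "continuous_on UNIV (X n)" for n by (rule continuous_at_imp_continuous_on) (use X(1) DERIV_isCont in blast)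
 have [measurable]: "X n \<in> bmeas" "X' n \<in> bmeas" for n
  by (intro borel_measurable_continuous_onI Xc X(2))+
 have X1: "(%n. X n s) ~> 1" if "s \<in> {tm<..<tp}" for s
 proof (rule tendsto_eventually)
  have p: "0 < (s - tm) * (tp - s)" using that by simp
  have "(%n. 2 * e n * \<rho>) ~> 2 * 0 * \<rho>" by (intro tendsto_intros e0)
  then have "\<forall>\<^sub>F n in sequentially. 2 * e n * \<rho> < (s - tm) * (tp - s)" using p by (auto dest!: order_tendstoD(2))
  then show "\<forall>\<^sub>F n in sequentially. X n s = 1" by eventually_elim (simp add: X(7))
 qed
 have [measurable]: "(%x :: 'm pt. X n (fst x)) \<in> bmeas" "(%x :: 'm pt. X' n (fst x)) \<in> bmeas" for n
  by (intro borel_measurable_continuous_onI continuous_on_compose2[OF Xc] continuous_on_compose2[OF X(2)] continuous_intros; simp)+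
 show ?thesis
  unfolding borel_grad_def
 proof (intro conjI ballI allI impI)
  fix K :: "'m pt set" assume K: "compact K \<and> K \<subseteq> UNIV"
  show "set_integrable lborel K (%x. (norm (w x))\<^sup>2)" using wK K by simp
  fix b :: "'m pt" assume "b \<in> Basis"
  then show "set_integrable lborel K (%x. (norm (E b x))\<^sup>2)" using EK K by simp
 next
  fix \<phi> \<phi>' and b :: "'m pt" assume t: "test_fun \<phi> \<phi>' (UNIV :: 'm pt set)" and b: "b \<in> Basis"
  obtain R0 where R0: "!!x. x \<notin> cball 0 R0 ==> \<phi> x = 0" "!!x h. x \<notin> cball 0 R0 ==> \<phi>' x h = 0" using test_fun_support_cball[OF t] by metis
  define R where "R = max R0 0"
  have R: "0 \<le> R" "!!x. x \<notin> cball 0 R ==> \<phi> x = 0" "!!x h. x \<notin> cball 0 R ==> \<phi>' x h = 0"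
   using R0 by (auto simp: R_def)
  obtain M where M: "0 \<le> M" "!!x. \<bar>\<phi> x\<bar> \<le> M" "!!x. \<bar>\<phi>' x b\<bar> \<le> M" using test_fun_bounded[OF t, of b] by metis
  note [measurable] = test_fun_borel[OF t]
  have Eb[measurable]: "E b \<in> bmeas" using b by simp
  have cb: "compact (cball (0 :: 'm pt) R)" by simp
  have ci: "integrable lborel (%x. \<psi> x *R g x)" 
   if "\<psi> \<in> bmeas" "!!x. x \<notin> cball 0 R ==> \<psi> x = 0" "!!x. \<bar>\<psi> x\<bar> \<le> Q" "g \<in> bmeas" "set_integrable lborel (cball 0 R) g" for \<psi> Q and g :: "'m pt => 'm pt"
   by (rule integrable_bounded_support[OF that(5,4,1,2,3)])
  have conv: "(%n. (LBINT x. (X n (fst x) * \<psi> x) *R g x)) ~> (LBINT x. \<psi> x *R g x)"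
   if \<psi>: "\<psi> \<in> bmeas" "!!x. x \<notin> cball 0 R ==> \<psi> x = 0" "!!x. \<bar>\<psi> x\<bar> \<le> M" and g: "g \<in> bmeas" "set_integrable lborel (cball 0 R) g"
    and gz: "!!x. fst x \<notin> {tm<..<tp} ==> g x = 0" for \<psi> and g :: "'m pt => 'm pt"
  proof (rule integral_dominated_convergence)
   note [measurable] = \<psi>(1) g(1)
   show "integrable lborel (%x. norm (\<psi> x *R g x))" by (rule integrable_norm[OF ci[OF \<psi> g]])
   show "(%x. \<psi> x *R g x) \<in> borel_measurable lborel" by measurable
   show "(%x. (X n (fst x) * \<psi> x) *R g x) \<in> borel_measurable lborel" for n by measurable
   show "AE x in lborel. (%n. (X n (fst x) * \<psi> x) *R g x) ~> \<psi> x *R g x"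
   proof (rule AE_I2)
    fix x :: "'m pt"
    show "(%n. (X n (fst x) * \<psi> x) *R g x) ~> \<psi> x *R g x"
    proof (cases "fst x \<in> {tm<..<tp}")
     case True
     have "(%n. (X n (fst x) * \<psi> x) *R g x) ~> (1 * \<psi> x) *R g x" by (intro tendsto_intros X1[OF True])
     then show ?thesis by simp
    qed (simp add: gz)
   qed
   show "AE x in lborel. norm ((X n (fst x) * \<psi> x) *R g x) \<le> norm (\<psi> x *R g x)" for n
   proof (rule AE_I2)
    fix x :: "'m pt"
    have "\<bar>X n (fst x)\<bar> * (\<bar>\<psi> x\<bar> * norm (g x)) \<le> 1 * (\<bar>\<psi> x\<bar> * norm (g x))" using X(3)[of n "fst x"] by (intro mult_right_mono) auto
    then show "norm ((X n (fst x) * \<psi> x) *R g x) \<le> norm (\<psi> x *R g x)" by (simp add: abs_mult)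
   qed
  qed
  \<comment> \<open>The term produced by differentiating the cut-off. Everything else converges by
    domination, since the cut-offs tend to 1 on the open strip and w and E vanish off it.\<close>
  define rem where "rem = (%n. (LBINT x. (\<phi> x * X' n (fst x)) *R w x))"
  have id: "(LBINT x. (X n (fst x) * \<phi> x) *R E b x) = - (LBINT x. (X n (fst x) * \<phi>' x b) *R w x) - fst b *R rem n" for n
  proof -
   have sub: "{tm + e n/2..tp - e n/2} \<times> cball 0 R \<subseteq> ?J" using e[of n] by auto
   have z: "X n (fst x) * \<phi> x = 0" if "x \<notin> {tm + e n/2..tp - e n/2} \<times> cball 0 R" for x :: "'m pt"
   proof (cases "fst x \<in> {tm + e n/2..tp - e n/2}")
    case True
    then have "snd x \<notin> cball 0 R" using that by (cases x) auto
    then have "x \<notin> cball 0 R" using norm_snd_le[of "snd x" "fst x"] by auto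
    then show ?thesis by (simp add: R)
   qed (simp add: X(4))
   have t2: "test_fun (%x. X n (fst x) * \<phi> x) (%x h. X n (fst x) * \<phi>' x h + \<phi> x * (X' n (fst x) * fst h)) ?J"
    by (rule test_fun_mult_fst[OF t X(1,2) _ sub z]) (auto intro!: compact_Times)
   have xb: "\<bar>X n (fst x) * \<phi>' x b\<bar> \<le> M" for x :: "'m pt"
   proof -
    have "\<bar>X n (fst x)\<bar> * \<bar>\<phi>' x b\<bar> \<le> 1 * M" using X(3)[of n "fst x"] M by (intro mult_mono) auto
    then show ?thesis by (simp add: abs_mult)
   qed
   have i1: "integrable lborel (%x. (X n (fst x) * \<phi>' x b) *R w x)"
    by (rule ci[OF _ _ xb _ wK(2)[OF cb]]) (auto simp: R)
   have xb': "\<bar>\<phi> x * X' n (fst x)\<bar> \<le> M * (4 / e n)" for x :: "'m pt"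
    unfolding abs_mult using X(6)[of n "fst x"] M by (intro mult_mono) auto
   have i2: "integrable lborel (%x. (\<phi> x * X' n (fst x)) *R w x)"
    by (rule ci[OF _ _ xb' _ wK(2)[OF cb]]) (auto simp: R)
   have "(LBINT x. (X n (fst x) * \<phi> x) *R E b x) = - (LBINT x. (X n (fst x) * \<phi>' x b + \<phi> x * (X' n (fst x) * fst b)) *R w x)"
    by (rule borel_gradD(6)[OF B t2 b])
   also have "(LBINT x. (X n (fst x) * \<phi>' x b + \<phi> x * (X' n (fst x) * fst b)) *R w x)
    = (LBINT x. (X n (fst x) * \<phi>' x b) *R w x + fst b *R ((\<phi> x * X' n (fst x)) *R w x))"
    by (rule Bochner_Integration.integral_cong) (simp_all add: scaleR_add_left mult_ac)
   also have "... = (LBINT x. (X n (fst x) * \<phi>' x b) *R w x) + fst b *R rem n"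
    unfolding rem_def by (subst Bochner_Integration.integral_add[OF i1 integrable_scaleR_right[OF i2]]) (simp only: integral_scaleR_right)
   finally show ?thesis by simp
  qed
  have rem0: "rem ~> 0"
  proof -
   obtain N :: nat where N: "!!(f :: 'm pt => ennreal) A. f \<in> bmeas ==> periodic_x' f ==> A \<in> sets borel ==>
    (NN x. indicator (A \<times> cball 0 R) x * f x) \<le> of_nat N * (NN x. indicator (A \<times> cell) x * f x)"
    by (rule nn_integral_periodic_ball_le[OF R(1)]) auto
   define V where "V = measure lborel (cball (0 :: real ^ 'm) R)"
   have V: "emeasure lborel (cball (0 :: real ^ 'm) R) = ennreal V" "0 \<le> V"
    using emeasure_compact_finite[of "cball (0 :: real ^ 'm) R"] by (simp_all add: V_def emeasure_eq_ennreal_measure)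
   define Z where "Z = (%n. ennreal (1 / (2 * e n)) * Il (2 * e n) + ennreal (1 / (2 * e n)) * Ir (2 * e n))"
   have f2: "filterlim (%n. 2 * e n) (at_right 0) sequentially"
    unfolding filterlim_at
   proof
    show "\<forall>\<^sub>F n in sequentially. 2 * e n \<in> {0<..} \<and> 2 * e n \<noteq> 0"
     by (rule always_eventually) (simp add: e less_imp_neq[OF e, symmetric])
    show "(%n. 2 * e n) ~> 0" by (rule tendsto_mult_right_zero[OF e0])
   qed
   have Z0: "Z ~> 0 + 0" unfolding Z_def
    by (intro tendsto_add filterlim_compose[OF tl' f2] filterlim_compose[OF tr' f2])
   have bound: "nsq (rem n) \<le> ennreal (128 * V * M\<^sup>2 * real N) * Z n" for n
   proof -
    define I where "I = {tm..tm + 2*e n} \<union> {tp - 2*e n..tp}"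
    have Im[measurable]: "I \<in> sets borel" by (simp add: I_def)
    let ?A = "I \<times> cball (0 :: real ^ 'm) R"
    have Am[measurable]: "?A \<in> sets borel" unfolding borel_prod[symmetric] by measurable
    have A: "x \<in> ?A \<or> \<phi> x * X' n (fst x) = 0" for x :: "'m pt"
    proof (cases "fst x \<in> I")
     case True
     show ?thesis
     proof (cases "snd x \<in> cball 0 R")
      case False
      then have "x \<notin> cball 0 R" using norm_snd_le[of "snd x" "fst x"] by auto
      then show ?thesis by (simp add: R)
     qed (use True in \<open>auto simp: mem_Times_iff\<close>)
    qed (simp add: X(5) I_def)
    have "rem n = (LBINT x. indicator ?A x *R ((\<phi> x * X' n (fst x)) *R w x))"
     unfolding rem_def by (rule Bochner_Integration.integral_cong) (use A in \<open>auto simp: indicator_def\<close>)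
    then have "nsq (rem n) \<le> emeasure lborel ?A * (NN x. indicator ?A x * nsq ((\<phi> x * X' n (fst x)) *R w x))"
     using norm_set_integral_power2_le[of ?A lborel "%x. (\<phi> x * X' n (fst x)) *R w x"] by simp
    also have "... \<le> ennreal (4 * e n * V) * (ennreal (16 * M\<^sup>2 / (e n)\<^sup>2) * (of_nat N * (Il (2 * e n) + Ir (2 * e n))))"
    proof (rule mult_mono)
     have "emeasure lborel ?A = emeasure lborel I * emeasure lborel (cball (0 :: real ^ 'm) R)"
      by (simp add: lborel_prod[symmetric] lborel.emeasure_pair_measure_Times)
     also have "emeasure lborel I \<le> emeasure lborel {tm..tm + 2*e n} + emeasure lborel {tp - 2*e n..tp}"
      unfolding I_def by (rule emeasure_subadditive) auto
     also have "... = ennreal (4 * e n)" using e[of n] by (simp add: ennreal_plus[symmetric] del: ennreal_plus)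
     finally show "emeasure lborel ?A \<le> ennreal (4 * e n * V)"
      using e[of n] V by (simp add: ennreal_mult mult_right_mono)
     have "(NN x. indicator ?A x * nsq ((\<phi> x * X' n (fst x)) *R w x))
      \<le> (NN x. ennreal (16 * M\<^sup>2 / (e n)\<^sup>2) * (indicator ?A x * nsq (w x)))"
     proof (rule nn_integral_mono)
      fix x :: "'m pt"
      have "\<bar>\<phi> x\<bar> * \<bar>X' n (fst x)\<bar> \<le> M * (4 / e n)" using X(6)[of n "fst x"] M by (intro mult_mono) auto
      then have "(\<bar>\<phi> x\<bar> * \<bar>X' n (fst x)\<bar>)\<^sup>2 \<le> (M * (4 / e n))\<^sup>2" by (intro power_mono) auto
      then have "(\<bar>\<phi> x\<bar> * \<bar>X' n (fst x)\<bar>)\<^sup>2 * (norm (w x))\<^sup>2 \<le> (M * (4 / e n))\<^sup>2 * (norm (w x))\<^sup>2" by (intro mult_right_mono) auto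
      then have "(norm ((\<phi> x * X' n (fst x)) *R w x))\<^sup>2 \<le> (16 * M\<^sup>2 / (e n)\<^sup>2) * (norm (w x))\<^sup>2"
       by (simp add: abs_mult power_mult_distrib power_divide mult_ac)
      then have "nsq ((\<phi> x * X' n (fst x)) *R w x) \<le> ennreal (16 * M\<^sup>2 / (e n)\<^sup>2) * nsq (w x)"
       by (simp add: ennreal_mult[symmetric] ennreal_leI del: norm_scaleR)
      then show "indicator ?A x * nsq ((\<phi> x * X' n (fst x)) *R w x) \<le> ennreal (16 * M\<^sup>2 / (e n)\<^sup>2) * (indicator ?A x * nsq (w x))"
       by (cases "x \<in> ?A") (simp_all del: norm_scaleR)
     qed
     also have "... = ennreal (16 * M\<^sup>2 / (e n)\<^sup>2) * (NN x. indicator ?A x * nsq (w x))"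
      by (rule nn_integral_cmult) measurable
     also have "(NN x. indicator ?A x * nsq (w x)) \<le> of_nat N * (NN x. indicator (I \<times> cell) x * nsq (w x))"
      by (rule N) (use per(1) in \<open>auto simp: periodic_x'_def\<close>)
     also have "(NN x. indicator (I \<times> cell) x * nsq (w x)) \<le> (NN x. indicator ({tm..tm + 2*e n} \<times> cell) x * nsq (w x) + indicator ({tp - 2*e n..tp} \<times> cell) x * nsq (w x))"
      by (rule nn_integral_mono) (auto simp: I_def indicator_def)
     also have "... = Il (2 * e n) + Ir (2 * e n)"
      unfolding Il_def Ir_def by (subst nn_integral_add) simp_all
     finally show "(NN x. indicator ?A x * nsq ((\<phi> x * X' n (fst x)) *R w x)) \<le> ennreal (16 * M\<^sup>2 / (e n)\<^sup>2) * (of_nat N * (Il (2 * e n) + Ir (2 * e n)))"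
      by (simp add: mult_left_mono)
    qed simp_all
    also have "... = ennreal (4 * e n * V * (16 * M\<^sup>2 / (e n)\<^sup>2) * real N) * (Il (2 * e n) + Ir (2 * e n))"
     using e[of n] V(2) M(1) by (subst ennreal_mult, simp, simp, subst ennreal_mult, simp, simp) (simp only: ennreal_of_nat_eq_real_of_nat mult.assoc)
    \<comment> \<open>The layers have total length 4 e and the squared cut-off derivative is at most
      16 / e^2. The surviving power 1/e is written as 2/(2 e) to match the layer width 2 e in the
      trace condition; 4 * 16 * 2 = 128.\<close>
    also have "4 * e n * V * (16 * M\<^sup>2 / (e n)\<^sup>2) * real N = (128 * V * M\<^sup>2 * real N) * (1 / (2 * e n))"
     using e[of n] by (simp add: power2_eq_square)
    also have "ennreal ((128 * V * M\<^sup>2 * real N) * (1 / (2 * e n))) * (Il (2 * e n) + Ir (2 * e n)) = ennreal (128 * V * M\<^sup>2 * real N) * Z n"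
     unfolding Z_def by (subst ennreal_mult) (use e[of n] V in \<open>simp_all add: mult.assoc distrib_left\<close>)
    finally show ?thesis .
   qed
   have "(%n. ennreal (128 * V * M\<^sup>2 * real N) * Z n) ~> ennreal (128 * V * M\<^sup>2 * real N) * (0 + 0)"
    by (rule ennreal_tendsto_cmult[OF _ Z0]) simp
   then have Z1: "(%n. ennreal (128 * V * M\<^sup>2 * real N) * Z n) ~> 0" by simp
   have "(%n. nsq (rem n)) ~> 0"
    by (rule tendsto_sandwich[OF always_eventually always_eventually tendsto_const Z1]) (simp_all add: bound)
   then have "(%n. (norm (rem n))\<^sup>2) ~> 0" using tendsto_ennreal_iff[where f = "%n. (norm (rem n))\<^sup>2" and F = sequentially and x = 0] by (simp add: ennreal_0)
   then have "(%n. norm (rem n)) ~> 0" by simp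
   then show ?thesis by (simp add: tendsto_norm_zero_iff)
  qed
  have "(%n. - (LBINT x. (X n (fst x) * \<phi>' x b) *R w x) - fst b *R rem n) ~> - (LBINT x. \<phi>' x b *R w x) - fst b *R 0"
   by (intro tendsto_intros rem0 conv wK(2) cb M(3) wz) (auto simp: R)
  moreover have "(%n. (LBINT x. (X n (fst x) * \<phi> x) *R E b x)) ~> (LBINT x. \<phi> x *R E b x)"
   by (intro conv EK(2)[OF b _] cb M(2) Ez[OF b]) (auto simp: R b)
  ultimately show "(LBINT x. \<phi> x *R E b x) = - (LBINT x. \<phi>' x b *R w x)"
   unfolding id by (simp add: LIMSEQ_unique)
 qed (use borel_gradD(2,3)[OF B] in auto)
qed

lemma sob_divI:
 fixes u :: "('m::finite) pt => 'm pt"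
 assumes B: "borel_grad UNIV u D" and per: "periodic_x' u" and dv: "AE x in lborel. (\<Sum>b\<in>Basis. D b x \<bullet> b) = 0"
  and fin: "!!b. b \<in> Basis ==> (NN x. indicator (UNIV \<times> cell) x * nsq (D b x)) < \<infinity>"
 shows "sob_div UNIV u D"
proof -
 note [measurable] = borel_gradD(3)[OF B]
 have [measurable]: "UNIV \<times> (cell :: (real ^ 'm) set) \<in> sets borel" by (intro borel_Times cell_borel) simp
 have "(\<integral>\<^sup>+x. indicator (UNIV \<times> cell) x * ennreal (sq_grad D x) \<partial>lebesgue) = (NN x. (\<Sum>b\<in>Basis. indicator (UNIV \<times> cell) x * nsq (D b x)))"
  unfolding nn_integral_completion by (rule nn_integral_cong) (simp add: sq_grad_def sum_ennreal[symmetric] sum_distrib_left del: sum_ennreal)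
 also have "... = (\<Sum>b\<in>Basis. (NN x. indicator (UNIV \<times> cell) x * nsq (D b x)))"
  by (rule nn_integral_sum) measurable
 also have "... < \<infinity>" using fin by simp
 finally show ?thesis
  using borel_grad_imp_weak_grad[OF B] per AE_completion[OF dv] by (simp add: sob_div_def)
qed

section \<open>Connecting constants, and comparison of the two infima\<close>

text \<open>A transition depending on the first variable only. It is divergence free because its
  only derivative is along e_1 and points in the direction up - um, whose first component is 0. The
  constant outer thirds make it coincide with the prescribed traces near both ends.\<close>

lemma interpolant:
 fixes um up :: "('m::finite) pt"
 assumes tt: "tm < tp" and f: "fst um = fst up"
 obtains L DL where "borel_grad UNIV L DL" "periodic_x' L" "!!b. periodic_x' (DL b)"
  "!!x. fst x \<le> tm + (tp - tm) / 3 ==> L x = um" "!!x. tp - (tp - tm) / 3 \<le> fst x ==> L x = up"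
  "!!b x. fst x \<notin> {tm<..<tp} ==> DL b x = 0" "!!x. (\<Sum>b\<in>Basis. DL b x \<bullet> b) = 0"
  "!!b. (NN x. indicator (UNIV \<times> cell) x * nsq (DL b x)) < \<infinity>"
proof -
 define d where "d = tp - tm"
 have d: "0 < d" using tt by (simp add: d_def)
 \<comment> \<open>The affine argument is 0 at tm + d/3 and 1 at tp - d/3.\<close>
 define l where "l = (%s. smoothstep ((3 * s - 2 * tm - tp) / d))"
 define l' where "l' = (%s. smoothstep_deriv ((3 * s - 2 * tm - tp) / d) * (3 / d))"
 have dl: "(l has_real_derivative l' s) (at s)" for s
  unfolding l_def l'_def by (rule DERIV_chain2[OF DERIV_smoothstep]) (use d in \<open>auto intro!: derivative_eq_intros\<close>)
 have lc: "continuous_on UNIV l'" unfolding l'_def using d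
  by (intro continuous_intros continuous_on_compose2[OF continuous_smoothstep_deriv]) auto
 have l0: "l s = 0" "l' s = 0" if "s \<le> tm + d / 3" for s
 proof -
  have "(3 * s - 2 * tm - tp) / d \<le> 0" using d that by (intro divide_nonpos_pos) (simp_all add: d_def field_simps)
  then show "l s = 0" "l' s = 0" by (simp_all add: l_def l'_def smoothstep_eq_0 smoothstep_deriv_eq_0)
 qed
 have l1: "l s = 1" "l' s = 0" if "tp - d / 3 \<le> s" for s
 proof -
  have "1 \<le> (3 * s - 2 * tm - tp) / d" using d that by (simp add: d_def field_simps)
  then show "l s = 1" "l' s = 0" by (simp_all add: l_def l'_def smoothstep_eq_1 smoothstep_deriv_eq_0')
 qed
 have lo: "l' s = 0" if "s \<notin> {tm<..<tp}" for s
  using that d l0(2)[of s] l1(2)[of s] by (cases "s \<le> tm") auto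
 have lb: "\<bar>l' s\<bar> \<le> 6 / d" for s
  using mult_right_mono[OF smoothstep_deriv_bound, of "3 / d"] d by (simp add: l'_def abs_mult)
 define L where "L = (%x :: 'm pt. 1 *R um + 1 *R (l (fst x) *R (up - um)))"
 define DL where "DL = (%(b :: 'm pt) (x :: 'm pt). 1 *R (0 :: 'm pt) + 1 *R ((fst b * l' (fst x)) *R (up - um)))"
 have [measurable]: "A \<times> (cell :: (real ^ 'm) set) \<in> sets borel" if "A \<in> sets borel" for A :: "real set"
  by (rule borel_Times[OF that cell_borel])
 show thesis
 proof (rule that[of L DL])
  show "borel_grad UNIV L DL" unfolding L_def DL_def
   by (rule borel_grad_lincomb[OF borel_grad_const borel_grad_profile[OF dl lc]])
  show "periodic_x' L" "periodic_x' (DL b)" for b by (simp_all add: periodic_x'_def L_def DL_def)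
  fix x :: "'m pt"
  show "L x = um" if "fst x \<le> tm + (tp - tm) / 3" using l0(1)[of "fst x"] that by (simp add: L_def d_def)
  show "L x = up" if "tp - (tp - tm) / 3 \<le> fst x" using l1(1)[of "fst x"] that by (simp add: L_def d_def)
  show "DL b x = 0" if "fst x \<notin> {tm<..<tp}" for b using lo[OF that] by (simp add: DL_def)
  show "(\<Sum>b\<in>Basis. DL b x \<bullet> b) = 0" unfolding sum_Basis_pt by (simp add: DL_def pair_one_inner f)
 next
  fix b :: "'m pt"
  define Q where "Q = (\<bar>fst b\<bar> * (6 / d) * norm (up - um))\<^sup>2"
  have "(NN x. indicator (UNIV \<times> cell) x * nsq (DL b x)) \<le> (NN x. ennreal Q * indicator ({tm..tp} \<times> (cell :: (real ^ 'm) set)) x)"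
  proof (rule nn_integral_mono)
   fix x :: "'m pt"
   have "norm (DL b x) \<le> \<bar>fst b\<bar> * (6 / d) * norm (up - um)"
    unfolding DL_def by (simp add: abs_mult del: times_divide_eq_right times_divide_eq_left) (intro mult_right_mono mult_left_mono lb; simp)
   then have "(norm (DL b x))\<^sup>2 \<le> Q" unfolding Q_def by (intro power_mono) auto
   then have "nsq (DL b x) \<le> ennreal Q" by (rule ennreal_leI)
   moreover have "DL b x = 0" if "fst x \<notin> {tm..tp}"
   proof -
    have "l' (fst x) = 0" by (rule lo) (use that in auto)
    then show ?thesis by (simp add: DL_def)
   qed
   ultimately show "indicator (UNIV \<times> cell) x * nsq (DL b x) \<le> ennreal Q * indicator ({tm..tp} \<times> cell) x"
    by (cases x) (auto simp: indicator_def)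
  qed
  also have "... = ennreal Q * emeasure lborel ({tm..tp} \<times> (cell :: (real ^ 'm) set))" by (rule nn_integral_cmult_indicator) simp
  also have "... < \<infinity>"
   using emeasure_compact_finite[OF compact_Times[OF compact_Icc[of tm tp] compact_cell[where 'a = 'm]]] by (simp add: ennreal_mult_less_top)
  finally show "(NN x. indicator (UNIV \<times> cell) x * nsq (DL b x)) < \<infinity>" .
 qed
qed

lemma xavg_const_slice:
 fixes u :: "('m::finite) pt => 'm pt"
 assumes "!!y. u (t, y) = c"
 shows "xavg u t = c"
proof -
 have "integrable lborel (indicat_real (cell :: (real ^ 'm) set))" by (rule integrable_real_indicator) (simp_all add: emeasure_cell)
 then have "(LBINT y. indicat_real (cell :: (real ^ 'm) set) y *R c) = c" by (simp add: measure_cell)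
 moreover have "xavg u t = (LBINT y. indicat_real (cell :: (real ^ 'm) set) y *R c)"
  unfolding xavg_def set_lebesgue_integral_def assms by (rule integral_completion) simp
 ultimately show ?thesis by simp
qed

lemma xavg_limits_of_constant_ends:
 fixes u :: "('m::finite) pt => 'm pt"
 assumes "!!x. fst x \<le> s ==> u x = um" "!!x. t \<le> fst x ==> u x = up"
 shows "(xavg u \<longlongrightarrow> um) at_bot" "(xavg u \<longlongrightarrow> up) at_top"
proof -
 show "(xavg u \<longlongrightarrow> um) at_bot"
  by (rule tendsto_eventually[OF eventually_mono[OF eventually_le_at_bot[of s]]]) (simp add: xavg_const_slice assms)
 show "(xavg u \<longlongrightarrow> up) at_top"
  by (rule tendsto_eventually[OF eventually_mono[OF eventually_ge_at_top[of t]]]) (simp add: xavg_const_slice assms)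
qed

text \<open>Non-emptiness of the admissible class, invoked when the infimum is infinite: every
  admissible field then attains it.\<close>

lemma ex_connecting_field:
 fixes um up :: "('m::finite) pt"
 assumes f: "fst um = fst up"
 obtains u D where "sob_div UNIV u D" "(xavg u \<longlongrightarrow> um) at_bot" "(xavg u \<longlongrightarrow> up) at_top"
proof (rule interpolant[OF zero_less_one f], goal_cases)
 case (1 L DL)
 show thesis
  by (rule that[OF sob_divI[OF 1(2,3) AE_I2[OF 1(8)] 1(9)] xavg_limits_of_constant_ends[OF 1(5,6)]])
qed

text \<open>A competitor on a bounded interval is extended by its constant traces. Subtracting an
  interpolant with the same end values reduces this to extension by zero. The extension costs
  nothing, since it is constant and W vanishes at the two constants.\<close>

lemma cW_le_dW:
 fixes um up :: "('m::finite) pt"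
 assumes f: "fst um = fst up" and W: "W um = 0" "W up = 0" "!!z. 0 \<le> W z"
 shows "cW W um up \<le> dW W (%_. um) (%_. up)"
proof -
 have "cW W um up \<le> energy W {tm..tp} u D"
  if tt: "tm < tp" and S: "sob_div {tm..tp} u D" and TL: "trace_left tm u (%_. um)" and TR: "trace_right tp u (%_. up)" for tm tp u D
 proof -
  let ?J = "{tm<..<tp}" and ?U = "UNIV :: (real ^ 'm) set"
  have per: "periodic_x' u" and wg: "weak_grad (?J \<times> ?U) u D"
   and fin: "(NN x. indicator ({tm..tp} \<times> cell) x * ennreal (sq_grad D x)) < \<infinity>"
   and dv: "AE x in lborel. x \<in> ?J \<times> ?U \<longrightarrow> (\<Sum>b\<in>Basis. D b x \<bullet> b) = 0"
   using S by (simp_all add: sob_div_def nn_integral_completion AE_completion_iff)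
  have um: "u \<in> borel_measurable lebesgue" and Dm: "!!b. b \<in> Basis ==> D b \<in> borel_measurable lebesgue"
   using wg by (simp_all add: weak_grad_def)
  obtain u0 where u0: "u0 \<in> bmeas" "AE x in lborel. u x = u0 x" using ex_borel_representative[OF um] by blast
  have "\<exists>g\<in>bmeas. periodic_x' g \<and> (AE x in lborel. u x = g x)"
   by (rule ex_periodic_borel_representative[OF u0]) (use per in \<open>auto simp: periodic_x'_def\<close>)
  then obtain u1 where u1[measurable]: "u1 \<in> bmeas" and u1p: "periodic_x' u1" and u1e: "AE x in lborel. u x = u1 x" by blast
  have "\<forall>b\<in>Basis. \<exists>g. g \<in> bmeas \<and> (AE x in lborel. D b x = g x)" using ex_borel_representative[OF Dm] by blast
  from bchoice[OF this] obtain D0 where D0: "!!b. b \<in> Basis ==> D0 b \<in> bmeas" "!!b. b \<in> Basis ==> AE x in lborel. D b x = D0 b x" by blast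
  have B0: "borel_grad (?J \<times> ?U) u1 D0" by (rule weak_grad_imp_borel_grad[OF wg u1 D0(1) u1e D0(2)])
  have Jm[measurable]: "(%x :: 'm pt. indicat_real ?J (fst x)) \<in> bmeas" by (rule measurable_compose[OF borel_measurable_continuous_onI borel_measurable_indicator]) (auto intro: continuous_intros)
  \<comment> \<open>The gradient is known on the open strip only, so it is restricted there before a
    periodic version is chosen.\<close>
  have ex1: "\<exists>g. g \<in> bmeas \<and> periodic_x' g \<and> (AE x in lborel. indicat_real ?J (fst x) *R D0 b x = g x)" if b: "b \<in> Basis" for b
  proof -
   note [measurable] = D0(1)[OF b]
   have "\<exists>g\<in>bmeas. periodic_x' g \<and> (AE x in lborel. indicat_real ?J (fst x) *R D0 b x = g x)"
   proof (rule ex_periodic_borel_representative)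
    show "(%x. indicat_real ?J (fst x) *R D0 b x) \<in> bmeas" by measurable
    fix i
    have "AE x in lborel. x \<in> ?J \<times> ?U \<longrightarrow> D0 b (x + (0, axis i 1)) = D0 b x"
     by (rule borel_grad_shift_invariant[OF B0 _ _ b]) (use u1p in \<open>auto simp: periodic_x'_def\<close>)
    then show "AE x in lborel. indicat_real ?J (fst (x + (0, axis i 1))) *R D0 b (x + (0, axis i 1)) = indicat_real ?J (fst x) *R D0 b x"
     by eventually_elim (auto simp: indicator_def mem_Times_iff)
   qed simp
   then show ?thesis by blast
  qed
  then have "\<forall>b\<in>Basis. \<exists>g. g \<in> bmeas \<and> periodic_x' g \<and> (AE x in lborel. indicat_real ?J (fst x) *R D0 b x = g x)" by blast
  from bchoice[OF this] obtain D1 where D1: "!!b. b \<in> Basis ==> D1 b \<in> bmeas" "!!b. b \<in> Basis ==> periodic_x' (D1 b)"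
   "!!b. b \<in> Basis ==> AE x in lborel. indicat_real ?J (fst x) *R D0 b x = D1 b x" by blast
  \<comment> \<open>The candidate gradient of the extension: D on the strip and 0 elsewhere, with no
    contribution from the end slices because the traces match.\<close>
  define Dt where "Dt = (%b x. indicat_real ?J (fst x) *R D1 b x)"
  note [measurable] = D1(1)
  have Dtm[measurable]: "Dt b \<in> bmeas" if "b \<in> Basis" for b unfolding Dt_def using D1(1)[OF that] by measurable
  have DtD0: "AE x in lborel. x \<in> ?J \<times> ?U \<longrightarrow> D0 b x = Dt b x" if "b \<in> Basis" for b
   using D1(3)[OF that] by eventually_elim (auto simp: Dt_def mem_Times_iff)
  have DtD: "AE x in lborel. Dt b x = indicat_real ?J (fst x) *R D b x" if "b \<in> Basis" for b
   using D1(3)[OF that] D0(2)[OF that] by eventually_elim (auto simp: Dt_def indicator_def split: if_splits)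
  have Dtz: "Dt b x = 0" if "fst x \<notin> ?J" for b x using that by (simp add: Dt_def)
  have Dt2: "(NN x. indicator (UNIV \<times> cell) x * nsq (Dt b x)) < \<infinity>" if b: "b \<in> Basis" for b
  proof -
   have "(NN x. indicator (UNIV \<times> cell) x * nsq (Dt b x)) \<le> (NN x. indicator ({tm..tp} \<times> cell) x * ennreal (sq_grad D x))"
   proof (rule nn_integral_mono_AE)
    show "AE x in lborel. indicator (UNIV \<times> cell) x * nsq (Dt b x) \<le> indicator ({tm..tp} \<times> cell) x * ennreal (sq_grad D x)"
     using DtD[OF b]
    proof eventually_elim
     case (elim x)
     have "(norm (D b x))\<^sup>2 \<le> sq_grad D x" unfolding sq_grad_def by (rule member_le_sum) (use b in auto)
     then show ?case unfolding elim by (cases x) (auto simp: indicator_def intro: ennreal_leI)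
    qed
   qed
   then show ?thesis using fin by (rule le_less_trans)
  qed
  obtain L DL where L: "borel_grad UNIV L DL" "periodic_x' L" "!!b. periodic_x' (DL b)"
   "!!x. fst x \<le> tm + (tp - tm) / 3 ==> L x = um" "!!x. tp - (tp - tm) / 3 \<le> fst x ==> L x = up"
   "!!b x. fst x \<notin> {tm<..<tp} ==> DL b x = 0" "!!x. (\<Sum>b\<in>Basis. DL b x \<bullet> b) = 0"
   "!!b. (NN x. indicator (UNIV \<times> cell) x * nsq (DL b x)) < \<infinity>"
   by (rule interpolant[OF tt f]) blast
  note [measurable] = borel_gradD(2,3)[OF L(1)]
  \<comment> \<open>Difference to the interpolant, which has zero trace at both ends and is extended
    by 0.\<close>
  define w where "w = (%x. indicat_real ?J (fst x) *R (u1 x - L x))"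
  define E where "E = (%b x. Dt b x - DL b x)"
  have wm[measurable]: "w \<in> bmeas" unfolding w_def by measurable
  have Em[measurable]: "E b \<in> bmeas" if "b \<in> Basis" for b unfolding E_def using that by measurable
  have [measurable]: "A \<times> (cell :: (real ^ 'm) set) \<in> sets borel" if "A \<in> sets borel" for A :: "real set"
   by (rule borel_Times[OF that cell_borel])
  have BJ: "borel_grad (?J \<times> ?U) w E"
  proof (rule borel_grad_cong_on[OF borel_grad_lincomb[OF B0 borel_grad_subset[OF L(1)], of 1 "-1"] wm Em])
   show "AE x in lborel. x \<in> ?J \<times> ?U \<longrightarrow> 1 *R u1 x + (- 1) *R L x = w x" by (auto simp: w_def)
   show "AE x in lborel. x \<in> ?J \<times> ?U \<longrightarrow> 1 *R D0 b x + (- 1) *R DL b x = E b x" if "b \<in> Basis" for b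
    using DtD0[OF that] by eventually_elim (auto simp: E_def)
  qed (auto intro: open_Times)
  have wb: "norm (w x) \<le> norm (u1 x - L x)" for x by (auto simp: w_def indicator_def)
  \<comment> \<open>For layers thinner than a third of the interval the interpolant equals the
    boundary constant c, so |w| is at most |u - c| there and the trace hypothesis transfers. The
    interval family I treats both ends.\<close>
  have tr: "((%h. ennreal (1 / h) * (NN x. indicator (I h \<times> cell) x * nsq (w x))) \<longlongrightarrow> 0) (at_right 0)"
   if T: "((%h. ennreal (1 / h) * (\<integral>\<^sup>+x. indicator (I h \<times> cell) x * nsq (u x - c) \<partial>lebesgue)) \<longlongrightarrow> 0) (at_right 0)"
    and I: "!!h x. h < (tp - tm) / 3 ==> fst x \<in> I h ==> L x = c" for I :: "real => real set" and c
  proof (rule tendsto_sandwich[OF _ _ tendsto_const T])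
   have "\<forall>\<^sub>F h in at_right (0::real). h < (tp - tm) / 3"
    by (rule eventually_at_rightI[of 0 "(tp - tm) / 3"]) (use tt in auto)
   then show "\<forall>\<^sub>F h in at_right 0. ennreal (1 / h) * (NN x. indicator (I h \<times> cell) x * nsq (w x))
    \<le> ennreal (1 / h) * (\<integral>\<^sup>+x. indicator (I h \<times> cell) x * nsq (u x - c) \<partial>lebesgue)"
   proof eventually_elim
    case (elim h)
    have "AE x in lborel. indicator (I h \<times> cell) x * nsq (w x) \<le> indicator (I h \<times> cell) x * nsq (u x - c)"
     using u1e
    proof eventually_elim
     case (elim x)
     have "nsq (w x) \<le> nsq (u x - c)" if "x \<in> I h \<times> cell"
      using wb[of x] elim I[OF \<open>h < (tp - tm) / 3\<close>, of x] that by (intro ennreal_leI power_mono) (auto simp: mem_Times_iff)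
     then show ?case by (auto simp: indicator_def)
    qed
    then show ?case unfolding nn_integral_completion by (intro mult_left_mono nn_integral_mono_AE) auto
   qed
  qed simp
  have BU: "borel_grad UNIV w E"
  proof (rule zero_extension[OF tt BJ])
   show "w x = 0" if "fst x \<notin> ?J" for x using that by (simp add: w_def)
   show "E b x = 0" if "fst x \<notin> ?J" for b x using that L(6)[OF that] by (simp add: E_def Dtz)
   show "periodic_x' w" using u1p L(2) by (simp add: periodic_x'_def w_def)
   show "periodic_x' (E b)" if "b \<in> Basis" for b using D1(2)[OF that] L(3)[of b] by (simp add: periodic_x'_def E_def Dt_def)
   show "(NN x. indicator (UNIV \<times> cell) x * nsq (E b x)) < \<infinity>" if b: "b \<in> Basis" for b
   proof -
    have "(NN x. indicator (UNIV \<times> cell) x * nsq (Dt b x + - DL b x)) \<le> 2 * (NN x. indicator (UNIV \<times> cell) x * nsq (Dt b x)) + 2 * (NN x. indicator (UNIV \<times> cell) x * nsq (- DL b x))"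
     by (rule nn_integral_norm_add_power2_le) (use b in \<open>simp_all\<close>)
    also have "... < \<infinity>" using Dt2[OF b] L(8)[of b] by (simp add: ennreal_mult_less_top)
    finally show ?thesis by (simp add: E_def)
   qed
   show "((%h. ennreal (1 / h) * (NN x. indicator ({tm..tm+h} \<times> cell) x * nsq (w x))) \<longlongrightarrow> 0) (at_right 0)"
    by (rule tr[OF TL[unfolded trace_left_def]]) (rule L(4), simp add: field_simps)
   show "((%h. ennreal (1 / h) * (NN x. indicator ({tp-h..tp} \<times> cell) x * nsq (w x))) \<longlongrightarrow> 0) (at_right 0)"
    by (rule tr[OF TR[unfolded trace_right_def]]) (rule L(5), simp add: field_simps)
  qed
  define ut where "ut = (%x. w x + L x)"
  have Bt: "borel_grad UNIV ut Dt"
   using borel_grad_lincomb[OF BU L(1), of 1 1] by (simp add: ut_def E_def)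
  have St: "sob_div UNIV ut Dt"
  proof (rule sob_divI[OF Bt _ _ Dt2])
   show "periodic_x' ut" using u1p L(2) by (simp add: periodic_x'_def ut_def w_def)
   have "AE x in lborel. \<forall>b\<in>Basis. Dt b x = indicat_real ?J (fst x) *R D b x" using DtD by (simp add: AE_finite_all)
   then show "AE x in lborel. (\<Sum>b\<in>Basis. Dt b x \<bullet> b) = 0" using dv
    by eventually_elim (auto simp: indicator_def mem_Times_iff)
  qed
  have ends: "ut x = um" if "fst x \<le> tm" for x
  proof -
   have "L x = um" by (rule L(4)) (use that tt in \<open>simp add: field_simps\<close>)
   then show ?thesis using that by (simp add: ut_def w_def)
  qed
  have ends': "ut x = up" if "tp \<le> fst x" for x
  proof -
   have "L x = up" by (rule L(5)) (use that tt in \<open>simp add: field_simps\<close>)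
   then show ?thesis using that by (simp add: ut_def w_def)
  qed
  have "cW W um up \<le> energy W UNIV ut Dt"
   unfolding cW_def by (rule INF_lower2[of "(ut, Dt)"]) (use St xavg_limits_of_constant_ends[OF ends ends'] in auto)
  also have "... \<le> energy W {tm..tp} u D"
   unfolding energy_def nn_integral_completion
  proof (rule nn_integral_mono_AE)
   have "AE x in lborel. \<forall>b\<in>Basis. Dt b x = indicat_real ?J (fst x) *R D b x" using DtD by (simp add: AE_finite_all)
   then show "AE x in lborel. indicator (UNIV \<times> cell) x * ennreal ((1/2) * sq_grad Dt x + W (ut x)) \<le> indicator ({tm..tp} \<times> cell) x * ennreal ((1/2) * sq_grad D x + W (u x))"
    using u1e
   proof eventually_elim
    case (elim x)
    show ?case
    proof (cases "fst x \<in> ?J")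
     case True
     then have "sq_grad Dt x = sq_grad D x" "ut x = u x" using elim by (simp_all add: sq_grad_def ut_def w_def)
     then show ?thesis using True by (cases x) (auto simp: indicator_def)
    next
     case False
     then have "sq_grad Dt x = 0" by (simp add: sq_grad_def Dtz)
     moreover have "W (ut x) = 0" using False ends[of x] ends'[of x] W by (cases "fst x \<le> tm") auto
     ultimately show ?thesis by simp
    qed
   qed
  qed
  finally show ?thesis .
 qed
 then show ?thesis unfolding dW_def by (intro INF_greatest) auto
qed

section \<open>Existence of a minimizer\<close>

lemma liminf_add_ennreal_le:
 fixes f g :: "nat => ennreal"
 shows "liminf f + liminf g \<le> liminf (%n. f n + g n)"
proof -
 have inc: "incseq (%n. INF m\<in>{n..}. h m)" for h :: "nat => ennreal"
  by (intro incseq_SucI INF_superset_mono) auto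
 have "liminf f + liminf g = (SUP n. (INF m\<in>{n..}. f m) + (INF m\<in>{n..}. g m))"
  unfolding liminf_SUP_INF by (rule ennreal_SUP_add[OF inc inc, symmetric])
 also have "... \<le> (SUP n. INF m\<in>{n..}. f m + g m)"
  by (intro SUP_mono' INF_greatest add_mono INF_lower) auto
 finally show ?thesis by (simp add: liminf_SUP_INF)
qed

text \<open>Non-empty open sets are not null.\<close>

lemma AE_open_inhabited:
 fixes S :: "'a::euclidean_space set"
 assumes "AE x in lborel. P x" "open S" "S \<noteq> {}"
 obtains x where "x \<in> S" "P x"
proof -
 have "\<not> (AE x in lborel. x \<notin> S)"
 proof
  assume "AE x in lborel. x \<notin> S"
  then have "emeasure lborel S = 0" using assms(2) AE_iff_measurable[of S lborel "%x. x \<notin> S"] by simp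
  then have "negligible S" using assms(2) by (simp add: negligible_iff_emeasure0)
  then show False using open_not_negligible assms by blast
 qed
 then have "\<exists>x\<in>S. P x" using assms(1) by (metis (mono_tags, lifting) eventually_mono)
 then show thesis using that by blast
qed

lemma xavg_cong_AE:
 fixes u v :: "('m::finite) pt => 'm pt"
 assumes eq: "AE x in lborel. u x = v x" and v: "v \<in> bmeas"
 shows "AE t in lborel. xavg u t = xavg v t"
 using AE_pair_lborel[OF eq]
proof eventually_elim
 case (elim t)
 then have e: "AE y in lebesgue. v (t, y) = u (t, y)" by (intro AE_completion) (auto elim: eventually_mono)
 have vm[measurable]: "(%y. v (t, y)) \<in> borel_measurable lebesgue"
  using borel_slice[OF v] by (simp add: measurable_completion)
 have um[measurable]: "(%y. u (t, y)) \<in> borel_measurable lebesgue" by (rule borel_measurable_AE[OF vm e])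
 have [measurable]: "(cell :: (real ^ 'm) set) \<in> sets lebesgue" by simp
 show ?case unfolding xavg_def set_lebesgue_integral_def
  by (rule integral_cong_AE) (measurable, use e in \<open>auto elim: eventually_mono\<close>)
qed

text \<open>The averages of the two versions agree at almost every time only. The average of the
  regular field is continuous, so the times at which it is far from z form an open set within the
  tail; if non-empty, this set would contain a time at which both averages agree.\<close>

lemma xavg_tendsto_cong_AE:
 fixes u v :: "('m::finite) pt => 'm pt"
 assumes eq: "AE x in lborel. u x = v x" and R: "regular_field v D"
 shows "(xavg u \<longlongrightarrow> z) at_top ==> (xavg v \<longlongrightarrow> z) at_top" "(xavg u \<longlongrightarrow> z) at_bot ==> (xavg v \<longlongrightarrow> z) at_bot"
proof -
 note ae = xavg_cong_AE[OF eq regular_fieldD(7)[OF R]]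
 have key: "dist (xavg v t) z \<le> e" if "open S" "!!s. s \<in> S ==> dist (xavg u s) z < e" "t \<in> S" for S e t
 proof (rule ccontr)
  assume "\<not> dist (xavg v t) z \<le> e"
  then have "t \<in> S \<inter> {s. e < dist (xavg v s) z}" using that by simp
  moreover have "open (S \<inter> {s. e < dist (xavg v s) z})"
   by (intro open_Int that(1) open_Collect_less continuous_intros xavg_continuous[OF R])
  ultimately obtain s where "s \<in> S \<inter> {s. e < dist (xavg v s) z}" "xavg u s = xavg v s" using AE_open_inhabited[OF ae] by (metis empty_iff)
  then show False using that(2)[of s] by simp
 qed
 show "(xavg v \<longlongrightarrow> z) at_top" if l: "(xavg u \<longlongrightarrow> z) at_top"
 proof (rule tendstoI)
  fix e :: real assume "0 < e"
  then obtain T where T: "!!s. T \<le> s ==> dist (xavg u s) z < e / 2" using tendstoD[OF l, of "e / 2"] by (auto simp: eventually_at_top_linorder)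
  have "dist (xavg v t) z < e" if "T < t" for t using key[of "{T<..}" "e / 2" t] T that \<open>0 < e\<close> by simp
  then show "\<forall>\<^sub>F t in at_top. dist (xavg v t) z < e" by (rule eventually_mono[OF eventually_gt_at_top[of T]])
 qed
 show "(xavg v \<longlongrightarrow> z) at_bot" if l: "(xavg u \<longlongrightarrow> z) at_bot"
 proof (rule tendstoI)
  fix e :: real assume "0 < e"
  then obtain T where T: "!!s. s \<le> T ==> dist (xavg u s) z < e / 2" using tendstoD[OF l, of "e / 2"] by (auto simp: eventually_at_bot_linorder)
  have "dist (xavg v t) z < e" if "t < T" for t using key[of "{..<T}" "e / 2" t] T that \<open>0 < e\<close> by simp
  then show "\<forall>\<^sub>F t in at_bot. dist (xavg v t) z < e" by (rule eventually_mono[OF eventually_gt_at_bot[of T]])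
 qed
qed

lemma borel_grad_shift:
 fixes u :: "'a::euclidean_space => 'b::euclidean_space"
 assumes B: "borel_grad UNIV u D"
 shows "borel_grad UNIV (%x. u (x + h)) (%b x. D b (x + h))"
proof -
 note [measurable] = borel_gradD(2,3)[OF B]
 have sh: "set_integrable lborel K (%x. (norm (f (x + h)))\<^sup>2)" if "compact K" "!!K. compact K ==> set_integrable lborel K (%x. (norm (f x))\<^sup>2)" for K and f :: "'a => 'b"
 proof -
  have "integrable lborel (%x. indicator ((+) h ` K) (x + h) *R (norm (f (x + h)))\<^sup>2)"
   by (rule integrable_shift) (use that(2)[OF compact_translation[OF that(1), of h]] in \<open>simp add: set_integrable_def\<close>)
  moreover have "indicat_real ((+) h ` K) (x + h) = indicator K x" for x by (auto simp: indicator_def add.commute)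
  ultimately show ?thesis by (simp add: set_integrable_def)
 qed
 show ?thesis
  unfolding borel_grad_def
 proof (intro conjI ballI allI impI)
  fix K :: "'a set" assume K: "compact K \<and> K \<subseteq> UNIV"
  show "set_integrable lborel K (%x. (norm (u (x + h)))\<^sup>2)" by (rule sh) (use K borel_gradD(4)[OF B] in auto)
  fix b :: 'a assume "b \<in> Basis"
  then show "set_integrable lborel K (%x. (norm (D b (x + h)))\<^sup>2)" by (intro sh) (use K borel_gradD(5)[OF B] in auto)
 next
  fix \<phi> \<phi>' and b :: 'a assume t: "test_fun \<phi> \<phi>' (UNIV :: 'a set)" and b: "b \<in> Basis"
  note [measurable] = test_fun_borel[OF t]
  have [measurable]: "D b \<in> bmeas" using b by simp
  have t2: "test_fun (%x. \<phi> (x - h)) (%x. \<phi>' (x - h)) UNIV" by (rule test_fun_translate[OF t]) simp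
  have s: "(LBINT x. g x *R f (x + h)) = (LBINT x. g (x - h) *R f x)" if [measurable]: "g \<in> bmeas" "f \<in> bmeas" for g :: "'a => real" and f :: "'a => 'b"
   using integral_shift[of "%x. g (x - h) *R f x" h] by simp
  show "(LBINT x. \<phi> x *R D b (x + h)) = - (LBINT x. \<phi>' x b *R u (x + h))"
   using borel_gradD(6)[OF B t2 b] s[of \<phi> "D b"] s[of "%x. \<phi>' x b" u] by simp
 qed (use borel_gradD(2,3)[OF B] in auto)
qed

lemma regular_field_shift:
 fixes u :: "('m::finite) pt => 'm pt" and \<tau> :: real
 assumes R: "regular_field u D"
 defines "u' \<equiv> %x. u (x + (\<tau>, 0))" and "D' \<equiv> %b x. D b (x + (\<tau>, 0))"
 shows "regular_field u' D'" "xavg u' t = xavg u (t + \<tau>)" "continuous_on UNIV W ==> energy W UNIV u' D' = energy W UNIV u D"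
proof -
 note [measurable] = regular_fieldD(7,8,9)[OF R]
 have ind: "indicator (UNIV \<times> cell) (x + (\<tau>, 0)) = (indicator (UNIV \<times> cell) x :: ennreal)" for x :: "'m pt" by (cases x) (simp add: indicator_def)
 have [measurable]: "UNIV \<times> (cell :: (real ^ 'm) set) \<in> sets borel" by (intro borel_Times cell_borel) simp
 have sq: "sq_grad D' x = sq_grad D (x + (\<tau>, 0))" for x by (simp add: sq_grad_def D'_def)
 have int: "(NN x. indicator (UNIV \<times> cell) x * f (x + (\<tau>, 0))) = (NN x. indicator (UNIV \<times> cell) x * f x)"
  if [measurable]: "f \<in> bmeas" for f :: "'m pt => ennreal"
  using nn_integral_shift[of "%x. indicator (UNIV \<times> cell) x * f x" "(\<tau>, 0)"] by (simp add: ind)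
 show "regular_field u' D'"
  unfolding regular_field_def
 proof (intro conjI allI impI ballI)
  show "borel_grad UNIV u' D'" unfolding u'_def D'_def by (rule borel_grad_shift[OF regular_fieldD(1)[OF R]])
  show "periodic_x' u'" using regular_fieldD(2)[OF R] by (simp add: periodic_x'_def u'_def)
  show "periodic_x' (D' b)" if "b \<in> Basis" for b using regular_fieldD(3)[OF R that] by (simp add: periodic_x'_def D'_def)
  show "(gradsq D') < \<infinity>"
   unfolding sq using int[of "%x. ennreal (sq_grad D x)"] regular_fieldD(4)[OF R] by simp
  show "AE x in lborel. (\<Sum>b\<in>Basis. D' b x \<bullet> b) = 0" unfolding D'_def by (rule AE_shift[OF regular_fieldD(5)[OF R]])
  fix s t :: real assume st: "s \<le> t"
  have [measurable]: "D (1, 0) \<in> bmeas" using regular_fieldD(8)[OF R, of "(1, 0)"] by (simp add: Basis_prod_def)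
  have [measurable]: "(%r. D (1, 0) (r, y)) \<in> bmeas" for y :: "real ^ 'm"
   by (rule measurable_compose[OF borel_measurable_continuous_onI]) (auto intro!: continuous_intros)
  have "(LBINT r. indicator {s..t} r *R D (1, 0) (r + \<tau>, y)) = (LBINT r. indicator {s + \<tau>..t + \<tau>} r *R D (1, 0) (r, y))" for y
  proof -
   have "indicat_real {s..t} r = indicator {s + \<tau>..t + \<tau>} (r + \<tau>)" for r by (simp add: indicator_def)
   then show ?thesis using integral_shift[of "%r. indicator {s + \<tau>..t + \<tau>} r *R D (1, 0) (r, y)" \<tau>] by simp
  qed
  then show "AE y in lborel. u' (t, y) - u' (s, y) = (LBINT r. indicator {s..t} r *R D' (1, 0) (r, y))"
   using regular_fieldD(6)[OF R, of "s + \<tau>" "t + \<tau>"] st by (simp add: u'_def D'_def)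
 qed
 show "xavg u' t = xavg u (t + \<tau>)" by (simp add: xavg_def u'_def)
 assume "continuous_on UNIV W"
 then have [measurable]: "W \<in> bmeas" by (rule borel_measurable_continuous_onI)
 show "energy W UNIV u' D' = energy W UNIV u D"
  unfolding energy_def nn_integral_completion sq using int[of "%x. ennreal ((1/2) * sq_grad D x + W (u x))"] by (simp add: u'_def)
qed

lemma xavg_diff_le_slices:
 fixes u v :: "('m::finite) pt => 'm pt"
 assumes R: "regular_field u D" and R': "regular_field v G"
 shows "nsq (xavg u t - xavg v t) \<le> (NN y. indicator cell y * nsq (u (t, y) - v (t, y)))"
proof -
 note um = regular_fieldD(7)[OF R] regular_fieldD(7)[OF R']
 note [measurable] = borel_slice[OF um(1)] borel_slice[OF um(2)]
 have "xavg u t - xavg v t = (LBINT y. indicator cell y *R (u (t, y) - v (t, y)))"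
  unfolding xavg_lborel[OF um(1)] xavg_lborel[OF um(2)] scaleR_diff_right
  using regular_field_slice_integrable(1)[OF R] regular_field_slice_integrable(1)[OF R'] unfolding set_integrable_def
  by (intro Bochner_Integration.integral_diff[symmetric])
 then show ?thesis
  using norm_set_integral_power2_le[of "cell :: (real ^ 'm) set" lborel "%y. u (t, y) - v (t, y)"] by (simp add: emeasure_cell)
qed

text \<open>The gradient part is the hypothesis on the liminf; the potential part is Fatou, using
  almost everywhere convergence and continuity of W. Superadditivity of the liminf joins the
  two.\<close>

lemma energy_lsc:
 fixes u :: "nat => ('m::finite) pt => 'm pt"
 assumes W: "continuous_on UNIV W" and nn: "!!z. 0 \<le> W z" and R: "!!n. regular_field (u n) (D n)" and R': "regular_field v G"
  and ae: "AE x in lborel. (%n. u n x) ~> v x"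
  and G: "(gradsq G) \<le> liminf (%n. (gradsq (D n)))"
 shows "energy W UNIV v G \<le> liminf (%n. energy W UNIV (u n) (D n))"
proof -
 have [measurable]: "W \<in> bmeas" by (rule borel_measurable_continuous_onI[OF W])
 have [measurable]: "UNIV \<times> (cell :: (real ^ 'm) set) \<in> sets borel" by (intro borel_Times cell_borel) simp
 note [measurable] = regular_fieldD(7)[OF R] regular_fieldD(9)[OF R]
 let ?q = "%D. (gradsq D)" and ?w = "%u. (NN x. indicator (UNIV \<times> cell) x * ennreal (W (u x)))"
 have split: "energy W UNIV f F = ennreal (1/2) * ?q F + ?w f" if "regular_field f F" for f F
 proof -
  note [measurable] = regular_fieldD(7)[OF that] regular_fieldD(9)[OF that]
  have e: "ennreal ((1/2) * sq_grad F x + W (f x)) = ennreal (1/2) * ennreal (sq_grad F x) + ennreal (W (f x))" for x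
   by (subst ennreal_plus) (simp_all only: nn sq_grad_nonneg ennreal_mult[symmetric] mult_nonneg_nonneg zero_le_divide_1_iff zero_le_numeral)
  have "energy W UNIV f F = (NN x. ennreal (1/2) * (indicator (UNIV \<times> cell) x * ennreal (sq_grad F x)) + indicator (UNIV \<times> cell) x * ennreal (W (f x)))"
   unfolding energy_def nn_integral_completion
   unfolding e by (rule nn_integral_cong) (simp add: distrib_left mult.left_commute)
  also have "... = ennreal (1/2) * ?q F + ?w f" by (subst nn_integral_add; simp add: nn_integral_cmult)
  finally show ?thesis .
 qed
 have "?w v = (NN x. liminf (%n. indicator (UNIV \<times> cell) x * ennreal (W (u n x))))"
 proof (rule nn_integral_cong_AE)
  show "AE x in lborel. indicator (UNIV \<times> cell) x * ennreal (W (v x)) = liminf (%n. indicator (UNIV \<times> cell) x * ennreal (W (u n x)))" using ae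
  proof eventually_elim
   case (elim x)
   have "(%n. W (u n x)) ~> W (v x)" by (rule continuous_on_tendsto_compose[OF W elim]) auto
   then have "(%n. indicator (UNIV \<times> cell) x * ennreal (W (u n x))) ~> indicator (UNIV \<times> cell) x * ennreal (W (v x))"
    by (intro ennreal_tendsto_cmult tendsto_ennrealI) (auto simp: indicator_def)
   then show ?case by (simp add: lim_imp_Liminf)
  qed
 qed
 also have "... \<le> liminf (%n. ?w (u n))" by (rule nn_integral_liminf) simp
 finally have w: "?w v \<le> liminf (%n. ?w (u n))" .
 have "ennreal (1/2) * ?q G \<le> ennreal (1/2) * liminf (%n. ?q (D n))" by (intro mult_left_mono G) simp
 also have "... \<le> liminf (%n. ennreal (1/2) * ?q (D n))"
  unfolding liminf_SUP_INF SUP_mult_left_ennreal by (intro SUP_mono' INF_greatest mult_left_mono INF_lower) auto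
 finally have "ennreal (1/2) * ?q G + ?w v \<le> liminf (%n. ennreal (1/2) * ?q (D n)) + liminf (%n. ?w (u n))" by (intro add_mono w)
 also have "... \<le> liminf (%n. ennreal (1/2) * ?q (D n) + ?w (u n))" by (rule liminf_add_ennreal_le)
 finally show ?thesis by (simp add: split[OF R] split[OF R'])
qed

section \<open>Slices close to a well\<close>

context potential
begin

text \<open>The data that make a slice eligible for (H4) near z: a weak gradient on the slice, small
  energy, and an average near z. With \<epsilon> tending to 0 these give strong H1 convergence to
  z.\<close>

definition near_slice :: "('m pt => 'm pt) => ('m pt => 'm pt => 'm pt) => real => 'm pt => real => bool" where
 "near_slice u D t z \<epsilon> \<longleftrightarrow> borel_grad UNIV (%y. u (t, y)) (%b y. D (0, b) (t, y)) \<and>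
  slice_energy W u D t \<le> ennreal \<epsilon> \<and> norm (xavg u t - z) \<le> \<epsilon>"

text \<open>Chebyshev applied to the sum of the slice energy and an auxiliary cost h, so that both
  are small at the same time. Two choices of h occur: 0, and a multiple of the squared L2 distance
  to the slice of a limit field.\<close>

lemma ex_near_slice:
 assumes R: "regular_field u D" and h[measurable]: "h \<in> bmeas" and J[measurable]: "J \<in> sets borel"
  and less: "(NN t. indicator J t * (slice_energy W u D t + h t)) < ennreal \<epsilon> * emeasure lborel J"
  and near: "!!t. t \<in> J ==> h t \<le> ennreal \<epsilon> ==> norm (xavg u t - z) \<le> \<epsilon>"
 shows "\<exists>t\<in>J. near_slice u D t z \<epsilon>"
proof -
 note [measurable] = energy_eq_slices(2)[OF R W_cont sets.empty_sets]
 obtain t where t: "t \<in> J" "borel_grad UNIV (%y. u (t, y)) (%b y. D (0, b) (t, y))" "slice_energy W u D t + h t \<le> ennreal \<epsilon>"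
  using ex_small_time[OF _ J less borel_grad_slice[OF regular_fieldD(1)[OF R]]] by auto
 have "slice_energy W u D t \<le> ennreal \<epsilon>" "h t \<le> ennreal \<epsilon>"
  using t(3) by (auto intro: order_trans[rotated] simp: add_increasing2 add_increasing)
 then show ?thesis using t near unfolding near_slice_def by blast
qed

text \<open>On a ray the energy is finite while \<epsilon> times the length is infinite, so some
  slice has energy at most \<epsilon>. The bound B allows the slice to be placed beyond any
  prescribed time.\<close>

lemma ex_near_slice_end:
 assumes R: "regular_field u D" and fin: "energy W UNIV u D < \<infinity>" and \<epsilon>: "0 < \<epsilon>"
 shows "(xavg u \<longlongrightarrow> z) at_bot ==> \<exists>t<B. near_slice u D t z \<epsilon>" "(xavg u \<longlongrightarrow> z) at_top ==> \<exists>t>B. near_slice u D t z \<epsilon>"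
proof -
 have key: "\<exists>t\<in>J. near_slice u D t z \<epsilon>" if J: "J \<in> sets borel" "emeasure lborel J = \<infinity>" and n: "!!t. t \<in> J ==> norm (xavg u t - z) \<le> \<epsilon>" for J
 proof (rule ex_near_slice[OF R _ J(1), where h = "%_. 0"])
  have "(NN t. indicator J t * (slice_energy W u D t + 0)) = energy W J u D" using energy_eq_slices(1)[OF R W_cont J(1)] by simp
  also have "... < \<infinity>" using energy_mono[of J UNIV W u D] fin by (auto intro: le_less_trans)
  also have "\<infinity> = ennreal \<epsilon> * emeasure lborel J" using \<epsilon> by (simp add: J ennreal_mult_top)
  finally show "(NN t. indicator J t * (slice_energy W u D t + 0)) < ennreal \<epsilon> * emeasure lborel J" .
 qed (use n in auto)
 show "\<exists>t<B. near_slice u D t z \<epsilon>" if l: "(xavg u \<longlongrightarrow> z) at_bot"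
 proof -
  obtain T where T: "!!t. t \<le> T ==> dist (xavg u t) z < \<epsilon>" using tendstoD[OF l \<epsilon>] by (auto simp: eventually_at_bot_linorder)
  have "\<exists>t\<in>{..min T (B - 1)}. near_slice u D t z \<epsilon>"
   by (rule key) (use T in \<open>auto simp: emeasure_lborel_Iic dist_norm less_imp_le\<close>)
  then obtain t where "t \<le> B - 1" "near_slice u D t z \<epsilon>" by auto
  then show ?thesis by (intro exI[of _ t]) simp
 qed
 show "\<exists>t>B. near_slice u D t z \<epsilon>" if l: "(xavg u \<longlongrightarrow> z) at_top"
 proof -
  obtain T where T: "!!t. T \<le> t ==> dist (xavg u t) z < \<epsilon>" using tendstoD[OF l \<epsilon>] by (auto simp: eventually_at_top_linorder)
  have "\<exists>t\<in>{max T (B + 1)..}. near_slice u D t z \<epsilon>"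
   by (rule key) (use T in \<open>auto simp: emeasure_lborel_Ici dist_norm less_imp_le\<close>)
  then obtain t where "B + 1 \<le> t" "near_slice u D t z \<epsilon>" by auto
  then show ?thesis by (intro exI[of _ t]) simp
 qed
qed

text \<open>Near slices with tolerances tending to 0 converge in H1 to the two wells. (H4) bounds
  the distance of the wells by the distances of the slices, and the latter are bounded by the energy
  of the piece in between.\<close>

lemma dW_le_liminf_energy:
 fixes u :: "nat => 'm pt => 'm pt"
 assumes H4: "\<forall>zm zp vm vp Dvm Dvp. zm \<in> wells \<and> zp \<in> wells \<and> (\<forall>n. h1a a (vm n) (Dvm n) \<and> h1a a (vp n) (Dvp n)) \<and>
       h1_conv_const vm Dvm zm \<and> h1_conv_const vp Dvp zp \<longrightarrow> dW W (%_. zm) (%_. zp) \<le> liminf (%n. dW W (vm n) (vp n))"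
  and R: "!!n. regular_field (u n) (D n)" and fa: "!!n t. fst (xavg (u n) t) = a" and st: "!!n. s n < t n"
  and z: "z \<in> wells" "z' \<in> wells" and e: "e ~> 0" "!!n. 0 \<le> e n"
  and n: "!!n. near_slice (u n) (D n) (s n) z (e n)" "!!n. near_slice (u n) (D n) (t n) z' (e n)"
 shows "dW W (%_. z) (%_. z') \<le> liminf (%n. energy W {s n..t n} (u n) (D n))"
proof -
 have key: "h1_conv_const (%n y. u n (r n, y)) (%n b y. D n (0, b) (r n, y)) x" "h1a a (%y. u n (r n, y)) (%b y. D n (0, b) (r n, y))"
  if r: "!!n. near_slice (u n) (D n) (r n) x (e n)" for r x n
 proof -
  have "(%n. xavg (u n) (r n) - x) ~> 0"
   by (rule Lim_null_comparison[OF always_eventually e(1)]) (use r in \<open>simp add: near_slice_def\<close>)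
  then have g: "(%n. xavg (u n) (r n)) ~> x" by (simp add: LIM_zero_iff)
  have B: "borel_grad UNIV (%y. u n (r n, y)) (%b y. D n (0, b) (r n, y))" and s: "slice_energy W (u n) (D n) (r n) \<le> ennreal (e n)" for n
   using r[of n] by (simp_all add: near_slice_def)
  show "h1_conv_const (%n y. u n (r n, y)) (%n b y. D n (0, b) (r n, y)) x" by (rule h1_conv_constI[OF W_cont W_nonneg R B s e(2,1) g])
  show "h1a a (%y. u n (r n, y)) (%b y. D n (0, b) (r n, y))" by (rule h1a_slice[OF R fa B])
 qed
 have "dW W (%_. z) (%_. z') \<le> liminf (%n. dW W (%y. u n (s n, y)) (%y. u n (t n, y)))"
  by (rule H4[rule_format, of z z' "%n y. u n (s n, y)" "%n b y. D n (0, b) (s n, y)" "%n y. u n (t n, y)" "%n b y. D n (0, b) (t n, y)"])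
   (intro conjI allI z key(1)[OF n(1)] key(1)[OF n(2)] key(2)[OF n(1)] key(2)[OF n(2)])
 also have "... \<le> liminf (%n. energy W {s n..t n} (u n) (D n))"
  by (intro Liminf_mono always_eventually allI dW_le_energy R st)
 finally show ?thesis .
qed

text \<open>An almost optimal field is replaced by its regular version and translated. The last time
  in the closed \<delta>-ball around \<open>um\<close> is chosen because what follows it, distance
  at least \<delta> for all later times, is a condition on a whole half-line and survives local
  convergence.\<close>

lemma ex_normalized_competitor:
 assumes um: "um \<in> wells" and c: "cW W um up < \<infinity>" and \<epsilon>: "0 < \<epsilon>" and \<delta>: "0 < \<delta>" and far: "4 * \<delta> \<le> norm (up - um)"
 shows "\<exists>u D. regular_field u D \<and> (xavg u \<longlongrightarrow> um) at_bot \<and> (xavg u \<longlongrightarrow> up) at_top \<and> energy W UNIV u D \<le> cW W um up + ennreal \<epsilon> \<and>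
  (\<forall>t. fst (xavg u t) = a) \<and> norm (xavg u 0 - um) \<le> \<delta> \<and> (\<forall>t>0. \<delta> \<le> norm (xavg u t - um))"
proof -
 define c where "c = cW W um up"
 have "cW W um up < c + ennreal \<epsilon>" unfolding c_def using c \<epsilon> by (cases "cW W um up") (auto simp: ennreal_plus[symmetric] ennreal_less_iff simp del: ennreal_plus)
 then have "\<exists>p\<in>{(u, D). sob_div UNIV u D \<and> (xavg u \<longlongrightarrow> um) at_bot \<and> (xavg u \<longlongrightarrow> up) at_top}. energy W UNIV (fst p) (snd p) < c + ennreal \<epsilon>"
  unfolding cW_def INF_less_iff .
 then obtain u0 D0 where 0: "sob_div UNIV u0 D0" "(xavg u0 \<longlongrightarrow> um) at_bot" "(xavg u0 \<longlongrightarrow> up) at_top" "energy W UNIV u0 D0 < cW W um up + ennreal \<epsilon>" by (auto simp: c_def)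
 obtain u D where R: "regular_field u D" and ue: "AE x in lborel. u0 x = u x" and De: "!!b. b \<in> Basis ==> AE x in lborel. D0 b x = D b x"
  by (rule ex_regular_representative[OF 0(1)]) blast
 have l: "(xavg u \<longlongrightarrow> um) at_bot" "(xavg u \<longlongrightarrow> up) at_top"
  using xavg_tendsto_cong_AE[OF ue R] 0(2,3) by auto
 have E: "energy W UNIV u D \<le> cW W um up + ennreal \<epsilon>" using energy_cong_AE[OF ue De, where W = W and I = UNIV] 0(4) by simp
 have fa: "fst (xavg u t) = a" for t
 \<comment> \<open>The first component of the average is constant in time, so it equals its limit at
   -\<infinity>, the first component of \<open>um\<close>.\<close>
 proof -
  have "((%s. fst (xavg u s)) \<longlongrightarrow> fst um) at_bot" by (intro tendsto_intros l)
  moreover have "(%s. fst (xavg u s)) = (%_. fst (xavg u t))" using xavg_fst_const[OF R] by blast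
  ultimately show ?thesis using um by (simp add: tendsto_const_iff wells_def)
 qed
 define S where "S = {t. norm (xavg u t - um) \<le> \<delta>}"
 have S: "closed S" unfolding S_def by (intro closed_Collect_le continuous_intros xavg_continuous[OF R])
 obtain T0 where "!!t. t \<le> T0 ==> dist (xavg u t) um < \<delta>" using tendstoD[OF l(1) \<delta>] by (auto simp: eventually_at_bot_linorder)
 from this[of T0] have "T0 \<in> S" by (simp add: S_def dist_norm)
 then have S0: "S \<noteq> {}" by auto
 obtain T1 where T1: "!!t. T1 \<le> t ==> dist (xavg u t) up < \<delta>" using tendstoD[OF l(2) \<delta>] by (auto simp: eventually_at_top_linorder)
 have "t \<le> T1" if "t \<in> S" for t
 proof (rule ccontr)
  assume "\<not> t \<le> T1"
  then have "dist (xavg u t) up < \<delta>" using T1 by simp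
  moreover have "dist (xavg u t) um \<le> \<delta>" using that by (simp add: S_def dist_norm)
  ultimately have "dist up um < 2 * \<delta>" using dist_triangle3[of up um "xavg u t"] by linarith
  then show False using far \<delta> by (simp add: dist_norm)
 qed
 then have bS: "bdd_above S" by (auto simp: bdd_above_def)
 \<comment> \<open>The set S is closed, non-empty by the limit at -\<infinity>, and bounded above
   because the average ends near \<open>up\<close>, at distance at least 4 \<delta> from
   \<open>um\<close>.\<close>
 define T where "T = Sup S"
 have T: "T \<in> S" unfolding T_def by (rule closed_contains_Sup[OF S0 bS S])
 have T': "\<delta> \<le> norm (xavg u t - um)" if "T < t" for t
 proof (rule ccontr)
  assume "\<not> \<delta> \<le> norm (xavg u t - um)"
  then have "t \<in> S" by (simp add: S_def)
  then show False using cSup_upper[OF _ bS, of t] that by (simp add: T_def)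
 qed
 note sh = regular_field_shift[OF R, where \<tau> = T]
 have sl: "((%t. xavg u (t + T)) \<longlongrightarrow> um) at_bot" and sl': "((%t. xavg u (t + T)) \<longlongrightarrow> up) at_top"
 proof -
  have "filterlim (%t. t + T) at_bot at_bot" unfolding filterlim_at_bot
  proof
   show "\<forall>\<^sub>F t in at_bot. t + T \<le> Z" for Z by (rule eventually_mono[OF eventually_le_at_bot[of "Z - T"]]) simp
  qed
  then show "((%t. xavg u (t + T)) \<longlongrightarrow> um) at_bot" by (rule filterlim_compose[OF l(1)])
  have "filterlim (%t. t + T) at_top at_top" unfolding filterlim_at_top
  proof
   show "\<forall>\<^sub>F t in at_top. Z \<le> t + T" for Z by (rule eventually_mono[OF eventually_ge_at_top[of "Z - T"]]) simp
  qed
  then show "((%t. xavg u (t + T)) \<longlongrightarrow> up) at_top" by (rule filterlim_compose[OF l(2)])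
 qed
 show ?thesis
 proof (intro exI conjI allI impI)
  show "regular_field (%x. u (x + (T, 0))) (%b x. D b (x + (T, 0)))" by (rule sh(1))
  show "(xavg (%x. u (x + (T, 0))) \<longlongrightarrow> um) at_bot" "(xavg (%x. u (x + (T, 0))) \<longlongrightarrow> up) at_top" using sl sl' by (simp_all add: sh(2)[abs_def])
  show "energy W UNIV (%x. u (x + (T, 0))) (%b x. D b (x + (T, 0))) \<le> cW W um up + ennreal \<epsilon>" using E by (simp add: sh(3)[OF W_cont])
  show "fst (xavg (%x. u (x + (T, 0))) t) = a" for t by (simp add: sh(2) fa)
  show "norm (xavg (%x. u (x + (T, 0))) 0 - um) \<le> \<delta>" using T by (simp add: sh(2) S_def)
  show "\<delta> \<le> norm (xavg (%x. u (x + (T, 0))) t - um)" if "0 < t" for t using T'[of "t + T"] that by (simp add: sh(2))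
 qed
qed

section \<open>The minimizer\<close>

lemma cW_le_energy:
 "sob_div UNIV u D ==> (xavg u \<longlongrightarrow> um) at_bot ==> (xavg u \<longlongrightarrow> up) at_top ==> cW W um up \<le> energy W UNIV u D"
 unfolding cW_def by (rule INF_lower2[of "(u, D)"]) auto

text \<open>Lower semicontinuity gives the limit field energy at most the infimum, and finite energy
  gives it ends in the set of wells. All the work lies in identifying these ends: three exclusions
  leave \<open>um\<close> on the left and \<open>up\<close> on the right.\<close>

lemma exists_minimizer:
 assumes um: "um \<in> wells" and up: "up \<in> wells" and ne: "um \<noteq> up"
  and H3: "\<forall>z\<in>wells - {um, up}. dW W (%_. um) (%_. up) < dW W (%_. um) (%_. z) + dW W (%_. z) (%_. up)"
  and H4: "\<forall>zm zp vm vp Dvm Dvp. zm \<in> wells \<and> zp \<in> wells \<and> (\<forall>n. h1a a (vm n) (Dvm n) \<and> h1a a (vp n) (Dvp n)) \<and>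
       h1_conv_const vm Dvm zm \<and> h1_conv_const vp Dvp zp \<longrightarrow> dW W (%_. zm) (%_. zp) \<le> liminf (%n. dW W (vm n) (vp n))"
 shows "\<exists>u D. sob_div UNIV u D \<and> (xavg u \<longlongrightarrow> um) at_bot \<and> (xavg u \<longlongrightarrow> up) at_top \<and> energy W UNIV u D = cW W um up"
proof (cases "cW W um up < \<infinity>")
 case False
 obtain u D where u: "sob_div UNIV u D" "(xavg u \<longlongrightarrow> um) at_bot" "(xavg u \<longlongrightarrow> up) at_top"
  by (rule ex_connecting_field[of um up]) (use um up in \<open>auto simp: wells_def\<close>)
 then show ?thesis using False cW_le_energy[OF u] by (intro exI[of _ u] exI[of _ D]) (simp add: less_top[symmetric] top_unique)
next
 case fin: True
 then obtain c where c: "0 \<le> c" "cW W um up = ennreal c" by (cases "cW W um up") auto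
 \<comment> \<open>Links the two notions of cost. Both contradictions below bound energies from
   below by distances, and distances from below by c.\<close>
 have cd: "ennreal c \<le> dW W (%_. um) (%_. up)"
  using cW_le_dW[of um up W] um up W_nonneg by (simp add: c(2) wells_def)
 obtain \<delta> where \<delta>: "\<delta> > 0" and sep: "!!z z'. z \<in> wells ==> z' \<in> wells ==> z \<noteq> z' ==> 4 * \<delta> \<le> norm (z - z')" by (rule wells_separated) blast
 define P where "P = (%n p. regular_field (fst p) (snd p) \<and> (xavg (fst p) \<longlongrightarrow> um) at_bot \<and> (xavg (fst p) \<longlongrightarrow> up) at_top \<and>
  energy W UNIV (fst p) (snd p) \<le> ennreal c + ennreal (1 / real (Suc n)) \<and> (\<forall>t. fst (xavg (fst p) t) = a) \<and>
  norm (xavg (fst p) 0 - um) \<le> \<delta> \<and> (\<forall>t>0. \<delta> \<le> norm (xavg (fst p) t - um)))"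
 have "\<exists>p. P n p" for n
  using ex_normalized_competitor[OF um fin _ \<delta>, of "1 / real (Suc n)"] sep[OF up um] ne unfolding P_def c(2) by auto
 then have "\<forall>n. \<exists>p. P n p" by (rule allI)
 from choice[OF this] obtain f where f: "!!n. P n (f n)" by blast
 have R0: "regular_field (fst (f n)) (snd (f n))" for n using f[of n] by (simp add: P_def)
 have E0: "energy W UNIV (fst (f n)) (snd (f n)) \<le> ennreal (c + 1 / real (Suc n))" for n
  using f[of n] c(1) by (simp add: P_def ennreal_plus)
 have E1: "energy W UNIV (fst (f n)) (snd (f n)) \<le> ennreal (c + 1)" for n
  by (rule order_trans[OF E0]) (simp add: ennreal_leI)
 have Q: "0 \<le> 2 * (c + 1)" "(gradsq (snd (f n))) \<le> ennreal (2 * (c + 1))" for n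
 proof -
  have "(gradsq (snd (f n))) \<le> 2 * energy W UNIV (fst (f n)) (snd (f n))"
   by (rule sq_grad_le_energy[OF R0 W_cont W_nonneg]) simp
  also have "... \<le> 2 * ennreal (c + 1)" by (intro mult_left_mono E1) simp
  finally show "(gradsq (snd (f n))) \<le> ennreal (2 * (c + 1))"
   using c(1) by (simp add: ennreal_two_mult del: ennreal_plus)
 qed (use c in simp)
 \<comment> \<open>The normalisation at time 0 supplies the bound on the average that compactness
   asks for.\<close>
 have M: "0 \<le> norm um + \<delta>" "norm (xavg (fst (f n)) 0) \<le> norm um + \<delta>" for n
  using f[of n] \<delta> norm_triangle_sub[of "xavg (fst (f n)) 0" um] by (auto simp: P_def)
 obtain r v0 G0 where r: "strict_mono r" and S0: "sob_div UNIV v0 G0"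
  and ae0: "AE x in lborel. (%n. fst (f (r n)) x) ~> v0 x"
  and sl0: "!!i. (%n. (NN x. indicator (slab i) x * nsq (fst (f (r n)) x - v0 x))) ~> 0"
  and q0: "(gradsq G0) \<le> liminf (%n. (NN x. indicator (UNIV \<times> cell) x * ennreal (sq_grad (snd (f (r n))) x)))"
  by (rule compactness[of "%n. fst (f n)" "%n. snd (f n)", OF R0 Q M]) blast
 obtain v G where R': "regular_field v G" and ve: "AE x in lborel. v0 x = v x" and Ge: "!!b. b \<in> Basis ==> AE x in lborel. G0 b x = G b x"
  by (rule ex_regular_representative[OF S0]) blast
 define U where "U = (%n. fst (f (r n)))"
 define F where "F = (%n. snd (f (r n)))"
 have R: "regular_field (U n) (F n)" and Um: "(xavg (U n) \<longlongrightarrow> um) at_bot" and Up: "(xavg (U n) \<longlongrightarrow> up) at_top"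
  and fa: "fst (xavg (U n) t) = a" and U0: "norm (xavg (U n) 0 - um) \<le> \<delta>" and Upos: "0 < t ==> \<delta> \<le> norm (xavg (U n) t - um)" for n t
  using f[of "r n"] by (simp_all add: P_def U_def F_def)
 \<comment> \<open>The subsequence satisfies r n \<ge> n, so the error 1/(n+1) survives the
   reindexing.\<close>
 have E: "energy W UNIV (U n) (F n) \<le> ennreal (c + 1 / real (Suc n))" for n
 proof -
  have "1 / real (Suc (r n)) \<le> 1 / real (Suc n)" using seq_suble[OF r, of n] by (intro divide_left_mono) auto
  then show ?thesis unfolding U_def F_def by (intro order_trans[OF E0] ennreal_leI) simp
 qed
 have limc: "liminf (%n. ennreal (c + 1 / real (Suc n))) = ennreal c"
 proof (rule lim_imp_Liminf)
  have "(%n. c + 1 / real (Suc n)) ~> c + 0" using LIMSEQ_inverse_real_of_nat by (intro tendsto_add tendsto_const) (simp add: inverse_eq_divide)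
  then show "(%n. ennreal (c + 1 / real (Suc n))) ~> ennreal c" by (intro tendsto_ennrealI) simp
 qed simp
 have ae: "AE x in lborel. (%n. U n x) ~> v x" using ae0 ve by eventually_elim (simp add: U_def)
 have sl: "(%n. (NN x. indicator (slab i) x * nsq (U n x - v x))) ~> 0" for i
 proof -
  have "(NN x. indicator (slab i) x * nsq (U n x - v x)) = (NN x. indicator (slab i) x * nsq (fst (f (r n)) x - v0 x))" for n
   by (rule nn_integral_cong_AE) (use ve in \<open>eventually_elim, simp add: U_def\<close>)
  then show ?thesis using sl0[of i] by simp
 qed
 have "(gradsq G) = (gradsq G0)"
 proof (rule nn_integral_cong_AE)
  have "AE x in lborel. \<forall>b\<in>Basis. G0 b x = G b x" using Ge by (simp add: AE_finite_all)
  then show "AE x in lborel. indicator (UNIV \<times> cell) x * ennreal (sq_grad G x) = indicator (UNIV \<times> cell) x * ennreal (sq_grad G0 x)"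
   by eventually_elim (simp add: sq_grad_def)
 qed
 then have q: "(gradsq G) \<le> liminf (%n. (gradsq (F n)))"
  using q0 by (simp add: F_def)
 have "energy W UNIV v G \<le> liminf (%n. energy W UNIV (U n) (F n))" by (rule energy_lsc[OF W_cont W_nonneg R R' ae q])
 also have "... \<le> liminf (%n. ennreal (c + 1 / real (Suc n)))" by (intro Liminf_mono always_eventually allI E)
 finally have Ev: "energy W UNIV v G \<le> ennreal c" unfolding limc .
 then have Efin: "energy W UNIV v G < \<infinity>" by (rule le_less_trans) simp
 have Ufin: "energy W UNIV (U n) (F n) < \<infinity>" for n by (rule le_less_trans[OF E]) simp
 \<comment> \<open>Squared L2 distance of the slices at time t of the n-th field and of the limit.
   It dominates the squared distance of the averages, and its time integral over bounded intervals
   tends to 0.\<close>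
 define h where "h = (%n t. (NN y. indicator cell y * nsq (U n (t, y) - v (t, y))))"
 have m: "(%x. nsq (U n x - v x)) \<in> bmeas" for n
  using regular_fieldD(7)[OF R, of n] regular_fieldD(7)[OF R'] by measurable
 have hm[measurable]: "h n \<in> bmeas" for n unfolding h_def by (rule nn_integral_Times(2)[OF m _ cell_borel, of UNIV]) simp
 have hg: "nsq (xavg (U n) t - xavg v t) \<le> h n t" for n t unfolding h_def by (rule xavg_diff_le_slices[OF R R'])
 have hint: "(%n. (NN t. indicator {p..q} t * h n t)) ~> 0" for p q :: real
 proof -
  obtain i where i: "{p..q} \<times> (cell :: (real ^ 'm) set) \<subseteq> slab i" using slab_cover_compact[OF compact_Times[OF compact_Icc compact_cell]] by blast
  have "(NN t. indicator {p..q} t * h n t) \<le> (NN x. indicator (slab i) x * nsq (U n x - v x))" for n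
   unfolding h_def by (subst nn_integral_Times(1)[OF m _ cell_borel, symmetric]) (simp, rule nn_integral_subset_mono[OF i])
  then show ?thesis by (intro tendsto_sandwich[OF always_eventually always_eventually tendsto_const sl[of i]]) simp_all
 qed
 \<comment> \<open>A lower bound on h valid for all n over a fixed unit interval contradicts
   convergence unless it is trivial. This is how statements on averages pass to the limit without
   pointwise convergence of averages.\<close>
 have lower: "e \<le> 0" if e: "!!n t. t \<in> {p..p + 1} ==> ennreal e \<le> h n t" for e p :: real
 proof -
  have "ennreal e \<le> (NN t. indicator {p..p + 1} t * h n t)" for n
  proof -
   have "ennreal e = (NN t. ennreal e * indicator {p..p + 1} t)" by (subst nn_integral_cmult_indicator) simp_all
   also have "... \<le> (NN t. indicator {p..p + 1} t * h n t)" by (rule nn_integral_mono) (use e in \<open>auto simp: indicator_def\<close>)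
   finally show ?thesis .
  qed
  then have "ennreal e \<le> 0" by (intro LIMSEQ_le_const[OF hint]) auto
  then show ?thesis by (simp add: ennreal_eq_0_iff)
 qed
 have fav: "fst (xavg v t) = a" for t
 proof -
  have "(fst (xavg v t) - a)\<^sup>2 \<le> 0"
  proof (rule lower[of 0])
   fix n s
   have "\<bar>fst (xavg (U n) s - xavg v s)\<bar> \<le> norm (xavg (U n) s - xavg v s)" using norm_fst_le[of "fst (xavg (U n) s - xavg v s)" "snd (xavg (U n) s - xavg v s)"] unfolding prod.collapse real_norm_def .
   then have "\<bar>fst (xavg v t) - a\<bar> \<le> norm (xavg (U n) s - xavg v s)" using fa[of n s] xavg_fst_const[OF R', of s t] by simp
   then have "(fst (xavg v t) - a)\<^sup>2 \<le> (norm (xavg (U n) s - xavg v s))\<^sup>2" by (rule abs_le_square_iff[THEN iffD1, OF order_trans]) simp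
   then show "ennreal ((fst (xavg v t) - a)\<^sup>2) \<le> h n s" by (rule order_trans[OF ennreal_leI hg])
  qed
  then show ?thesis by simp
 qed
 obtain zp where zp: "zp \<in> wells" "(xavg v \<longlongrightarrow> zp) at_top" by (rule xavg_limit_at_top[OF R' _ Efin]) (use fav in auto)
 obtain zm where zm: "zm \<in> wells" "(xavg v \<longlongrightarrow> zm) at_bot" by (rule xavg_limit_at_bot[OF R' _ Efin]) (use fav in auto)
 \<comment> \<open>At large positive times the averages of the approximating fields stay \<delta>
   away from \<open>um\<close>; a limit average within \<delta>/2 of \<open>um\<close> would keep h
   at least (\<delta>/2)^2. The maximum with 1 guarantees positive times.\<close>
 have zpum: "zp \<noteq> um"
 proof
  assume "zp = um"
  then obtain T where T: "!!t. T \<le> t ==> dist (xavg v t) um < \<delta> / 2"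
   using tendstoD[OF zp(2), of "\<delta> / 2"] \<delta> by (auto simp: eventually_at_top_linorder)
  have "(\<delta> / 2)\<^sup>2 \<le> 0"
  proof (rule lower[of "max T 1"])
   fix n t assume t: "t \<in> {max T 1..max T 1 + 1}"
   have "\<delta> \<le> norm (xavg (U n) t - um)" using t by (intro Upos) auto
   moreover have "norm (xavg v t - um) < \<delta> / 2" using T[of t] t by (simp add: dist_norm)
   ultimately have "\<delta> / 2 \<le> norm (xavg (U n) t - xavg v t)" using norm_triangle_ineq[of "xavg (U n) t - xavg v t" "xavg v t - um"] by simp
   then have "(\<delta> / 2)\<^sup>2 \<le> (norm (xavg (U n) t - xavg v t))\<^sup>2" using \<delta> by (intro power_mono) auto
   then show "ennreal ((\<delta> / 2)\<^sup>2) \<le> h n t" by (rule order_trans[OF ennreal_leI hg])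
  qed
  then show False using \<delta> by simp
 qed
 \<comment> \<open>Explains the weight 4/e below: a weighted squared distance of at most e means a
   distance of at most e/2.\<close>
 have quad: "x \<le> e / 2" if "0 < e" "4 / e * x\<^sup>2 \<le> e" for x e :: real
 proof -
  have "x\<^sup>2 \<le> (e / 2)\<^sup>2" using that by (simp add: pos_divide_le_eq power2_eq_square)
  then show ?thesis by (rule power2_le_imp_le) (use that in simp)
 qed
 \<comment> \<open>Where the limit stays near z for a long time, the approximating fields have near
   slices. The total cost is at most c + 1 for the energy plus 1 for the weighted distance, and the
   window length l is chosen such that e l exceeds it.\<close>
 have near: "\<exists>N. \<forall>n\<ge>N. \<exists>t\<in>{p..p + l}. near_slice (U n) (F n) t z e" if e: "0 < e" and l: "0 \<le> l" "c + 2 < e * l" and z: "!!t. t \<in> {p..p + l} ==> norm (xavg v t - z) \<le> e / 2" for e l p z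
 proof -
  have "(%n. ennreal (4 / e) * (NN t. indicator {p..p + l} t * h n t)) ~> ennreal (4 / e) * 0" by (rule ennreal_tendsto_cmult[OF _ hint]) simp
  then have "\<forall>\<^sub>F n in sequentially. ennreal (4 / e) * (NN t. indicator {p..p + l} t * h n t) < 1" by (rule order_tendstoD(2)) simp
  then obtain N where N: "!!n. N \<le> n ==> ennreal (4 / e) * (NN t. indicator {p..p + l} t * h n t) < 1" by (auto simp: eventually_sequentially)
  have "\<exists>t\<in>{p..p + l}. near_slice (U n) (F n) t z e" if n: "N \<le> n" for n
  proof (rule ex_near_slice[OF R, where h = "%t. ennreal (4 / e) * h n t"])
   note [measurable] = energy_eq_slices(2)[OF R W_cont sets.empty_sets]
   have "(NN t. indicator {p..p + l} t * (slice_energy W (U n) (F n) t + ennreal (4 / e) * h n t))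
    = (NN t. indicator {p..p + l} t * slice_energy W (U n) (F n) t + ennreal (4 / e) * (indicator {p..p + l} t * h n t))"
    by (rule nn_integral_cong) (simp add: distrib_left mult.left_commute)
   also have "... = energy W {p..p + l} (U n) (F n) + ennreal (4 / e) * (NN t. indicator {p..p + l} t * h n t)"
    by (subst nn_integral_add) (simp_all add: nn_integral_cmult energy_eq_slices(1)[OF R W_cont])
   also have "... \<le> ennreal (c + 1) + 1"
    using N[OF n] by (intro add_mono order_trans[OF energy_mono[of _ UNIV] order_trans[OF E]] ennreal_leI) auto
   also have "... = ennreal (c + 2)" using c(1) by (simp add: ennreal_plus[symmetric] ennreal_1[symmetric] del: ennreal_plus ennreal_1)
   also have "... < ennreal (e * l)" using l(2) c(1) by (simp add: ennreal_less_iff del: ennreal_plus)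
   also have "... = ennreal e * emeasure lborel {p..p + l}" using e l by (simp add: ennreal_mult)
   finally show "(NN t. indicator {p..p + l} t * (slice_energy W (U n) (F n) t + ennreal (4 / e) * h n t)) < ennreal e * emeasure lborel {p..p + l}" .
   fix t assume t: "t \<in> {p..p + l}" and ht: "ennreal (4 / e) * h n t \<le> ennreal e"
   let ?x = "norm (xavg (U n) t - xavg v t)"
   have "ennreal (4 / e * ?x\<^sup>2) = ennreal (4 / e) * ennreal (?x\<^sup>2)" using e by (intro ennreal_mult) auto
   also have "... \<le> ennreal (4 / e) * h n t" by (intro mult_left_mono hg) simp
   also note ht
   finally have "4 / e * ?x\<^sup>2 \<le> e" using e by (simp add: ennreal_le_iff)
   then have "?x \<le> e / 2" by (rule quad[OF e])
   then show "norm (xavg (U n) t - z) \<le> e" using z[OF t] norm_triangle_ineq[of "xavg (U n) t - xavg v t" "xavg v t - z"] by simp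
  qed simp_all
  then show ?thesis by blast
 qed
 have len: "\<exists>l\<ge>0. c + 2 < e * l" if "0 < e" for e
  using that c(1) by (intro exI[of _ "(c + 3) / e"]) simp
 have nearp: "\<exists>N. \<forall>n\<ge>N. \<exists>t. near_slice (U n) (F n) t zp e" if e: "0 < e" for e
 proof -
  obtain T where T: "!!t. T \<le> t ==> dist (xavg v t) zp < e / 2" using tendstoD[OF zp(2), of "e / 2"] e by (auto simp: eventually_at_top_linorder)
  obtain l where l: "0 \<le> l" "c + 2 < e * l" using len[OF e] by blast
  have "norm (xavg v t - zp) \<le> e / 2" if "t \<in> {T..T + l}" for t using T[of t] that by (simp add: dist_norm)
  from near[OF e l this] show ?thesis by blast
 qed
 \<comment> \<open>The window is placed to end at or before time 0, so that the slice found precedes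
   the normalisation time; this order is used to exclude zm = \<open>up\<close>.\<close>
 have nearm: "\<exists>N. \<forall>n\<ge>N. \<exists>t\<le>0. near_slice (U n) (F n) t zm e" if e: "0 < e" for e
 proof -
  obtain T where T: "!!t. t \<le> T ==> dist (xavg v t) zm < e / 2" using tendstoD[OF zm(2), of "e / 2"] e by (auto simp: eventually_at_bot_linorder)
  obtain l where l: "0 \<le> l" "c + 2 < e * l" using len[OF e] by blast
  define p where "p = min T 0 - l"
  have "norm (xavg v t - zm) \<le> e / 2" if "t \<in> {p..p + l}" for t using T[of t] that by (simp add: dist_norm p_def)
  from near[OF e l this] obtain N where N: "\<forall>n\<ge>N. \<exists>t\<in>{p..p + l}. near_slice (U n) (F n) t zm e" by blast
  have "\<exists>t\<le>0. near_slice (U n) (F n) t zm e" if n: "N \<le> n" for n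
  proof -
   obtain t where "t \<in> {p..p + l}" "near_slice (U n) (F n) t zm e" using N n by blast
   then show ?thesis by (intro exI[of _ t]) (simp add: p_def)
  qed
  then show ?thesis by blast
 qed
 define e where "e = (%k. \<delta> / real (Suc k))"
 have e: "0 < e k" "0 \<le> e k" "e k \<le> \<delta>" for k using \<delta> by (auto simp: e_def field_simps mult_le_cancel_left1)
 have e0: "e ~> 0" unfolding e_def using tendsto_mult_right_zero[OF LIMSEQ_inverse_real_of_nat, of \<delta>] by (simp add: divide_inverse)
 have Ek: "energy W I (U n) (F n) \<le> ennreal (c + 1 / real (Suc k))" if "k \<le> n" for I n k
 proof -
  have "1 / real (Suc n) \<le> 1 / real (Suc k)" using that by (intro divide_left_mono) auto
  then show ?thesis by (intro order_trans[OF energy_mono[of I UNIV] order_trans[OF E]] ennreal_leI) auto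
 qed
 \<comment> \<open>A near slice at a third well lies between a near slice at \<open>um\<close> and
   one at \<open>up\<close>, which exist because each approximating field itself joins
   \<open>um\<close> to \<open>up\<close>. The two pieces cost at least the two distances in the
   limit, together at most c, and c is at most the direct distance: a contradiction to (H3).\<close>
 have excl: "z \<in> {um, up}" if z: "z \<in> wells" and nz: "!!e. 0 < e ==> \<exists>N. \<forall>n\<ge>N. \<exists>t. near_slice (U n) (F n) t z e" for z
 proof (rule ccontr)
  assume zn: "z \<notin> {um, up}"
  \<comment> \<open>Diagonal choice: the index of the field is at least k and the tolerance is e k,
    so energy error and slice tolerance tend to 0 together.\<close>
  define P where "P = (%k (n, s, t, t'). k \<le> n \<and> t < s \<and> s < t' \<and> near_slice (U n) (F n) s z (e k) \<and> near_slice (U n) (F n) t um (e k) \<and> near_slice (U n) (F n) t' up (e k))"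
  have "\<exists>q. P k q" for k
  proof -
   obtain N where N: "\<forall>n\<ge>N. \<exists>t. near_slice (U n) (F n) t z (e k)" using nz[OF e(1)] by blast
   define n where "n = max N k"
   have n: "N \<le> n" "k \<le> n" by (simp_all add: n_def)
   obtain s where s: "near_slice (U n) (F n) s z (e k)" using N[rule_format, OF n(1)] by blast
   obtain t where t: "t < s" "near_slice (U n) (F n) t um (e k)" using ex_near_slice_end(1)[OF R Ufin e(1) Um] by blast
   obtain t' where t': "s < t'" "near_slice (U n) (F n) t' up (e k)" using ex_near_slice_end(2)[OF R Ufin e(1) Up] by blast
   show ?thesis by (intro exI[of _ "(n, s, t, t')"]) (simp add: P_def s t t' n)
  qed
  then have "\<forall>k. \<exists>q. P k q" by (rule allI)
  from choice[OF this] obtain q where q: "!!k. P k (q k)" by blast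
  define n s t t' where "n = (%k. fst (q k))" and "s = (%k. fst (snd (q k)))" and "t = (%k. fst (snd (snd (q k))))" and "t' = (%k. snd (snd (snd (q k))))"
  have q': "k \<le> n k" "t k < s k" "s k < t' k" "near_slice (U (n k)) (F (n k)) (s k) z (e k)" "near_slice (U (n k)) (F (n k)) (t k) um (e k)" "near_slice (U (n k)) (F (n k)) (t' k) up (e k)" for k
   using q[of k] by (simp_all add: P_def n_def s_def t_def t'_def split: prod.splits)
  have "dW W (%_. um) (%_. z) + dW W (%_. z) (%_. up) \<le> liminf (%k. energy W {t k..s k} (U (n k)) (F (n k))) + liminf (%k. energy W {s k..t' k} (U (n k)) (F (n k)))"
   by (intro add_mono dW_le_liminf_energy[OF H4 R fa q'(2) um z e0 e(2) q'(5,4)] dW_le_liminf_energy[OF H4 R fa q'(3) z up e0 e(2) q'(4,6)])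
  also have "... \<le> liminf (%k. energy W {t k..s k} (U (n k)) (F (n k)) + energy W {s k..t' k} (U (n k)) (F (n k)))" by (rule liminf_add_ennreal_le)
  \<comment> \<open>The two time intervals meet in a single time, so their energies add up to at
    most the total.\<close>
  also have "... \<le> liminf (%k. ennreal (c + 1 / real (Suc k)))"
   by (intro Liminf_mono always_eventually allI order_trans[OF energy_additive_le[OF R W_cont, where c = "s _"] Ek] q'(1)) auto
  also have "... \<le> dW W (%_. um) (%_. up)" unfolding limc by (rule cd)
  finally show False using H3[rule_format, of z] z zn by (simp add: not_le[symmetric])
 qed
 have "zp \<in> {um, up}" by (rule excl[OF zp(1) nearp])
 then have zpup: "zp = up" using zpum by simp
 have "zm \<in> {um, up}"
  by (rule excl[OF zm(1)]) (use nearm in blast)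
 \<comment> \<open>The fields would run from \<open>um\<close> to near \<open>up\<close> before time
   0, at asymptotic cost at least c, and still have to be within \<delta> of \<open>um\<close> at
   time 0. The return crosses from 2 \<delta> to \<delta> around \<open>um\<close> and costs
   \<kappa> more.\<close>
 moreover have "zm \<noteq> up"
 proof
  assume zu: "zm = up"
  obtain \<kappa> where \<kappa>: "0 < \<kappa>" and cost: "!!u D z s t. regular_field u D ==> (\<forall>t. fst (xavg u t) = a) ==> z \<in> wells ==> s \<le> t ==>
   2 * \<delta> \<le> norm (xavg u s - z) \<and> norm (xavg u t - z) \<le> \<delta> ==> ennreal \<kappa> \<le> energy W {s..t} u D"
   using crossing_cost[OF \<delta> sep] by blast
  define P where "P = (%k (n, s, t). k \<le> n \<and> t < s \<and> s \<le> 0 \<and> near_slice (U n) (F n) s up (e k) \<and> near_slice (U n) (F n) t um (e k))"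
  have "\<exists>q. P k q" for k
  proof -
   obtain N where N: "\<forall>n\<ge>N. \<exists>t\<le>0. near_slice (U n) (F n) t up (e k)" using nearm[OF e(1)] zu by blast
   define n where "n = max N k"
   have n: "N \<le> n" "k \<le> n" by (simp_all add: n_def)
   obtain s where s: "s \<le> 0" "near_slice (U n) (F n) s up (e k)" using N[rule_format, OF n(1)] by blast
   obtain t where t: "t < s" "near_slice (U n) (F n) t um (e k)" using ex_near_slice_end(1)[OF R Ufin e(1) Um] by blast
   show ?thesis by (intro exI[of _ "(n, s, t)"]) (simp add: P_def s t n)
  qed
  then have "\<forall>k. \<exists>q. P k q" by (rule allI)
  from choice[OF this] obtain q where q: "!!k. P k (q k)" by blast
  define n s t where "n = (%k. fst (q k))" and "s = (%k. fst (snd (q k)))" and "t = (%k. snd (snd (q k)))"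
  have q': "k \<le> n k" "t k < s k" "s k \<le> 0" "near_slice (U (n k)) (F (n k)) (s k) up (e k)" "near_slice (U (n k)) (F (n k)) (t k) um (e k)" for k
   using q[of k] by (simp_all add: P_def n_def s_def t_def split: prod.splits)
  \<comment> \<open>An average within \<delta> of \<open>up\<close> is at least 3 \<delta> from
    \<open>um\<close>, so the crossing estimate applies from time s k to time 0.\<close>
  have cross: "ennreal \<kappa> \<le> energy W {s k..0} (U (n k)) (F (n k))" for k
  proof (rule cost[OF R _ um q'(3)])
   have "norm (xavg (U (n k)) (s k) - up) \<le> \<delta>" using q'(4)[of k] e(3)[of k] by (simp add: near_slice_def)
   moreover have "4 * \<delta> \<le> norm (up - um)" using sep[OF up um] ne by simp
   ultimately have "2 * \<delta> \<le> norm (xavg (U (n k)) (s k) - um)"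
    using norm_triangle_ineq[of "up - xavg (U (n k)) (s k)" "xavg (U (n k)) (s k) - um"] \<delta> by (simp add: norm_minus_commute)
   then show "2 * \<delta> \<le> norm (xavg (U (n k)) (s k) - um) \<and> norm (xavg (U (n k)) 0 - um) \<le> \<delta>" using U0 by simp
  qed (simp add: fa)
  have "ennreal c + ennreal \<kappa> \<le> liminf (%k. energy W {t k..s k} (U (n k)) (F (n k))) + liminf (%k. energy W {s k..0} (U (n k)) (F (n k)))"
   by (intro add_mono order_trans[OF cd] dW_le_liminf_energy[OF H4 R fa q'(2) um up e0 e(2) q'(5,4)] Liminf_bounded always_eventually allI cross)
  also have "... \<le> liminf (%k. energy W {t k..s k} (U (n k)) (F (n k)) + energy W {s k..0} (U (n k)) (F (n k)))" by (rule liminf_add_ennreal_le)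
  also have "... \<le> liminf (%k. ennreal (c + 1 / real (Suc k)))"
   by (intro Liminf_mono always_eventually allI order_trans[OF energy_additive_le[OF R W_cont, where c = "s _"] Ek] q'(1)) auto
  finally have "ennreal (c + \<kappa>) \<le> ennreal c" unfolding limc using \<kappa> c(1) by simp
  then show False using \<kappa> c(1) by (simp add: ennreal_le_iff)
 qed
 ultimately have zmum: "zm = um" by simp
 have S: "sob_div UNIV v G" by (rule regular_field_sob_div[OF R'])
 have "cW W um up \<le> energy W UNIV v G" by (rule cW_le_energy[OF S]) (use zm zp zmum zpup in auto)
 then show ?thesis using S zm(2) zp(2) zmum zpup Ev c(2) by (intro exI[of _ v] exI[of _ G]) auto
qed

end

theorem theorem2p3:
  fixes W :: "('m::finite) pt \<Rightarrow> real" and a :: real and um up :: "'m pt"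
  assumes W_cont: "continuous_on UNIV W"
    and W_nonneg: "\<forall>z. W z \<ge> 0"
    and um_in: "um \<in> {z. fst z = a \<and> W z = 0}"
    and up_in: "up \<in> {z. fst z = a \<and> W z = 0}"
    and distinct: "um \<noteq> up"
    and H1: "finite {z. fst z = a \<and> W z = 0}"
    and H2: "Liminf (inf (filtercomap fst (nhds a)) (filtercomap (\<lambda>z. norm (snd z)) at_top))
               (\<lambda>z. ereal (W z)) > 0"
    and H3: "\<forall>z \<in> {z. fst z = a \<and> W z = 0} - {um, up}.
               dW W (\<lambda>_. um) (\<lambda>_. z) + dW W (\<lambda>_. z) (\<lambda>_. up) > dW W (\<lambda>_. um) (\<lambda>_. up)"
    and H4: "\<forall>zm zp vm vp Dvm Dvp.
               zm \<in> {z. fst z = a \<and> W z = 0} \<and> zp \<in> {z. fst z = a \<and> W z = 0} \<and>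
               (\<forall>n. h1a a (vm n) (Dvm n) \<and> h1a a (vp n) (Dvp n)) \<and>
               h1_conv_const vm Dvm zm \<and> h1_conv_const vp Dvp zp \<longrightarrow>
               dW W (\<lambda>_. zm) (\<lambda>_. zp) \<le> liminf (\<lambda>n. dW W (vm n) (vp n))"
  shows "\<exists>u D. sob_div UNIV u D \<and> (xavg u \<longlongrightarrow> um) at_bot \<and> (xavg u \<longlongrightarrow> up) at_top \<and>
               energy W UNIV u D = cW W um up"
proof -
 interpret potential W a
  by unfold_locales (use W_cont W_nonneg H1 H2 in auto)
 show ?thesis
  by (rule exists_minimizer[unfolded wells_def, OF um_in up_in distinct H3 H4])
qed

end
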